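(* Let $(\mathcal X,d,\mu)$ be an RD-space with $\mu(\mathcal X)=\infty$ and doubling exponent $n$. Let $\epsilon_1\in(0,1]$, $\epsilon_2,\epsilon_3>0$, $\epsilon\in(0,\epsilon_1\wedge\epsilon_2)$, let $\{S_k\}_{k\in\mathbb Z}$ be an $(\epsilon_1,\epsilon_2,\epsilon_3)$-AOTI, and let $\ell\in\mathbb Z$, $p\in(n/(n+\epsilon),1]$, $\beta,\gamma\in(n(1/p-1),\epsilon)$. For $k\in\mathbb Z$, $a>0$ and $f\in(\mathcal G_0^\epsilon(\beta,\gamma))'$ set $S^{(a)}_k(f)(x)=\frac{1}{V_{a2^{-k}}(x)}\int_{B(x,a2^{-k})}|S_k(f)(y)|\,d\mu(y)$. (i) $f\in H^p_\ell(\mathcal X)$ if and only if $f\in(\mathcal G_0^\epsilon(\beta,\gamma))'$, $S^+_{\ell+1}(f)\in L^p(\mathcal X)$ and $S^{(a)}_\ell(f)\in L^p(\mathcal X)$. Moreover, for any $a>0$ there exists a constant $C>0$ depending on $a$ such that for all $\ell\in\mathbb Z$ and $f\in(\mathcal G_0^\epsilon(\beta,\gamma))'$, $$C^{-1}\|f\|_{H^p_\ell(\mathcal X)}\le\|S^+_{\ell+1}(f)\|_{L^p(\mathcal X)}+\|S^{(a)}_\ell(f)\|_{L^p(\mathcal X)}\le C\|f\|_{H^p_\ell(\mathcal X)}.$$ (ii) If $f\in(\mathcal G_0^\epsilon(\beta,\gamma))'$ and $S^{(a)}_k(f)\in L^p(\mathcal X)$ for every $k\in\mathbb Z$ and $a>0$,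 then $f\in H^p_\ell(\mathcal X)$ if and only if $S^+_\ell(f)\in L^p(\mathcal X)$; moreover, there exists a constant $C>0$, independent of $k$ and $\ell$, such that for all such $f\in H^p_\ell(\mathcal X)$, $C^{-1}\|f\|_{H^p_\ell(\mathcal X)}\le\|S^+_\ell(f)\|_{L^p(\mathcal X)}\le C\|f\|_{H^p_\ell(\mathcal X)}$.
   Context: A triple $(\mathcal X,d,\mu)$, with $(\mathcal X,d)$ a metric space and $\mu$ a Borel regular measure such that every ball $B(x,r)=\{y:d(x,y)<r\}$ has finite positive measure, is a space of homogeneous type if there exist $C_1\ge1$ and $n>0$ with $\mu(B(x,\lambda r))\le C_1\lambda^n\mu(B(x,r))$ for all $x$, $\lambda\ge1$, $r>0$ ($n$ = doubling exponent); it is an RD-space if moreover there are $C_2,C_3>1$ with $\mu(B(x,C_2r))\ge C_3\mu(B(x,r))$ for all $x$ and $0<r<\operatorname{diam}(\mathcal X)$. Write $V_r(x)=\mu(B(x,r))$, $V(x,y)=\mu(B(x,d(x,y)))$, $a\wedge b=\min\{a,b\}$. AOTI: for $\epsilon_1\in(0,1]$, $\epsilon_2,\epsilon_3>0$, an $(\epsilon_1,\epsilon_2,\epsilon_3)$-AOTI is a sequence $\{S_k\}_{k\in\mathbb Z}$ of bounded linear integral operators on $L^2(\mathcal X)$ with measurable kernels $S_k(x,y)$ satisfying, for some $C_4>0$ and all $k,x,x',y,y'$: (i) $|S_k(x,y)|\le C_4\frac{1}{V_{2^{-k}}(x)+V(x,y)}\big[\frac{2^{-k}}{2^{-k}+d(x,y)}\big]^{\epsilon_2}$;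 (ii) $|S_k(x,y)-S_k(x',y)|\le C_4\big[\frac{d(x,x')}{2^{-k}+d(x,y)}\big]^{\epsilon_1}\frac{1}{V_{2^{-k}}(x)+V(x,y)}\big[\frac{2^{-k}}{2^{-k}+d(x,y)}\big]^{\epsilon_2}$ if $d(x,x')\le[2^{-k}+d(x,y)]/2$; (iii) (ii) with $x,y$ interchanged; (iv) $|[S_k(x,y)-S_k(x,y')]-[S_k(x',y)-S_k(x',y')]|\le C_4\big[\frac{d(x,x')}{2^{-k}+d(x,y)}\big]^{\epsilon_1}\big[\frac{d(y,y')}{2^{-k}+d(x,y)}\big]^{\epsilon_1}\frac{1}{V_{2^{-k}}(x)+V(x,y)}\big[\frac{2^{-k}}{2^{-k}+d(x,y)}\big]^{\epsilon_3}$ if $d(x,x'),d(y,y')\le[2^{-k}+d(x,y)]/3$; (v) $\int S_k(x,z)\,d\mu(z)=1=\int S_k(z,y)\,d\mu(z)$. Test functions: for $x\in\mathcal X$, $r>0$, $\beta\in(0,1]$, $\gamma>0$, $\mathcal G(x,r,\beta,\gamma)$ is the set of $f$ with some $C\ge0$ such that $|f(y)|\le C\frac{1}{V_r(x)+V(x,y)}\big(\frac{r}{r+d(x,y)}\big)^\gamma$ for all $y$ and $|f(z)-f(y)|\le C\big(\frac{d(y,z)}{r+d(x,y)}\big)^\beta\frac{1}{V_r(x)+V(x,y)}\big(\frac{r}{r+d(x,y)}\big)^\gamma$ whenever $d(y,z)\le[r+d(x,y)]/2$; the norm is the infimum of such $C$. Fix $x_1\in\mathcal X$; for $\epsilon\in(0,1]$,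 $\beta,\gamma\in(0,\epsilon]$, $\mathcal G_0^\epsilon(\beta,\gamma)$ is the closure of $\mathcal G(x_1,1,\epsilon,\epsilon)$ in $\mathcal G(x_1,1,\beta,\gamma)$, and $(\mathcal G_0^\epsilon(\beta,\gamma))'$ its dual. $S_k(f)(x)=\langle f,S_k(x,\cdot)\rangle$; the localized radial maximal function is $S^+_\ell(f)(x)=\sup_{k\ge\ell}|S_k(f)(x)|$; the localized grand maximal function is $G_\ell(f)(x)=\sup\{|\langle f,\varphi\rangle|:\varphi\in\mathcal G_0^\epsilon(\beta,\gamma),\ \|\varphi\|_{\mathcal G(x,r,\beta,\gamma)}\le1\text{ for some }r\in(0,2^{-\ell}]\}$. The localized Hardy space is $H^p_\ell(\mathcal X)=\{f\in(\mathcal G_0^\epsilon(\beta,\gamma))':\|f\|_{H^p_\ell(\mathcal X)}=\|G_\ell(f)\|_{L^p(\mathcal X)}<\infty\}$. *)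

theory Defs
  imports "HOL-Analysis.Analysis"
begin

definition Vr :: "'a::metric_space measure \<Rightarrow> real \<Rightarrow> 'a \<Rightarrow> real" where
  "Vr \<mu> r x = measure \<mu> (ball x r)"

definition Vxy :: "'a::metric_space measure \<Rightarrow> 'a \<Rightarrow> 'a \<Rightarrow> real" where
  "Vxy \<mu> x y = measure \<mu> (ball x (dist x y))"

definition homogeneous_type :: "'a::metric_space measure \<Rightarrow> real \<Rightarrow> bool" where
  "homogeneous_type \<mu> n \<longleftrightarrow>
     sets \<mu> = sets borel \<and>
     (\<forall>x r. 0 < r \<longrightarrow> 0 < emeasure \<mu> (ball x r) \<and> emeasure \<mu> (ball x r) < \<infinity>) \<and>
     0 < n \<and>
     (\<exists>C1\<ge>1. \<forall>x lam r. 1 \<le> lam \<longrightarrow> 0 < r \<longrightarrow>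
        measure \<mu> (ball x (lam * r)) \<le> C1 * lam powr n * measure \<mu> (ball x r))"

text \<open>Reverse doubling for 0 < r < diam X; r < diam X iff some pair of points is at
  distance > r.\<close>
definition RD_space :: "'a::metric_space measure \<Rightarrow> real \<Rightarrow> bool" where
  "RD_space \<mu> n \<longleftrightarrow> homogeneous_type \<mu> n \<and>
     (\<exists>C2>1. \<exists>C3>1. \<forall>x r. 0 < r \<and> (\<exists>y z::'a. r < dist y z) \<longrightarrow>
        C3 * measure \<mu> (ball x r) \<le> measure \<mu> (ball x (C2 * r)))"

definition L2_bounded_integral_op :: "'a::metric_space measure \<Rightarrow> ('a \<Rightarrow> 'a \<Rightarrow> real) \<Rightarrow> bool" where
  "L2_bounded_integral_op \<mu> K \<longleftrightarrow>
     (\<exists>B. \<forall>g. g \<in> borel_measurable \<mu> \<and> integrable \<mu> (\<lambda>y. (g y)\<^sup>2) \<longrightarrow>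
        (AE x in \<mu>. integrable \<mu> (\<lambda>y. K x y * g y)) \<and>
        (\<lambda>x. \<integral>y. K x y * g y \<partial>\<mu>) \<in> borel_measurable \<mu> \<and>
        integrable \<mu> (\<lambda>x. (\<integral>y. K x y * g y \<partial>\<mu>)\<^sup>2) \<and>
        (\<integral>x. (\<integral>y. K x y * g y \<partial>\<mu>)\<^sup>2 \<partial>\<mu>) \<le> B * (\<integral>y. (g y)\<^sup>2 \<partial>\<mu>))"

definition AOTI :: "'a::metric_space measure \<Rightarrow> real \<Rightarrow> real \<Rightarrow> real \<Rightarrow> (int \<Rightarrow> 'a \<Rightarrow> 'a \<Rightarrow> real) \<Rightarrow> bool" where
  "AOTI \<mu> e1 e2 e3 S \<longleftrightarrow>
     0 < e1 \<and> e1 \<le> 1 \<and> 0 < e2 \<and> 0 < e3 \<and>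
     (\<forall>k. (\<lambda>(x, y). S k x y) \<in> borel_measurable (\<mu> \<Otimes>\<^sub>M \<mu>) \<and> L2_bounded_integral_op \<mu> (S k)) \<and>
     (\<exists>C4>0. \<forall>k x y. let t = 2 powr (- real_of_int k) in
        \<bar>S k x y\<bar> \<le> C4 * (1 / (Vr \<mu> t x + Vxy \<mu> x y)) * (t / (t + dist x y)) powr e2
      \<and> (\<forall>x'. dist x x' \<le> (t + dist x y) / 2 \<longrightarrow>
          \<bar>S k x y - S k x' y\<bar> \<le> C4 * (dist x x' / (t + dist x y)) powr e1
             * (1 / (Vr \<mu> t x + Vxy \<mu> x y)) * (t / (t + dist x y)) powr e2)
      \<and> (\<forall>y'. dist y y' \<le> (t + dist x y) / 2 \<longrightarrow>
          \<bar>S k x y - S k x y'\<bar> \<le> C4 * (dist y y' / (t + dist x y)) powr e1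
             * (1 / (Vr \<mu> t x + Vxy \<mu> x y)) * (t / (t + dist x y)) powr e2)
      \<and> (\<forall>x' y'. dist x x' \<le> (t + dist x y) / 3 \<and> dist y y' \<le> (t + dist x y) / 3 \<longrightarrow>
          \<bar>(S k x y - S k x y') - (S k x' y - S k x' y')\<bar> \<le>
             C4 * (dist x x' / (t + dist x y)) powr e1 * (dist y y' / (t + dist x y)) powr e1
             * (1 / (Vr \<mu> t x + Vxy \<mu> x y)) * (t / (t + dist x y)) powr e3)
      \<and> (\<integral>z. S k x z \<partial>\<mu>) = 1 \<and> (\<integral>z. S k z y \<partial>\<mu>) = 1)"

definition G_bound :: "'a::metric_space measure \<Rightarrow> 'a \<Rightarrow> real \<Rightarrow> real \<Rightarrow> real \<Rightarrow> ('a \<Rightarrow> real) \<Rightarrow> real \<Rightarrow> bool" where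
  "G_bound \<mu> x r \<beta> \<gamma> \<phi> C \<longleftrightarrow> 0 \<le> C \<and>
     (\<forall>y. \<bar>\<phi> y\<bar> \<le> C * (1 / (Vr \<mu> r x + Vxy \<mu> x y)) * (r / (r + dist x y)) powr \<gamma>) \<and>
     (\<forall>y z. dist y z \<le> (r + dist x y) / 2 \<longrightarrow>
        \<bar>\<phi> z - \<phi> y\<bar> \<le> C * (dist y z / (r + dist x y)) powr \<beta>
           * (1 / (Vr \<mu> r x + Vxy \<mu> x y)) * (r / (r + dist x y)) powr \<gamma>)"

definition Gtest :: "'a::metric_space measure \<Rightarrow> 'a \<Rightarrow> real \<Rightarrow> real \<Rightarrow> real \<Rightarrow> ('a \<Rightarrow> real) set" where
  "Gtest \<mu> x r \<beta> \<gamma> = {\<phi>. \<exists>C. G_bound \<mu> x r \<beta> \<gamma> \<phi> C}"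

definition Gnorm :: "'a::metric_space measure \<Rightarrow> 'a \<Rightarrow> real \<Rightarrow> real \<Rightarrow> real \<Rightarrow> ('a \<Rightarrow> real) \<Rightarrow> real" where
  "Gnorm \<mu> x r \<beta> \<gamma> \<phi> = Inf {C. G_bound \<mu> x r \<beta> \<gamma> \<phi> C}"

definition G0 :: "'a::metric_space measure \<Rightarrow> 'a \<Rightarrow> real \<Rightarrow> real \<Rightarrow> real \<Rightarrow> ('a \<Rightarrow> real) set" where
  "G0 \<mu> x1 \<epsilon> \<beta> \<gamma> = {\<phi> \<in> Gtest \<mu> x1 1 \<beta> \<gamma>. \<forall>\<eta>>0. \<exists>\<psi>\<in>Gtest \<mu> x1 1 \<epsilon> \<epsilon>.
        Gnorm \<mu> x1 1 \<beta> \<gamma> (\<lambda>y. \<phi> y - \<psi> y) < \<eta>}"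

text \<open>Dual space: continuous linear functionals on G_0^eps(beta,gamma).  A functional is
  represented as a function on all real functions; only its values on G0 matter.\<close>
definition G0_dual :: "'a::metric_space measure \<Rightarrow> 'a \<Rightarrow> real \<Rightarrow> real \<Rightarrow> real \<Rightarrow> (('a \<Rightarrow> real) \<Rightarrow> real) set" where
  "G0_dual \<mu> x1 \<epsilon> \<beta> \<gamma> = {f.
     (\<forall>\<phi>\<in>G0 \<mu> x1 \<epsilon> \<beta> \<gamma>. \<forall>\<psi>\<in>G0 \<mu> x1 \<epsilon> \<beta> \<gamma>. \<forall>c.
         f (\<lambda>y. c * \<phi> y + \<psi> y) = c * f \<phi> + f \<psi>) \<and>
     (\<exists>C. \<forall>\<phi>\<in>G0 \<mu> x1 \<epsilon> \<beta> \<gamma>. \<bar>f \<phi>\<bar> \<le> C * Gnorm \<mu> x1 1 \<beta> \<gamma> \<phi>)}"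

text \<open>Real powers of extended nonnegative reals (exponent q > 0).\<close>
definition enn_powr :: "ennreal \<Rightarrow> real \<Rightarrow> ennreal" where
  "enn_powr x q = (if x = \<infinity> then \<infinity> else ennreal (enn2real x powr q))"

definition in_Lp :: "'a::metric_space measure \<Rightarrow> real \<Rightarrow> ('a \<Rightarrow> ennreal) \<Rightarrow> bool" where
  "in_Lp \<mu> p g \<longleftrightarrow> g \<in> borel_measurable \<mu> \<and> (\<integral>\<^sup>+x. enn_powr (g x) p \<partial>\<mu>) < \<infinity>"

definition Lp_norm :: "'a::metric_space measure \<Rightarrow> real \<Rightarrow> ('a \<Rightarrow> ennreal) \<Rightarrow> ennreal" where
  "Lp_norm \<mu> p g = enn_powr (\<integral>\<^sup>+x. enn_powr (g x) p \<partial>\<mu>) (1 / p)"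

definition Sk_f :: "(int \<Rightarrow> 'a \<Rightarrow> 'a \<Rightarrow> real) \<Rightarrow> (('a \<Rightarrow> real) \<Rightarrow> real) \<Rightarrow> int \<Rightarrow> 'a \<Rightarrow> real" where
  "Sk_f S f k x = f (S k x)"

definition radial_max :: "(int \<Rightarrow> 'a \<Rightarrow> 'a \<Rightarrow> real) \<Rightarrow> (('a \<Rightarrow> real) \<Rightarrow> real) \<Rightarrow> int \<Rightarrow> 'a \<Rightarrow> ennreal" where
  "radial_max S f l x = (SUP k\<in>{l..}. ennreal \<bar>Sk_f S f k x\<bar>)"

definition S_avg :: "'a::metric_space measure \<Rightarrow> (int \<Rightarrow> 'a \<Rightarrow> 'a \<Rightarrow> real) \<Rightarrow> real \<Rightarrow> (('a \<Rightarrow> real) \<Rightarrow> real) \<Rightarrow> int \<Rightarrow> 'a \<Rightarrow> ennreal" where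
  "S_avg \<mu> S a f k x =
     ennreal (1 / Vr \<mu> (a * 2 powr (- real_of_int k)) x) *
     (\<integral>\<^sup>+y\<in>ball x (a * 2 powr (- real_of_int k)). ennreal \<bar>Sk_f S f k y\<bar> \<partial>\<mu>)"

definition grand_max :: "'a::metric_space measure \<Rightarrow> 'a \<Rightarrow> real \<Rightarrow> real \<Rightarrow> real \<Rightarrow> (('a \<Rightarrow> real) \<Rightarrow> real) \<Rightarrow> int \<Rightarrow> 'a \<Rightarrow> ennreal" where
  "grand_max \<mu> x1 \<epsilon> \<beta> \<gamma> f l x =
     (SUP \<phi>\<in>{\<phi> \<in> G0 \<mu> x1 \<epsilon> \<beta> \<gamma>. \<exists>r. 0 < r \<and> r \<le> 2 powr (- real_of_int l) \<and>
              \<phi> \<in> Gtest \<mu> x r \<beta> \<gamma> \<and> Gnorm \<mu> x r \<beta> \<gamma> \<phi> \<le> 1}. ennreal \<bar>f \<phi>\<bar>)"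

definition in_Hardy :: "'a::metric_space measure \<Rightarrow> 'a \<Rightarrow> real \<Rightarrow> real \<Rightarrow> real \<Rightarrow> real \<Rightarrow> int \<Rightarrow> (('a \<Rightarrow> real) \<Rightarrow> real) \<Rightarrow> bool" where
  "in_Hardy \<mu> x1 \<epsilon> \<beta> \<gamma> p l f \<longleftrightarrow> f \<in> G0_dual \<mu> x1 \<epsilon> \<beta> \<gamma> \<and> in_Lp \<mu> p (grand_max \<mu> x1 \<epsilon> \<beta> \<gamma> f l)"

definition Hardy_norm :: "'a::metric_space measure \<Rightarrow> 'a \<Rightarrow> real \<Rightarrow> real \<Rightarrow> real \<Rightarrow> real \<Rightarrow> int \<Rightarrow> (('a \<Rightarrow> real) \<Rightarrow> real) \<Rightarrow> ennreal" where
  "Hardy_norm \<mu> x1 \<epsilon> \<beta> \<gamma> p l f = Lp_norm \<mu> p (grand_max \<mu> x1 \<epsilon> \<beta> \<gamma> f l)"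

end

theory Submission
  imports Defs
begin

text \<open>
  Everything reduces to one estimate: for \<open>n / (n + min \<beta> \<gamma>) < q < p\<close> the grand maximal function
  \<open>G\<^sub>l f\<close> is bounded pointwise by \<open>(M ((S\<^sup>+\<^sub>l\<^sub>+\<^sub>1 f)\<^sup>q))\<^bsup>1/q\<^esup>\<close>, where \<open>M\<close> is the
  Hardy--Littlewood maximal function, bounded on \<open>L\<^bsup>p/q\<^esup>\<close>.  The converse estimates are pointwise, because
  \<open>S\<^sub>k(y, \<cdot>)\<close> is a bounded multiple of a test function at scale \<open>2\<^bsup>-k\<^esup>\<close> around any nearby point.

  No Calderon reproducing formula is used for the main estimate.  A test function \<open>\<psi>\<close> at scale \<open>r\<close> is
  approximated by \<open>A \<psi> = \<Sum>\<^sub>Q \<mu>(Q) \<psi>(y\<^sub>Q) S\<^sub>k(y\<^sub>Q, \<cdot>)\<close> with \<open>2\<^bsup>-k\<^esup> = \<theta> r\<close> and a much finer net of cells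
  \<open>Q\<close>.  The remainder \<open>\<psi> - A \<psi>\<close> is smaller by a factor \<open>C \<theta>\<^sup>\<beta>\<close>, but regular only at scale \<open>\<theta> r\<close>.  This loss
  is harmless: iterating with \<open>\<theta>\<close> small, the sizes decay geometrically, faster than the factor
  \<open>\<theta>\<^bsup>-m n (1/q - 1)\<^esup>\<close> that enters when \<open>|S\<^sub>k f|\<close> at the points \<open>y\<^sub>Q\<close>, chosen where it does not exceed its
  local average, is compared with the maximal function.  Between the steps the remainders are cut off at radii
  \<open>4\<^sup>m R\<close>, which keeps all sums finite; the tails vanish as \<open>R \<longrightarrow> \<infinity>\<close>.

  Membership in \<open>L\<^sup>p\<close> includes measurability.  That of \<open>G\<^sub>l f\<close> follows from the separability of the space of
  test functions and the lower semicontinuity of ball volumes.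
\<close>

section \<open>Ball volumes and weights\<close>

text \<open>The number a = n (1/q - 1) is the price of estimating sampled values through averages of
  q-th powers. It appears as a loss of decay, which requires a < \<gamma>, and as the growth of the
  cost when the mesh shrinks, which requires a < \<beta>; taking q close to p keeps a below both. A
  functional is only known to be bounded by some constant N, on which the final constant must not
  depend. So N may multiply only quantities that vanish in a limit: the tails that are cut off and
  the last remainder. For the last remainder \<beta>-regularity is not enough: turning regularity at
  scale \<theta>^m r into a test norm of order \<beta> costs about \<theta>^(-m \<beta>), which eats
  up the gain of m steps. The iteration therefore carries a second bound of order \<epsilon> >
  \<beta>, whose constant disappears in the limit. All this takes place on the dense class
  \<open>tests \<epsilon>\<close>; the closure \<open>G0\<close> enters only through an
  approximation that also controls the norm at the given centre and scale.\<close>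

locale doubling_measure =
  fixes \<mu> :: "'a::metric_space measure" and n C1 :: real
  assumes sets_mu: "sets \<mu> = sets borel"
    and emeasure_ball_pos: "0 < r \<Longrightarrow> 0 < emeasure \<mu> (ball x r)"
    and emeasure_ball_finite: "0 < r \<Longrightarrow> emeasure \<mu> (ball x r) < \<infinity>"
    and n_pos: "0 < n" and C1_ge1: "1 \<le> C1"
    and doubling: "1 \<le> lam \<Longrightarrow> 0 < r \<Longrightarrow>
        measure \<mu> (ball x (lam * r)) \<le> C1 * lam powr n * measure \<mu> (ball x r)"
begin

definition V :: "'a \<Rightarrow> real \<Rightarrow> real" where
  "V x r = measure \<mu> (ball x r)"

text \<open>The majorant of test functions centred at \<open>x\<close> at scale \<open>r\<close>, up to constants.\<close>

definition P :: "real \<Rightarrow> 'a \<Rightarrow> real \<Rightarrow> 'a \<Rightarrow> real" where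
  "P g x r y = (r / (r + dist x y)) powr g / V x (r + dist x y)"

lemma space_mu [simp]: "space \<mu> = UNIV"
  using sets_eq_imp_space_eq[OF sets_mu] by simp

lemma ball_sets [measurable, simp]: "ball x r \<in> sets \<mu>"
  by (simp add: sets_mu)

lemma emeasure_ball: "emeasure \<mu> (ball x r) = ennreal (V x r)"
proof (cases "0 < r")
  case True
  then show ?thesis using emeasure_ball_finite[OF True, of x]
    by (simp add: V_def emeasure_eq_ennreal_measure less_top)
next
  case False
  then have B: "ball x r = {}" by auto
  show ?thesis unfolding V_def B by simp
qed

lemma radius_dist_pos [simp]: "0 < r \<Longrightarrow> 0 < r + dist x y"
  by (simp add: add_pos_nonneg)

lemma radius_dist_neq [simp]: "0 < r \<Longrightarrow> r + dist x y \<noteq> 0"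
  by (metis radius_dist_pos less_irrefl)

lemma V_pos [simp]: "0 < r \<Longrightarrow> 0 < V x r"
  using emeasure_ball_pos[of r x] by (simp add: emeasure_ball)

lemma V_nonneg [simp]: "0 \<le> V x r"
  by (simp add: V_def)

lemma V_mono_ball: "ball x r \<subseteq> ball y s \<Longrightarrow> V x r \<le> V y s"
  using emeasure_mono[of "ball x r" "ball y s" \<mu>] by (simp add: emeasure_ball)

lemma V_mono: "r \<le> s \<Longrightarrow> V x r \<le> V x s"
  by (rule V_mono_ball) auto

lemma V_comp:
  assumes "0 < s" "1 \<le> L" "r + dist x y \<le> L * s"
  shows "V x r \<le> C1 * L powr n * V y s"
proof -
  have "ball x r \<subseteq> ball y (L * s)"
  proof
    fix z assume "z \<in> ball x r"
    then show "z \<in> ball y (L * s)"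
      using assms(3) dist_triangle[of y z x] by (simp add: dist_commute)
  qed
  then have "V x r \<le> V y (L * s)" by (rule V_mono_ball)
  also have "\<dots> \<le> C1 * L powr n * V y s"
    using doubling[OF assms(2,1), of y] by (simp add: V_def)
  finally show ?thesis .
qed

lemma V_doubling: "0 < s \<Longrightarrow> 1 \<le> L \<Longrightarrow> r \<le> L * s \<Longrightarrow> V x r \<le> C1 * L powr n * V x s"
  using V_comp[of s L r x x] by simp

lemma P_nonneg [simp]: "0 \<le> P g x r y"
  by (simp add: P_def)

text \<open>The volumes compare with factor \<open>C1 * L powr n\<close>. In the ratio r / (r + d)
  both the scale and the denominator change by at most a factor L, so its power costs
  \<open>L powr (2 * g)\<close>.\<close>

lemma P_change:
  assumes "0 < r" "0 < r'" "1 \<le> L" "0 \<le> g"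
    and le: "r' + dist x' y' + dist x x' \<le> L * (r + dist x y)" and rr: "r \<le> L * r'"
  shows "P g x r y \<le> C1 * L powr (n + 2 * g) * P g x' r' y'"
proof -
  let ?d = "r + dist x y" and ?d' = "r' + dist x' y'"
  have d: "0 < ?d" "0 < ?d'" using assms by (simp_all add: add_pos_nonneg)
  have VV: "V x' ?d' \<le> C1 * L powr n * V x ?d"
    by (rule V_comp) (use d assms in \<open>simp_all add: dist_commute\<close>)
  have "r * ?d' \<le> (L * r') * (L * ?d)"
  proof (rule mult_mono)
    show "?d' \<le> L * ?d" using le zero_le_dist[of x x'] by linarith
  qed (use assms d in auto)
  then have "r / ?d \<le> L powr 2 * (r' / ?d')"
    using d assms(3) by (simp add: field_simps power2_eq_square)
  then have "(r / ?d) powr g \<le> (L powr 2 * (r' / ?d')) powr g"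
    using assms d by (intro powr_mono2) auto
  also have "\<dots> = L powr (2 * g) * (r' / ?d') powr g"
  proof -
    have "(L powr 2 * (r' / ?d')) powr g = (L powr 2) powr g * (r' / ?d') powr g"
      by (rule powr_mult)
    then show ?thesis by (simp only: powr_powr)
  qed
  finally have R: "(r / ?d) powr g \<le> L powr (2 * g) * (r' / ?d') powr g" .
  have "P g x r y \<le> L powr (2 * g) * (r' / ?d') powr g / V x ?d"
    unfolding P_def using R d by (intro divide_right_mono) auto
  also have "\<dots> \<le> L powr (2 * g) * (r' / ?d') powr g * (C1 * L powr n / V x' ?d')"
  proof -
    have "1 / V x ?d \<le> C1 * L powr n / V x' ?d'"
      using VV d by (simp add: field_simps)
    then have "L powr (2 * g) * (r' / ?d') powr g * (1 / V x ?d)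
       \<le> L powr (2 * g) * (r' / ?d') powr g * (C1 * L powr n / V x' ?d')"
      by (intro mult_left_mono) auto
    then show ?thesis by simp
  qed
  also have "\<dots> = C1 * L powr (n + 2 * g) * P g x' r' y'"
    by (simp add: P_def powr_add algebra_simps)
  finally show ?thesis .
qed

definition near_const :: "real \<Rightarrow> real" where "near_const g = C1 * 2 powr (n + 2 * g)"

lemma near_const_ge1: "0 \<le> g \<Longrightarrow> 1 \<le> near_const g"
proof -
  assume "0 \<le> g"
  then have "1 \<le> 2 powr (n + 2 * g)" using n_pos by (simp add: ge_one_powr_ge_zero)
  then show ?thesis using C1_ge1 mult_mono[of 1 C1 1 "2 powr (n + 2 * g)"] by (simp add: near_const_def)
qed

lemma P_change2:
  assumes "0 < r" "0 < r'" "0 \<le> g"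
    and "r' + dist x' y' + dist x x' \<le> 2 * (r + dist x y)" "r \<le> 2 * r'"
  shows "P g x r y \<le> near_const g * P g x' r' y'"
  unfolding near_const_def using assms by (intro P_change) auto

lemma P_near:
  assumes "0 < r" "0 \<le> g" "dist y z \<le> (r + dist x y) / 2"
  shows "P g x r z \<le> near_const g * P g x r y" "P g x r y \<le> near_const g * P g x r z"
proof -
  show "P g x r z \<le> near_const g * P g x r y"
    by (rule P_change2) (use assms dist_triangle[of x y z] in \<open>auto simp: dist_commute\<close>)
  show "P g x r y \<le> near_const g * P g x r z"
  proof (rule P_change2)
    show "r + dist x z + dist x x \<le> 2 * (r + dist x y)"
    proof -
      have "dist x z \<le> dist x y + dist y z" by (rule dist_triangle)
      moreover have "0 \<le> dist x y" by simp
      ultimately show ?thesis using assms(1,3) unfolding dist_self by argo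
    qed
  qed (use assms in auto)
qed

lemma P_antimono_exp:
  assumes "0 < r" "g \<le> g'" shows "P g' x r y \<le> P g x r y"
proof -
  have "(r / (r + dist x y)) powr g' \<le> (r / (r + dist x y)) powr g"
    using assms by (intro powr_mono') (auto simp: divide_le_eq_1 add_pos_nonneg)
  then show ?thesis using assms by (simp add: P_def divide_right_mono)
qed

lemma P_le_V: assumes "0 < r" "0 \<le> g" shows "P g x r y \<le> 1 / V x r"
proof -
  have a: "(r / (r + dist x y)) powr g \<le> 1"
    using assms by (intro powr_le1) (auto simp: divide_le_eq_1 add_pos_nonneg)
  have b: "V x r \<le> V x (r + dist x y)" by (rule V_mono) simp
  have "P g x r y \<le> 1 / V x (r + dist x y)"
    unfolding P_def using a by (intro divide_right_mono) auto
  also have "\<dots> \<le> 1 / V x r" using assms b by (intro divide_left_mono) (auto simp: add_pos_nonneg intro!: mult_pos_pos)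
  finally show ?thesis .
qed

text \<open>This is how a factor that grows with the distance is absorbed into the weight at the
  price of part of the decay exponent.\<close>

lemma P_mult:
  assumes "0 < r"
  shows "P g x r y * ((r + dist x y) / r) powr b = P (g - b) x r y"
proof -
  let ?q = "r / (r + dist x y)"
  have "(r + dist x y) / r = inverse ?q" by simp
  moreover have "0 < ?q" using assms by simp
  ultimately have "?q powr g * ((r + dist x y) / r) powr b = ?q powr (g - b)"
    by (simp only: powr_diff inverse_powr divide_inverse powr_minus)
  then show ?thesis by (simp add: P_def field_simps)
qed

text \<open>For the least admissible j the point lies outside the ball of radius
  \<open>2 ^ (j - 1) * r\<close> (unless j = 0), which controls both the ratio and the volume. The
  weight is thus dominated by geometrically decreasing multiples of normalized indicators of dyadic
  balls.\<close>

lemma P_dyadic: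
  assumes "0 < g" "0 < r"
  shows "\<exists>j::nat. dist x y < 2 ^ j * r
     \<and> P g x r y \<le> C1 * 2 powr (n + g) * (2 powr - g) ^ j / V x (2 ^ j * r)"
proof -
  define j where "j = (LEAST j::nat. dist x y < 2 ^ j * r)"
  have "\<exists>j::nat. dist x y < 2 ^ j * r"
    using real_arch_pow[of 2 "dist x y / r"] assms by (auto simp: field_simps)
  then have j: "dist x y < 2 ^ j * r" unfolding j_def by (rule LeastI_ex)
  have c: "1 \<le> C1 * 2 powr (n + g)"
    using C1_ge1 n_pos assms mult_mono[of 1 C1 1 "2 powr (n+g)"]
    by (simp add: ge_one_powr_ge_zero)
  have "P g x r y \<le> C1 * 2 powr (n + g) * (2 powr - g) ^ j / V x (2 ^ j * r)"
  proof (cases j)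
    case 0
    have "P g x r y \<le> 1 / V x r" using assms by (intro P_le_V) auto
    also have "\<dots> \<le> C1 * 2 powr (n + g) / V x r" using c assms by (intro divide_right_mono) auto
    finally show ?thesis by (simp add: 0)
  next
    case (Suc i)
    have i: "2 ^ i * r \<le> dist x y"
      using not_less_Least[of i "\<lambda>j. dist x y < 2 ^ j * r"] Suc by (simp add: j_def)
    have p: "0 < 2 ^ i * r" using assms by simp
    have "V x (2 ^ j * r) \<le> C1 * 2 powr n * V x (2 ^ i * r)"
      by (rule V_doubling) (use assms Suc in auto)
    also have "\<dots> \<le> C1 * 2 powr n * V x (r + dist x y)"
      using i assms C1_ge1 by (intro mult_left_mono V_mono) auto
    finally have V1: "V x (2 ^ j * r) \<le> C1 * 2 powr n * V x (r + dist x y)" .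
    have "r / (r + dist x y) \<le> 1 / 2 ^ i"
      using i assms by (simp add: field_simps add_pos_nonneg)
    then have "(r / (r + dist x y)) powr g \<le> (1 / 2 ^ i) powr g"
      using assms by (intro powr_mono2) auto
    also have "\<dots> = (2 powr - g) ^ i"
      by (simp add: powr_minus powr_divide powr_power powr_realpow[symmetric] powr_powr inverse_eq_divide mult.commute)
    also have "\<dots> = 2 powr g * (2 powr - g) ^ j" by (simp add: Suc powr_minus)
    finally have R: "(r / (r + dist x y)) powr g \<le> 2 powr g * (2 powr - g) ^ j" .
    have "P g x r y \<le> 2 powr g * (2 powr - g) ^ j * (1 / V x (r + dist x y))"
      unfolding P_def using R by (simp add: divide_right_mono)
    also have "\<dots> \<le> 2 powr g * (2 powr - g) ^ j * (C1 * 2 powr n / V x (2 ^ j * r))"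
      using V1 assms by (intro mult_left_mono) (auto simp: field_simps add_pos_nonneg)
    also have "\<dots> = C1 * 2 powr (n + g) * (2 powr - g) ^ j / V x (2 ^ j * r)"
      by (simp add: powr_add)
    finally show ?thesis .
  qed
  with j show ?thesis by blast
qed

definition mass_const :: "real \<Rightarrow> real" where
  "mass_const g = C1 * 2 powr (n + g) / (1 - 2 powr - g)"

lemma powr_minus_less1: "0 < g \<Longrightarrow> (2::real) powr - g < 1"
  by (simp add: powr_less_one)

lemma mass_const_pos: "0 < g \<Longrightarrow> 0 < mass_const g"
  using C1_ge1 powr_minus_less1[of g] by (simp add: mass_const_def)

text \<open>The weight acts like a normalized average around x: each dyadic ball contributes its
  coefficient times A, and \<open>mass_const g\<close> is the sum of the geometric series. With h =
  1 this gives the total mass of the weight.\<close>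

lemma nn_integral_P_le:
  assumes "0 < g" "0 < r" and h [measurable]: "h \<in> borel_measurable \<mu>"
    and A: "\<And>\<rho>. 0 < \<rho> \<Longrightarrow> (\<integral>\<^sup>+y\<in>ball x \<rho>. h y \<partial>\<mu>) \<le> A * ennreal (V x \<rho>)"
  shows "(\<integral>\<^sup>+y. ennreal (P g x r y) * h y \<partial>\<mu>) \<le> ennreal (mass_const g) * A"
proof -
  define c where "c j = C1 * 2 powr (n + g) * (2 powr - g) ^ j" for j :: nat
  have c0: "0 \<le> c j" for j using C1_ge1 by (simp add: c_def)
  have pt: "ennreal (P g x r y) * h y \<le> (\<Sum>j. ennreal (c j / V x (2 ^ j * r)) * (h y * indicator (ball x (2 ^ j * r)) y))" for y
  proof -
    obtain j :: nat where j: "dist x y < 2 ^ j * r" "P g x r y \<le> c j / V x (2 ^ j * r)"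
      using P_dyadic[OF assms(1,2)] unfolding c_def by blast
    have "ennreal (P g x r y) * h y \<le> ennreal (c j / V x (2 ^ j * r)) * (h y * indicator (ball x (2 ^ j * r)) y)"
      using j by (auto intro!: mult_right_mono ennreal_leI)
    also have "\<dots> = (\<Sum>j\<in>{j}. ennreal (c j / V x (2 ^ j * r)) * (h y * indicator (ball x (2 ^ j * r)) y))" by simp
    also have "\<dots> \<le> (\<Sum>j. ennreal (c j / V x (2 ^ j * r)) * (h y * indicator (ball x (2 ^ j * r)) y))"
      by (rule sum_le_suminf) auto
    finally show ?thesis .
  qed
  have "(\<integral>\<^sup>+y. ennreal (P g x r y) * h y \<partial>\<mu>)
     \<le> (\<integral>\<^sup>+y. (\<Sum>j. ennreal (c j / V x (2 ^ j * r)) * (h y * indicator (ball x (2 ^ j * r)) y)) \<partial>\<mu>)"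
    by (intro nn_integral_mono pt)
  also have "\<dots> = (\<Sum>j. \<integral>\<^sup>+y. ennreal (c j / V x (2 ^ j * r)) * (h y * indicator (ball x (2 ^ j * r)) y) \<partial>\<mu>)"
    by (rule nn_integral_suminf) measurable
  also have "\<dots> = (\<Sum>j. ennreal (c j / V x (2 ^ j * r)) * (\<integral>\<^sup>+y\<in>ball x (2 ^ j * r). h y \<partial>\<mu>))"
    by (intro suminf_cong nn_integral_cmult) measurable
  also have "\<dots> \<le> (\<Sum>j. ennreal (c j) * A)"
  proof (intro suminf_le)
    fix j :: nat
    have "ennreal (c j / V x (2 ^ j * r)) * (\<integral>\<^sup>+y\<in>ball x (2 ^ j * r). h y \<partial>\<mu>)
       \<le> ennreal (c j / V x (2 ^ j * r)) * (A * ennreal (V x (2 ^ j * r)))"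
      using assms(2) by (intro mult_left_mono A) auto
    also have "\<dots> = ennreal (c j / V x (2 ^ j * r) * V x (2 ^ j * r)) * A"
      using c0 by (subst ennreal_mult) (auto simp: mult_ac)
    also have "\<dots> = ennreal (c j) * A"
      using less_imp_neq[OF V_pos[of "2 ^ j * r" x]] assms(2) by simp
    finally show "ennreal (c j / V x (2 ^ j * r)) * (\<integral>\<^sup>+y\<in>ball x (2 ^ j * r). h y \<partial>\<mu>) \<le> ennreal (c j) * A" .
  qed auto
  also have "\<dots> = (\<Sum>j. ennreal (c j)) * A" by (rule ennreal_suminf_multc)
  also have "(\<Sum>j. ennreal (c j)) = ennreal (mass_const g)"
  proof -
    have "c sums (C1 * 2 powr (n + g) * (1 / (1 - 2 powr - g)))"
      unfolding c_def using powr_minus_less1[OF assms(1)] by (intro sums_mult geometric_sums) auto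
    then have "c sums mass_const g" by (simp add: mass_const_def)
    then show ?thesis using c0
      by (metis suminf_ennreal_eq)
  qed
  finally show ?thesis .
qed

section \<open>Semicontinuity and measurability of ball volumes\<close>

lemma borel_measurable_mu: "borel_measurable \<mu> = borel_measurable borel"
  using sets_mu by (rule measurable_cong_sets) simp

text \<open>A slightly smaller ball still has measure above c, and it is contained in the balls
  around all nearby centres. The measure is arbitrary because the result is also applied to a
  measure with a density.\<close>

lemma V_lower:
  fixes \<nu> :: "'a measure"
  assumes sn: "sets \<nu> = sets borel" and \<rho>: "continuous_on UNIV \<rho>"
  shows "open {x. c < emeasure \<nu> (ball x (\<rho> x))}"
proof (rule openI)
  fix x assume "x \<in> {x. c < emeasure \<nu> (ball x (\<rho> x))}"
  then have c: "c < emeasure \<nu> (ball x (\<rho> x))" by simp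
  let ?B = "\<lambda>i::nat. ball x (\<rho> x - 1 / Suc i)"
  have "ball x (\<rho> x) \<subseteq> (\<Union>i. ?B i)"
  proof
    fix z assume "z \<in> ball x (\<rho> x)"
    then obtain i where "inverse (real (Suc i)) < \<rho> x - dist x z"
      using reals_Archimedean[of "\<rho> x - dist x z"] by auto
    then have "z \<in> ?B i" by (simp add: inverse_eq_divide)
    then show "z \<in> (\<Union>i. ?B i)" by blast
  qed
  moreover have "?B i \<subseteq> ball x (\<rho> x)" for i by (rule subset_ball) simp
  ultimately have U: "(\<Union>i. ?B i) = ball x (\<rho> x)" by blast
  have "incseq ?B" 
    by (intro incseq_SucI subset_ball diff_left_mono divide_left_mono) auto
  then have "(SUP i. emeasure \<nu> (?B i)) = emeasure \<nu> (ball x (\<rho> x))"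
    by (subst SUP_emeasure_incseq) (auto simp: sn simp flip: U)
  with c have "c < (SUP i. emeasure \<nu> (?B i))" by simp
  then obtain i where i: "c < emeasure \<nu> (?B i)" unfolding less_SUP_iff by blast
  \<comment> \<open>Half the amount by which the radius was shrunk: one half absorbs the
    displacement of the centre, the other the variation of \<open>\<rho>\<close>.\<close>
  define e where "e = 1 / (2 * real (Suc i))"
  have e: "0 < e" "2 * e = 1 / Suc i" by (auto simp: e_def field_simps)
  have "isCont \<rho> x" using \<rho> by (simp add: continuous_on_eq_continuous_at)
  then obtain d where d: "0 < d" "\<And>x'. dist x' x < d \<Longrightarrow> dist (\<rho> x') (\<rho> x) < e"
    using e by (auto simp: continuous_at_eps_delta)
  show "\<exists>e>0. ball x e \<subseteq> {x. c < emeasure \<nu> (ball x (\<rho> x))}"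
  proof (intro exI conjI subsetI)
    show "0 < min d e" using d e by simp
    fix x' assume "x' \<in> ball x (min d e)"
    then have x': "dist x' x < d" "dist x x' < e" by (auto simp: dist_commute)
    have "?B i \<subseteq> ball x' (\<rho> x')"
    proof
      fix z assume "z \<in> ?B i"
      then have "dist x z < \<rho> x - 2 * e" by (simp add: e)
      then show "z \<in> ball x' (\<rho> x')"
        using x' d(2)[OF x'(1)] dist_triangle[of x' z x] by (auto simp: dist_commute dist_real_def)
    qed
    then have "emeasure \<nu> (?B i) \<le> emeasure \<nu> (ball x' (\<rho> x'))"
      by (intro emeasure_mono) (auto simp: sn)
    with i show "x' \<in> {x. c < emeasure \<nu> (ball x (\<rho> x))}" by simp
  qed
qed

lemma V_measurable:
  assumes "continuous_on UNIV \<rho>" shows "(\<lambda>x. V x (\<rho> x)) \<in> borel_measurable \<mu>"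
proof -
  have "(\<lambda>x. emeasure \<mu> (ball x (\<rho> x))) \<in> borel_measurable borel"
    by (rule borel_measurableI_greater) (use V_lower[OF sets_mu assms] in auto)
  then have "(\<lambda>x. enn2real (emeasure \<mu> (ball x (\<rho> x)))) \<in> borel_measurable borel" by measurable
  then show ?thesis by (simp add: borel_measurable_mu V_def measure_def)
qed

lemma V_measurable_dist [measurable]: "(\<lambda>y. V x (r + dist x y)) \<in> borel_measurable \<mu>"
proof -
  have "(\<lambda>u. V x u) \<in> borel_measurable borel"
    by (rule borel_measurable_mono) (simp add: mono_def V_mono)
  moreover have "(\<lambda>y. r + dist x y) \<in> borel_measurable \<mu>"
    unfolding borel_measurable_mu by (intro borel_measurable_continuous_onI continuous_intros)
  ultimately show ?thesis by measurable
qed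

lemma dist_measurable [measurable]: "(\<lambda>y. dist x y) \<in> borel_measurable \<mu>"
  unfolding borel_measurable_mu by (intro borel_measurable_continuous_onI continuous_intros)

lemma P_measurable [measurable]: "P g x r \<in> borel_measurable \<mu>"
  unfolding P_def[abs_def] by measurable

lemma nn_integral_P: 
  assumes "0 < g" "0 < r" shows "(\<integral>\<^sup>+y. ennreal (P g x r y) \<partial>\<mu>) \<le> ennreal (mass_const g)"
proof -
  have "(\<integral>\<^sup>+y. ennreal (P g x r y) * 1 \<partial>\<mu>) \<le> ennreal (mass_const g) * 1"
    by (rule nn_integral_P_le) (use assms in \<open>auto simp: emeasure_ball\<close>)
  then show ?thesis by simp
qed

lemma integrable_P: assumes "0 < g" "0 < r" shows "integrable \<mu> (P g x r)"
  using nn_integral_P[OF assms, of x] by (intro integrableI_bounded) (auto simp: ennreal_less_top intro: le_less_trans)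

lemma integral_P: assumes "0 < g" "0 < r" shows "(\<integral>y. P g x r y \<partial>\<mu>) \<le> mass_const g"
  using nn_integral_P[OF assms, of x] mass_const_pos[OF assms(1)]
  by (subst (asm) nn_integral_eq_integral[OF integrable_P[OF assms]]) (auto simp: ennreal_le_iff)

end

section \<open>Covering balls and the maximal function\<close>

lemma enn_powr_ennreal [simp]: "0 \<le> x \<Longrightarrow> enn_powr (ennreal x) q = ennreal (x powr q)"
  by (simp add: enn_powr_def)

lemma enn_powr_top [simp]: "enn_powr top q = top"
  by (simp add: enn_powr_def)

lemma enn_powr_zero [simp]: "enn_powr 0 q = 0"
  by (simp add: enn_powr_def)

lemma enn_powr_mono: "0 \<le> q \<Longrightarrow> x \<le> y \<Longrightarrow> enn_powr x q \<le> enn_powr y q"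
  by (cases x; cases y) (auto simp: powr_mono2 top_unique)

lemma enn_powr_mult: "0 < q \<Longrightarrow> 0 < c \<Longrightarrow> enn_powr (ennreal c * x) q = ennreal (c powr q) * enn_powr x q"
  by (cases x) (auto simp: powr_mult ennreal_mult_top simp flip: ennreal_mult)

lemma enn_powr_powr: "enn_powr (enn_powr x q) s = enn_powr x (q * s)"
  by (cases x) (auto simp: powr_powr)

lemma enn_powr_one [simp]: "enn_powr x 1 = x"
  by (cases x) auto

lemma enn_powr_measurable [measurable]:
  assumes [measurable]: "f \<in> borel_measurable M" shows "(\<lambda>x. enn_powr (f x) q) \<in> borel_measurable M"
  unfolding enn_powr_def by measurable

text \<open>Vitali's greedy selection: keep a ball of largest radius, discard every ball that meets
  it, and recurse. The discarded balls have radius at most that of the chosen one, so its triple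
  contains them.\<close>

lemma finite_ball_covering:
  fixes F :: "('a::metric_space \<times> real) set"
  assumes "finite F"
  shows "\<exists>G\<subseteq>F. disjoint_family_on (\<lambda>(c, \<rho>). ball c \<rho>) G
     \<and> (\<Union>(c, \<rho>)\<in>F. ball c \<rho>) \<subseteq> (\<Union>(c, \<rho>)\<in>G. ball c (3 * \<rho>))"
  using assms
proof (induction F rule: finite_psubset_induct)
  case (psubset F)
  show ?case
  proof (cases "\<exists>p\<in>F. 0 < snd p")
    case False
    have "(\<Union>(c, \<rho>)\<in>F. ball c \<rho>) = {}"
    proof (intro equals0I)
      fix y assume "y \<in> (\<Union>(c, \<rho>)\<in>F. ball c \<rho>)"
      then obtain c \<rho> where "(c, \<rho>) \<in> F" "dist c y < \<rho>" by auto
      moreover from this have "0 < \<rho>" using zero_le_dist[of c y] by linarith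
      ultimately show False using False by force
    qed
    then show ?thesis
      by (intro exI[of _ "{}"]) (auto simp: disjoint_family_on_def)
  next
    case True
    define m where "m = Max (snd ` F)"
    have "m \<in> snd ` F" unfolding m_def using True psubset(1) by (intro Max_in) auto
    then obtain c where c: "(c, m) \<in> F" by auto
    have le: "\<rho> \<le> m" if "(z, \<rho>) \<in> F" for z \<rho>
      unfolding m_def using that psubset(1) by (intro Max_ge) force+
    have m: "0 < m" using True le by fastforce
    define F' where "F' = {(z, \<rho>) \<in> F. ball z \<rho> \<inter> ball c m = {}}"
    have "(c, m) \<notin> F'" using m by (auto simp: F'_def)
    moreover have "F' \<subseteq> F" by (auto simp: F'_def)
    ultimately have "F' \<subset> F" using c by blast
    from psubset(2)[OF this] obtain G where G: "G \<subseteq> F'"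
      "disjoint_family_on (\<lambda>(c, \<rho>). ball c \<rho>) G"
      "(\<Union>(c, \<rho>)\<in>F'. ball c \<rho>) \<subseteq> (\<Union>(c, \<rho>)\<in>G. ball c (3 * \<rho>))" by blast
    have "ball z \<rho> \<subseteq> ball c (3 * m)" if z: "(z, \<rho>) \<in> F" "(z, \<rho>) \<notin> F'" for z \<rho>
    proof
      obtain w where w: "dist z w < \<rho>" "dist c w < m" using z by (auto simp: F'_def)
      fix y assume "y \<in> ball z \<rho>"
      then show "y \<in> ball c (3 * m)"
        using w le[OF z(1)] dist_triangle[of c y z] dist_triangle[of c z w] by (auto simp: dist_commute)
    qed
    note inc = this
    have "(\<Union>(c, \<rho>)\<in>F. ball c \<rho>) \<subseteq> (\<Union>(c, \<rho>)\<in>insert (c, m) G. ball c (3 * \<rho>))"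
    proof
      fix y assume "y \<in> (\<Union>(c, \<rho>)\<in>F. ball c \<rho>)"
      then obtain z \<rho> where z: "(z, \<rho>) \<in> F" "y \<in> ball z \<rho>" by (auto simp del: mem_ball)
      show "y \<in> (\<Union>(c, \<rho>)\<in>insert (c, m) G. ball c (3 * \<rho>))"
      proof (cases "(z, \<rho>) \<in> F'")
        case True
        then have "y \<in> (\<Union>(c, \<rho>)\<in>F'. ball c \<rho>)" using z(2) by (intro UN_I[of "(z, \<rho>)"]) auto
        then have "y \<in> (\<Union>(c, \<rho>)\<in>G. ball c (3 * \<rho>))" using G(3) by (rule rev_subsetD)
        then show ?thesis by simp
      next
        case False
        have "y \<in> ball c (3 * m)" using inc[OF z(1) False] z(2) by (rule subsetD)
        then show ?thesis by simp
      qed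
    qed
    moreover have "disjoint_family_on (\<lambda>(c, \<rho>). ball c \<rho>) (insert (c, m) G)"
    proof -
      let ?b = "\<lambda>p. case p of (c, \<rho>) \<Rightarrow> ball c \<rho>"
      have A: "?b p \<inter> ?b (c, m) = {}" if "p \<in> G" for p
      proof -
        have "p \<in> F'" using that G(1) by (rule rev_subsetD)
        then show ?thesis unfolding F'_def by (cases p) simp
      qed
      have B: "?b p \<inter> ?b q = {}" if "p \<in> G" "q \<in> G" "p \<noteq> q" for p q
        by (rule disjoint_family_onD[OF G(2) that])
      show ?thesis unfolding disjoint_family_on_def
      proof (intro ballI impI)
        fix p q assume "p \<in> insert (c, m) G" "q \<in> insert (c, m) G" "p \<noteq> q"
        then consider "p = (c, m)" "q \<in> G" | "q = (c, m)" "p \<in> G" | "p \<in> G" "q \<in> G" by (elim insertE) simp_all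
        then show "?b p \<inter> ?b q = {}"
        proof cases
          case 1 then show ?thesis using A[of q] by (simp only: Int_commute)
        next
          case 2 then show ?thesis using A[of p] by (simp only:)
        next
          case 3 then show ?thesis using \<open>p \<noteq> q\<close> by (rule B)
        qed
      qed
    qed
    ultimately show ?thesis using G(1) c
      by (intro exI[of _ "insert (c, m) G"]) (auto simp: F'_def)
  qed
qed

section \<open>Separated sets and weak-type estimates\<close>

definition separated :: "real \<Rightarrow> 'a::metric_space set \<Rightarrow> bool" where
  "separated \<delta> Z \<longleftrightarrow> (\<forall>x\<in>Z. \<forall>y\<in>Z. x \<noteq> y \<longrightarrow> \<delta> \<le> dist x y)"

lemma maximal_separated:
  assumes "0 < \<delta>"
  obtains Z :: "'a::metric_space set" where "separated \<delta> Z" "\<And>x. \<exists>z\<in>Z. dist x z < \<delta>"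
proof -
  have "\<exists>M\<in>{Z::'a set. separated \<delta> Z}. \<forall>X\<in>{Z. separated \<delta> Z}. M \<subseteq> X \<longrightarrow> X = M"
  proof (rule subset_Zorn')
    fix C assume C: "subset.chain {Z::'a set. separated \<delta> Z} C"
    show "\<Union>C \<in> {Z. separated \<delta> Z}"
      unfolding mem_Collect_eq separated_def
    proof safe
      fix x y X Y assume "x \<in> X" "X \<in> C" "y \<in> Y" "Y \<in> C" "x \<noteq> y"
      moreover have "X \<subseteq> Y \<or> Y \<subseteq> X" "separated \<delta> X" "separated \<delta> Y"
        using C calculation by (auto simp: subset_chain_def)
      ultimately show "\<delta> \<le> dist x y" by (auto simp: separated_def)
    qed
  qed
  then obtain Z :: "'a set" where Z: "separated \<delta> Z" and
    max: "\<And>X. separated \<delta> X \<Longrightarrow> Z \<subseteq> X \<Longrightarrow> X = Z" by auto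
  have "\<exists>z\<in>Z. dist x z < \<delta>" for x
  proof (rule ccontr)
    assume "\<not> ?thesis"
    then have far: "\<forall>z\<in>Z. \<delta> \<le> dist x z" by (auto simp: not_less)
    then have "separated \<delta> (insert x Z)" using Z by (auto simp: separated_def dist_commute)
    then have "x \<in> Z" using max by blast
    with far assms show False by auto
  qed
  with Z that show ?thesis by blast
qed

context doubling_measure
begin

text \<open>This is countable additivity of the measure with density h.\<close>

lemma nn_integral_Union_countable:
  assumes [measurable]: "h \<in> borel_measurable \<mu>" and "countable I" "\<And>i. i \<in> I \<Longrightarrow> B i \<in> sets \<mu>"
    and "disjoint_family_on B I"
  shows "(\<integral>\<^sup>+x\<in>(\<Union>i\<in>I. B i). h x \<partial>\<mu>) = (\<integral>\<^sup>+i. (\<integral>\<^sup>+x\<in>B i. h x \<partial>\<mu>) \<partial>count_space I)"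
proof -
  have "emeasure (density \<mu> h) (\<Union>i\<in>I. B i) = (\<integral>\<^sup>+i. emeasure (density \<mu> h) (B i) \<partial>count_space I)"
    by (rule emeasure_UN_countable) (use assms in auto)
  moreover have "(\<Union>i\<in>I. B i) \<in> sets \<mu>" using assms by (intro sets.countable_UN') auto
  ultimately show ?thesis using assms
    by (simp add: emeasure_density cong: nn_integral_cong_simp)
qed

lemma UNIV_sets [simp]: "UNIV \<in> sets \<mu>"
  by (simp add: sets_mu)

text \<open>The balls of radius \<open>\<delta> / 2\<close> around the points are disjoint, lie in
  one fixed ball, and by doubling each has at least a fixed positive volume.\<close>

lemma separated_finite:
  fixes Z :: "'a set"
  assumes "0 < \<delta>" "separated \<delta> Z" shows "finite (Z \<inter> ball x R)"
proof (rule ccontr)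
  assume inf: "infinite (Z \<inter> ball x R)"
  then obtain z0 where "z0 \<in> ball x R" by (metis Int_iff finite.emptyI equals0I)
  then have R: "0 < R" using zero_le_dist[of x z0] by (simp del: zero_le_dist)
  \<comment> \<open>Chosen so that \<open>L * (\<delta> / 2)\<close> equals 2 R + \<delta>, the
    radius needed around a point z of the ball to contain the ball of radius R + \<delta> around
    x.\<close>
  define L where "L = (2 * R + \<delta>) / (\<delta> / 2)"
  have L: "1 \<le> L" "0 < L" using R assms by (auto simp: L_def field_simps)
  define c where "c = V x (R + \<delta>) / (C1 * L powr n)"
  have c: "0 < c" using R assms C1_ge1 L by (auto simp: c_def)
  have cV: "c \<le> V z (\<delta> / 2)" if "z \<in> ball x R" for z
  proof -
    have "V x (R + \<delta>) \<le> C1 * L powr n * V z (\<delta> / 2)"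
      by (rule V_comp) (use that L assms in \<open>auto simp: L_def field_simps\<close>)
    then show ?thesis using C1_ge1 L by (simp add: c_def field_simps)
  qed
  obtain N :: nat where N: "V x (R + \<delta>) < N * c"
    using reals_Archimedean3[OF c] by blast
  obtain F where F: "finite F" "card F = N" "F \<subseteq> Z \<inter> ball x R"
    using infinite_arbitrarily_large[OF inf] by blast
  have disj: "disjoint_family_on (\<lambda>z. ball z (\<delta> / 2)) F"
    unfolding disjoint_family_on_def
  proof safe
    fix z w y assume "z \<in> F" "w \<in> F" "z \<noteq> w" and y: "y \<in> ball z (\<delta> / 2)" "y \<in> ball w (\<delta> / 2)"
    then have "\<delta> \<le> dist z w" using F assms(2) by (auto simp: separated_def)
    with y dist_triangle[of z w y] show "y \<in> {}" by (simp add: dist_commute)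
  qed
  have "ennreal (N * c) = (\<Sum>z\<in>F. ennreal c)"
    using F c by (simp add: ennreal_mult ennreal_of_nat_eq_real_of_nat)
  also have "\<dots> \<le> (\<Sum>z\<in>F. emeasure \<mu> (ball z (\<delta> / 2)))"
    using F cV by (intro sum_mono) (auto simp: emeasure_ball intro!: ennreal_leI)
  also have "\<dots> = emeasure \<mu> (\<Union>z\<in>F. ball z (\<delta> / 2))"
    using F disj by (intro sum_emeasure) auto
  also have "\<dots> \<le> emeasure \<mu> (ball x (R + \<delta>))"
  proof (intro emeasure_mono subsetI)
    fix y assume "y \<in> (\<Union>z\<in>F. ball z (\<delta> / 2))"
    then obtain z where "z \<in> F" "dist z y < \<delta> / 2" by auto
    then show "y \<in> ball x (R + \<delta>)" using F(3) dist_triangle[of x y z] assms(1) by fastforce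
  qed simp
  finally show False using N by (simp add: emeasure_ball ennreal_le_iff)
qed

lemma separated_countable:
  fixes Z :: "'a set"
  assumes "0 < \<delta>" "separated \<delta> Z" shows "countable Z"
proof -
  obtain x :: 'a where True by simp
  have "Z = (\<Union>N::nat. Z \<inter> ball x N)"
    using reals_Archimedean2 by fastforce
  moreover have "countable (\<Union>N::nat. Z \<inter> ball x N)"
    using separated_finite[OF assms] by (intro countable_UN) (auto intro: countable_finite)
  ultimately show ?thesis by simp
qed

text \<open>The disjoint balls of the covering lemma carry in total at most the integral of h, and
  passing to their triples costs the factor \<open>C1 * 3 powr n\<close>.\<close>

lemma weak_type_finite:
  assumes [measurable]: "h \<in> borel_measurable \<mu>" and "finite F"
    and F: "\<And>c \<rho>. (c, \<rho>) \<in> F \<Longrightarrow> 0 < \<rho> \<and> a * ennreal (V c \<rho>) \<le> (\<integral>\<^sup>+y\<in>ball c \<rho>. h y \<partial>\<mu>)"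
  shows "a * emeasure \<mu> (\<Union>(c, \<rho>)\<in>F. ball c \<rho>) \<le> ennreal (C1 * 3 powr n) * (\<integral>\<^sup>+y. h y \<partial>\<mu>)"
proof -
  obtain G where G: "G \<subseteq> F" "disjoint_family_on (\<lambda>(c, \<rho>). ball c \<rho>) G"
    "(\<Union>(c, \<rho>)\<in>F. ball c \<rho>) \<subseteq> (\<Union>(c, \<rho>)\<in>G. ball c (3 * \<rho>))"
    using finite_ball_covering[OF assms(2)] by blast
  have finG: "finite G" using G(1) assms(2) by (rule finite_subset)
  have "emeasure \<mu> (\<Union>(c, \<rho>)\<in>F. ball c \<rho>) \<le> emeasure \<mu> (\<Union>(c, \<rho>)\<in>G. ball c (3 * \<rho>))"
    using G finG by (intro emeasure_mono) auto
  also have "\<dots> \<le> (\<Sum>p\<in>G. emeasure \<mu> (case p of (c, \<rho>) \<Rightarrow> ball c (3 * \<rho>)))"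
    using finG by (intro emeasure_subadditive_finite) auto
  also have "\<dots> \<le> (\<Sum>p\<in>G. ennreal (C1 * 3 powr n) * ennreal (V (fst p) (snd p)))"
  proof (intro sum_mono)
    fix p assume "p \<in> G"
    then obtain c \<rho> where p: "p = (c, \<rho>)" "0 < \<rho>" using F G(1) by (cases p) auto
    show "emeasure \<mu> (case p of (c, \<rho>) \<Rightarrow> ball c (3 * \<rho>)) \<le> ennreal (C1 * 3 powr n) * ennreal (V (fst p) (snd p))"
      using V_doubling[of \<rho> 3 "3 * \<rho>" c] p C1_ge1
      by (simp add: emeasure_ball ennreal_leI flip: ennreal_mult)
  qed
  finally have "a * emeasure \<mu> (\<Union>(c, \<rho>)\<in>F. ball c \<rho>)
     \<le> a * (\<Sum>p\<in>G. ennreal (C1 * 3 powr n) * ennreal (V (fst p) (snd p)))"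
    by (rule mult_left_mono) simp
  also have "\<dots> = ennreal (C1 * 3 powr n) * (\<Sum>p\<in>G. a * ennreal (V (fst p) (snd p)))"
    by (simp add: sum_distrib_left mult_ac)
  also have "(\<Sum>p\<in>G. a * ennreal (V (fst p) (snd p))) \<le> (\<Sum>p\<in>G. emeasure (density \<mu> h) (case p of (c, \<rho>) \<Rightarrow> ball c \<rho>))"
    using F G(1) by (intro sum_mono) (auto simp: emeasure_density split: prod.split)
  also have "(\<Sum>p\<in>G. emeasure (density \<mu> h) (case p of (c, \<rho>) \<Rightarrow> ball c \<rho>)) = emeasure (density \<mu> h) (\<Union>p\<in>G. case p of (c, \<rho>) \<Rightarrow> ball c \<rho>)"
    using G finG by (intro sum_emeasure) auto
  also have "\<dots> \<le> emeasure (density \<mu> h) (space \<mu>)"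
    by (intro emeasure_mono) auto
  also have "\<dots> = (\<integral>\<^sup>+y. h y \<partial>\<mu>)" by (subst emeasure_density) auto
  finally show ?thesis by (simp add: mult_left_mono)
qed

text \<open>Finite initial segments of an enumeration exhaust the union, and the finite bound does
  not depend on their length.\<close>

lemma weak_type_countable:
  assumes h: "h \<in> borel_measurable \<mu>" and "countable F"
    and F: "\<And>c \<rho>. (c, \<rho>) \<in> F \<Longrightarrow> 0 < \<rho> \<and> a * ennreal (V c \<rho>) \<le> (\<integral>\<^sup>+y\<in>ball c \<rho>. h y \<partial>\<mu>)"
  shows "a * emeasure \<mu> (\<Union>(c, \<rho>)\<in>F. ball c \<rho>) \<le> ennreal (C1 * 3 powr n) * (\<integral>\<^sup>+y. h y \<partial>\<mu>)"
proof (cases "F = {}")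
  case False
  define U where "U N = (\<Union>(c, \<rho>)\<in>from_nat_into F ` {..<N}. ball c \<rho>)" for N :: nat
  have inF: "from_nat_into F i \<in> F" for i using False by (rule from_nat_into)
  have "incseq U" unfolding U_def by (intro incseq_SucI UN_mono) auto
  moreover have "range U \<subseteq> sets \<mu>" by (auto simp: U_def intro!: sets.finite_UN split: prod.split)
  ultimately have "(SUP N. emeasure \<mu> (U N)) = emeasure \<mu> (\<Union>N. U N)"
    by (intro SUP_emeasure_incseq)
  also have "(\<Union>N. U N) = (\<Union>(c, \<rho>)\<in>F. ball c \<rho>)"
  proof (intro equalityI subsetI)
    fix y assume "y \<in> (\<Union>(c, \<rho>)\<in>F. ball c \<rho>)"
    then obtain p where p: "p \<in> F" "y \<in> (case p of (c, \<rho>) \<Rightarrow> ball c \<rho>)" by blast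
    obtain i where "p = from_nat_into F i" using p(1) from_nat_into_surj[OF assms(2)] by metis
    then have "p \<in> from_nat_into F ` {..<Suc i}" by auto
    with p(2) have "y \<in> U (Suc i)" unfolding U_def by (intro UN_I)
    then show "y \<in> (\<Union>N. U N)" by (rule UN_I[rotated]) simp
  next
    fix y assume "y \<in> (\<Union>N. U N)"
    then obtain N p where "p \<in> from_nat_into F ` {..<N}" "y \<in> (case p of (c, \<rho>) \<Rightarrow> ball c \<rho>)"
      unfolding U_def by (elim UN_E)
    moreover from this have "p \<in> F" using inF by auto
    ultimately show "y \<in> (\<Union>(c, \<rho>)\<in>F. ball c \<rho>)" by (intro UN_I)
  qed
  finally have eq: "emeasure \<mu> (\<Union>(c, \<rho>)\<in>F. ball c \<rho>) = (SUP N. emeasure \<mu> (U N))" ..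
  show ?thesis unfolding eq SUP_mult_left_ennreal
  proof (rule SUP_least)
    fix N
    show "a * emeasure \<mu> (U N) \<le> ennreal (C1 * 3 powr n) * (\<integral>\<^sup>+y. h y \<partial>\<mu>)"
      unfolding U_def
    proof (rule weak_type_finite[OF h])
      fix c \<rho> assume "(c, \<rho>) \<in> from_nat_into F ` {..<N}"
      then have "(c, \<rho>) \<in> F" using inF by (metis imageE)
      then show "0 < \<rho> \<and> a * ennreal (V c \<rho>) \<le> (\<integral>\<^sup>+y\<in>ball c \<rho>. h y \<partial>\<mu>)" by (rule F)
    qed simp
  qed
qed simp

end

text \<open>The sum runs downwards from its largest term, which is comparable with
  \<open>a powr \<sigma>\<close>; for \<sigma> > 0 the rest is a convergent geometric
  series.\<close>

lemma nn_integral_geometric_int_le: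
  fixes \<sigma> a :: real
  assumes "0 < \<sigma>" "0 < a"
  shows "(\<integral>\<^sup>+j. ennreal ((2 powr \<sigma>) powr real_of_int j) * indicator {j. 2 powr real_of_int j < 2 * a} j \<partial>count_space (UNIV::int set))
     \<le> ennreal (2 powr \<sigma> / (1 - 2 powr - \<sigma>) * a powr \<sigma>)"
proof -
  \<comment> \<open>The largest integer with \<open>2 powr k < 2 * a\<close>; it is the ceiling
    minus one, and not the floor, because the inequality is strict.\<close>
  define k where "k = \<lceil>log 2 (2 * a)\<rceil> - 1"
  have k: "2 powr j < 2 * a \<longleftrightarrow> j \<le> k" for j :: int
    using assms by (simp add: powr_less_iff k_def) linarith
  have bij: "bij_betw (\<lambda>i::nat. k - int i) UNIV {..k}"
    by (rule bij_betwI[where g = "\<lambda>j. nat (k - j)"]) auto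
  have "(\<integral>\<^sup>+j. ennreal ((2 powr \<sigma>) powr real_of_int j) * indicator {j. 2 powr real_of_int j < 2 * a} j \<partial>count_space (UNIV::int set))
     = (\<integral>\<^sup>+j. ennreal ((2 powr \<sigma>) powr real_of_int j) * indicator {..k} j \<partial>count_space UNIV)"
    unfolding k by (simp add: atMost_def)
  also have "\<dots> = (\<integral>\<^sup>+j. ennreal ((2 powr \<sigma>) powr real_of_int j) \<partial>count_space {..k})"
    by (subst nn_integral_count_space_indicator) auto
  also have "\<dots> = (\<integral>\<^sup>+i. ennreal ((2 powr \<sigma>) powr real_of_int (k - int i)) \<partial>count_space UNIV)"
    by (rule nn_integral_bij_count_space[OF bij, symmetric])
  also have "\<dots> = (\<Sum>i. ennreal ((2 powr \<sigma>) powr real_of_int k * (2 powr - \<sigma>) ^ i))"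
    by (subst nn_integral_count_space_nat)
       (simp add: powr_diff powr_minus powr_realpow power_inverse divide_inverse)
  also have "\<dots> = ennreal ((2 powr \<sigma>) powr real_of_int k * (1 / (1 - 2 powr - \<sigma>)))"
  proof -
    have "(2::real) powr - \<sigma> < 1" using assms by (simp add: powr_less_one)
    then have "(\<lambda>i. (2 powr \<sigma>) powr real_of_int k * (2 powr - \<sigma>) ^ i) sums
      ((2 powr \<sigma>) powr real_of_int k * (1 / (1 - 2 powr - \<sigma>)))"
      by (intro sums_mult geometric_sums) auto
    then show ?thesis by (intro suminf_ennreal_eq) auto
  qed
  also have "\<dots> \<le> ennreal (2 powr \<sigma> / (1 - 2 powr - \<sigma>) * a powr \<sigma>)"
  proof (rule ennreal_leI)
    have d: "0 < 1 - (2::real) powr - \<sigma>" using assms by (simp add: powr_less_one)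
    have "(2 powr \<sigma>) powr real_of_int k = (2 powr k) powr \<sigma>"
      by (simp add: powr_powr mult.commute)
    also have "\<dots> \<le> (2 * a) powr \<sigma>" using k[of k] assms by (intro powr_mono2) auto
    also have "\<dots> = 2 powr \<sigma> * a powr \<sigma>" by (simp add: powr_mult)
    finally show "(2 powr \<sigma>) powr real_of_int k * (1 / (1 - 2 powr - \<sigma>)) \<le> 2 powr \<sigma> / (1 - 2 powr - \<sigma>) * a powr \<sigma>"
      using d by (simp add: divide_right_mono)
  qed
  finally show ?thesis .
qed

text \<open>A discrete layer-cake bound: if 2^j < y and y is at most 2^(j + 1), the single term with
  this j already dominates; for infinite y the terms are unbounded.\<close>

lemma enn_powr_le_dyadic:
  assumes "0 < s"
  shows "enn_powr y s \<le> (\<integral>\<^sup>+j. ennreal (2 powr ((real_of_int j + 1) * s)) * indicator {j. ennreal (2 powr real_of_int j) < y} j \<partial>count_space UNIV)"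
    (is "_ \<le> ?S")
proof -
  have ge: "ennreal (2 powr ((real_of_int j + 1) * s)) \<le> ?S" if "ennreal (2 powr real_of_int j) < y" for j
  proof -
    have "ennreal (2 powr ((real_of_int j + 1) * s)) * indicator {j. ennreal (2 powr real_of_int j) < y} j \<le> ?S"
      by (rule nn_integral_ge_point) simp
    then show ?thesis using that by simp
  qed
  show ?thesis
  proof (cases y)
    case top
    have "?S = top"
    proof (rule ccontr)
      assume "?S \<noteq> top"
      then obtain c where c: "?S = ennreal c" "0 \<le> c" by (cases ?S) auto
      obtain m :: nat where m: "c < m" using reals_Archimedean2 by blast
      define j where "j = \<lceil>log 2 (m + 1) / s\<rceil>"
      have "log 2 (m + 1) \<le> (real_of_int j + 1) * s"
      proof -
        have "log 2 (m + 1) / s \<le> real_of_int j + 1" unfolding j_def by linarith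
        then show ?thesis using assms by (simp add: field_simps)
      qed
      then have "real m + 1 \<le> 2 powr ((real_of_int j + 1) * s)" by (simp add: le_powr_iff add.commute)
      moreover have "2 powr ((real_of_int j + 1) * s) \<le> c"
        using ge[of j] top c by (simp add: ennreal_le_iff)
      ultimately show False using m by simp
    qed
    then show ?thesis by (simp only: top_greatest)
  next
    case (real r)
    show ?thesis
    proof (cases "r = 0")
      case False
      then have r: "0 < r" using real by simp
      define j where "j = \<lceil>log 2 r\<rceil> - 1"
      have "real_of_int j < log 2 r" "log 2 r \<le> real_of_int j + 1" unfolding j_def by linarith+
      then have j: "2 powr real_of_int j < r" "r \<le> 2 powr (real_of_int j + 1)"
        using r by (simp_all add: powr_less_iff le_powr_iff)
      have "r powr s \<le> (2 powr (real_of_int j + 1)) powr s"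
        using j r assms by (intro powr_mono2) auto
      then have "enn_powr y s \<le> ennreal (2 powr ((real_of_int j + 1) * s))"
        using real r by (simp add: powr_powr ennreal_leI)
      also have "\<dots> \<le> ?S" by (rule ge) (use real j in \<open>simp add: ennreal_less_iff\<close>)
      finally show ?thesis .
    qed (use real in simp)
  qed
qed

context doubling_measure
begin

text \<open>The maximal function is built from a countable family of
  balls, so its level sets are unions of balls to which the finite covering lemma applies.\<close>

lemma maximal_function:
  assumes "1 < s"
  obtains C where "0 < C" "\<And>h. h \<in> borel_measurable \<mu> \<Longrightarrow> \<exists>M\<in>borel_measurable \<mu>.
    (\<forall>x \<rho>. 0 < \<rho> \<longrightarrow> (\<integral>\<^sup>+y\<in>ball x \<rho>. h y \<partial>\<mu>) \<le> M x * ennreal (V x \<rho>))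
    \<and> (\<integral>\<^sup>+x. enn_powr (M x) s \<partial>\<mu>) \<le> ennreal C * (\<integral>\<^sup>+x. enn_powr (h x) s \<partial>\<mu>)"
proof -
  have "\<exists>Z::int \<Rightarrow> 'a set. \<forall>j. separated (2 powr j) (Z j) \<and> (\<forall>x. \<exists>z\<in>Z j. dist x z < 2 powr j)"
    by (intro choice allI) (metis maximal_separated powr_gt_zero zero_neq_numeral)
  then obtain Z :: "int \<Rightarrow> 'a set" where Z: "\<And>j. separated (2 powr j) (Z j)"
    "\<And>j x. \<exists>z\<in>Z j. dist x z < 2 powr j" by metis
  have Zc: "countable (Z j)" for j using separated_countable[OF _ Z(1)] by simp
  \<comment> \<open>Every ball of radius between 2^(j - 1) and 2^j is contained in a ball of this
    countable family with comparable volume, so the uncentred maximal function over \<open>F\<close>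
    controls all averages.\<close>
  define F where "F = (\<Union>j. (\<lambda>z. (z, 2 * 2 powr real_of_int j)) ` Z j)"
  have F: "countable F" using Zc by (auto simp: F_def)
  have F0: "0 < \<rho>" if "(c, \<rho>) \<in> F" for c \<rho> using that by (auto simp: F_def)
  \<comment> \<open>With \<rho> below 2^j and 2^j < 2 \<rho>, the family ball has radius 2 * 2^j < 4
    \<rho> and centre within 2 \<rho> of x, hence the 6. \<open>W\<close> is the constant of the
    weak-type bound.\<close>
  define K where "K = C1 * 6 powr n"
  define W where "W = C1 * 3 powr n"
  have KW: "0 < K" "0 < W" using C1_ge1 by (auto simp: K_def W_def)
  define D where "D = 2 powr (s + 1) * W * (2 powr (s - 1) / (1 - 2 powr - (s - 1)))"
  have "2 powr - (s - 1) < 1" using assms by (intro powr_less_one) auto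
  then have D: "0 < D" using KW by (simp add: D_def)
  show ?thesis
  proof (rule that[of "K powr s * D"])
    show "0 < K powr s * D" using KW D by simp
    fix h :: "'a \<Rightarrow> ennreal" assume h[measurable]: "h \<in> borel_measurable \<mu>"
    define av where "av c \<rho> = (\<integral>\<^sup>+y\<in>ball c \<rho>. h y \<partial>\<mu>) / ennreal (V c \<rho>)" for c \<rho>
    define M where "M x = (SUP p\<in>F. case p of (c, \<rho>) \<Rightarrow> av c \<rho> * indicator (ball c \<rho>) x)" for x
    have M[measurable]: "M \<in> borel_measurable \<mu>"
      unfolding M_def by (rule borel_measurable_SUP[OF F]) (auto split: prod.split)
    have lvl [measurable]: "{x. a < f x} \<in> sets \<mu>" if "f \<in> borel_measurable \<mu>" for f :: "'a \<Rightarrow> ennreal" and a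
    proof -
      have "{x \<in> space \<mu>. a < f x} \<in> sets \<mu>" using that by measurable
      then show ?thesis by simp
    qed
    have avV: "(\<integral>\<^sup>+y\<in>ball c \<rho>. h y \<partial>\<mu>) = av c \<rho> * ennreal (V c \<rho>)" if "0 < \<rho>" for c \<rho>
    proof -
      have "ennreal (V c \<rho>) / ennreal (V c \<rho>) = 1"
        using V_pos[OF that, of c] by (simp add: divide_ennreal)
      then show ?thesis by (simp add: av_def ennreal_divide_times)
    qed
    have ball_M: "(\<integral>\<^sup>+y\<in>ball x \<rho>. h y \<partial>\<mu>) \<le> ennreal K * M x * ennreal (V x \<rho>)" if \<rho>: "0 < \<rho>" for x \<rho>
    proof -
      define j where "j = \<lceil>log 2 \<rho>\<rceil>"
      have "log 2 \<rho> \<le> real_of_int j" "real_of_int j < log 2 (2 * \<rho>)"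
        unfolding j_def using \<rho> by (auto simp: log_mult) linarith+
      then have j: "\<rho> \<le> 2 powr j" "2 powr j < 2 * \<rho>"
        using \<rho> by (simp_all add: le_powr_iff powr_less_iff)
      obtain z where z: "z \<in> Z j" "dist x z < 2 powr j" using Z(2) by blast
      let ?R = "2 * 2 powr real_of_int j"
      have zF: "(z, ?R) \<in> F" using z by (auto simp: F_def)
      have "0 < 2 powr real_of_int j" by simp
      then have "dist z x < ?R" using z(2) unfolding dist_commute[of z x] by linarith
      then have xz: "x \<in> ball z ?R" by simp
      have sub: "ball x \<rho> \<subseteq> ball z ?R"
      proof
        fix y assume "y \<in> ball x \<rho>"
        then show "y \<in> ball z ?R" using z j dist_triangle[of z y x] by (simp add: dist_commute)
      qed
      have "(\<integral>\<^sup>+y\<in>ball x \<rho>. h y \<partial>\<mu>) \<le> (\<integral>\<^sup>+y\<in>ball z ?R. h y \<partial>\<mu>)"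
        using sub by (intro nn_integral_mono) (auto simp: indicator_def)
      also have "\<dots> = av z ?R * ennreal (V z ?R)" by (rule avV) simp
      also have "av z ?R \<le> M x"
        unfolding M_def by (rule SUP_upper2[OF zF]) (use xz in simp)
      also have "M x * ennreal (V z ?R) \<le> M x * ennreal (K * V x \<rho>)"
        unfolding K_def using z j \<rho>
        by (intro mult_left_mono ennreal_leI V_comp) (auto simp: dist_commute)
      also have "\<dots> = ennreal K * M x * ennreal (V x \<rho>)"
        using KW by (simp add: ennreal_mult mult_ac)
      finally show ?thesis by (simp add: mult_right_mono)
    qed
    have weak: "ennreal (2 powr j) * emeasure \<mu> {x. ennreal (2 powr real_of_int j) < M x}
       \<le> ennreal (2 * W) * (\<integral>\<^sup>+y. h y * indicator {y. ennreal (2 powr real_of_int j) < 2 * h y} y \<partial>\<mu>)" for j :: int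
    proof -
      \<comment> \<open>Half the level. On a ball with average above \<open>2 * a\<close>, the
        values of h not exceeding a contribute at most a times the volume; subtracting them leaves a
        contribution of at least a times the volume from the part where h > a.\<close>
      define a where "a = 2 powr real_of_int j / 2"
      have a: "0 < a" "2 powr real_of_int j = 2 * a" by (auto simp: a_def)
      let ?h = "\<lambda>y. h y * indicator {y. ennreal (2 * a) < 2 * h y} y"
      have eq: "{x. ennreal (2 * a) < M x} = (\<Union>(c, \<rho>)\<in>{(c, \<rho>)\<in>F. ennreal (2 * a) < av c \<rho>}. ball c \<rho>)"
        unfolding M_def less_SUP_iff using a(1)
        by (auto split: prod.splits simp: indicator_def split: if_splits; fastforce)
      have "ennreal a * emeasure \<mu> {x. ennreal (2 * a) < M x} \<le> ennreal W * (\<integral>\<^sup>+y. ?h y \<partial>\<mu>)"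
        unfolding eq W_def
      proof (rule weak_type_countable)
        show "countable {(c, \<rho>)\<in>F. ennreal (2 * a) < av c \<rho>}"
          by (rule countable_subset[OF _ F]) auto
        fix c \<rho> assume "(c, \<rho>) \<in> {(c, \<rho>)\<in>F. ennreal (2 * a) < av c \<rho>}"
        then have \<rho>: "0 < \<rho>" and av: "ennreal (2 * a) < av c \<rho>" using F0 by auto
        have ne: "ennreal a * ennreal (V c \<rho>) \<noteq> top" using a by (simp flip: ennreal_mult)
        have "ennreal a * ennreal (V c \<rho>) + ennreal a * ennreal (V c \<rho>) = ennreal (2 * a) * ennreal (V c \<rho>)"
          using a by (simp flip: ennreal_mult ennreal_plus)
        also have "\<dots> \<le> (\<integral>\<^sup>+y\<in>ball c \<rho>. h y \<partial>\<mu>)"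
          unfolding avV[OF \<rho>] using av by (intro mult_right_mono) auto
        also have "\<dots> \<le> (\<integral>\<^sup>+y. ?h y * indicator (ball c \<rho>) y + ennreal a * indicator (ball c \<rho>) y \<partial>\<mu>)"
        proof (rule nn_integral_mono)
          fix y
          have "h y \<le> ennreal a" if "\<not> ennreal (2 * a) < 2 * h y"
          proof (cases "h y")
            case (real r)
            then have "2 * h y = ennreal (2 * r)" by (simp add: ennreal_mult)
            then show ?thesis using that real a by (auto simp: ennreal_less_iff not_less ennreal_le_iff)
          qed (use that a in \<open>auto simp: ennreal_mult_top\<close>)
          then show "h y * indicator (ball c \<rho>) y \<le> ?h y * indicator (ball c \<rho>) y + ennreal a * indicator (ball c \<rho>) y"
            by (auto simp: indicator_def)
        qed
        also have "\<dots> = (\<integral>\<^sup>+y\<in>ball c \<rho>. ?h y \<partial>\<mu>) + ennreal a * ennreal (V c \<rho>)"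
          by (subst nn_integral_add) (auto simp: nn_integral_cmult_indicator emeasure_ball)
        finally show "0 < \<rho> \<and> ennreal a * ennreal (V c \<rho>) \<le> (\<integral>\<^sup>+y\<in>ball c \<rho>. ?h y \<partial>\<mu>)"
          using \<rho> ne by (auto simp: add.commute[of "\<integral>\<^sup>+y. _ y \<partial>\<mu>"])
      qed measurable
      then have "2 * (ennreal a * emeasure \<mu> {x. ennreal (2 * a) < M x}) \<le> 2 * (ennreal W * (\<integral>\<^sup>+y. ?h y \<partial>\<mu>))"
        by (intro mult_left_mono) auto
      then show ?thesis
        using a(1) KW unfolding a(2) by (simp add: ennreal_mult mult.assoc)
    qed
    have "(\<integral>\<^sup>+x. enn_powr (M x) s \<partial>\<mu>)
       \<le> (\<integral>\<^sup>+x. (\<integral>\<^sup>+j. ennreal (2 powr ((real_of_int j + 1) * s)) * indicator {x. ennreal (2 powr real_of_int j) < M x} x \<partial>count_space UNIV) \<partial>\<mu>)"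
      using enn_powr_le_dyadic[of s] assms by (intro nn_integral_mono) (auto simp: indicator_def)
    also have "\<dots> = (\<integral>\<^sup>+j. (\<integral>\<^sup>+x. ennreal (2 powr ((real_of_int j + 1) * s)) * indicator {x. ennreal (2 powr real_of_int j) < M x} x \<partial>\<mu>) \<partial>count_space UNIV)"
      by (rule nn_integral_count_space_nn_integral) auto
    also have "\<dots> \<le> (\<integral>\<^sup>+j. (\<integral>\<^sup>+y. ennreal (2 powr (s + 1) * W) * (ennreal ((2 powr (s - 1)) powr real_of_int j) * (h y * indicator {y. ennreal (2 powr real_of_int j) < 2 * h y} y)) \<partial>\<mu>) \<partial>count_space UNIV)"
    proof (rule nn_integral_mono)
      fix j :: int
      have e: "2 powr ((real_of_int j + 1) * s) = 2 powr (s + (s - 1) * j) * 2 powr j"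
        by (simp add: powr_add[symmetric] algebra_simps)
      have "(\<integral>\<^sup>+x. ennreal (2 powr ((real_of_int j + 1) * s)) * indicator {x. ennreal (2 powr real_of_int j) < M x} x \<partial>\<mu>)
        = ennreal (2 powr ((real_of_int j + 1) * s)) * emeasure \<mu> {x. ennreal (2 powr real_of_int j) < M x}"
        by (rule nn_integral_cmult_indicator[OF lvl[OF M]])
      also have "\<dots> = ennreal (2 powr (s + (s - 1) * j)) * (ennreal (2 powr j) * emeasure \<mu> {x. ennreal (2 powr real_of_int j) < M x})"
        unfolding e by (simp add: ennreal_mult mult.assoc)
      also have "\<dots> \<le> ennreal (2 powr (s + (s - 1) * j)) * (ennreal (2 * W) * (\<integral>\<^sup>+y. h y * indicator {y. ennreal (2 powr real_of_int j) < 2 * h y} y \<partial>\<mu>))"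
        by (intro mult_left_mono weak) auto
      also have "\<dots> = ennreal (2 powr (s + 1) * W) * (ennreal ((2 powr (s - 1)) powr real_of_int j) * (\<integral>\<^sup>+y. h y * indicator {y. ennreal (2 powr real_of_int j) < 2 * h y} y \<partial>\<mu>))"
      proof -
        have "2 powr (s + (s - 1) * j) * (2 * W) = 2 powr (s + 1) * W * (2 powr (s - 1)) powr j"
          by (simp add: powr_add powr_powr)
        then have "ennreal (2 powr (s + (s - 1) * j)) * ennreal (2 * W) = ennreal (2 powr (s + 1) * W) * ennreal ((2 powr (s - 1)) powr real_of_int j)"
          using KW by (simp flip: ennreal_mult)
        then show ?thesis by (simp add: mult.assoc[symmetric])
      qed
      also have "\<dots> = (\<integral>\<^sup>+y. ennreal (2 powr (s + 1) * W) * (ennreal ((2 powr (s - 1)) powr real_of_int j) * (h y * indicator {y. ennreal (2 powr real_of_int j) < 2 * h y} y)) \<partial>\<mu>)"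
        by (subst nn_integral_cmult, measurable, subst nn_integral_cmult, measurable)
      finally show "(\<integral>\<^sup>+x. ennreal (2 powr ((real_of_int j + 1) * s)) * indicator {x. ennreal (2 powr real_of_int j) < M x} x \<partial>\<mu>) \<le> \<dots>" .
    qed
    also have "\<dots> = (\<integral>\<^sup>+y. (\<integral>\<^sup>+j. ennreal (2 powr (s + 1) * W) * (ennreal ((2 powr (s - 1)) powr real_of_int j) * (h y * indicator {y. ennreal (2 powr real_of_int j) < 2 * h y} y)) \<partial>count_space UNIV) \<partial>\<mu>)"
      by (rule nn_integral_count_space_nn_integral[symmetric]) auto
    \<comment> \<open>After the exchange of sum and integral, the levels at a fixed y are those with
      2^j < 2 h(y). Their weights form a geometric series with ratio 2^(s - 1), whose convergence is
      where s > 1 enters.\<close>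
    also have "\<dots> \<le> (\<integral>\<^sup>+y. ennreal D * enn_powr (h y) s \<partial>\<mu>)"
    proof (rule nn_integral_mono)
      fix y
      show "(\<integral>\<^sup>+j. ennreal (2 powr (s + 1) * W) * (ennreal ((2 powr (s - 1)) powr real_of_int j) * (h y * indicator {y. ennreal (2 powr real_of_int j) < 2 * h y} y)) \<partial>count_space UNIV)
        \<le> ennreal D * enn_powr (h y) s"
      proof (cases "h y")
        case top then show ?thesis using D by (simp add: ennreal_mult_top)
      next
        case (real a)
        show ?thesis
        proof (cases "a = 0")
          case False
          then have a: "0 < a" using real by simp
          have lt: "ennreal (2 powr real_of_int j) < 2 * h y \<longleftrightarrow> 2 powr real_of_int j < 2 * a" for j
          proof -
            have "2 * h y = ennreal (2 * a)" using real by (simp add: ennreal_mult)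
            then show ?thesis by (simp add: ennreal_less_iff)
          qed
          have "(\<integral>\<^sup>+j. ennreal (2 powr (s + 1) * W) * (ennreal ((2 powr (s - 1)) powr real_of_int j) * (h y * indicator {y. ennreal (2 powr real_of_int j) < 2 * h y} y)) \<partial>count_space UNIV)
            = (\<integral>\<^sup>+j. (ennreal (2 powr (s + 1) * W) * h y) * (ennreal ((2 powr (s - 1)) powr real_of_int j) * indicator {j. 2 powr real_of_int j < 2 * a} j) \<partial>count_space UNIV)"
            by (intro nn_integral_cong, unfold indicator_def mem_Collect_eq lt, simp only: mult_ac)
          also have "\<dots> = (ennreal (2 powr (s + 1) * W) * h y) * (\<integral>\<^sup>+j. (ennreal ((2 powr (s - 1)) powr real_of_int j) * indicator {j. 2 powr real_of_int j < 2 * a} j) \<partial>count_space UNIV)"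
            by (rule nn_integral_cmult) simp
          also have "\<dots> \<le> (ennreal (2 powr (s + 1) * W) * h y) * ennreal (2 powr (s - 1) / (1 - 2 powr - (s - 1)) * a powr (s - 1))"
            using assms a by (intro mult_left_mono nn_integral_geometric_int_le) auto
          also have "\<dots> = ennreal (2 powr (s + 1) * W * a * (2 powr (s - 1) / (1 - 2 powr - (s - 1)) * a powr (s - 1)))"
          proof -
            have "(ennreal (2 powr (s + 1) * W) * h y) * ennreal G = ennreal (2 powr (s + 1) * W * a * G)" for G
              using KW real a by (simp add: ennreal_mult' mult.assoc)
            then show ?thesis .
          qed
          also have "\<dots> = ennreal D * enn_powr (h y) s"
          proof -
            have "a * a powr (s - 1) = a powr s" using a by (simp add: powr_mult_base)
            then have "2 powr (s + 1) * W * a * (2 powr (s - 1) / (1 - 2 powr - (s - 1)) * a powr (s - 1)) = D * a powr s"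
              unfolding D_def by (simp add: mult_ac)
            then show ?thesis using real D by (simp flip: ennreal_mult)
          qed
          finally show ?thesis .
        qed (use real in simp)
      qed
    qed
    also have "\<dots> = ennreal D * (\<integral>\<^sup>+y. enn_powr (h y) s \<partial>\<mu>)" by (rule nn_integral_cmult) measurable
    finally have strong: "(\<integral>\<^sup>+x. enn_powr (M x) s \<partial>\<mu>) \<le> ennreal D * (\<integral>\<^sup>+y. enn_powr (h y) s \<partial>\<mu>)" .
    show "\<exists>M\<in>borel_measurable \<mu>.
      (\<forall>x \<rho>. 0 < \<rho> \<longrightarrow> (\<integral>\<^sup>+y\<in>ball x \<rho>. h y \<partial>\<mu>) \<le> M x * ennreal (V x \<rho>))
      \<and> (\<integral>\<^sup>+x. enn_powr (M x) s \<partial>\<mu>) \<le> ennreal (K powr s * D) * (\<integral>\<^sup>+x. enn_powr (h x) s \<partial>\<mu>)"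
    proof (intro bexI[of _ "\<lambda>x. ennreal K * M x"] conjI allI impI)
      have "(\<integral>\<^sup>+x. enn_powr (ennreal K * M x) s \<partial>\<mu>) = ennreal (K powr s) * (\<integral>\<^sup>+x. enn_powr (M x) s \<partial>\<mu>)"
        using assms KW by (simp add: enn_powr_mult nn_integral_cmult)
      also have "\<dots> \<le> ennreal (K powr s) * (ennreal D * (\<integral>\<^sup>+x. enn_powr (h x) s \<partial>\<mu>))"
        by (intro mult_left_mono strong) simp
      finally show "(\<integral>\<^sup>+x. enn_powr (ennreal K * M x) s \<partial>\<mu>) \<le> ennreal (K powr s * D) * (\<integral>\<^sup>+x. enn_powr (h x) s \<partial>\<mu>)"
        using D by (simp add: ennreal_mult mult.assoc)
    qed (use ball_M in auto)
  qed
qed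


section \<open>Sampling\<close>

text \<open>The map \<open>\<pi>\<close> sends a point to the sample point of its cell, so
  integrating a function of \<open>\<pi> u\<close> is summing over the sample points with the cell
  volumes as weights. Local finiteness of the range makes such a sum finite for functions of bounded
  support.\<close>

definition sampling_map :: "real \<Rightarrow> ('a \<Rightarrow> 'a) \<Rightarrow> bool" where
  "sampling_map \<delta> \<pi> \<longleftrightarrow> (\<forall>u. dist u (\<pi> u) \<le> \<delta>) \<and> countable (range \<pi>) \<and>
     (\<forall>p. \<pi> -` {p} \<in> sets \<mu>) \<and> (\<forall>x R. finite (range \<pi> \<inter> ball x R))"

text \<open>The fibres are countably many measurable cells, so composition with any h whatsoever is
  measurable.\<close>

lemma sampling_map_measurable:
  assumes "sampling_map \<delta> \<pi>" shows "(\<lambda>u. h (\<pi> u)) \<in> measurable \<mu> (count_space UNIV)"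
proof -
  have c: "countable (range \<pi>)" and m: "\<And>p. \<pi> -` {p} \<in> sets \<mu>"
    using assms by (auto simp: sampling_map_def)
  show ?thesis
  proof (rule measurableI)
    fix A
    have "(\<lambda>u. h (\<pi> u)) -` A = (\<Union>p\<in>{p\<in>range \<pi>. h p \<in> A}. \<pi> -` {p})" by auto
    also have "\<dots> \<in> sets \<mu>" using m by (intro sets.countable_UN'' countable_subset[OF _ c]) auto
    finally show "(\<lambda>u. h (\<pi> u)) -` A \<inter> space \<mu> \<in> sets \<mu>" by simp
  qed simp
qed

lemma sampling_map_borel [measurable (raw)]:
  assumes "sampling_map \<delta> \<pi>" shows "(\<lambda>u. h (\<pi> u)) \<in> borel_measurable \<mu>"
  using sampling_map_measurable[OF assms, of id] measurable_compose[of \<pi> \<mu> "count_space UNIV" h borel] by simp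

text \<open>If g exceeded its mean throughout the ball, then, the ball having positive measure, its
  integral would exceed itself.\<close>

lemma exists_le_average:
  fixes g :: "'a \<Rightarrow> ennreal"
  assumes [measurable]: "g \<in> borel_measurable \<mu>" and r: "0 < r"
  shows "\<exists>y\<in>ball z r. g y * ennreal (V z r) \<le> (\<integral>\<^sup>+y\<in>ball z r. g y \<partial>\<mu>)"
proof (rule ccontr)
  assume "\<not> ?thesis"
  then have lt: "(\<integral>\<^sup>+y\<in>ball z r. g y \<partial>\<mu>) < g y * ennreal (V z r)" if "y \<in> ball z r" for y
    using that by (auto simp: not_le)
  define I where "I = (\<integral>\<^sup>+y\<in>ball z r. g y \<partial>\<mu>)"
  have "z \<in> ball z r" using r by simp
  \<comment> \<open>The assumed inequality is strict, so the integral cannot be infinite and the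
    mean is a real number.\<close>
  from lt[OF this] have "I < top" unfolding I_def by (metis top.extremum less_le_trans)
  then obtain i where i: "I = ennreal i" "0 \<le> i" by (cases I) auto
  define a where "a = i / V z r"
  have v: "0 < V z r" using r by simp
  have a: "0 \<le> a" "I = ennreal a * ennreal (V z r)"
    using i v by (simp_all add: a_def flip: ennreal_mult)
  have ga: "ennreal a < g y" if "y \<in> ball z r" for y
  proof (rule ccontr)
    assume "\<not> ennreal a < g y"
    then have "g y * ennreal (V z r) \<le> I" unfolding a(2) by (intro mult_right_mono) (auto simp: not_less)
    then show False using lt[OF that] by (simp add: I_def)
  qed
  have Ia: "(\<integral>\<^sup>+y. ennreal a * indicator (ball z r) y \<partial>\<mu>) = I"
    by (simp add: nn_integral_cmult_indicator emeasure_ball a(2))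
  have "(\<integral>\<^sup>+y. ennreal a * indicator (ball z r) y \<partial>\<mu>) < (\<integral>\<^sup>+y. g y * indicator (ball z r) y \<partial>\<mu>)"
  proof (rule nn_integral_less)
    show "(\<integral>\<^sup>+y. ennreal a * indicator (ball z r) y \<partial>\<mu>) \<noteq> \<infinity>" unfolding Ia i by simp
    show "AE y in \<mu>. ennreal a * indicator (ball z r) y \<le> g y * indicator (ball z r) y"
      using ga by (intro AE_I2) (auto simp: indicator_def intro: less_imp_le)
    show "\<not> (AE y in \<mu>. g y * indicator (ball z r) y \<le> ennreal a * indicator (ball z r) y)"
    proof
      assume "AE y in \<mu>. g y * indicator (ball z r) y \<le> ennreal a * indicator (ball z r) y"
      then have "AE y in \<mu>. y \<notin> ball z r"
      proof eventually_elim
        case (elim y)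
        show ?case
        proof
          assume "y \<in> ball z r"
          then show False using elim ga[of y] by (simp add: leD)
        qed
      qed
      then have "emeasure \<mu> (ball z r) = 0" by (subst (asm) AE_iff_measurable[OF ball_sets]) auto
      then show False using emeasure_ball_pos[OF r, of z] by simp
    qed
  qed measurable
  then show False by (simp add: Ia I_def)
qed

text \<open>The 6 compares a ball of radius \<delta> with a ball of radius \<delta> / 4 whose centre
  is less than \<delta> / 2 away: \<delta> + \<delta> / 2 = 6 (\<delta> / 4).\<close>

definition sampling_const :: real where "sampling_const = C1 * 6 powr n"

lemma sampling_const_pos: "0 < sampling_const" using C1_ge1 by (simp add: sampling_const_def)

text \<open>Each cell lies around a point of a \<delta>/2-separated net, and its sample point is
  taken where g does not exceed the average over a small ball around that net point. The first
  estimate controls single sampled values; the second controls sampled integrals against weights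
  that vary slowly at scale \<delta>, because the small balls are disjoint and each is comparable
  with its cell.\<close>

lemma sampling:
  fixes g :: "'a \<Rightarrow> ennreal"
  assumes g[measurable]: "g \<in> borel_measurable \<mu>" and \<delta>: "0 < \<delta>"
  obtains \<pi> where "sampling_map \<delta> \<pi>"
    "\<And>u. g (\<pi> u) * ennreal (V u \<delta>) \<le> ennreal sampling_const * (\<integral>\<^sup>+y\<in>ball u (2 * \<delta>). g y \<partial>\<mu>)"
    "\<And>w L. w \<in> borel_measurable \<mu> \<Longrightarrow> (\<And>u v. dist u v \<le> \<delta> \<Longrightarrow> w u \<le> L * w v) \<Longrightarrow>
      (\<integral>\<^sup>+u. w u * g (\<pi> u) \<partial>\<mu>) \<le> ennreal sampling_const * L * (\<integral>\<^sup>+u. w u * g u \<partial>\<mu>)"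
proof -
  obtain Z :: "'a set" where Z: "separated (\<delta> / 2) Z" "\<And>x. \<exists>z\<in>Z. dist x z < \<delta> / 2"
    using maximal_separated[of "\<delta> / 2"] \<delta> by auto
  have Zc: "countable Z" by (rule separated_countable[OF _ Z(1)]) (use \<delta> in simp)
  have Zne: "Z \<noteq> {}" using Z(2) by blast
  define \<zeta> where "\<zeta> = from_nat_into Z"
  have \<zeta>Z: "\<zeta> i \<in> Z" for i unfolding \<zeta>_def using Zne by (rule from_nat_into)
  \<comment> \<open>Taking the first net point within \<delta> / 2 turns the overlapping covering
    into a partition into measurable cells.\<close>
  define ix where "ix u = (LEAST i. dist u (\<zeta> i) < \<delta> / 2)" for u
  have ex: "\<exists>i. dist u (\<zeta> i) < \<delta> / 2" for u
    using Z(2)[of u] from_nat_into_surj[OF Zc] unfolding \<zeta>_def by metis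
  have ix: "dist u (\<zeta> (ix u)) < \<delta> / 2" for u unfolding ix_def by (rule LeastI_ex[OF ex])
  have ixm: "{u. Q (ix u)} \<in> sets \<mu>" for Q
  proof -
    have "{u. ix u = i} = ball (\<zeta> i) (\<delta> / 2) - (\<Union>j<i. ball (\<zeta> j) (\<delta> / 2))" for i
    proof (intro equalityI subsetI)
      fix u assume "u \<in> {u. ix u = i}"
      then have "ix u = i" by simp
      then show "u \<in> ball (\<zeta> i) (\<delta> / 2) - (\<Union>j<i. ball (\<zeta> j) (\<delta> / 2))"
        using ix[of u] not_less_Least[of _ "\<lambda>i. dist u (\<zeta> i) < \<delta> / 2"] by (auto simp: ix_def dist_commute)
    next
      fix u assume u: "u \<in> ball (\<zeta> i) (\<delta> / 2) - (\<Union>j<i. ball (\<zeta> j) (\<delta> / 2))"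
      have "ix u = i" unfolding ix_def
        by (rule Least_equality) (use u in \<open>auto simp: dist_commute not_less[symmetric]\<close>)
      then show "u \<in> {u. ix u = i}" by simp
    qed
    then have "{u. ix u = i} \<in> sets \<mu>" for i by auto
    then have "(\<Union>i\<in>{i. Q i}. {u. ix u = i}) \<in> sets \<mu>" by (intro sets.countable_UN'') auto
    also have "(\<Union>i\<in>{i. Q i}. {u. ix u = i}) = {u. Q (ix u)}" by auto
    finally show ?thesis .
  qed
  \<comment> \<open>Radius \<delta> / 4 is half the separation of the net, so that integrals over
    these balls add up.\<close>
  have "\<exists>y. dist z y < \<delta> / 4 \<and> g y * ennreal (V z (\<delta> / 4)) \<le> (\<integral>\<^sup>+u\<in>ball z (\<delta> / 4). g u \<partial>\<mu>)" for z
    using exists_le_average[OF g, of "\<delta> / 4" z] \<delta> by (auto simp: Bex_def)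
  then obtain y where y: "\<And>z. dist z (y z) < \<delta> / 4"
    "\<And>z. g (y z) * ennreal (V z (\<delta> / 4)) \<le> (\<integral>\<^sup>+u\<in>ball z (\<delta> / 4). g u \<partial>\<mu>)" by metis
  define \<pi> where "\<pi> u = y (\<zeta> (ix u))" for u
  show ?thesis
  proof (rule that[of \<pi>])
    have "dist u (\<pi> u) \<le> \<delta>" for u
      using ix[of u] y(1)[of "\<zeta> (ix u)"] dist_triangle[of u "\<pi> u" "\<zeta> (ix u)"] \<delta> unfolding \<pi>_def by linarith
    moreover have "countable (range \<pi>)"
    proof (rule countable_subset)
      show "range \<pi> \<subseteq> y ` Z" using \<zeta>Z by (auto simp: \<pi>_def)
    qed (use Zc in simp)
    moreover have "\<pi> -` {p} \<in> sets \<mu>" for p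
      using ixm[of "\<lambda>i. y (\<zeta> i) = p"] by (simp add: \<pi>_def vimage_def)
    moreover have "finite (range \<pi> \<inter> ball x R)" for x R
    proof (rule finite_subset)
      show "range \<pi> \<inter> ball x R \<subseteq> y ` (Z \<inter> ball x (R + \<delta>))"
      proof
        fix p assume p: "p \<in> range \<pi> \<inter> ball x R"
        then obtain z where z: "z \<in> Z" "p = y z" using \<zeta>Z by (auto simp: \<pi>_def)
        have "dist x z < R + \<delta>"
          using p z y(1)[of z] dist_triangle[of x z "y z"] \<delta> by (simp add: dist_commute)
        then show "p \<in> y ` (Z \<inter> ball x (R + \<delta>))" using z by auto
      qed
      show "finite (y ` (Z \<inter> ball x (R + \<delta>)))"
        using separated_finite[OF _ Z(1)] \<delta> by simp
    qed
    ultimately show sp: "sampling_map \<delta> \<pi>" by (auto simp: sampling_map_def)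
    show "g (\<pi> u) * ennreal (V u \<delta>) \<le> ennreal sampling_const * (\<integral>\<^sup>+y\<in>ball u (2 * \<delta>). g y \<partial>\<mu>)" for u
    proof -
      let ?z = "\<zeta> (ix u)"
      have "V u \<delta> \<le> sampling_const * V ?z (\<delta> / 4)"
        unfolding sampling_const_def by (rule V_comp) (use \<delta> ix[of u] in auto)
      then have "g (\<pi> u) * ennreal (V u \<delta>) \<le> g (\<pi> u) * ennreal (sampling_const * V ?z (\<delta> / 4))"
        by (intro mult_left_mono ennreal_leI) auto
      also have "\<dots> = ennreal sampling_const * (g (y ?z) * ennreal (V ?z (\<delta> / 4)))"
        using sampling_const_pos by (simp add: \<pi>_def ennreal_mult mult_ac)
      also have "\<dots> \<le> ennreal sampling_const * (\<integral>\<^sup>+v\<in>ball ?z (\<delta> / 4). g v \<partial>\<mu>)"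
        by (intro mult_left_mono y) auto
      also have "\<dots> \<le> ennreal sampling_const * (\<integral>\<^sup>+v\<in>ball u (2 * \<delta>). g v \<partial>\<mu>)"
      proof (rule mult_left_mono, rule nn_integral_mono)
        fix v
        have "v \<in> ball u (2 * \<delta>)" if "v \<in> ball ?z (\<delta> / 4)"
          using that ix[of u] dist_triangle[of u v ?z] \<delta> by simp
        then show "g v * indicator (ball ?z (\<delta> / 4)) v \<le> g v * indicator (ball u (2 * \<delta>)) v"
          by (auto simp: indicator_def)
      qed simp
      finally show ?thesis .
    qed
    fix w :: "'a \<Rightarrow> ennreal" and L :: ennreal
    assume w[measurable]: "w \<in> borel_measurable \<mu>" and L: "\<And>u v. dist u v \<le> \<delta> \<Longrightarrow> w u \<le> L * w v"
    note [measurable] = sampling_map_borel[OF sp]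
    let ?Q = "\<lambda>z. {u. \<zeta> (ix u) = z}" and ?B = "\<lambda>z. ball z (\<delta> / 4)"
    have UQ: "(\<Union>z\<in>Z. ?Q z) = UNIV" using \<zeta>Z by auto
    have Qm[measurable]: "?Q z \<in> sets \<mu>" for z using ixm[of "\<lambda>i. \<zeta> i = z"] .
    have "(\<integral>\<^sup>+u. w u * g (\<pi> u) \<partial>\<mu>) = (\<integral>\<^sup>+u\<in>(\<Union>z\<in>Z. ?Q z). w u * g (\<pi> u) \<partial>\<mu>)"
      unfolding UQ by simp
    also have "\<dots> = (\<integral>\<^sup>+z. (\<integral>\<^sup>+u\<in>?Q z. w u * g (\<pi> u) \<partial>\<mu>) \<partial>count_space Z)"
      by (rule nn_integral_Union_countable) (use Zc in \<open>auto simp: disjoint_family_on_def\<close>)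
    also have "\<dots> \<le> (\<integral>\<^sup>+z. ennreal sampling_const * L * (\<integral>\<^sup>+v\<in>?B z. w v * g v \<partial>\<mu>) \<partial>count_space Z)"
    proof (rule nn_integral_mono)
      fix z
      define J where "J = (\<integral>\<^sup>+v\<in>?B z. w v * g v \<partial>\<mu>)"
      let ?v = "ennreal (V z (\<delta> / 4))"
      have v: "?v \<noteq> 0" "?v \<noteq> top" using \<delta> less_imp_neq[OF V_pos[of "\<delta> / 4" z]] by auto
      have pt: "?v * (w u * g (\<pi> u)) \<le> L * J" if "u \<in> ?Q z" for u
      proof -
        have zu: "\<zeta> (ix u) = z" using that by simp
        have du: "dist u z < \<delta> / 2" using ix[of u] by (simp add: zu)
        have "?v * (w u * g (\<pi> u)) = w u * (g (y z) * ?v)" by (simp add: \<pi>_def zu mult_ac)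
        also have "\<dots> \<le> w u * (\<integral>\<^sup>+v\<in>?B z. g v \<partial>\<mu>)" by (intro mult_left_mono y) auto
        also have "\<dots> = (\<integral>\<^sup>+v. w u * (g v * indicator (?B z) v) \<partial>\<mu>)" by (rule nn_integral_cmult[symmetric]) measurable
        also have "\<dots> \<le> (\<integral>\<^sup>+v. L * (w v * g v * indicator (?B z) v) \<partial>\<mu>)"
        proof (rule nn_integral_mono)
          fix v
          have "w u \<le> L * w v" if "v \<in> ?B z"
            using that du dist_triangle[of u v z] \<delta> by (intro L) simp
          then have "w u * g v \<le> L * w v * g v" if "v \<in> ?B z" using that by (intro mult_right_mono) auto
          then show "w u * (g v * indicator (?B z) v) \<le> L * (w v * g v * indicator (?B z) v)"
            by (auto simp: indicator_def mult.assoc)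
        qed
        also have "\<dots> = L * J" unfolding J_def by (rule nn_integral_cmult) measurable
        finally show ?thesis .
      qed
      have "?v * (\<integral>\<^sup>+u\<in>?Q z. w u * g (\<pi> u) \<partial>\<mu>) = (\<integral>\<^sup>+u. ?v * (w u * g (\<pi> u) * indicator (?Q z) u) \<partial>\<mu>)"
        by (rule nn_integral_cmult[symmetric]) measurable
      also have "\<dots> \<le> (\<integral>\<^sup>+u. (L * J) * indicator (?Q z) u \<partial>\<mu>)"
        using pt by (intro nn_integral_mono) (auto simp: indicator_def)
      also have "\<dots> = L * J * emeasure \<mu> (?Q z)" by (rule nn_integral_cmult_indicator[OF Qm])
      also have "\<dots> \<le> L * J * ennreal (sampling_const * V z (\<delta> / 4))"
      proof (rule mult_left_mono)
        have "?Q z \<subseteq> ball z (\<delta> / 2)" using ix by (auto simp: dist_commute)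
        then have "emeasure \<mu> (?Q z) \<le> emeasure \<mu> (ball z (\<delta> / 2))" by (rule emeasure_mono) simp
        also have "\<dots> \<le> ennreal (sampling_const * V z (\<delta> / 4))"
          unfolding emeasure_ball sampling_const_def by (intro ennreal_leI V_doubling) (use \<delta> in auto)
        finally show "emeasure \<mu> (?Q z) \<le> ennreal (sampling_const * V z (\<delta> / 4))" .
      qed simp
      also have "\<dots> = ?v * (ennreal sampling_const * L * J)" using sampling_const_pos by (simp add: ennreal_mult mult_ac)
      finally show "(\<integral>\<^sup>+u\<in>?Q z. w u * g (\<pi> u) \<partial>\<mu>) \<le> ennreal sampling_const * L * (\<integral>\<^sup>+v\<in>?B z. w v * g v \<partial>\<mu>)"
        using v unfolding J_def by (subst (asm) ennreal_mult_le_mult_iff) auto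
    qed
    also have "\<dots> = ennreal sampling_const * L * (\<integral>\<^sup>+z. (\<integral>\<^sup>+v\<in>?B z. w v * g v \<partial>\<mu>) \<partial>count_space Z)"
      by (rule nn_integral_cmult) simp
    also have "(\<integral>\<^sup>+z. (\<integral>\<^sup>+v\<in>?B z. w v * g v \<partial>\<mu>) \<partial>count_space Z) = (\<integral>\<^sup>+v\<in>(\<Union>z\<in>Z. ?B z). w v * g v \<partial>\<mu>)"
    proof (rule nn_integral_Union_countable[symmetric])
      show "disjoint_family_on ?B Z"
        unfolding disjoint_family_on_def
      proof safe
        fix z z' v assume "z \<in> Z" "z' \<in> Z" "z \<noteq> z'" and v: "v \<in> ?B z" "v \<in> ?B z'"
        then have "\<delta> / 2 \<le> dist z z'" using Z(1) by (auto simp: separated_def)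
        with v dist_triangle[of z z' v] show "v \<in> {}" by (simp add: dist_commute)
      qed
    qed (use Zc in auto)
    also have "\<dots> \<le> (\<integral>\<^sup>+u. w u * g u \<partial>\<mu>)"
      by (intro nn_integral_mono) (auto simp: indicator_def)
    finally show "(\<integral>\<^sup>+u. w u * g (\<pi> u) \<partial>\<mu>) \<le> ennreal sampling_const * L * (\<integral>\<^sup>+u. w u * g u \<partial>\<mu>)"
      by (simp add: mult_left_mono)
  qed
qed

text \<open>A sampled value is split as F = (F^q)^(1/q - 1) F^q. In the first factor, F^q at a
  sample point is at most an average, which in terms of A costs ((r + d) / \<delta>)^n. Raised to
  the power 1/q - 1 this is (r / \<delta>)^a times the growth ((r + d) / r)^a, which the weight
  absorbs because a < \<gamma>. The second factor is integrated against the remaining weight of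
  exponent \<gamma> - a. One sampling map serves all x, r and A.\<close>

lemma sampled_integral_bound:
  assumes q: "0 < q" "q < 1" and \<gamma>: "n * (1 / q - 1) < \<gamma>"
  obtains C where "0 < C" "\<And>F \<delta>. F \<in> borel_measurable \<mu> \<Longrightarrow> (\<And>u. 0 \<le> F u) \<Longrightarrow> 0 < \<delta> \<Longrightarrow>
    \<exists>\<pi>. sampling_map \<delta> \<pi> \<and> (\<forall>x r A. \<delta> \<le> r / 2 \<longrightarrow> 0 \<le> A \<longrightarrow>
      (\<forall>\<rho>>0. (\<integral>\<^sup>+y\<in>ball x \<rho>. ennreal (F y powr q) \<partial>\<mu>) \<le> ennreal A * ennreal (V x \<rho>)) \<longrightarrow>
      (\<integral>\<^sup>+u. ennreal (P \<gamma> x r u * F (\<pi> u)) \<partial>\<mu>) \<le> ennreal (C * (r / \<delta>) powr (n * (1 / q - 1)) * A powr (1 / q)))"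
proof -
  define a where "a = n * (1 / q - 1)"
  have a: "0 < a" "a < \<gamma>" using q n_pos \<gamma> by (auto simp: a_def field_simps)
  define k where "k = sampling_const * C1 * 3 powr n"
  have k: "0 < k" using sampling_const_pos C1_ge1 by (simp add: k_def)
  define C where "C = k powr (1 / q - 1) * (sampling_const * near_const (\<gamma> - a) * mass_const (\<gamma> - a))"
  have ccp: "0 < near_const (\<gamma> - a)" using near_const_ge1[of "\<gamma> - a"] a by simp
  have C: "0 < C" using k sampling_const_pos ccp mass_const_pos[of "\<gamma> - a"] a by (simp add: C_def)
  show ?thesis
  proof (rule that[OF C])
    fix F :: "'a \<Rightarrow> real" and \<delta> :: real
    assume F[measurable]: "F \<in> borel_measurable \<mu>" and F0: "\<And>u. 0 \<le> F u" and \<delta>: "0 < \<delta>"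
    define g where "g u = ennreal (F u powr q)" for u
    have g[measurable]: "g \<in> borel_measurable \<mu>" unfolding g_def by measurable
    obtain \<pi> where sp: "sampling_map \<delta> \<pi>"
      and \<pi>1: "\<And>u. g (\<pi> u) * ennreal (V u \<delta>) \<le> ennreal sampling_const * (\<integral>\<^sup>+y\<in>ball u (2 * \<delta>). g y \<partial>\<mu>)"
      and \<pi>2: "\<And>w L. w \<in> borel_measurable \<mu> \<Longrightarrow> (\<And>u v. dist u v \<le> \<delta> \<Longrightarrow> w u \<le> L * w v) \<Longrightarrow>
      (\<integral>\<^sup>+u. w u * g (\<pi> u) \<partial>\<mu>) \<le> ennreal sampling_const * L * (\<integral>\<^sup>+u. w u * g u \<partial>\<mu>)"
      using sampling[OF g \<delta>] by blast
    note [measurable] = sampling_map_borel[OF sp]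
    show "\<exists>\<pi>. sampling_map \<delta> \<pi> \<and> (\<forall>x r A. \<delta> \<le> r / 2 \<longrightarrow> 0 \<le> A \<longrightarrow>
      (\<forall>\<rho>>0. (\<integral>\<^sup>+y\<in>ball x \<rho>. ennreal (F y powr q) \<partial>\<mu>) \<le> ennreal A * ennreal (V x \<rho>)) \<longrightarrow>
      (\<integral>\<^sup>+u. ennreal (P \<gamma> x r u * F (\<pi> u)) \<partial>\<mu>) \<le> ennreal (C * (r / \<delta>) powr (n * (1 / q - 1)) * A powr (1 / q)))"
      unfolding a_def[symmetric]
    proof (intro exI[of _ \<pi>] conjI sp allI impI)
      fix x :: 'a and r A :: real
      assume r2: "\<delta> \<le> r / 2" and A: "0 \<le> A"
        and "\<forall>\<rho>>0. (\<integral>\<^sup>+y\<in>ball x \<rho>. ennreal (F y powr q) \<partial>\<mu>) \<le> ennreal A * ennreal (V x \<rho>)"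
      then have av: "(\<integral>\<^sup>+y\<in>ball x \<rho>. g y \<partial>\<mu>) \<le> ennreal A * ennreal (V x \<rho>)" if "0 < \<rho>" for \<rho>
        using that by (simp add: g_def)
      have r: "0 < r" using r2 \<delta> by simp
      have pt: "P \<gamma> x r u * F (\<pi> u) \<le> k powr (1 / q - 1) * A powr (1 / q - 1) * (r / \<delta>) powr a * (P (\<gamma> - a) x r u * F (\<pi> u) powr q)" for u
      proof -
        let ?d = "r + dist x u"
        have d: "0 < ?d" using r by simp
        \<comment> \<open>The ball around x contains the ball of radius 2 \<delta> around u. The 3
          arises because 2 \<delta> is at most r, so that 2 d(x, u) + 2 \<delta> is at most 3 (r +
          d(x, u)).\<close>
        have VB: "V x (dist x u + 2 * \<delta>) \<le> C1 * (3 * (?d / \<delta>)) powr n * V u \<delta>"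
        proof (rule V_comp)
          have "\<delta> \<le> ?d" using r2 r zero_le_dist[of x u] by linarith
          then show "1 \<le> 3 * (?d / \<delta>)" using \<delta> by (simp add: field_simps)
          show "dist x u + 2 * \<delta> + dist x u \<le> 3 * (?d / \<delta>) * \<delta>"
          proof -
            have "dist x u + 2 * \<delta> + dist x u \<le> 3 * ?d" using r2 zero_le_dist[of x u] \<delta> by argo
            then show ?thesis using \<delta> by simp
          qed
        qed (use \<delta> in simp)
        note VB = VB[unfolded powr_mult[of 3]]
        have "g (\<pi> u) * ennreal (V u \<delta>) \<le> ennreal sampling_const * (\<integral>\<^sup>+y\<in>ball u (2 * \<delta>). g y \<partial>\<mu>)" by (rule \<pi>1)
        also have "(\<integral>\<^sup>+y\<in>ball u (2 * \<delta>). g y \<partial>\<mu>) \<le> (\<integral>\<^sup>+y\<in>ball x (dist x u + 2 * \<delta>). g y \<partial>\<mu>)"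
        proof (rule nn_integral_mono)
          fix v
          have "v \<in> ball x (dist x u + 2 * \<delta>)" if "v \<in> ball u (2 * \<delta>)"
            using that dist_triangle[of x v u] by simp
          then show "g v * indicator (ball u (2 * \<delta>)) v \<le> g v * indicator (ball x (dist x u + 2 * \<delta>)) v"
            by (auto simp: indicator_def)
        qed
        also have "\<dots> \<le> ennreal A * ennreal (V x (dist x u + 2 * \<delta>))"
          using \<delta> by (intro av) (simp add: add_nonneg_pos)
        also have "\<dots> \<le> ennreal A * ennreal (C1 * (3 powr n * (?d / \<delta>) powr n) * V u \<delta>)"
          using VB by (intro mult_left_mono ennreal_leI) auto
        finally have "ennreal (F (\<pi> u) powr q * V u \<delta>) \<le> ennreal (sampling_const * (A * (C1 * (3 powr n * (?d / \<delta>) powr n) * V u \<delta>)))"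
          using sampling_const_pos A C1_ge1 by (simp add: g_def ennreal_mult mult_left_mono)
        then have "F (\<pi> u) powr q * V u \<delta> \<le> (k * A * (?d / \<delta>) powr n) * V u \<delta>"
          using sampling_const_pos A C1_ge1 by (subst (asm) ennreal_le_iff) (auto simp: k_def mult_ac)
        then have B: "F (\<pi> u) powr q \<le> k * A * (?d / \<delta>) powr n" using \<delta> by simp
        \<comment> \<open>Only the factor of exponent 1/q - 1 is replaced by its pointwise bound;
          the other is kept for the sampled integral.\<close>
        have "F (\<pi> u) = (F (\<pi> u) powr q) powr (1 / q - 1) * F (\<pi> u) powr q"
        proof (cases "F (\<pi> u) = 0")
          case False
          have "q * (1 / q - 1) + q = 1" using q by (simp add: field_simps)
          then show ?thesis using False F0[of "\<pi> u"] by (simp add: powr_powr powr_add[symmetric])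
        qed (use q in simp)
        also have "\<dots> \<le> (k * A * (?d / \<delta>) powr n) powr (1 / q - 1) * F (\<pi> u) powr q"
          using B q by (intro mult_right_mono powr_mono2) (auto simp: field_simps)
        also have "(k * A * (?d / \<delta>) powr n) powr (1 / q - 1) = k powr (1 / q - 1) * A powr (1 / q - 1) * (r / \<delta>) powr a * (?d / r) powr a"
        proof -
          have "?d / \<delta> = (r / \<delta>) * (?d / r)" using r by simp
          then show ?thesis by (simp only: powr_mult powr_powr a_def[symmetric] mult_ac)
        qed
        finally have "P \<gamma> x r u * F (\<pi> u) \<le> P \<gamma> x r u * (k powr (1 / q - 1) * A powr (1 / q - 1) * (r / \<delta>) powr a * (?d / r) powr a * F (\<pi> u) powr q)"
          by (intro mult_left_mono) auto
        also have "\<dots> = k powr (1 / q - 1) * A powr (1 / q - 1) * (r / \<delta>) powr a * ((P \<gamma> x r u * (?d / r) powr a) * F (\<pi> u) powr q)"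
          by (simp add: mult_ac)
        finally show ?thesis unfolding P_mult[OF r] .
      qed
      let ?k = "k powr (1 / q - 1) * A powr (1 / q - 1) * (r / \<delta>) powr a"
      have "(\<integral>\<^sup>+u. ennreal (P \<gamma> x r u * F (\<pi> u)) \<partial>\<mu>) \<le> (\<integral>\<^sup>+u. ennreal ?k * (ennreal (P (\<gamma> - a) x r u) * g (\<pi> u)) \<partial>\<mu>)"
        using pt by (intro nn_integral_mono) (auto simp: g_def simp flip: ennreal_mult intro!: ennreal_leI)
      also have "\<dots> = ennreal ?k * (\<integral>\<^sup>+u. ennreal (P (\<gamma> - a) x r u) * g (\<pi> u) \<partial>\<mu>)"
        by (rule nn_integral_cmult) measurable
      also have "(\<integral>\<^sup>+u. ennreal (P (\<gamma> - a) x r u) * g (\<pi> u) \<partial>\<mu>)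
        \<le> ennreal sampling_const * ennreal (near_const (\<gamma> - a)) * (\<integral>\<^sup>+u. ennreal (P (\<gamma> - a) x r u) * g u \<partial>\<mu>)"
      proof (rule \<pi>2)
        fix u v :: 'a assume "dist u v \<le> \<delta>"
        then have "dist u v \<le> (r + dist x u) / 2" using r2 zero_le_dist[of x u] by argo
        then have "P (\<gamma> - a) x r u \<le> near_const (\<gamma> - a) * P (\<gamma> - a) x r v"
          using r a by (intro P_near(2)) auto
        then show "ennreal (P (\<gamma> - a) x r u) \<le> ennreal (near_const (\<gamma> - a)) * ennreal (P (\<gamma> - a) x r v)"
          using ccp by (simp add: ennreal_leI flip: ennreal_mult)
      qed measurable
      also have "(\<integral>\<^sup>+u. ennreal (P (\<gamma> - a) x r u) * g u \<partial>\<mu>) \<le> ennreal (mass_const (\<gamma> - a)) * ennreal A"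
        using a r by (intro nn_integral_P_le av) auto
      finally have "(\<integral>\<^sup>+u. ennreal (P \<gamma> x r u * F (\<pi> u)) \<partial>\<mu>)
        \<le> ennreal ?k * (ennreal sampling_const * ennreal (near_const (\<gamma> - a)) * (ennreal (mass_const (\<gamma> - a)) * ennreal A))"
        by (simp add: mult_left_mono)
      also have "\<dots> = ennreal (?k * (sampling_const * near_const (\<gamma> - a) * (mass_const (\<gamma> - a) * A)))"
        using sampling_const_pos ccp mass_const_pos[of "\<gamma> - a"] a A by (simp add: ennreal_mult)
      also have "?k * (sampling_const * near_const (\<gamma> - a) * (mass_const (\<gamma> - a) * A)) = C * (r / \<delta>) powr a * (A powr (1 / q - 1) * A)"
        by (simp add: C_def mult_ac)
      also have "A powr (1 / q - 1) * A = A powr (1 / q)"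
        using A by (cases "A = 0") (auto simp: powr_diff)
      finally show "(\<integral>\<^sup>+u. ennreal (P \<gamma> x r u * F (\<pi> u)) \<partial>\<mu>) \<le> ennreal (C * (r / \<delta>) powr a * A powr (1 / q))" .
    qed
  qed
qed


section \<open>Kernels\<close>

text \<open>One level of an approximation of the identity, with the weights expressed by
  \<open>P\<close>. The normalization is in the first variable, the one over which sampled averages
  integrate.\<close>

definition good_kernel :: "real \<Rightarrow> real \<Rightarrow> real \<Rightarrow> real \<Rightarrow> real \<Rightarrow> ('a \<Rightarrow> 'a \<Rightarrow> real) \<Rightarrow> bool" where
  "good_kernel c e1 e2 e3 t k \<longleftrightarrow> 0 < t \<and> 0 < c \<and> 0 < e1 \<and> 0 < e2 \<and> 0 < e3 \<and>
     (\<forall>x y. \<bar>k x y\<bar> \<le> c * P e2 x t y) \<and>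
     (\<forall>x x' y. dist x x' \<le> (t + dist x y) / 2 \<longrightarrow>
        \<bar>k x y - k x' y\<bar> \<le> c * (dist x x' / (t + dist x y)) powr e1 * P e2 x t y) \<and>
     (\<forall>x y y'. dist y y' \<le> (t + dist x y) / 2 \<longrightarrow>
        \<bar>k x y - k x y'\<bar> \<le> c * (dist y y' / (t + dist x y)) powr e1 * P e2 x t y) \<and>
     (\<forall>x x' y y'. dist x x' \<le> (t + dist x y) / 3 \<longrightarrow> dist y y' \<le> (t + dist x y) / 3 \<longrightarrow>
        \<bar>(k x y - k x y') - (k x' y - k x' y')\<bar>
          \<le> c * (dist x x' / (t + dist x y)) powr e1 * (dist y y' / (t + dist x y)) powr e1 * P e3 x t y) \<and>
     (\<forall>y. (\<integral>u. k u y \<partial>\<mu>) = 1)"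

lemma ratio_powr_mono:
  assumes "0 \<le> d" "d \<le> \<delta>" "0 < t" "0 \<le> e" shows "(d / (t + dist x y)) powr e \<le> (\<delta> / t) powr e"
proof (rule powr_mono2)
  have "d / (t + dist x y) \<le> d / t" using assms by (intro divide_left_mono) auto
  also have "\<dots> \<le> \<delta> / t" using assms by (intro divide_right_mono) auto
  finally show "d / (t + dist x y) \<le> \<delta> / t" .
qed (use assms in auto)

text \<open>Exchanges centre and argument. Kernels are integrated in their first variable with z
  fixed, so their bounds are needed as weights centred at z, and at u rather than at its sample
  point v.\<close>

lemma P_shift:
  assumes "0 < t" "0 \<le> e" "dist u v \<le> t"
  shows "P e v t z \<le> near_const e * P e z t u"
proof (rule P_change2)
  show "t + dist z u + dist v z \<le> 2 * (t + dist v z)"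
    using assms(3) dist_triangle[of z u v] by (simp add: dist_commute)
qed (use assms in auto)

section \<open>Kernel bounds recentred at the second variable\<close>

context
  fixes c e1 e2 e3 t k
  assumes gk: "good_kernel c e1 e2 e3 t k"
begin

lemma gk_pos: "0 < t" "0 < c" "0 < e1" "0 < e2" "0 < e3"
  using gk by (auto simp: good_kernel_def)

lemma gk_size:
  assumes "dist u v \<le> t" shows "\<bar>k v z\<bar> \<le> c * near_const e2 * P e2 z t u"
proof -
  have "\<bar>k v z\<bar> \<le> c * P e2 v t z" using gk by (simp add: good_kernel_def)
  also have "\<dots> \<le> c * (near_const e2 * P e2 z t u)"
    using gk_pos assms by (intro mult_left_mono P_shift) auto
  finally show ?thesis by simp
qed

lemma gk_first:
  assumes "dist u v \<le> \<delta>" "\<delta> \<le> t / 2"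
  shows "\<bar>k u z - k v z\<bar> \<le> c * near_const e2 * (\<delta> / t) powr e1 * P e2 z t u"
proof -
  have "dist u v \<le> (t + dist u z) / 2" using assms zero_le_dist[of u z] by argo
  then have "\<bar>k u z - k v z\<bar> \<le> c * (dist u v / (t + dist u z)) powr e1 * P e2 u t z"
    using gk by (simp add: good_kernel_def)
  also have "\<dots> \<le> c * (\<delta> / t) powr e1 * (near_const e2 * P e2 z t u)"
    using gk_pos assms near_const_ge1[of e2]
    by (intro mult_mono mult_left_mono ratio_powr_mono P_shift) auto
  finally show ?thesis by (simp add: mult_ac)
qed

lemma gk_second:
  assumes "dist u v \<le> t" "dist y z \<le> t / 2"
  shows "\<bar>k v y - k v z\<bar> \<le> c * near_const e2 * (dist y z / t) powr e1 * P e2 y t u"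
proof -
  have "dist y z \<le> (t + dist v y) / 2" using assms zero_le_dist[of v y] by argo
  then have "\<bar>k v y - k v z\<bar> \<le> c * (dist y z / (t + dist v y)) powr e1 * P e2 v t y"
    using gk by (simp add: good_kernel_def)
  also have "\<dots> \<le> c * (dist y z / t) powr e1 * (near_const e2 * P e2 y t u)"
    using gk_pos assms near_const_ge1[of e2]
    by (intro mult_mono mult_left_mono ratio_powr_mono P_shift) auto
  finally show ?thesis by (simp add: mult_ac)
qed

lemma gk_both:
  assumes "dist u v \<le> \<delta>" "\<delta> \<le> t / 3" "dist y z \<le> t / 3"
  shows "\<bar>(k v y - k v z) - (k u y - k u z)\<bar> \<le> c * near_const e3 * (\<delta> / t) powr e1 * (dist y z / t) powr e1 * P e3 y t u"
proof -
  have "dist y z \<le> (t + dist u y) / 3" "dist u v \<le> (t + dist u y) / 3"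
    using assms zero_le_dist[of u y] by argo+
  then have "\<bar>(k u y - k u z) - (k v y - k v z)\<bar> \<le> c * (dist u v / (t + dist u y)) powr e1 * (dist y z / (t + dist u y)) powr e1 * P e3 u t y"
    using gk by (simp add: good_kernel_def)
  also have "\<dots> \<le> c * (\<delta> / t) powr e1 * (dist y z / t) powr e1 * (near_const e3 * P e3 y t u)"
    using gk_pos assms near_const_ge1[of e3]
    by (intro mult_mono mult_left_mono ratio_powr_mono P_shift) auto
  finally show ?thesis by (simp add: mult_ac abs_minus_commute)
qed

lemma gk_continuous: "continuous_on UNIV (\<lambda>u. k u z)"
  unfolding continuous_on_eq_continuous_at[OF open_UNIV]
proof
  fix u
  let ?b = "\<lambda>v. c * (dist u v / t) powr e1 * (1 / V u t)"
  have lim: "?b \<midarrow>u\<rightarrow> 0"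
  proof -
    have "((\<lambda>v. dist u v / t) \<longlongrightarrow> dist u u / t) (at u)" using gk_pos by (intro tendsto_intros) auto
    then have "((\<lambda>v. (dist u v / t) powr e1) \<longlongrightarrow> 0) (at u)"
      using gk_pos by (intro tendsto_zero_powrI[where b = e1]) (auto intro!: always_eventually)
    then have "(?b \<longlongrightarrow> c * 0 * (1 / V u t)) (at u)" by (intro tendsto_intros)
    then show ?thesis by simp
  qed
  have bd: "\<forall>\<^sub>F v in at u. norm (k v z - k u z) \<le> ?b v"
  proof -
    have "\<forall>\<^sub>F v in at u. dist v u < t / 2" unfolding eventually_at using gk_pos by (intro exI[of _ "t / 2"]) auto
    then show ?thesis
    proof eventually_elim
      case (elim v)
      have "dist u v \<le> (t + dist u z) / 2" using elim zero_le_dist[of u z] unfolding dist_commute[of v u] by argo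
      then have "\<bar>k u z - k v z\<bar> \<le> c * (dist u v / (t + dist u z)) powr e1 * P e2 u t z"
        using gk by (simp add: good_kernel_def)
      also have "\<dots> \<le> c * (dist u v / t) powr e1 * (1 / V u t)"
        using gk_pos by (intro mult_mono mult_left_mono ratio_powr_mono P_le_V) auto
      finally show ?case by (simp add: abs_minus_commute)
    qed
  qed
  have "((\<lambda>v. k v z - k u z) \<longlongrightarrow> 0) (at u)" by (rule Lim_null_comparison[OF bd lim])
  then show "isCont (\<lambda>u. k u z) u" unfolding isCont_def by (rule LIM_zero_cancel)
qed

lemma gk_measurable [measurable]: "(\<lambda>u. k u z) \<in> borel_measurable \<mu>"
  unfolding borel_measurable_mu by (rule borel_measurable_continuous_onI[OF gk_continuous])

lemma gk_integrable: "integrable \<mu> (\<lambda>u. k u z)"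
proof (rule Bochner_Integration.integrable_bound)
  show "integrable \<mu> (\<lambda>u. c * near_const e2 * P e2 z t u)" using gk_pos by (intro integrable_mult_right integrable_P)
  show "AE u in \<mu>. norm (k u z) \<le> norm (c * near_const e2 * P e2 z t u)"
    using gk_size[of u u for u] gk_pos near_const_ge1[of e2] by (intro AE_I2) (auto simp: abs_mult)
qed measurable

end

text \<open>Unlike for test functions, the regularity scale \<open>s\<close> is allowed to be much smaller than the
  scale \<open>r\<close> of the size condition and does not grow away from \<open>x\<close>.\<close>

definition regular :: "'a \<Rightarrow> real \<Rightarrow> real \<Rightarrow> real \<Rightarrow> real \<Rightarrow> real \<Rightarrow> ('a \<Rightarrow> real) \<Rightarrow> bool" where
  "regular x r s b g K E \<longleftrightarrow> 0 \<le> K \<and> (\<forall>y. \<bar>E y\<bar> \<le> K * P g x r y) \<and>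
     (\<forall>y z. dist y z \<le> s \<longrightarrow> \<bar>E z - E y\<bar> \<le> K * (dist y z / s) powr b * P g x r y)"

text \<open>The summands belong to the cases of the next lemma: u near z; the term with E z for u
  far from z; the term with E v when u is still close to z on the scale r + d(x, z); and the term
  with E v when it is not.\<close>

definition product_const :: "real \<Rightarrow> real \<Rightarrow> real \<Rightarrow> real" where
  "product_const b g e = 1 + 2 powr b + near_const g * near_const g * 2 powr b + near_const g * (2 powr e * C1 * 4 powr n)"

lemma product_const_pos: "0 \<le> g \<Longrightarrow> 0 < product_const b g e"
  using near_const_ge1[of g] C1_ge1 by (auto simp: product_const_def intro!: add_pos_nonneg)

text \<open>Near z the regularity of E produces the growing factor ((t + d) / t)^b, which the kernel
  weight absorbs by lowering its exponent. Away from z the kernel decay itself supplies (t / s)^b,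
  and the size of E suffices. Two weights appear on the right because E v is comparable with the
  weight at z only as long as u is not too far from z.\<close>

lemma regular_product_bound:
  assumes b: "0 < b" "b < e" and g: "0 < g" "g \<le> e" and t: "0 < t" "t \<le> s / 2" "s \<le> r"
    and E: "regular x r s b g K E" and uv: "dist u v \<le> t"
  shows "\<bar>E v - E z\<bar> * P e z t u \<le> product_const b g e * K * (t / s) powr b * P g x r z * (P (e - b) z t u + P g x r u)"
proof -
  have s: "0 < s" "0 < r" "2 * t \<le> s" "2 * t \<le> r" using t by auto
  have K: "0 \<le> K" and size: "\<And>y. \<bar>E y\<bar> \<le> K * P g x r y"
    and hol: "\<And>y z. dist y z \<le> s \<Longrightarrow> \<bar>E z - E y\<bar> \<le> K * (dist y z / s) powr b * P g x r y"
    using E by (auto simp: regular_def)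
  have cg: "1 \<le> near_const g" using g by (intro near_const_ge1) auto
  let ?\<theta> = "(t / s) powr b" and ?Pz = "P g x r z"
  let ?X = "K * ?\<theta> * ?Pz * P (e - b) z t u" and ?Y = "K * ?\<theta> * ?Pz * P g x r u"
  have XY: "0 \<le> ?X" "0 \<le> ?Y" using K by auto
  have goal_eq: "product_const b g e * K * ?\<theta> * ?Pz * (P (e - b) z t u + P g x r u)
     = product_const b g e * ?X + product_const b g e * ?Y" by (simp add: algebra_simps)
  have Pe: "P e z t u * ((t + dist z u) / t) powr b = P (e - b) z t u" by (rule P_mult[OF t(1)])
  show ?thesis
  proof (cases "dist z u \<le> s / 2")
    case True
    have zv: "dist z v \<le> dist z u + t" using uv dist_triangle[of z v u] by simp
    have "\<bar>E v - E z\<bar> \<le> K * (dist z v / s) powr b * ?Pz"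
      by (rule hol) (use zv True s in auto)
    also have "\<dots> \<le> K * (?\<theta> * ((t + dist z u) / t) powr b) * ?Pz"
    proof -
      have "(dist z v / s) powr b \<le> ((t / s) * ((t + dist z u) / t)) powr b"
        using zv s t b by (intro powr_mono2) (auto simp: divide_right_mono)
      then show ?thesis using K unfolding powr_mult by (intro mult_right_mono mult_left_mono) auto
    qed
    finally have "\<bar>E v - E z\<bar> * P e z t u \<le> K * (?\<theta> * ((t + dist z u) / t) powr b) * ?Pz * P e z t u"
      by (rule mult_right_mono) simp
    also have "\<dots> = K * ?\<theta> * ?Pz * (P e z t u * ((t + dist z u) / t) powr b)" by (simp add: mult_ac)
    also have "\<dots> = 1 * ?X" unfolding Pe by simp
    also have "\<dots> \<le> product_const b g e * ?X + product_const b g e * ?Y"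
    proof -
      have "1 \<le> product_const b g e" using cg C1_ge1 by (auto simp: product_const_def intro!: add_nonneg_nonneg)
      then have "1 * ?X \<le> product_const b g e * ?X" using XY by (intro mult_right_mono)
      moreover have "0 \<le> product_const b g e * ?Y" using XY product_const_pos[of g b e] g by (intro mult_nonneg_nonneg[OF _ XY(2)]) auto
      ultimately show ?thesis by linarith
    qed
    finally show ?thesis unfolding goal_eq .
  next
    case False
    \<comment> \<open>Beyond s / 2 the part b of the kernel decay is worth (2 t / s)^b.\<close>
    have far: "P e z t u \<le> 2 powr b * ?\<theta> * P (e - b) z t u"
    proof -
      have q: "s / (2 * t) \<le> (t + dist z u) / t" using False t by (simp add: field_simps)
      have "P e z t u = P (e - b) z t u / ((t + dist z u) / t) powr b"
        using t by (simp add: Pe[symmetric])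
      also have "\<dots> \<le> P (e - b) z t u / (s / (2 * t)) powr b"
        using q s t b by (intro divide_left_mono powr_mono2) auto
      also have "\<dots> = P (e - b) z t u * (2 * t / s) powr b"
        using s t by (simp add: powr_divide)
      also have "(2 * t / s) powr b = 2 powr b * ?\<theta>"
        by (simp add: powr_mult powr_divide)
      finally show ?thesis by (simp add: mult_ac)
    qed
    have 1: "\<bar>E z\<bar> * P e z t u \<le> 2 powr b * ?X"
    proof -
      have "\<bar>E z\<bar> * P e z t u \<le> (K * ?Pz) * (2 powr b * ?\<theta> * P (e - b) z t u)"
        by (intro mult_mono size far) (use K in auto)
      then show ?thesis by (simp add: mult_ac)
    qed
    have Ev: "\<bar>E v\<bar> \<le> K * (near_const g * P g x r u)"
    proof -
      have "dist u v \<le> (r + dist x u) / 2" using uv s zero_le_dist[of x u] by argo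
      then have "P g x r v \<le> near_const g * P g x r u" using s g by (intro P_near) auto
      then have "K * P g x r v \<le> K * (near_const g * P g x r u)" using K by (rule mult_left_mono)
      then show ?thesis using size[of v] by linarith
    qed
    have 2: "\<bar>E v\<bar> * P e z t u \<le> near_const g * near_const g * 2 powr b * ?X + near_const g * (2 powr e * C1 * 4 powr n) * ?Y"
    proof (cases "dist z u \<le> (r + dist x z) / 2")
      case True
      then have "P g x r u \<le> near_const g * ?Pz" using s g by (intro P_near) auto
      then have "K * (near_const g * P g x r u) \<le> K * (near_const g * (near_const g * ?Pz))" using K cg by (intro mult_left_mono) auto
      then have "\<bar>E v\<bar> \<le> K * (near_const g * (near_const g * ?Pz))" using Ev by linarith
      then have "\<bar>E v\<bar> * P e z t u \<le> K * (near_const g * (near_const g * ?Pz)) * (2 powr b * ?\<theta> * P (e - b) z t u)"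
        using K cg by (intro mult_mono far) auto
      also have "\<dots> = near_const g * near_const g * 2 powr b * ?X" by (simp add: mult_ac)
      also have "\<dots> \<le> near_const g * near_const g * 2 powr b * ?X + near_const g * (2 powr e * C1 * 4 powr n) * ?Y"
        using XY(2) cg C1_ge1 by simp
      finally show ?thesis .
    next
      case far2: False
      \<comment> \<open>Here the kernel weight at u is itself at most a multiple of (t / s)^b times
        the weight of E at z, while the size of E at u supplies the second weight of the
        sum.\<close>
      let ?\<rho> = "r + dist x z"
      have \<rho>: "0 < ?\<rho>" using s by simp
      have V4: "V x ?\<rho> \<le> C1 * 4 powr n * V z (t + dist z u)"
        by (rule V_comp) (use far2 s t in auto)
      have "P e z t u \<le> 2 powr e * C1 * 4 powr n * ?\<theta> * ?Pz"
      proof -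
        have "t / (t + dist z u) \<le> t / (?\<rho> / 2)"
          using far2 t \<rho> by (intro divide_left_mono) auto
        also have "\<dots> = 2 * ((t / r) * (r / ?\<rho>))" using s by simp
        finally have "(t / (t + dist z u)) powr e \<le> (2 * ((t / r) * (r / ?\<rho>))) powr e"
          using b t by (intro powr_mono2) auto
        also have "\<dots> = 2 powr e * ((t / r) powr e * (r / ?\<rho>) powr e)" by (simp only: powr_mult)
        also have "\<dots> \<le> 2 powr e * (?\<theta> * (r / ?\<rho>) powr g)"
        proof (intro mult_left_mono mult_mono)
          have "(t / r) powr e \<le> (t / s) powr e"
            using s t b by (intro powr_mono2 divide_left_mono) auto
          also have "\<dots> \<le> ?\<theta>" using s t b by (intro powr_mono') auto
          finally show "(t / r) powr e \<le> ?\<theta>" .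
          show "(r / ?\<rho>) powr e \<le> (r / ?\<rho>) powr g" using s g \<rho> by (intro powr_mono') auto
        qed auto
        finally have num: "(t / (t + dist z u)) powr e \<le> 2 powr e * (?\<theta> * (r / ?\<rho>) powr g)" .
        have "1 / V z (t + dist z u) \<le> C1 * 4 powr n / V x ?\<rho>"
          using V4 t \<rho> by (simp add: field_simps)
        then have "(t / (t + dist z u)) powr e * (1 / V z (t + dist z u))
           \<le> 2 powr e * (?\<theta> * (r / ?\<rho>) powr g) * (C1 * 4 powr n / V x ?\<rho>)"
          using num by (intro mult_mono) auto
        then show ?thesis by (simp add: P_def mult_ac)
      qed
      then have "\<bar>E v\<bar> * P e z t u \<le> K * (near_const g * P g x r u) * (2 powr e * C1 * 4 powr n * ?\<theta> * ?Pz)"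
        using K cg Ev by (intro mult_mono) auto
      also have "\<dots> = near_const g * (2 powr e * C1 * 4 powr n) * ?Y" by (simp add: mult_ac)
      also have "\<dots> \<le> near_const g * near_const g * 2 powr b * ?X + near_const g * (2 powr e * C1 * 4 powr n) * ?Y"
        using XY(1) cg by simp
      finally show ?thesis .
    qed
    have "\<bar>E v - E z\<bar> * P e z t u \<le> (\<bar>E z\<bar> + \<bar>E v\<bar>) * P e z t u" by (intro mult_right_mono) auto
    also have "\<dots> \<le> (2 powr b + near_const g * near_const g * 2 powr b) * ?X + near_const g * (2 powr e * C1 * 4 powr n) * ?Y"
      using 1 2 by (simp add: algebra_simps)
    also have "\<dots> \<le> product_const b g e * ?X + product_const b g e * ?Y"
      using XY cg C1_ge1 by (intro add_mono mult_right_mono) (auto simp: product_const_def)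
    finally show ?thesis unfolding goal_eq .
  qed
qed


text \<open>A Riemann sum written as an integral, so that it can be compared with the exact integral
  of \<open>k u z\<close> without indexing the cells.\<close>

definition sampled_average :: "('a \<Rightarrow> 'a) \<Rightarrow> ('a \<Rightarrow> 'a \<Rightarrow> real) \<Rightarrow> ('a \<Rightarrow> real) \<Rightarrow> 'a \<Rightarrow> real" where
  "sampled_average \<pi> k E z = (\<integral>u. E (\<pi> u) * k (\<pi> u) z \<partial>\<mu>)"

lemma sampled_average_integrable:
  assumes gk: "good_kernel c e1 e2 e3 t k" and sp: "sampling_map \<delta> \<pi>" "\<delta> \<le> t"
    and E: "\<And>y. \<bar>E y\<bar> \<le> B"
  shows "integrable \<mu> (\<lambda>u. E (\<pi> u) * k (\<pi> u) z)"
proof (rule Bochner_Integration.integrable_bound)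
  note gp = gk_pos[OF gk]
  have B: "0 \<le> B" using E abs_ge_zero order_trans by blast
  show "integrable \<mu> (\<lambda>u. B * (c * near_const e2 * P e2 z t u))"
    using gp by (intro integrable_mult_right integrable_P)
  show "(\<lambda>u. E (\<pi> u) * k (\<pi> u) z) \<in> borel_measurable \<mu>"
    by (rule sampling_map_borel[OF sp(1), of "\<lambda>v. E v * k v z"])
  show "AE u in \<mu>. norm (E (\<pi> u) * k (\<pi> u) z) \<le> norm (B * (c * near_const e2 * P e2 z t u))"
  proof (intro AE_I2)
    fix u
    have "dist u (\<pi> u) \<le> t" using sp by (auto simp: sampling_map_def intro: order_trans)
    then have "\<bar>E (\<pi> u)\<bar> * \<bar>k (\<pi> u) z\<bar> \<le> B * (c * near_const e2 * P e2 z t u)"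
      by (intro mult_mono E gk_size[OF gk]) (use B in auto)
    then show "norm (E (\<pi> u) * k (\<pi> u) z) \<le> norm (B * (c * near_const e2 * P e2 z t u))"
      by (metis abs_ge_self abs_mult order_trans real_norm_def)
  qed
qed

lemma integral_bound:
  fixes f :: "'a \<Rightarrow> real"
  assumes "integrable \<mu> f" "integrable \<mu> g" "\<And>u. \<bar>f u\<bar> \<le> g u" "(\<integral>u. g u \<partial>\<mu>) \<le> B"
  shows "\<bar>\<integral>u. f u \<partial>\<mu>\<bar> \<le> B"
proof -
  have "\<bar>\<integral>u. f u \<partial>\<mu>\<bar> \<le> (\<integral>u. \<bar>f u\<bar> \<partial>\<mu>)" by (rule integral_abs_bound)
  also have "\<dots> \<le> (\<integral>u. g u \<partial>\<mu>)" using assms by (intro integral_mono) auto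
  finally show ?thesis using assms(4) by simp
qed

text \<open>One step of the iteration: subtracting the sampled kernel average of a function that is
  regular at scale \<open>s\<close> leaves a remainder that is regular at the smaller scale \<open>t\<close>, with a
  constant smaller by the factor \<open>(t / s) powr b\<close>.  The kernels have integral one, so the
  remainder is an integral of differences; the error of sampling is controlled by the mixed
  second difference of the kernel.\<close>

lemma regular_remainder:
  assumes b: "0 < b" "b < e2" "b \<le> e1" and g: "0 < g" "g \<le> e2"
  obtains C where "1 \<le> C" "\<And>x r s t \<delta> K \<pi> k E. good_kernel c e1 e2 e3 t k \<Longrightarrow> sampling_map \<delta> \<pi> \<Longrightarrow>
    regular x r s b g K E \<Longrightarrow> t \<le> s / 2 \<Longrightarrow> s \<le> r \<Longrightarrow> 0 < \<delta> \<Longrightarrow> \<delta> \<le> t / 3 \<Longrightarrow> \<delta> / t \<le> t / s \<Longrightarrow>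
    regular x r t b g (C * (t / s) powr b * K) (\<lambda>z. E z - sampled_average \<pi> k E z)"
proof -
  \<comment> \<open>\<open>S\<close> bounds the size of the remainder and \<open>1 + S'\<close> its
    regularity for increments up to \<open>t / 3\<close>; the last summand of \<open>C\<close>
    covers increments between \<open>t / 3\<close> and \<open>t\<close>. Absolute values stand where
    a sign is known only once a kernel is given.\<close>
  define S where "S = \<bar>c\<bar> * near_const e2 * (product_const b g e2 * (mass_const (e2 - b) + mass_const g) + mass_const e2)"
  define S' where "S' = \<bar>c\<bar> * near_const e2 * (product_const b g e2 * (mass_const (e2 - b) + mass_const g)) + \<bar>c\<bar> * near_const e3 * mass_const e3"
  define C where "C = 1 + S + \<bar>S'\<bar> + 3 powr b * (S + near_const g * S)"
  have pos: "0 < mass_const (e2 - b)" "0 < mass_const g" "0 < mass_const e2" "0 < product_const b g e2" "1 \<le> near_const e2" "1 \<le> near_const g"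
    using b g by (auto intro!: mass_const_pos product_const_pos near_const_ge1)
  have S0: "0 \<le> S" unfolding S_def using pos by (intro mult_nonneg_nonneg add_nonneg_nonneg) auto
  have C1: "1 \<le> C" and SC: "S \<le> C" and S'C: "1 + S' \<le> C" and S3C: "3 powr b * (S + near_const g * S) \<le> C"
  proof -
    have "0 \<le> 3 powr b * (S + near_const g * S)" using S0 pos by simp
    then show "1 \<le> C" "S \<le> C" "1 + S' \<le> C" "3 powr b * (S + near_const g * S) \<le> C"
      using S0 unfolding C_def by linarith+
  qed
  show ?thesis
  proof (rule that[OF C1])
    fix x :: 'a and r s t \<delta> K :: real and \<pi> :: "'a \<Rightarrow> 'a" and k :: "'a \<Rightarrow> 'a \<Rightarrow> real" and E :: "'a \<Rightarrow> real"
    assume gk: "good_kernel c e1 e2 e3 t k" and sp: "sampling_map \<delta> \<pi>" and E: "regular x r s b g K E"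
      and t: "t \<le> s / 2" "s \<le> r" and \<delta>: "0 < \<delta>" "\<delta> \<le> t / 3" "\<delta> / t \<le> t / s"
    note gp = gk_pos[OF gk]
    have s: "0 < s" "0 < r" "2 * t \<le> r" "\<delta> \<le> t" "\<delta> \<le> t / 2" using gp t \<delta> by auto
    have K: "0 \<le> K" and size: "\<And>y. \<bar>E y\<bar> \<le> K * P g x r y"
      and hol: "\<And>y z. dist y z \<le> s \<Longrightarrow> \<bar>E z - E y\<bar> \<le> K * (dist y z / s) powr b * P g x r y"
      using E by (auto simp: regular_def)
    have c: "0 < c" "\<bar>c\<bar> = c" using gp by auto
    have u\<pi>: "dist u (\<pi> u) \<le> \<delta>" for u using sp by (simp add: sampling_map_def)
    have u\<pi>t: "dist u (\<pi> u) \<le> t" for u using u\<pi>[of u] s by simp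
    have Ebd: "\<bar>E y\<bar> \<le> K * (1 / V x r)" for y
      using size[of y] P_le_V[of r g x y] K s g mult_left_mono[of "P g x r y" "1 / V x r" K] by simp
    note int1 = sampled_average_integrable[OF gk sp s(4) Ebd]
    let ?k = "\<lambda>u. k (\<pi> u)"
    have int2: "integrable \<mu> (\<lambda>u. ?k u z)" for z
      using sampled_average_integrable[OF gk sp s(4), of "\<lambda>_. 1" 1] by simp
    note int3 = gk_integrable[OF gk]
    have mass: "(\<integral>u. k u z \<partial>\<mu>) = 1" for z using gk by (simp add: good_kernel_def)
    let ?\<theta> = "(t / s) powr b"
    have \<theta>: "0 \<le> ?\<theta>" by simp
    \<comment> \<open>The mesh is finer than t by at least the ratio t / s, so the sampling error
      gains the same factor as the step from s to t.\<close>
    have \<delta>\<theta>: "(\<delta> / t) powr e1 \<le> ?\<theta>"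
    proof -
      have "(\<delta> / t) powr e1 \<le> (t / s) powr e1" using \<delta> gp by (intro powr_mono2) auto
      also have "\<dots> \<le> ?\<theta>" using b gp s t by (intro powr_mono') auto
      finally show ?thesis .
    qed
    have ce: "0 \<le> c * near_const e2" using c pos by simp
    have prod: "\<bar>E (\<pi> u) - E z\<bar> * (c * near_const e2 * P e2 z t u)
       \<le> c * near_const e2 * (product_const b g e2 * K * ?\<theta> * P g x r z * (P (e2 - b) z t u + P g x r u))" for u z
    proof -
      have "\<bar>E (\<pi> u) - E z\<bar> * P e2 z t u \<le> product_const b g e2 * K * ?\<theta> * P g x r z * (P (e2 - b) z t u + P g x r u)"
        by (rule regular_product_bound[OF b(1,2) g gp(1) t E u\<pi>t])
      from mult_left_mono[OF this ce] show ?thesis by (simp add: mult_ac)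
    qed
    let ?F = "\<lambda>z. E z - sampled_average \<pi> k E z"
    have Fsize: "\<bar>?F z\<bar> \<le> S * ?\<theta> * K * P g x r z" for z
    proof -
      \<comment> \<open>Because the kernel has integral one, the remainder is the integral of this
        sum: E z is compared with the sampled values, and \<open>k u\<close> with
        \<open>k (\<pi> u)\<close>.\<close>
      let ?f = "\<lambda>u. (E z - E (\<pi> u)) * ?k u z + E z * (k u z - ?k u z)"
      have feq: "?f u = E z * k u z - E (\<pi> u) * ?k u z" for u by (simp add: algebra_simps)
      have fint: "integrable \<mu> ?f" unfolding feq by (intro Bochner_Integration.integrable_diff integrable_mult_right int3 int1)
      have "(\<integral>u. ?f u \<partial>\<mu>) = ?F z" unfolding feq sampled_average_def
        by (subst Bochner_Integration.integral_diff) (auto intro!: integrable_mult_right int3 int1 simp: mass)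
      moreover have "\<bar>\<integral>u. ?f u \<partial>\<mu>\<bar> \<le> S * ?\<theta> * K * P g x r z"
      proof (rule integral_bound[OF fint])
        let ?g = "\<lambda>u. c * near_const e2 * product_const b g e2 * K * ?\<theta> * P g x r z * (P (e2 - b) z t u + P g x r u)
           + K * P g x r z * (c * near_const e2) * ?\<theta> * P e2 z t u"
        show "integrable \<mu> ?g" using gp s b g
          by (intro Bochner_Integration.integrable_add integrable_mult_right integrable_P) auto
        show "\<bar>?f u\<bar> \<le> ?g u" for u
        proof -
          have "\<bar>E z - E (\<pi> u)\<bar> * \<bar>?k u z\<bar> \<le> \<bar>E (\<pi> u) - E z\<bar> * (c * near_const e2 * P e2 z t u)"
            using gk_size[OF gk u\<pi>t] by (intro mult_mono) (auto simp: abs_minus_commute)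
          moreover have "\<bar>E z\<bar> * \<bar>k u z - ?k u z\<bar> \<le> (K * P g x r z) * (c * near_const e2 * ?\<theta> * P e2 z t u)"
          proof (intro mult_mono size)
            have "\<bar>k u z - ?k u z\<bar> \<le> c * near_const e2 * (\<delta> / t) powr e1 * P e2 z t u"
              by (rule gk_first[OF gk u\<pi> s(5)])
            also have "\<dots> \<le> c * near_const e2 * ?\<theta> * P e2 z t u"
              using ce by (intro mult_right_mono mult_left_mono \<delta>\<theta>) auto
            finally show "\<bar>k u z - ?k u z\<bar> \<le> c * near_const e2 * ?\<theta> * P e2 z t u" .
          qed (use K in auto)
          ultimately have "\<bar>E z - E (\<pi> u)\<bar> * \<bar>?k u z\<bar> + \<bar>E z\<bar> * \<bar>k u z - ?k u z\<bar> \<le> ?g u"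
            using prod[of u z] by (simp add: mult_ac)
          then show ?thesis by (intro order_trans[OF abs_triangle_ineq]) (simp add: abs_mult)
        qed
        have "(\<integral>u. ?g u \<partial>\<mu>) = c * near_const e2 * product_const b g e2 * K * ?\<theta> * P g x r z * ((\<integral>u. P (e2 - b) z t u \<partial>\<mu>) + (\<integral>u. P g x r u \<partial>\<mu>))
           + K * P g x r z * (c * near_const e2) * ?\<theta> * (\<integral>u. P e2 z t u \<partial>\<mu>)"
          using gp s b g by (simp add: integrable_P)
        also have "\<dots> \<le> c * near_const e2 * product_const b g e2 * K * ?\<theta> * P g x r z * (mass_const (e2 - b) + mass_const g)
           + K * P g x r z * (c * near_const e2) * ?\<theta> * mass_const e2"
          using K ce c pos gp s b g by (intro add_mono mult_left_mono integral_P) auto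
        also have "\<dots> = S * ?\<theta> * K * P g x r z" unfolding S_def c(2) by (simp add: algebra_simps)
        finally show "(\<integral>u. ?g u \<partial>\<mu>) \<le> S * ?\<theta> * K * P g x r z" .
      qed
      ultimately show ?thesis by simp
    qed
    have Fhol: "\<bar>?F y - ?F z\<bar> \<le> (1 + S') * ?\<theta> * K * (dist y z / t) powr b * P g x r y" if d: "dist y z \<le> t / 3" for y z
    proof -
      let ?h = "(dist y z / t) powr b"
      have d2: "dist y z \<le> t / 2" "dist y z \<le> s" "dist y z \<le> t" using d gp t by auto
      have hb: "(dist y z / t) powr e1 \<le> ?h" using b gp d2 by (intro powr_mono') auto
      \<comment> \<open>The difference \<open>k u y - k u z\<close> integrates to zero. Subtracting
        E y times it replaces E at the samples by a difference and leaves a mixed second difference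
        of the kernel, which is small both in the mesh and in d(y, z).\<close>
      let ?f = "\<lambda>u. (E (\<pi> u) - E y) * (?k u y - ?k u z) + E y * ((?k u y - ?k u z) - (k u y - k u z))"
      have feq: "?f u = (E (\<pi> u) * ?k u y - E (\<pi> u) * ?k u z) - (E y * k u y - E y * k u z)" for u
        by (simp add: algebra_simps)
      have fint: "integrable \<mu> ?f" unfolding feq
        by (intro Bochner_Integration.integrable_diff integrable_mult_right int3 int1)
      have "(\<integral>u. E y * k u y - E y * k u z \<partial>\<mu>) = 0"
        by (subst Bochner_Integration.integral_diff) (auto intro!: integrable_mult_right int3 simp: mass)
      moreover have "(\<integral>u. E (\<pi> u) * ?k u y - E (\<pi> u) * ?k u z \<partial>\<mu>) = sampled_average \<pi> k E y - sampled_average \<pi> k E z"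
        unfolding sampled_average_def by (rule Bochner_Integration.integral_diff) (rule int1)+
      ultimately have "(\<integral>u. ?f u \<partial>\<mu>) = sampled_average \<pi> k E y - sampled_average \<pi> k E z" unfolding feq
        by (subst Bochner_Integration.integral_diff) (auto intro!: integrable_mult_right int3 int1 Bochner_Integration.integrable_diff)
      moreover have "\<bar>\<integral>u. ?f u \<partial>\<mu>\<bar> \<le> S' * ?\<theta> * K * ?h * P g x r y"
      proof (rule integral_bound[OF fint])
        let ?g = "\<lambda>u. ?h * (c * near_const e2 * product_const b g e2 * K * ?\<theta> * P g x r y) * (P (e2 - b) y t u + P g x r u)
           + K * P g x r y * (c * near_const e3) * ?\<theta> * ?h * P e3 y t u"
        show "integrable \<mu> ?g" using gp s b g
          by (intro Bochner_Integration.integrable_add integrable_mult_right integrable_P) auto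
        have ce3: "0 \<le> c * near_const e3" using c gp near_const_ge1[of e3] by simp
        show "\<bar>?f u\<bar> \<le> ?g u" for u
        proof -
          have "\<bar>E (\<pi> u) - E y\<bar> * \<bar>?k u y - ?k u z\<bar> \<le> \<bar>E (\<pi> u) - E y\<bar> * (c * near_const e2 * ?h * P e2 y t u)"
          proof (rule mult_left_mono)
            have "\<bar>?k u y - ?k u z\<bar> \<le> c * near_const e2 * (dist y z / t) powr e1 * P e2 y t u"
              by (rule gk_second[OF gk u\<pi>t d2(1)])
            also have "\<dots> \<le> c * near_const e2 * ?h * P e2 y t u"
              using ce by (intro mult_right_mono mult_left_mono hb) auto
            finally show "\<bar>?k u y - ?k u z\<bar> \<le> c * near_const e2 * ?h * P e2 y t u" .
          qed simp
          also have "\<dots> = ?h * (\<bar>E (\<pi> u) - E y\<bar> * (c * near_const e2 * P e2 y t u))" by (simp add: mult_ac)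
          also have "\<dots> \<le> ?h * (c * near_const e2 * (product_const b g e2 * K * ?\<theta> * P g x r y * (P (e2 - b) y t u + P g x r u)))"
            by (intro mult_left_mono prod) simp
          finally have 1: "\<bar>E (\<pi> u) - E y\<bar> * \<bar>?k u y - ?k u z\<bar>
            \<le> ?h * (c * near_const e2 * product_const b g e2 * K * ?\<theta> * P g x r y) * (P (e2 - b) y t u + P g x r u)"
            by (simp add: mult_ac)
          have 2: "\<bar>E y\<bar> * \<bar>(?k u y - ?k u z) - (k u y - k u z)\<bar> \<le> (K * P g x r y) * (c * near_const e3 * ?\<theta> * ?h * P e3 y t u)"
          proof (intro mult_mono[OF size])
            have "\<bar>(?k u y - ?k u z) - (k u y - k u z)\<bar> \<le> c * near_const e3 * (\<delta> / t) powr e1 * (dist y z / t) powr e1 * P e3 y t u"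
              by (rule gk_both[OF gk u\<pi> \<delta>(2) d])
            also have "\<dots> \<le> c * near_const e3 * ?\<theta> * ?h * P e3 y t u"
              using ce3 \<delta>\<theta> hb c gp near_const_ge1[of e3] by (intro mult_right_mono mult_mono) auto
            finally show "\<bar>(?k u y - ?k u z) - (k u y - k u z)\<bar> \<le> c * near_const e3 * ?\<theta> * ?h * P e3 y t u" .
          qed (use K in auto)
          have "\<bar>?f u\<bar> \<le> \<bar>E (\<pi> u) - E y\<bar> * \<bar>?k u y - ?k u z\<bar> + \<bar>E y\<bar> * \<bar>(?k u y - ?k u z) - (k u y - k u z)\<bar>"
            by (rule order_trans[OF abs_triangle_ineq]) (simp add: abs_mult)
          then show ?thesis using 1 2 by (simp add: mult_ac)
        qed
        have "(\<integral>u. ?g u \<partial>\<mu>) = ?h * (c * near_const e2 * product_const b g e2 * K * ?\<theta> * P g x r y) * ((\<integral>u. P (e2 - b) y t u \<partial>\<mu>) + (\<integral>u. P g x r u \<partial>\<mu>))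
           + K * P g x r y * (c * near_const e3) * ?\<theta> * ?h * (\<integral>u. P e3 y t u \<partial>\<mu>)"
          using gp s b g by (simp add: integrable_P)
        also have "\<dots> \<le> ?h * (c * near_const e2 * product_const b g e2 * K * ?\<theta> * P g x r y) * (mass_const (e2 - b) + mass_const g)
           + K * P g x r y * (c * near_const e3) * ?\<theta> * ?h * mass_const e3"
          using K ce ce3 c pos gp s b g by (intro add_mono mult_left_mono integral_P) auto
        also have "\<dots> = S' * ?\<theta> * K * ?h * P g x r y" unfolding S'_def c(2) by (simp add: algebra_simps)
        finally show "(\<integral>u. ?g u \<partial>\<mu>) \<le> S' * ?\<theta> * K * ?h * P g x r y" .
      qed
      ultimately have AVd: "\<bar>sampled_average \<pi> k E y - sampled_average \<pi> k E z\<bar> \<le> S' * ?\<theta> * K * ?h * P g x r y" by simp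
      have "\<bar>E z - E y\<bar> \<le> K * (dist y z / s) powr b * P g x r y" by (rule hol[OF d2(2)])
      also have "(dist y z / s) powr b = ?\<theta> * ?h" using gp by (simp flip: powr_mult)
      finally have "\<bar>E z - E y\<bar> \<le> ?\<theta> * K * ?h * P g x r y" by (simp add: mult_ac)
      moreover have "\<bar>?F y - ?F z\<bar> \<le> \<bar>E z - E y\<bar> + \<bar>sampled_average \<pi> k E y - sampled_average \<pi> k E z\<bar>" by linarith
      ultimately show ?thesis using AVd by (simp add: algebra_simps)
    qed
    show "regular x r t b g (C * ?\<theta> * K) ?F"
      unfolding regular_def
    proof (intro conjI allI impI)
      show "0 \<le> C * ?\<theta> * K" using C1 K by simp
      fix y
      have "S * ?\<theta> * K * P g x r y \<le> C * ?\<theta> * K * P g x r y"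
        using SC K by (intro mult_right_mono) auto
      then show "\<bar>?F y\<bar> \<le> C * ?\<theta> * K * P g x r y" using Fsize[of y] by linarith
      fix z assume d: "dist y z \<le> t"
      let ?h = "(dist y z / t) powr b"
      show "\<bar>?F z - ?F y\<bar> \<le> C * ?\<theta> * K * ?h * P g x r y"
      \<comment> \<open>The mixed difference estimate reaches only to t / 3; for larger increments
        the factor (d(y, z) / t)^b is bounded below and the size bound suffices.\<close>
      proof (cases "dist y z \<le> t / 3")
        case True
        have "(1 + S') * ?\<theta> * K * ?h * P g x r y \<le> C * ?\<theta> * K * ?h * P g x r y"
          using S'C K by (intro mult_right_mono) auto
        then show ?thesis using Fhol[OF True] by (simp add: abs_minus_commute)
      next
        case False
        have "dist y z \<le> (r + dist x y) / 2" using d s zero_le_dist[of x y] by argo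
        then have "P g x r z \<le> near_const g * P g x r y" using s g by (intro P_near) auto
        then have "S * ?\<theta> * K * P g x r z \<le> S * ?\<theta> * K * (near_const g * P g x r y)"
          using S0 K by (intro mult_left_mono) auto
        then have "\<bar>?F z - ?F y\<bar> \<le> (S + near_const g * S) * (?\<theta> * K * P g x r y)"
          using Fsize[of y] Fsize[of z] by (simp add: algebra_simps)
        also have "\<dots> \<le> (3 powr b * (S + near_const g * S)) * ?h * (?\<theta> * K * P g x r y)"
        proof (intro mult_right_mono)
          have "1 = 3 powr b * (1 / 3) powr b" by (simp flip: powr_mult)
          also have "\<dots> \<le> 3 powr b * ?h"
            using False gp b by (intro mult_left_mono powr_mono2) (auto simp: field_simps)
          finally have "1 * (S + near_const g * S) \<le> (3 powr b * ?h) * (S + near_const g * S)"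
            using S0 pos by (intro mult_right_mono) auto
          then show "S + near_const g * S \<le> 3 powr b * (S + near_const g * S) * ?h" by (simp add: mult_ac)
        qed (use K in auto)
        also have "\<dots> \<le> C * ?h * (?\<theta> * K * P g x r y)"
          using S3C K by (intro mult_right_mono) auto
        finally show ?thesis by (simp add: mult_ac)
      qed
    qed
  qed
qed


section \<open>Test functions\<close>

text \<open>The size and regularity conditions of a test function, with the weight
  \<open>1 / (V\<^sub>r(x) + V(x, y))\<close> replaced by the equivalent \<open>1 / V(x, r + d(x, y))\<close>.\<close>

definition test_bound :: "'a \<Rightarrow> real \<Rightarrow> real \<Rightarrow> real \<Rightarrow> ('a \<Rightarrow> real) \<Rightarrow> real \<Rightarrow> bool" where
  "test_bound x r b g \<phi> C \<longleftrightarrow> 0 \<le> C \<and> (\<forall>y. \<bar>\<phi> y\<bar> \<le> C * P g x r y) \<and>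
     (\<forall>y z. dist y z \<le> (r + dist x y) / 2 \<longrightarrow>
        \<bar>\<phi> z - \<phi> y\<bar> \<le> C * (dist y z / (r + dist x y)) powr b * P g x r y)"

text \<open>The larger of r and d(x, y) is at least half of r + d(x, y), so doubling compares its
  ball with the large one.\<close>

lemma weight_equiv:
  assumes r: "0 < r"
  shows "1 / (Vr \<mu> r x + Vxy \<mu> x y) * (r / (r + dist x y)) powr g \<le> C1 * 2 powr n * P g x r y"
    and "P g x r y \<le> 2 * (1 / (Vr \<mu> r x + Vxy \<mu> x y) * (r / (r + dist x y)) powr g)"
proof -
  have W: "Vr \<mu> r x + Vxy \<mu> x y = V x r + V x (dist x y)" by (simp add: Vr_def Vxy_def V_def)
  have Vp: "0 < V x (r + dist x y)" using r by simp
  have Wp: "0 < V x r + V x (dist x y)" using r by (simp add: add_pos_nonneg)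
  have "V x (r + dist x y) \<le> C1 * 2 powr n * (V x r + V x (dist x y))"
  proof (cases "dist x y \<le> r")
    case True
    then have "V x (r + dist x y) \<le> C1 * 2 powr n * V x r" using r by (intro V_doubling) auto
    also have "\<dots> \<le> C1 * 2 powr n * (V x r + V x (dist x y))" using C1_ge1 by (intro mult_left_mono) auto
    finally show ?thesis .
  next
    case False
    then have "V x (r + dist x y) \<le> C1 * 2 powr n * V x (dist x y)" using r by (intro V_doubling) auto
    also have "\<dots> \<le> C1 * 2 powr n * (V x r + V x (dist x y))" using C1_ge1 by (intro mult_left_mono) auto
    finally show ?thesis .
  qed
  then have 1: "1 / (V x r + V x (dist x y)) \<le> C1 * 2 powr n / V x (r + dist x y)"
    using Vp Wp by (simp add: field_simps)
  from mult_right_mono[OF this, of "(r / (r + dist x y)) powr g"]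
  show "1 / (Vr \<mu> r x + Vxy \<mu> x y) * (r / (r + dist x y)) powr g \<le> C1 * 2 powr n * P g x r y"
    unfolding W P_def by simp
  have "V x r \<le> V x (r + dist x y)" "V x (dist x y) \<le> V x (r + dist x y)" using r by (auto intro!: V_mono)
  then have "V x r + V x (dist x y) \<le> 2 * V x (r + dist x y)" by simp
  then have "1 / V x (r + dist x y) \<le> 2 / (V x r + V x (dist x y))"
    using Vp Wp by (simp add: field_simps)
  from mult_right_mono[OF this, of "(r / (r + dist x y)) powr g"]
  show "P g x r y \<le> 2 * (1 / (Vr \<mu> r x + Vxy \<mu> x y) * (r / (r + dist x y)) powr g)"
    unfolding W P_def by simp
qed

lemma G_bound_imp_test_bound:
  assumes "G_bound \<mu> x r b g \<phi> C" "0 < r" shows "test_bound x r b g \<phi> (C1 * 2 powr n * C)"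
  unfolding test_bound_def
proof (intro conjI allI impI)
  let ?w = "\<lambda>y. 1 / (Vr \<mu> r x + Vxy \<mu> x y) * (r / (r + dist x y)) powr g"
  have C: "0 \<le> C" and 1: "\<And>y. \<bar>\<phi> y\<bar> \<le> C * ?w y"
    and 2: "\<And>y z. dist y z \<le> (r + dist x y) / 2 \<Longrightarrow> \<bar>\<phi> z - \<phi> y\<bar> \<le> C * (dist y z / (r + dist x y)) powr b * ?w y"
    using assms(1) by (auto simp: G_bound_def mult.assoc)
  note w = weight_equiv(1)[OF assms(2)]
  show "0 \<le> C1 * 2 powr n * C" using C C1_ge1 by simp
  show "\<bar>\<phi> y\<bar> \<le> C1 * 2 powr n * C * P g x r y" for y
    using order_trans[OF 1 mult_left_mono[OF w C]] by (simp add: mult_ac)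
  show "\<bar>\<phi> z - \<phi> y\<bar> \<le> C1 * 2 powr n * C * (dist y z / (r + dist x y)) powr b * P g x r y"
    if "dist y z \<le> (r + dist x y) / 2" for y z
    using order_trans[OF 2[OF that] mult_left_mono[OF w, of "C * (dist y z / (r + dist x y)) powr b"]] C
    by (simp add: mult_ac)
qed

lemma test_bound_imp_G_bound:
  assumes "test_bound x r b g \<phi> C" "0 < r" shows "G_bound \<mu> x r b g \<phi> (2 * C)"
  unfolding G_bound_def
proof (intro conjI allI impI)
  have C: "0 \<le> C" and 1: "\<And>y. \<bar>\<phi> y\<bar> \<le> C * P g x r y"
    and 2: "\<And>y z. dist y z \<le> (r + dist x y) / 2 \<Longrightarrow> \<bar>\<phi> z - \<phi> y\<bar> \<le> C * (dist y z / (r + dist x y)) powr b * P g x r y"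
    using assms(1) by (auto simp: test_bound_def mult.assoc)
  note w = weight_equiv(2)[OF assms(2)]
  show "0 \<le> 2 * C" using C by simp
  show "\<bar>\<phi> y\<bar> \<le> 2 * C * (1 / (Vr \<mu> r x + Vxy \<mu> x y)) * (r / (r + dist x y)) powr g" for y
    using order_trans[OF 1 mult_left_mono[OF w C]] by (simp add: mult_ac)
  show "\<bar>\<phi> z - \<phi> y\<bar> \<le> 2 * C * (dist y z / (r + dist x y)) powr b * (1 / (Vr \<mu> r x + Vxy \<mu> x y)) * (r / (r + dist x y)) powr g"
    if "dist y z \<le> (r + dist x y) / 2" for y z
    using order_trans[OF 2[OF that] mult_left_mono[OF w, of "C * (dist y z / (r + dist x y)) powr b"]] C
    by (simp add: mult_ac)
qed

lemma test_bound_D: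
  assumes "test_bound x r b g \<phi> C"
  shows "0 \<le> C" "\<bar>\<phi> y\<bar> \<le> C * P g x r y"
    "dist y z \<le> (r + dist x y) / 2 \<Longrightarrow> \<bar>\<phi> z - \<phi> y\<bar> \<le> C * (dist y z / (r + dist x y)) powr b * P g x r y"
  using assms by (auto simp: test_bound_def)

lemma test_bound_lincomb:
  assumes "test_bound x r b g \<phi> C" "test_bound x r b g \<psi> D" shows "test_bound x r b g (\<lambda>y. a * \<phi> y + \<psi> y) (\<bar>a\<bar> * C + D)"
  unfolding test_bound_def
proof (intro conjI allI impI)
  note p = test_bound_D[OF assms(1)] and q = test_bound_D[OF assms(2)]
  show "0 \<le> \<bar>a\<bar> * C + D" using p(1) q(1) by simp
  show "\<bar>a * \<phi> y + \<psi> y\<bar> \<le> (\<bar>a\<bar> * C + D) * P g x r y" for y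
  proof -
    have "\<bar>a * \<phi> y + \<psi> y\<bar> \<le> \<bar>a\<bar> * \<bar>\<phi> y\<bar> + \<bar>\<psi> y\<bar>" by (metis abs_mult abs_triangle_ineq)
    also have "\<dots> \<le> \<bar>a\<bar> * (C * P g x r y) + D * P g x r y" by (intro add_mono mult_left_mono p(2) q(2)) auto
    finally show ?thesis by (simp add: algebra_simps)
  qed
  show "\<bar>(a * \<phi> z + \<psi> z) - (a * \<phi> y + \<psi> y)\<bar> \<le> (\<bar>a\<bar> * C + D) * (dist y z / (r + dist x y)) powr b * P g x r y"
    if d: "dist y z \<le> (r + dist x y) / 2" for y z
  proof -
    let ?h = "(dist y z / (r + dist x y)) powr b"
    have "(a * \<phi> z + \<psi> z) - (a * \<phi> y + \<psi> y) = a * (\<phi> z - \<phi> y) + (\<psi> z - \<psi> y)" by (simp add: algebra_simps)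
    then have "\<bar>(a * \<phi> z + \<psi> z) - (a * \<phi> y + \<psi> y)\<bar> \<le> \<bar>a\<bar> * \<bar>\<phi> z - \<phi> y\<bar> + \<bar>\<psi> z - \<psi> y\<bar>"
      by (metis abs_mult abs_triangle_ineq)
    also have "\<dots> \<le> \<bar>a\<bar> * (C * ?h * P g x r y) + D * ?h * P g x r y"
      by (intro add_mono mult_left_mono p(3) q(3) d) auto
    finally show ?thesis by (simp add: algebra_simps)
  qed
qed

lemma test_bound_mono:
  assumes "test_bound x r b g \<phi> C" "C \<le> D" shows "test_bound x r b g \<phi> D"
  unfolding test_bound_def
proof (intro conjI allI impI)
  note p = test_bound_D[OF assms(1)]
  show "0 \<le> D" using p(1) assms(2) by simp
  show "\<bar>\<phi> y\<bar> \<le> D * P g x r y" for y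
    using assms(2) by (intro order_trans[OF p(2)] mult_right_mono) auto
  show "\<bar>\<phi> z - \<phi> y\<bar> \<le> D * (dist y z / (r + dist x y)) powr b * P g x r y"
    if "dist y z \<le> (r + dist x y) / 2" for y z
    using assms(2) by (intro order_trans[OF p(3)[OF that]] mult_right_mono) auto
qed

lemma test_bound_exponents:
  assumes G: "test_bound x r b g \<phi> C" and r: "0 < r" and le: "b' \<le> b" "g' \<le> g"
  shows "test_bound x r b' g' \<phi> C"
  unfolding test_bound_def
proof (intro conjI allI impI)
  note p = test_bound_D[OF G]
  show "0 \<le> C" by (rule p(1))
  show "\<bar>\<phi> y\<bar> \<le> C * P g' x r y" for y
    using p(1) le(2) r by (intro order_trans[OF p(2)] mult_left_mono P_antimono_exp) auto
  show "\<bar>\<phi> z - \<phi> y\<bar> \<le> C * (dist y z / (r + dist x y)) powr b' * P g' x r y"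
    if d: "dist y z \<le> (r + dist x y) / 2" for y z
  proof -
    have "dist y z \<le> r + dist x y" using d r zero_le_dist[of x y] by argo
    then have "(dist y z / (r + dist x y)) powr b \<le> (dist y z / (r + dist x y)) powr b'"
      using le(1) r by (intro powr_mono') (auto simp: divide_le_eq_1)
    then have "C * (dist y z / (r + dist x y)) powr b * P g x r y \<le> C * (dist y z / (r + dist x y)) powr b' * P g' x r y"
      using p(1) le(2) r by (intro mult_mono mult_left_mono P_antimono_exp) auto
    then show ?thesis using p(3)[OF d] by linarith
  qed
qed

text \<open>The constant depends on the two centres and scales only through M. This uniformity makes
  a kernel centred at y a test function around every x within a fixed multiple of its scale, with
  one constant for all levels.\<close>

lemma test_bound_change_uniform:
  assumes bg: "0 \<le> b" "0 \<le> g" and M1: "1 \<le> M"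
  obtains L where "1 \<le> L" "\<And>x x' r r' \<phi> C. 0 < r \<Longrightarrow> 0 < r' \<Longrightarrow> 1 + (r' + 2 * dist x x') / r \<le> M \<Longrightarrow>
    1 + (r + dist x x') / r' \<le> M \<Longrightarrow> test_bound x r b g \<phi> C \<Longrightarrow> test_bound x' r' b g \<phi> (L * C)"
proof -
  define c where "c = C1 * M powr (n + 2 * g)"
  have c1: "1 \<le> c"
  proof -
    have "1 \<le> M powr (n + 2 * g)" using M1 n_pos bg by (intro ge_one_powr_ge_zero) auto
    then show ?thesis using C1_ge1 mult_mono[of 1 C1 1 "M powr (n + 2 * g)"] by (simp add: c_def)
  qed
  have cg: "1 \<le> near_const g" using bg by (intro near_const_ge1)
  \<comment> \<open>One summand is for increments that were already admissible for the old centre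
    and scale, the other for larger ones, which are handled by size.\<close>
  define L where "L = c * (M powr b + (near_const g + 1) * (2 * M) powr b)"
  have Mb1: "1 \<le> M powr b" using M1 bg by (intro ge_one_powr_ge_zero) auto
  have L: "c \<le> L" "c * M powr b \<le> L" "c * ((near_const g + 1) * (2 * M) powr b) \<le> L"
  proof -
    have p: "0 \<le> (near_const g + 1) * (2 * M) powr b" using cg by simp
    have "c * 1 \<le> c * (M powr b + (near_const g + 1) * (2 * M) powr b)"
      using Mb1 p c1 by (intro mult_left_mono) auto
    then show "c \<le> L" by (simp add: L_def)
    show "c * M powr b \<le> L" unfolding L_def using p c1 by (intro mult_left_mono) auto
    show "c * ((near_const g + 1) * (2 * M) powr b) \<le> L" unfolding L_def using c1 by (intro mult_left_mono) auto
  qed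
  show ?thesis
  proof (rule that[of L])
    show "1 \<le> L" using L(1) c1 by simp
    fix x x' :: 'a and r r' :: real and \<phi> C
    assume r: "0 < r" "0 < r'" and M: "1 + (r' + 2 * dist x x') / r \<le> M" "1 + (r + dist x x') / r' \<le> M"
      and G: "test_bound x r b g \<phi> C"
    define D where "D = dist x x'"
    have D: "0 \<le> D" by (simp add: D_def)
    have Mr: "r \<le> M * r'"
    proof -
      have "r \<le> (r + D) / r' * r'" using r D by simp
      also have "\<dots> \<le> M * r'" using r M(2) by (intro mult_right_mono) (auto simp: D_def)
      finally show ?thesis .
    qed
    have Ma: "r' + dist x' y + D \<le> M * (r + dist x y)" for y
    proof -
      have "r' + dist x' y + D \<le> (r' + 2 * D) / r * r + dist x y"
        using dist_triangle[of x' y x] r by (simp add: D_def dist_commute)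
      also have "\<dots> \<le> (r' + 2 * D) / r * (r + dist x y) + (r + dist x y)"
        using r D by (intro add_mono mult_left_mono) auto
      also have "\<dots> = (1 + (r' + 2 * D) / r) * (r + dist x y)" by (simp add: algebra_simps)
      also have "\<dots> \<le> M * (r + dist x y)" using r M(1) by (intro mult_right_mono) (auto simp: D_def)
      finally show ?thesis .
    qed
    have Pc: "P g x r y \<le> c * P g x' r' y" for y
      unfolding c_def using Ma[of y] by (intro P_change r M1 bg Mr) (simp add: D_def)
    note p = test_bound_D[OF G]
    have s: "\<bar>\<phi> y\<bar> \<le> C * (c * P g x' r' y)" for y
      by (rule order_trans[OF p(2) mult_left_mono[OF Pc p(1)]])
    show "test_bound x' r' b g \<phi> (L * C)"
      unfolding test_bound_def
    proof (intro conjI allI impI)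
      show "0 \<le> L * C" using p(1) L c1 by simp
      show "\<bar>\<phi> y\<bar> \<le> L * C * P g x' r' y" for y
      proof -
        have "C * (c * P g x' r' y) = c * (C * P g x' r' y)" by simp
        also have "\<dots> \<le> L * (C * P g x' r' y)" using L(1) p(1) by (intro mult_right_mono) auto
        finally show ?thesis using s[of y] by simp
      qed
      show "\<bar>\<phi> z - \<phi> y\<bar> \<le> L * C * (dist y z / (r' + dist x' y)) powr b * P g x' r' y"
        if d: "dist y z \<le> (r' + dist x' y) / 2" for y z
      proof (cases "dist y z \<le> (r + dist x y) / 2")
        case True
        let ?h' = "(dist y z / (r' + dist x' y)) powr b"
        have "dist y z / (r + dist x y) \<le> M * (dist y z / (r' + dist x' y))"
        proof -
          have "1 / (r + dist x y) \<le> M / (r' + dist x' y)"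
            using Ma[of y] D r by (simp add: field_simps)
          from mult_left_mono[OF this, of "dist y z"] show ?thesis by (simp add: mult_ac)
        qed
        then have "(dist y z / (r + dist x y)) powr b \<le> (M * (dist y z / (r' + dist x' y))) powr b"
          using bg r by (intro powr_mono2) auto
        also have "\<dots> = M powr b * ?h'" by (rule powr_mult)
        finally have "C * (dist y z / (r + dist x y)) powr b * P g x r y \<le> C * (M powr b * ?h') * (c * P g x' r' y)"
          using p(1) by (intro mult_mono mult_left_mono Pc) auto
        also have "\<dots> = c * M powr b * (C * ?h' * P g x' r' y)" by (simp add: mult_ac)
        also have "\<dots> \<le> L * (C * ?h' * P g x' r' y)" using L p(1) by (intro mult_right_mono) auto
        finally show ?thesis using p(3)[OF True] by (simp add: mult.assoc)
      next
        case False
        let ?h' = "(dist y z / (r' + dist x' y)) powr b"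
        have "1 \<le> 2 * M * (dist y z / (r' + dist x' y))"
        proof -
          have "r' + dist x' y \<le> M * (r + dist x y)" using Ma[of y] D by linarith
          also have "\<dots> \<le> M * (2 * dist y z)" using False M1 by (intro mult_left_mono) auto
          finally show ?thesis using r by (simp add: field_simps)
        qed
        then have "1 \<le> (2 * M * (dist y z / (r' + dist x' y))) powr b" using bg by (intro ge_one_powr_ge_zero)
        then have h: "1 \<le> (2 * M) powr b * ?h'" by (simp only: powr_mult)
        have "\<bar>\<phi> z - \<phi> y\<bar> \<le> C * (c * P g x' r' z) + C * (c * P g x' r' y)"
          using s[of z] s[of y] by linarith
        also have "\<dots> \<le> C * (c * (near_const g * P g x' r' y)) + C * (c * P g x' r' y)"
          using p(1) c1 r bg d by (intro add_right_mono mult_left_mono P_near) auto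
        also have "\<dots> = (c * (near_const g + 1) * (C * P g x' r' y)) * 1" by (simp add: algebra_simps)
        also have "\<dots> \<le> (c * (near_const g + 1) * (C * P g x' r' y)) * ((2 * M) powr b * ?h')"
          using h p(1) c1 cg by (intro mult_left_mono) auto
        also have "\<dots> = c * ((near_const g + 1) * (2 * M) powr b) * (C * ?h' * P g x' r' y)" by (simp add: mult_ac)
        also have "\<dots> \<le> L * (C * ?h' * P g x' r' y)" using L p(1) by (intro mult_right_mono) auto
        finally show ?thesis by (simp add: mult.assoc)
      qed
    qed
  qed
qed

lemma test_bound_change:
  assumes r: "0 < r" "0 < r'" and bg: "0 \<le> b" "0 \<le> g"
  obtains L where "1 \<le> L" "\<And>\<phi> C. test_bound x r b g \<phi> C \<Longrightarrow> test_bound x' r' b g \<phi> (L * C)"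
proof -
  define M where "M = 1 + (r' + 2 * dist x x') / r + (r + dist x x') / r'"
  have M: "1 \<le> M" "1 + (r' + 2 * dist x x') / r \<le> M" "1 + (r + dist x x') / r' \<le> M"
    using r by (auto simp: M_def)
  obtain L where "1 \<le> L" "\<And>x x' r r' \<phi> C. 0 < r \<Longrightarrow> 0 < r' \<Longrightarrow> 1 + (r' + 2 * dist x x') / r \<le> M \<Longrightarrow>
    1 + (r + dist x x') / r' \<le> M \<Longrightarrow> test_bound x r b g \<phi> C \<Longrightarrow> test_bound x' r' b g \<phi> (L * C)"
    by (rule test_bound_change_uniform[OF bg M(1)]) blast
  with r M(2,3) that show ?thesis by blast
qed

lemma test_bound_regular:
  assumes G: "test_bound x r b g \<phi> C" and s: "0 < s" "s \<le> r / 2" and b: "0 \<le> b"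
  shows "regular x r s b g C \<phi>"
  unfolding regular_def
proof (intro conjI allI impI)
  note p = test_bound_D[OF G]
  show "0 \<le> C" "\<bar>\<phi> y\<bar> \<le> C * P g x r y" for y by (rule p)+
  show "\<bar>\<phi> z - \<phi> y\<bar> \<le> C * (dist y z / s) powr b * P g x r y" if d: "dist y z \<le> s" for y z
  proof -
    have d2: "dist y z \<le> (r + dist x y) / 2" using d s zero_le_dist[of x y] by argo
    have "s \<le> r + dist x y" using s zero_le_dist[of x y] by argo
    then have "dist y z / (r + dist x y) \<le> dist y z / s" using s by (intro divide_left_mono) auto
    then have "(dist y z / (r + dist x y)) powr b \<le> (dist y z / s) powr b"
      using b s by (intro powr_mono2) auto
    then have "C * (dist y z / (r + dist x y)) powr b * P g x r y \<le> C * (dist y z / s) powr b * P g x r y"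
      using p(1) by (intro mult_right_mono mult_left_mono) auto
    then show ?thesis using p(3)[OF d2] by linarith
  qed
qed

text \<open>Where the function matters, r + d(x, y) is at most 4 R. Regularity at the fixed scale s
  therefore becomes regularity at scale r + d(x, y) at the price (4 R / s)^b', and the decay
  exponent can be raised from g to g' at the price (4 R / r)^(g' - g). One use is qualitative,
  membership in \<open>tests \<epsilon>\<close>; the other needs the explicit constant for the last
  remainder.\<close>

lemma regular_bounded_support_test_bound:
  assumes E: "regular x r s b g K E" and s: "0 < s" "s \<le> r" "r \<le> R"
    and supp: "\<And>y. R \<le> dist x y \<Longrightarrow> E y = 0" and b: "0 \<le> b'" "b' \<le> b" and g: "0 \<le> g" "g \<le> g'"
  shows "test_bound x r b' g' E (K * (near_const g + 1) * (4 * R / s) powr b' * (4 * R / r) powr (g' - g))"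
  unfolding test_bound_def
proof (intro conjI allI impI)
  have K: "0 \<le> K" and size: "\<And>y. \<bar>E y\<bar> \<le> K * P g x r y"
    and hol: "\<And>y z. dist y z \<le> s \<Longrightarrow> \<bar>E z - E y\<bar> \<le> K * (dist y z / s) powr b * P g x r y"
    using E by (auto simp: regular_def)
  have cg: "1 \<le> near_const g" using g by (intro near_const_ge1)
  have r: "0 < r" "0 < R" using s by auto
  let ?c = "(4 * R / s) powr b'" and ?e = "(4 * R / r) powr (g' - g)"
  have c1: "1 \<le> ?c" using s b by (intro ge_one_powr_ge_zero) auto
  show "0 \<le> K * (near_const g + 1) * ?c * ?e" using K cg by simp
  have Pe: "P g x r y \<le> ?e * P g' x r y" if "dist x y \<le> 3 * R" for y
  proof -
    have "P g x r y = P (g' - (g' - g)) x r y" by simp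
    also have "\<dots> = P g' x r y * ((r + dist x y) / r) powr (g' - g)" by (rule P_mult[OF r(1), symmetric])
    also have "\<dots> \<le> P g' x r y * ?e"
      using that s g r by (intro mult_left_mono powr_mono2 divide_right_mono) auto
    finally show ?thesis by (simp add: mult.commute)
  qed
  show "\<bar>E y\<bar> \<le> K * (near_const g + 1) * ?c * ?e * P g' x r y" for y
  proof (cases "R \<le> dist x y")
    case True
    then show ?thesis using supp K cg by simp
  next
    case False
    have "1 * 1 \<le> (near_const g + 1) * ?c" using cg c1 by (intro mult_mono) auto
    then have k: "K * 1 \<le> K * ((near_const g + 1) * ?c)" using K by (intro mult_left_mono) auto
    have "\<bar>E y\<bar> \<le> K * (?e * P g' x r y)"
      using False r by (intro order_trans[OF size] mult_left_mono Pe K) auto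
    also have "\<dots> \<le> K * ((near_const g + 1) * ?c) * (?e * P g' x r y)" using k by (intro mult_right_mono) auto
    finally show ?thesis by (simp add: mult_ac)
  qed
  fix y z assume d: "dist y z \<le> (r + dist x y) / 2"
  let ?h = "(dist y z / (r + dist x y)) powr b'"
  show "\<bar>E z - E y\<bar> \<le> K * (near_const g + 1) * ?c * ?e * ?h * P g' x r y"
  proof (cases "dist x y \<le> 3 * R")
    case False
    \<comment> \<open>An increment of at most half of r + d(x, y) cannot lead from beyond 3 R back
      inside R, so both values vanish.\<close>
    have "R \<le> dist x z" using False d s dist_triangle[of x y z] by (simp add: dist_commute)
    then show ?thesis using supp[of z] supp[of y] False r K cg by simp
  next
    case True
    have base: "\<bar>E z - E y\<bar> \<le> K * (near_const g + 1) * (dist y z / s) powr b' * P g x r y"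
    proof (cases "dist y z \<le> s")
      case ds: True
      have "(dist y z / s) powr b \<le> (dist y z / s) powr b'" using ds s b by (intro powr_mono') auto
      then have "K * (dist y z / s) powr b * P g x r y \<le> (K * (near_const g + 1)) * (dist y z / s) powr b' * P g x r y"
        using K cg by (intro mult_right_mono mult_mono) (auto simp: mult_le_cancel_left1)
      then show ?thesis using hol[OF ds] by linarith
    next
      case False
      then have h: "1 \<le> (dist y z / s) powr b'" using s b by (intro ge_one_powr_ge_zero) auto
      have "\<bar>E z - E y\<bar> \<le> K * P g x r z + K * P g x r y" using size[of z] size[of y] by linarith
      also have "\<dots> \<le> K * (near_const g * P g x r y) + K * P g x r y"
        using K d r g by (intro add_right_mono mult_left_mono P_near) auto
      also have "\<dots> = (K * (near_const g + 1) * P g x r y) * 1" by (simp add: algebra_simps)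
      also have "\<dots> \<le> (K * (near_const g + 1) * P g x r y) * (dist y z / s) powr b'"
        using h K cg by (intro mult_left_mono) auto
      finally show ?thesis by (simp add: mult_ac)
    qed
    have "(dist y z / s) powr b' \<le> (4 * R / s * (dist y z / (r + dist x y))) powr b'"
    proof (rule powr_mono2)
      have "r + dist x y \<le> 4 * R" using True s by simp
      then have "1 \<le> 4 * R / (r + dist x y)" using r by simp
      from mult_left_mono[OF this, of "dist y z / s"]
      show "dist y z / s \<le> 4 * R / s * (dist y z / (r + dist x y))"
        using s by (simp add: mult_ac)
    qed (use b s in auto)
    also have "\<dots> = ?c * ?h" by (rule powr_mult)
    finally have "K * (near_const g + 1) * (dist y z / s) powr b' * P g x r y \<le> K * (near_const g + 1) * (?c * ?h) * (?e * P g' x r y)"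
      using K cg by (intro mult_mono mult_left_mono Pe[OF True]) auto
    then show ?thesis using base by (simp add: mult_ac)
  qed
qed

section \<open>Cutoffs and tails\<close>

definition cutoff :: "'a \<Rightarrow> real \<Rightarrow> 'a \<Rightarrow> real" where
  "cutoff x R y = max 0 (min 1 (2 - dist x y / R))"

lemma cutoff_range: "0 \<le> cutoff x R y" "cutoff x R y \<le> 1"
  by (auto simp: cutoff_def)

lemma cutoff_in: "0 < R \<Longrightarrow> dist x y \<le> R \<Longrightarrow> cutoff x R y = 1"
  by (auto simp: cutoff_def field_simps)

lemma cutoff_out: "0 < R \<Longrightarrow> 2 * R \<le> dist x y \<Longrightarrow> cutoff x R y = 0"
  by (auto simp: cutoff_def field_simps)

lemma cutoff_lipschitz:
  fixes x y z :: 'a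
  assumes "0 < R" shows "\<bar>cutoff x R y - cutoff x R z\<bar> \<le> dist y z / R"
proof -
  have "\<bar>dist x y / R - dist x z / R\<bar> = \<bar>dist x y - dist x z\<bar> / R"
    using assms by (simp add: diff_divide_distrib[symmetric] abs_divide)
  also have "\<dots> \<le> dist y z / R"
    using assms abs_dist_diff_le[of y x z] by (intro divide_right_mono) (auto simp: dist_commute)
  finally show ?thesis unfolding cutoff_def by (auto simp: max_def min_def abs_if split: if_splits)
qed

text \<open>The cutoff is Lipschitz at scale R, hence for b at most 1 also b-regular at every
  smaller scale s. The product rule then doubles the constant.\<close>

lemma regular_cutoff:
  assumes E: "regular x r s b g K E" and s: "0 < s" "s \<le> R" and b: "b \<le> 1"
  shows "regular x r s b g (2 * K) (\<lambda>y. cutoff x R y * E y)"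
  unfolding regular_def
proof (intro conjI allI impI)
  have K: "0 \<le> K" and size: "\<And>y. \<bar>E y\<bar> \<le> K * P g x r y"
    and hol: "\<And>y z. dist y z \<le> s \<Longrightarrow> \<bar>E z - E y\<bar> \<le> K * (dist y z / s) powr b * P g x r y"
    using E by (auto simp: regular_def)
  show "0 \<le> 2 * K" using K by simp
  show "\<bar>cutoff x R y * E y\<bar> \<le> 2 * K * P g x r y" for y
  proof -
    have "\<bar>cutoff x R y * E y\<bar> \<le> 1 * \<bar>E y\<bar>" unfolding abs_mult
      using cutoff_range[of x R y] by (intro mult_right_mono) auto
    moreover have "K * P g x r y \<le> 2 * K * P g x r y" using K by simp
    ultimately show ?thesis using size[of y] by linarith
  qed
  fix y z :: 'a assume d: "dist y z \<le> s"
  let ?h = "(dist y z / s) powr b"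
  have h: "dist y z / R \<le> ?h"
  proof -
    have "dist y z / R \<le> dist y z / s" using s by (intro divide_left_mono) auto
    also have "\<dots> = (dist y z / s) powr 1" using s by simp
    also have "\<dots> \<le> ?h" using d s b by (intro powr_mono') auto
    finally show ?thesis .
  qed
  have "cutoff x R z * E z - cutoff x R y * E y = cutoff x R z * (E z - E y) + (cutoff x R z - cutoff x R y) * E y"
    by (simp add: algebra_simps)
  then have "\<bar>cutoff x R z * E z - cutoff x R y * E y\<bar> \<le> \<bar>cutoff x R z\<bar> * \<bar>E z - E y\<bar> + \<bar>cutoff x R z - cutoff x R y\<bar> * \<bar>E y\<bar>"
    by (metis abs_mult abs_triangle_ineq)
  also have "\<dots> \<le> 1 * (K * ?h * P g x r y) + ?h * (K * P g x r y)"
  proof (intro add_mono mult_mono hol d size)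
    show "\<bar>cutoff x R z - cutoff x R y\<bar> \<le> ?h"
      using cutoff_lipschitz[of R x z y] s h by (simp add: dist_commute)
  qed (use cutoff_range[of x R z] K in auto)
  finally show "\<bar>cutoff x R z * E z - cutoff x R y * E y\<bar> \<le> 2 * K * ?h * P g x r y" by (simp add: algebra_simps)
qed

text \<open>Beyond R the surplus decay g' - g is worth (r / R)^(g' - g). The regularity hypothesis
  is confined to y outside R and to increments up to (r + d(x, y)) / 8, the range in which it can be
  verified for sampled averages.\<close>

lemma test_bound_tail:
  assumes r: "0 < r" "r \<le> R" and b: "0 \<le> b" "b \<le> 1" and g: "0 \<le> g" "g \<le> g'" and K: "0 \<le> K"
    and size: "\<And>y. R \<le> dist x y \<Longrightarrow> \<bar>\<phi> y\<bar> \<le> K * P g' x r y"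
    and hol: "\<And>y z. R \<le> dist x y \<Longrightarrow> dist y z \<le> (r + dist x y) / 8 \<Longrightarrow>
       \<bar>\<phi> z - \<phi> y\<bar> \<le> K * (dist y z / (r + dist x y)) powr b * P g' x r y"
  shows "test_bound x r b g (\<lambda>y. (1 - cutoff x R y) * \<phi> y) ((8 powr b * (near_const g + 1) + 6 * near_const g) * (K * (r / R) powr (g' - g)))"
  unfolding test_bound_def
proof (intro conjI allI impI)
  let ?F = "\<lambda>y. (1 - cutoff x R y) * \<phi> y"
  let ?K = "K * (r / R) powr (g' - g)"
  have R: "0 < R" using r by simp
  have cg: "1 \<le> near_const g" using g by (intro near_const_ge1)
  have K': "0 \<le> ?K" using K by simp
  let ?C = "8 powr b * (near_const g + 1) + 6 * near_const g"
  have C1: "1 \<le> ?C" "8 powr b * (near_const g + 1) \<le> ?C" "6 * near_const g \<le> ?C" "6 \<le> ?C"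
    using cg by (auto simp: add_increasing)
  show "0 \<le> ?C * ?K" using C1 K' by simp
  have Pg: "K * P g' x r y \<le> ?K * P g x r y" if "R \<le> dist x y" for y
  proof -
    have "P g' x r y = P (g - (g - g')) x r y" by simp
    also have "\<dots> = P g x r y * ((r + dist x y) / r) powr (g - g')" by (rule P_mult[OF r(1), symmetric])
    also have "((r + dist x y) / r) powr (g - g') \<le> (R / r) powr (g - g')"
      using that r g by (intro powr_mono2' divide_right_mono) auto
    also have "(R / r) powr (g - g') = (r / R) powr (g' - g)"
      using r R by (metis inverse_divide inverse_powr minus_diff_eq powr_minus less_imp_le divide_nonneg_nonneg)
    finally have "P g' x r y \<le> P g x r y * (r / R) powr (g' - g)" by (simp add: mult_left_mono)
    from mult_left_mono[OF this K] show ?thesis by (simp add: mult_ac)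
  qed
  have in0: "?F y = 0" if "dist x y \<le> R" for y using cutoff_in[OF R that] by simp
  have F1: "\<bar>?F y\<bar> \<le> ?K * P g x r y" for y
  proof (cases "R \<le> dist x y")
    case True
    have "\<bar>?F y\<bar> \<le> 1 * \<bar>\<phi> y\<bar>" unfolding abs_mult
      using cutoff_range[of x R y] by (intro mult_right_mono) auto
    then show ?thesis using size[OF True] Pg[OF True] by linarith
  next
    case False
    then have "?F y = 0" by (intro in0) simp
    then show ?thesis using mult_nonneg_nonneg[OF K' P_nonneg[of g x r y]] by (simp only: abs_zero)
  qed
  show "\<bar>?F y\<bar> \<le> ?C * ?K * P g x r y" for y
  proof -
    have "1 * (?K * P g x r y) \<le> ?C * (?K * P g x r y)" using C1 K' by (intro mult_right_mono mult_nonneg_nonneg[OF K']) auto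
    then show ?thesis using F1[of y] by (simp add: mult.assoc)
  qed
  have hol2: "\<bar>?F z - ?F y\<bar> \<le> 6 * (?K * (dist y z / (r + dist x y)) powr b * P g x r y)"
    if y: "R \<le> dist x y" and d: "dist y z \<le> (r + dist x y) / 8" for y z
  proof -
    let ?h = "(dist y z / (r + dist x y)) powr b"
    have "dist y z \<le> r + dist x y" using d r zero_le_dist[of x y] by argo
    then have ratio: "dist y z / (r + dist x y) \<le> 1" using r by (simp add: divide_le_eq_1)
    \<comment> \<open>Up to distance 4 R, r + d(x, y) is at most 5 R and the Lipschitz bound
      suffices. Beyond it, both y and z lie outside 2 R, where the cutoff vanishes.\<close>
    have chi: "\<bar>cutoff x R y - cutoff x R z\<bar> \<le> 5 * ?h"
    proof (cases "dist x y \<le> 4 * R")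
      case True
      have "\<bar>cutoff x R y - cutoff x R z\<bar> \<le> dist y z / R" by (rule cutoff_lipschitz[OF R])
      also have "\<dots> \<le> 5 * (dist y z / (r + dist x y))"
      proof -
        have "r + dist x y \<le> 5 * R" using True r by simp
        then have "dist y z * (r + dist x y) \<le> dist y z * (5 * R)" by (intro mult_left_mono) auto
        then show ?thesis using R r by (simp add: field_simps)
      qed
      also have "\<dots> = 5 * (dist y z / (r + dist x y)) powr 1" using r by simp
      also have "\<dots> \<le> 5 * ?h" using ratio b r by (intro mult_left_mono powr_mono') auto
      finally show ?thesis .
    next
      case False
      have "2 * R \<le> dist x z" using False d r dist_triangle[of x y z] by (simp add: dist_commute)
      then have "cutoff x R z = 0" "cutoff x R y = 0" using False R by (auto intro!: cutoff_out)
      then show ?thesis by simp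
    qed
    have "?F z - ?F y = (1 - cutoff x R z) * (\<phi> z - \<phi> y) + (cutoff x R y - cutoff x R z) * \<phi> y"
      by (simp add: algebra_simps)
    then have "\<bar>?F z - ?F y\<bar> \<le> \<bar>1 - cutoff x R z\<bar> * \<bar>\<phi> z - \<phi> y\<bar> + \<bar>cutoff x R y - cutoff x R z\<bar> * \<bar>\<phi> y\<bar>"
      by (metis abs_mult abs_triangle_ineq)
    also have "\<dots> \<le> 1 * (K * ?h * P g' x r y) + 5 * ?h * (K * P g' x r y)"
      by (intro add_mono mult_mono hol size y d chi) (use cutoff_range[of x R z] K in auto)
    also have "\<dots> = 6 * ?h * (K * P g' x r y)" by (simp add: algebra_simps)
    also have "\<dots> \<le> 6 * ?h * (?K * P g x r y)" by (intro mult_left_mono Pg y) auto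
    finally show ?thesis by (simp add: mult_ac)
  qed
  fix y z assume d: "dist y z \<le> (r + dist x y) / 2"
  let ?h = "(dist y z / (r + dist x y)) powr b"
  have near: "P g x r z \<le> near_const g * P g x r y" using r g d by (intro P_near) auto
  show "\<bar>?F z - ?F y\<bar> \<le> ?C * ?K * ?h * P g x r y"
  proof -
    \<comment> \<open>Large increments are handled by size, giving the constant with 8. If y lies
      inside R and z outside, the roles are exchanged: r + d(x, z) is then the larger scale, so the
      increment stays admissible. If both lie inside, the function vanishes.\<close>
    consider "(r + dist x y) / 8 < dist y z" | "dist y z \<le> (r + dist x y) / 8" "R \<le> dist x y"
      | "dist y z \<le> (r + dist x y) / 8" "dist x y < R" "R < dist x z"
      | "dist x y < R" "dist x z \<le> R" by linarith
    then have "\<bar>?F z - ?F y\<bar> \<le> ?C * (?K * ?h * P g x r y)"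
    proof cases
      case 1
      have "1 \<le> (8 * (dist y z / (r + dist x y))) powr b"
        using 1 b r by (intro ge_one_powr_ge_zero) (auto simp: field_simps)
      then have h: "1 \<le> 8 powr b * ?h" by (simp only: powr_mult)
      have "\<bar>?F z - ?F y\<bar> \<le> ?K * P g x r z + ?K * P g x r y" using F1[of z] F1[of y] by linarith
      also have "\<dots> \<le> ?K * (near_const g * P g x r y) + ?K * P g x r y"
        by (intro add_right_mono mult_left_mono near K')
      also have "\<dots> = ((near_const g + 1) * (?K * P g x r y)) * 1" by (simp add: algebra_simps)
      also have "\<dots> \<le> ((near_const g + 1) * (?K * P g x r y)) * (8 powr b * ?h)"
        using h K' cg by (intro mult_left_mono mult_nonneg_nonneg[OF _ mult_nonneg_nonneg[OF K']]) auto
      also have "\<dots> = 8 powr b * (near_const g + 1) * (?K * ?h * P g x r y)" by (simp add: mult_ac)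
      also have "\<dots> \<le> ?C * (?K * ?h * P g x r y)"
        using C1(2) by (rule mult_right_mono) (intro mult_nonneg_nonneg K' P_nonneg powr_ge_zero)
      finally show ?thesis .
    next
      case 2
      have "6 * (?K * ?h * P g x r y) \<le> ?C * (?K * ?h * P g x r y)"
        using C1(4) by (rule mult_right_mono) (intro mult_nonneg_nonneg K' P_nonneg powr_ge_zero)
      then show ?thesis using hol2[OF 2(2,1)] by linarith
    next
      case 3
      have "dist z y \<le> (r + dist x z) / 8" using 3 unfolding dist_commute[of z y] by argo
      from hol2[OF _ this] 3 have "\<bar>?F y - ?F z\<bar> \<le> 6 * (?K * (dist y z / (r + dist x z)) powr b * P g x r z)"
        by (simp add: dist_commute)
      also have "\<dots> \<le> 6 * (?K * ?h * (near_const g * P g x r y))"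
      proof (intro mult_left_mono mult_mono near)
        show "(dist y z / (r + dist x z)) powr b \<le> ?h"
          using 3 r b by (intro powr_mono2 divide_left_mono) auto
      qed (use K' in auto)
      also have "\<dots> = 6 * near_const g * (?K * ?h * P g x r y)" by (simp add: mult_ac)
      also have "\<dots> \<le> ?C * (?K * ?h * P g x r y)"
        using C1(3) by (rule mult_right_mono) (intro mult_nonneg_nonneg K' P_nonneg powr_ge_zero)
      finally show ?thesis by (simp add: abs_minus_commute)
    next
      case 4
      have "?F z = 0" by (rule in0) (use 4 in simp)
      moreover have "?F y = 0" by (rule in0) (use 4 in simp)
      ultimately have "?F z - ?F y = 0" by (simp only: diff_0_right)
      moreover have "0 \<le> ?C * (?K * ?h * P g x r y)"
        using C1(1) by (intro mult_nonneg_nonneg[OF _ mult_nonneg_nonneg[OF mult_nonneg_nonneg[OF K']]]) auto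
      ultimately show ?thesis by simp
    qed
    then show ?thesis by (simp add: mult.assoc)
  qed
qed

text \<open>Beyond twice the support radius of E only kernels centred far from z contribute. There
  the kernel regularity lives at scale comparable with r + d(x, z) and not at t, so the tail is a
  genuine test function, small because the kernel decay e2 exceeds g or equals it.\<close>

lemma sampled_average_tail:
  assumes b: "0 \<le> b" "b \<le> e1" "b \<le> 1" and g: "0 < g" "g \<le> e2"
  obtains C where "0 < C" "\<And>x r t \<delta> K R \<pi> k E. good_kernel c e1 e2 e3 t k \<Longrightarrow> sampling_map \<delta> \<pi> \<Longrightarrow> \<delta> \<le> t \<Longrightarrow> t \<le> r / 2 \<Longrightarrow> r \<le> R \<Longrightarrow>
     0 \<le> K \<Longrightarrow> (\<And>y. \<bar>E y\<bar> \<le> K * P g x r y) \<Longrightarrow> (\<And>y. R / 2 \<le> dist x y \<Longrightarrow> E y = 0) \<Longrightarrow>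
     test_bound x r b g (\<lambda>y. (1 - cutoff x R y) * sampled_average \<pi> k E y) (C * (K * (r / R) powr (e2 - g)))"
proof -
  define D where "D = \<bar>c\<bar> * 4 powr e1 * (C1 * 5 powr (n + 2 * e2)) * (near_const g * mass_const g)"
  define C where "C = (8 powr b * (near_const g + 1) + 6 * near_const g) * \<bar>D\<bar> + 1"
  have cg: "1 \<le> near_const g" and Ig: "0 < mass_const g" using g by (auto intro!: near_const_ge1 mass_const_pos)
  have D0: "0 \<le> D" using cg Ig C1_ge1 by (simp add: D_def)
  have C0: "0 < C" using cg by (simp add: C_def add_nonneg_pos)
  show ?thesis
  proof (rule that[OF C0])
    fix x :: 'a and r t \<delta> K R :: real and \<pi> k E
    assume gk: "good_kernel c e1 e2 e3 t k" and sp: "sampling_map \<delta> \<pi>" and t: "\<delta> \<le> t" "t \<le> r / 2" and R: "r \<le> R"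
      and K: "0 \<le> K" and size: "\<And>y. \<bar>E y\<bar> \<le> K * P g x r y" and supp: "\<And>y. R / 2 \<le> dist x y \<Longrightarrow> E y = 0"
    note gp = gk_pos[OF gk]
    have r: "0 < r" using gp t by linarith
    have "\<bar>E y\<bar> \<le> K * (1 / V x r)" for y
      using size[of y] P_le_V[of r g x y] K r g mult_left_mono[of "P g x r y" "1 / V x r" K] by simp
    note int1 = sampled_average_integrable[OF gk sp t(1) this]
    have u\<pi>: "dist u (\<pi> u) \<le> t" for u using sp t(1) by (auto simp: sampling_map_def intro: order_trans)
    have E\<pi>: "\<bar>E (\<pi> u)\<bar> \<le> K * (near_const g * P g x r u)" for u
    proof -
      have "dist u (\<pi> u) \<le> (r + dist x u) / 2" using u\<pi>[of u] t zero_le_dist[of x u] by argo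
      then have "K * P g x r (\<pi> u) \<le> K * (near_const g * P g x r u)" using K r g by (intro mult_left_mono P_near) auto
      then show ?thesis using size[of "\<pi> u"] by linarith
    qed
    \<comment> \<open>For such v and z both r and d(x, z) are at most 2 d(v, z), and d(x, v) is at
      most d(v, z), which gives the 5. The lower bound with 1/4 makes increments up to (r + d(x, z))
      / 8 admissible for the kernel.\<close>
    have Pv: "P e2 v t z \<le> C1 * 5 powr (n + 2 * e2) * P e2 x r z \<and> (r + dist x z) / 4 \<le> dist v z"
      if v: "dist x v < R / 2" and z: "R \<le> dist x z" for v z
    proof -
      have dv: "dist x z \<le> 2 * dist v z" using dist_triangle[of x z v] v z by linarith
      have "P e2 v t z \<le> C1 * 5 powr (n + 2 * e2) * P e2 x r z"
        by (rule P_change) (use gp r t v z dv R dist_commute[of v x] in auto)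
      moreover have "(r + dist x z) / 4 \<le> dist v z" using dv z R by simp
      ultimately show ?thesis ..
    qed
    let ?A = "\<bar>c\<bar> * 4 powr e1 * (C1 * 5 powr (n + 2 * e2))"
    have c: "\<bar>c\<bar> = c" "0 < c" using gp by auto
    have four: "1 \<le> (4::real) powr e1" using gp by (intro ge_one_powr_ge_zero) auto
    have intE: "(\<integral>u. K * (near_const g * P g x r u) * B \<partial>\<mu>) \<le> K * (near_const g * mass_const g) * B" if "0 \<le> B" for B
      using K cg that integral_P[OF g(1) r, of x] by (simp add: mult_left_mono mult_right_mono)
    have bd: "\<bar>sampled_average \<pi> k E z\<bar> \<le> (D * K) * P e2 x r z" if z: "R \<le> dist x z" for z
      unfolding sampled_average_def
    proof (rule integral_bound[OF int1])
      let ?B = "?A * P e2 x r z"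
      show "integrable \<mu> (\<lambda>u. K * (near_const g * P g x r u) * ?B)"
        using r g by (intro integrable_mult_left integrable_mult_right integrable_P)
      show "\<bar>E (\<pi> u) * k (\<pi> u) z\<bar> \<le> K * (near_const g * P g x r u) * ?B" for u
      proof (cases "R / 2 \<le> dist x (\<pi> u)")
        case True
        then show ?thesis using supp[OF True] K cg C1_ge1 by simp
      next
        case False
        have "\<bar>k (\<pi> u) z\<bar> \<le> c * P e2 (\<pi> u) t z" using gk by (simp add: good_kernel_def)
        also have "\<dots> \<le> c * (C1 * 5 powr (n + 2 * e2) * P e2 x r z)"
          using Pv[of "\<pi> u" z] False z c by (intro mult_left_mono) auto
        also have "\<dots> \<le> 4 powr e1 * (c * (C1 * 5 powr (n + 2 * e2) * P e2 x r z))"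
          using mult_right_mono[OF four, of "c * (C1 * 5 powr (n + 2 * e2) * P e2 x r z)"] c C1_ge1 by simp
        finally have "\<bar>k (\<pi> u) z\<bar> \<le> ?B" unfolding c by (simp add: mult_ac)
        then show ?thesis unfolding abs_mult using K cg by (intro mult_mono E\<pi>) auto
      qed
      show "(\<integral>u. K * (near_const g * P g x r u) * ?B \<partial>\<mu>) \<le> (D * K) * P e2 x r z"
        by (rule order_trans[OF intE]) (use C1_ge1 in \<open>auto simp: D_def mult_ac\<close>)
    qed
    have hol: "\<bar>sampled_average \<pi> k E z' - sampled_average \<pi> k E z\<bar> \<le> (D * K) * (dist z z' / (r + dist x z)) powr b * P e2 x r z"
      if z: "R \<le> dist x z" and d: "dist z z' \<le> (r + dist x z) / 8" for z z'
    proof -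
      let ?h = "(dist z z' / (r + dist x z)) powr b"
      let ?B = "?A * ?h * P e2 x r z"
      have "sampled_average \<pi> k E z' - sampled_average \<pi> k E z = (\<integral>u. E (\<pi> u) * k (\<pi> u) z' - E (\<pi> u) * k (\<pi> u) z \<partial>\<mu>)"
        unfolding sampled_average_def by (rule Bochner_Integration.integral_diff[symmetric]) (rule int1)+
      also have "\<bar>\<dots>\<bar> \<le> (D * K) * ?h * P e2 x r z"
      proof (rule integral_bound)
        show "integrable \<mu> (\<lambda>u. E (\<pi> u) * k (\<pi> u) z' - E (\<pi> u) * k (\<pi> u) z)"
          by (intro Bochner_Integration.integrable_diff int1)
        show "integrable \<mu> (\<lambda>u. K * (near_const g * P g x r u) * ?B)"
          using r g by (intro integrable_mult_left integrable_mult_right integrable_P)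
        show "\<bar>E (\<pi> u) * k (\<pi> u) z' - E (\<pi> u) * k (\<pi> u) z\<bar> \<le> K * (near_const g * P g x r u) * ?B" for u
        proof (cases "R / 2 \<le> dist x (\<pi> u)")
          case True
          then show ?thesis using supp[OF True] K cg C1_ge1 by simp
        next
          case False
          let ?v = "\<pi> u"
          note pv = Pv[of ?v z]
          have dv: "(r + dist x z) / 4 \<le> dist ?v z" using pv False z by simp
          have "dist z z' \<le> (t + dist ?v z) / 2" using d dv gp by argo
          then have "\<bar>k ?v z - k ?v z'\<bar> \<le> c * (dist z z' / (t + dist ?v z)) powr e1 * P e2 ?v t z"
            using gk by (simp add: good_kernel_def)
          also have "\<dots> \<le> c * (4 powr e1 * ?h) * (C1 * 5 powr (n + 2 * e2) * P e2 x r z)"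
          proof (intro mult_mono mult_left_mono)
            have "dist z z' / (t + dist ?v z) \<le> dist z z' / ((r + dist x z) / 4)"
              using dv gp r by (intro divide_left_mono mult_pos_pos) auto
            then have "(dist z z' / (t + dist ?v z)) powr e1 \<le> (4 * (dist z z' / (r + dist x z))) powr e1"
              using gp by (intro powr_mono2) (auto simp: mult_ac)
            also have "\<dots> = 4 powr e1 * (dist z z' / (r + dist x z)) powr e1" by (rule powr_mult)
            also have "\<dots> \<le> 4 powr e1 * ?h"
            proof (intro mult_left_mono powr_mono')
              have "dist z z' \<le> r + dist x z" using d r zero_le_dist[of x z] by argo
              then show "dist z z' / (r + dist x z) \<le> 1" using r by (simp add: divide_le_eq_1)
            qed (use b r in auto)
            finally show "(dist z z' / (t + dist ?v z)) powr e1 \<le> 4 powr e1 * ?h" .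
            show "P e2 ?v t z \<le> C1 * 5 powr (n + 2 * e2) * P e2 x r z" using pv False z by simp
          qed (use c in auto)
          finally have "\<bar>k ?v z - k ?v z'\<bar> \<le> ?B" unfolding c by (simp add: mult_ac)
          then have "\<bar>E ?v\<bar> * \<bar>k ?v z - k ?v z'\<bar> \<le> K * (near_const g * P g x r u) * ?B"
            using K cg by (intro mult_mono E\<pi>) auto
          moreover have "\<bar>E ?v * k ?v z' - E ?v * k ?v z\<bar> = \<bar>E ?v\<bar> * \<bar>k ?v z - k ?v z'\<bar>"
            by (simp add: abs_mult[symmetric] algebra_simps abs_minus_commute)
          ultimately show ?thesis by simp
        qed
        show "(\<integral>u. K * (near_const g * P g x r u) * ?B \<partial>\<mu>) \<le> (D * K) * ?h * P e2 x r z"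
          by (rule order_trans[OF intE]) (use C1_ge1 in \<open>auto simp: D_def mult_ac\<close>)
      qed
      finally show ?thesis .
    qed
    have "test_bound x r b g (\<lambda>y. (1 - cutoff x R y) * sampled_average \<pi> k E y) ((8 powr b * (near_const g + 1) + 6 * near_const g) * (D * K * (r / R) powr (e2 - g)))"
      by (rule test_bound_tail[OF r R b(1,3) _ g(2) _ bd hol]) (use g D0 K in auto)
    moreover have "(8 powr b * (near_const g + 1) + 6 * near_const g) * (D * K * (r / R) powr (e2 - g)) \<le> C * (K * (r / R) powr (e2 - g))"
    proof -
      have "(8 powr b * (near_const g + 1) + 6 * near_const g) * D * (K * (r / R) powr (e2 - g)) \<le> C * (K * (r / R) powr (e2 - g))"
        using D0 K by (intro mult_right_mono) (auto simp: C_def)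
      then show ?thesis by (simp add: mult_ac)
    qed
    ultimately show "test_bound x r b g (\<lambda>y. (1 - cutoff x R y) * sampled_average \<pi> k E y) (C * (K * (r / R) powr (e2 - g)))"
      by (rule test_bound_mono)
  qed
qed


section \<open>Functionals and the main estimate\<close>

text \<open>Changing the centre or the scale changes only the constant, not the class. For \<beta>,
  \<gamma> at most \<epsilon> it is dense in \<open>G0\<close>, and the iteration can stay inside
  it.\<close>

definition tests :: "real \<Rightarrow> ('a \<Rightarrow> real) set" where
  "tests \<epsilon> = {\<phi>. \<exists>x r C. 0 < r \<and> test_bound x r \<epsilon> \<epsilon> \<phi> C}"

lemma testsI: "0 < r \<Longrightarrow> test_bound x r \<epsilon> \<epsilon> \<phi> C \<Longrightarrow> \<phi> \<in> tests \<epsilon>"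
  by (auto simp: tests_def)

lemma testsE:
  assumes "\<phi> \<in> tests \<epsilon>" "0 \<le> \<epsilon>" "0 < r" obtains C where "test_bound x r \<epsilon> \<epsilon> \<phi> C"
proof -
  obtain x' r' C where "0 < r'" "test_bound x' r' \<epsilon> \<epsilon> \<phi> C" using assms(1) by (auto simp: tests_def)
  then show ?thesis using test_bound_change[of r' r \<epsilon> \<epsilon> x' x] assms that by metis
qed

lemma tests_lincomb:
  assumes "\<phi> \<in> tests \<epsilon>" "\<psi> \<in> tests \<epsilon>" "0 \<le> \<epsilon>" shows "(\<lambda>y. a * \<phi> y + \<psi> y) \<in> tests \<epsilon>"
proof -
  obtain x :: 'a where True by simp
  obtain C where "test_bound x 1 \<epsilon> \<epsilon> \<phi> C" by (rule testsE[OF assms(1,3), of 1 x]) simp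
  moreover obtain D where "test_bound x 1 \<epsilon> \<epsilon> \<psi> D" by (rule testsE[OF assms(2,3), of 1 x]) simp
  ultimately show ?thesis by (intro testsI[OF _ test_bound_lincomb]) auto
qed

lemma tests_zero [simp]: "(\<lambda>_. 0) \<in> tests \<epsilon>"
  by (rule testsI[of 1 _ _ _ 0]) (auto simp: test_bound_def)

lemma tests_diff:
  assumes "\<phi> \<in> tests \<epsilon>" "\<psi> \<in> tests \<epsilon>" "0 \<le> \<epsilon>" shows "(\<lambda>y. \<phi> y - \<psi> y) \<in> tests \<epsilon>"
  using tests_lincomb[OF assms(2,1,3), of "-1"] by simp

text \<open>Continuity is in the weaker norm with exponents \<beta>, \<gamma>, with a constant that
  may depend on the centre and the scale.\<close>

definition functional :: "real \<Rightarrow> real \<Rightarrow> real \<Rightarrow> (('a \<Rightarrow> real) \<Rightarrow> real) \<Rightarrow> bool" where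
  "functional \<epsilon> \<beta> \<gamma> f \<longleftrightarrow>
     (\<forall>\<phi>\<in>tests \<epsilon>. \<forall>\<psi>\<in>tests \<epsilon>. \<forall>a. f (\<lambda>y. a * \<phi> y + \<psi> y) = a * f \<phi> + f \<psi>) \<and>
     (\<forall>x r. 0 < r \<longrightarrow> (\<exists>N\<ge>0. \<forall>\<phi>\<in>tests \<epsilon>. \<forall>C. test_bound x r \<beta> \<gamma> \<phi> C \<longrightarrow> \<bar>f \<phi>\<bar> \<le> N * C))"

lemma functional_lincomb:
  "functional \<epsilon> \<beta> \<gamma> f \<Longrightarrow> \<phi> \<in> tests \<epsilon> \<Longrightarrow> \<psi> \<in> tests \<epsilon> \<Longrightarrow> f (\<lambda>y. a * \<phi> y + \<psi> y) = a * f \<phi> + f \<psi>"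
  by (auto simp: functional_def)

lemma functional_zero: "functional \<epsilon> \<beta> \<gamma> f \<Longrightarrow> f (\<lambda>_. 0) = 0"
  using functional_lincomb[of \<epsilon> \<beta> \<gamma> f "\<lambda>_. 0" "\<lambda>_. 0" 1] by simp

lemma functional_diff:
  "functional \<epsilon> \<beta> \<gamma> f \<Longrightarrow> \<phi> \<in> tests \<epsilon> \<Longrightarrow> \<psi> \<in> tests \<epsilon> \<Longrightarrow> f (\<lambda>y. \<phi> y - \<psi> y) = f \<phi> - f \<psi>"
  using functional_lincomb[of \<epsilon> \<beta> \<gamma> f \<psi> \<phi> "-1"] by simp

lemma functional_sum:
  assumes f: "functional \<epsilon> \<beta> \<gamma> f" and \<epsilon>: "0 \<le> \<epsilon>" and "finite F" and k: "\<And>p. p \<in> F \<Longrightarrow> k p \<in> tests \<epsilon>"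
  shows "(\<lambda>z. \<Sum>p\<in>F. a p * k p z) \<in> tests \<epsilon> \<and> f (\<lambda>z. \<Sum>p\<in>F. a p * k p z) = (\<Sum>p\<in>F. a p * f (k p))"
  using assms(3) k
proof (induction F rule: finite_induct)
  case empty
  then show ?case using functional_zero[OF f] by simp
next
  case (insert p F)
  then have IH: "(\<lambda>z. \<Sum>p\<in>F. a p * k p z) \<in> tests \<epsilon>" "f (\<lambda>z. \<Sum>p\<in>F. a p * k p z) = (\<Sum>p\<in>F. a p * f (k p))"
    and p: "k p \<in> tests \<epsilon>" by auto
  show ?case
    using insert(1,2) tests_lincomb[OF p IH(1) \<epsilon>, of "a p"] functional_lincomb[OF f p IH(1), of "a p"] IH(2) by simp
qed

lemma good_kernel_test_bound:
  assumes gk: "good_kernel c e1 e2 e3 t k" and "\<epsilon> \<le> e1" "\<epsilon> \<le> e2"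
  shows "test_bound v t \<epsilon> \<epsilon> (k v) c"
proof (rule test_bound_exponents)
  show "test_bound v t e1 e2 (k v) c" using gk by (auto simp: good_kernel_def test_bound_def abs_minus_commute)
qed (use gk_pos[OF gk] assms in auto)

lemma good_kernel_tests:
  assumes gk: "good_kernel c e1 e2 e3 t k" and "\<epsilon> \<le> e1" "\<epsilon> \<le> e2" shows "k v \<in> tests \<epsilon>"
  by (rule testsI[OF gk_pos(1)[OF gk] good_kernel_test_bound[OF assms]])

text \<open>A sampled average of a function of bounded support is a finite linear combination of the
  kernels \<open>k p\<close>, so a functional can be applied to it term by term.\<close>

lemma functional_sampled_average:
  assumes f: "functional \<epsilon> \<beta> \<gamma> f" and gk: "good_kernel c e1 e2 e3 t k" and \<epsilon>: "0 \<le> \<epsilon>" "\<epsilon> \<le> e1" "\<epsilon> \<le> e2"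
    and sp: "sampling_map \<delta> \<pi>" and supp: "\<And>y. R \<le> dist x y \<Longrightarrow> E y = 0"
    and g: "0 \<le> g" and r: "0 < r" "\<delta> \<le> r / 2" and K: "0 \<le> K" and size: "\<And>y. \<bar>E y\<bar> \<le> K * P g x r y"
    and B: "0 \<le> B" "(\<integral>\<^sup>+u. ennreal (P g x r u * \<bar>f (k (\<pi> u))\<bar>) \<partial>\<mu>) \<le> ennreal B"
  shows "sampled_average \<pi> k E \<in> tests \<epsilon>" "\<bar>f (sampled_average \<pi> k E)\<bar> \<le> K * near_const g * B"
proof -
  define F where "F = range \<pi> \<inter> ball x R"
  have finF: "finite F" using sp by (simp add: sampling_map_def F_def)
  have u\<pi>: "dist u (\<pi> u) \<le> \<delta>" for u using sp by (simp add: sampling_map_def)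
  let ?S = "\<lambda>p. \<pi> -` {p}"
  have S: "?S p \<in> sets \<mu>" for p using sp by (simp add: sampling_map_def)
  have fin: "emeasure \<mu> (?S p) < \<infinity>" for p
  proof -
    have "?S p \<subseteq> ball p (\<delta> + 1)"
    proof
      fix u assume "u \<in> ?S p"
      then show "u \<in> ball p (\<delta> + 1)" using u\<pi>[of u] by (simp add: dist_commute)
    qed
    then have "emeasure \<mu> (?S p) \<le> emeasure \<mu> (ball p (\<delta> + 1))" by (rule emeasure_mono) simp
    then show ?thesis unfolding emeasure_ball by (simp add: ennreal_less_top le_less_trans)
  qed
  \<comment> \<open>Along \<open>\<pi>\<close>, a function vanishing outside the ball takes its
    values at the finitely many sample points in \<open>F\<close>, so it is a finite combination of
    cell indicators.\<close>
  have expand: "h (\<pi> u) = (\<Sum>p\<in>F. indicator (?S p) u * h p)" if h: "\<And>v. v \<notin> ball x R \<Longrightarrow> h v = 0" for h :: "'a \<Rightarrow> real" and u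
  proof (cases "\<pi> u \<in> F")
    case True
    have "(\<Sum>p\<in>F. indicator (?S p) u * h p) = (\<Sum>p\<in>F. if p = \<pi> u then h p else 0)"
      by (intro sum.cong) (auto simp: indicator_def)
    then show ?thesis using True finF by simp
  next
    case False
    then have "h (\<pi> u) = 0" by (intro h) (auto simp: F_def)
    moreover have "(\<Sum>p\<in>F. indicator (?S p) u * h p) = 0"
      using False by (intro sum.neutral) (auto simp: indicator_def)
    ultimately show ?thesis by simp
  qed
  let ?m = "\<lambda>p. measure \<mu> (?S p)"
  have sampled_average: "sampled_average \<pi> k E = (\<lambda>z. \<Sum>p\<in>F. (?m p * E p) * k p z)"
  proof
    fix z
    have "sampled_average \<pi> k E z = (\<integral>u. (\<Sum>p\<in>F. indicator (?S p) u * (E p * k p z)) \<partial>\<mu>)"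
      unfolding sampled_average_def by (subst expand[of "\<lambda>v. E v * k v z"]) (auto simp: supp)
    also have "\<dots> = (\<Sum>p\<in>F. \<integral>u. indicator (?S p) u * (E p * k p z) \<partial>\<mu>)"
      using S fin by (intro Bochner_Integration.integral_sum integrable_mult_left integrable_real_indicator)
    also have "\<dots> = (\<Sum>p\<in>F. (?m p * E p) * k p z)"
      using S by (intro sum.cong) (auto simp: mult.assoc)
    finally show "sampled_average \<pi> k E z = (\<Sum>p\<in>F. (?m p * E p) * k p z)" .
  qed
  have kt: "k p \<in> tests \<epsilon>" for p by (rule good_kernel_tests[OF gk \<epsilon>(2,3)])
  note fs = functional_sum[OF f \<epsilon>(1) finF kt, of "\<lambda>p. ?m p * E p"]
  show "sampled_average \<pi> k E \<in> tests \<epsilon>" unfolding sampled_average using fs by simp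
  have "\<bar>f (sampled_average \<pi> k E)\<bar> = \<bar>(\<Sum>p\<in>F. (?m p * E p) * f (k p))\<bar>" unfolding sampled_average using fs by simp
  also have "\<dots> \<le> (\<Sum>p\<in>F. \<bar>(?m p * E p) * f (k p)\<bar>)" by (rule sum_abs)
  also have "\<dots> = (\<Sum>p\<in>F. ?m p * (\<bar>E p\<bar> * \<bar>f (k p)\<bar>))" by (simp add: abs_mult mult.assoc)
  finally have le: "\<bar>f (sampled_average \<pi> k E)\<bar> \<le> (\<Sum>p\<in>F. ?m p * (\<bar>E p\<bar> * \<bar>f (k p)\<bar>))" .
  have "ennreal (\<Sum>p\<in>F. ?m p * (\<bar>E p\<bar> * \<bar>f (k p)\<bar>)) = (\<Sum>p\<in>F. ennreal (\<bar>E p\<bar> * \<bar>f (k p)\<bar>) * emeasure \<mu> (?S p))"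
    using fin by (subst sum_ennreal[symmetric]) (auto simp: ennreal_mult emeasure_eq_ennreal_measure less_top mult.commute)
  also have "\<dots> = (\<Sum>p\<in>F. \<integral>\<^sup>+u. ennreal (\<bar>E p\<bar> * \<bar>f (k p)\<bar>) * indicator (?S p) u \<partial>\<mu>)"
    using S by (simp add: nn_integral_cmult_indicator)
  also have "\<dots> = (\<integral>\<^sup>+u. (\<Sum>p\<in>F. ennreal (\<bar>E p\<bar> * \<bar>f (k p)\<bar>) * indicator (?S p) u) \<partial>\<mu>)"
    using S by (intro nn_integral_sum[symmetric]) auto
  also have "\<dots> = (\<integral>\<^sup>+u. ennreal (\<bar>E (\<pi> u)\<bar> * \<bar>f (k (\<pi> u))\<bar>) \<partial>\<mu>)"
  proof (rule nn_integral_cong)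
    fix u
    have "(\<Sum>p\<in>F. ennreal (\<bar>E p\<bar> * \<bar>f (k p)\<bar>) * indicator (?S p) u) = (\<Sum>p\<in>F. ennreal (indicator (?S p) u * (\<bar>E p\<bar> * \<bar>f (k p)\<bar>)))"
      by (intro sum.cong) (auto simp: indicator_def)
    also have "\<dots> = ennreal (\<Sum>p\<in>F. indicator (?S p) u * (\<bar>E p\<bar> * \<bar>f (k p)\<bar>))" by (rule sum_ennreal) auto
    also have "(\<Sum>p\<in>F. indicator (?S p) u * (\<bar>E p\<bar> * \<bar>f (k p)\<bar>)) = \<bar>E (\<pi> u)\<bar> * \<bar>f (k (\<pi> u))\<bar>"
      by (rule expand[symmetric]) (auto simp: supp)
    finally show "(\<Sum>p\<in>F. ennreal (\<bar>E p\<bar> * \<bar>f (k p)\<bar>) * indicator (?S p) u) = ennreal (\<bar>E (\<pi> u)\<bar> * \<bar>f (k (\<pi> u))\<bar>)" .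
  qed
  also have "\<dots> \<le> (\<integral>\<^sup>+u. ennreal (K * near_const g) * ennreal (P g x r u * \<bar>f (k (\<pi> u))\<bar>) \<partial>\<mu>)"
  proof (rule nn_integral_mono)
    fix u
    have "dist u (\<pi> u) \<le> (r + dist x u) / 2" using u\<pi>[of u] r zero_le_dist[of x u] by argo
    then have "K * P g x r (\<pi> u) \<le> K * (near_const g * P g x r u)" using K r g by (intro mult_left_mono P_near) auto
    then have "\<bar>E (\<pi> u)\<bar> \<le> K * (near_const g * P g x r u)" using size[of "\<pi> u"] by linarith
    then have "\<bar>E (\<pi> u)\<bar> * \<bar>f (k (\<pi> u))\<bar> \<le> K * (near_const g * P g x r u) * \<bar>f (k (\<pi> u))\<bar>" by (rule mult_right_mono) simp
    then show "ennreal (\<bar>E (\<pi> u)\<bar> * \<bar>f (k (\<pi> u))\<bar>) \<le> ennreal (K * near_const g) * ennreal (P g x r u * \<bar>f (k (\<pi> u))\<bar>)"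
      using K near_const_ge1[OF g] by (simp add: mult_ac flip: ennreal_mult)
  qed
  also have "\<dots> = ennreal (K * near_const g) * (\<integral>\<^sup>+u. ennreal (P g x r u * \<bar>f (k (\<pi> u))\<bar>) \<partial>\<mu>)"
    by (intro nn_integral_cmult measurable_compose[OF borel_measurable_times[OF P_measurable sampling_map_borel[OF sp]] measurable_ennreal])
  also have "\<dots> \<le> ennreal (K * near_const g) * ennreal B" by (intro mult_left_mono B) auto
  also have "\<dots> = ennreal (K * near_const g * B)" using K near_const_ge1[OF g] B by (simp flip: ennreal_mult)
  finally have "(\<Sum>p\<in>F. ?m p * (\<bar>E p\<bar> * \<bar>f (k p)\<bar>)) \<le> K * near_const g * B"
    using K near_const_ge1[OF g] B by (simp add: ennreal_le_iff)
  then show "\<bar>f (sampled_average \<pi> k E)\<bar> \<le> K * near_const g * B" using le by linarith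
qed

section \<open>The iteration behind the main estimate\<close>

lemma geometric_sum_le: "0 \<le> \<kappa> \<Longrightarrow> \<kappa> \<le> 1 / 2 \<Longrightarrow> (\<Sum>m<M. \<kappa> ^ m) \<le> (2::real)"
proof -
  assume l: "0 \<le> \<kappa>" "\<kappa> \<le> 1 / 2"
  have "(\<Sum>m<M. \<kappa> ^ m) \<le> (\<Sum>m<M. (1 / 2) ^ m)" using l by (intro sum_mono power_mono) auto
  also have "\<dots> = ((1 / 2) ^ M - 1) / (1 / 2 - 1)" by (rule geometric_sum) simp
  also have "\<dots> \<le> 2" by simp
  finally show ?thesis .
qed

text \<open>Kernels exist only at dyadic scales, so the contraction ratio \<theta> must be a power
  of two. The bound holds for all larger exponents, which allows two demands on \<theta> to be met
  together.\<close>

lemma small_dyadic: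
  assumes "0 < \<eta>" "0 < (B::real)" obtains J :: nat where "2 \<le> J" "\<And>J'. J \<le> J' \<Longrightarrow> (2 powr - real J') powr \<eta> \<le> B"
proof -
  define J where "J = max 2 (nat \<lceil>- log 2 B / \<eta>\<rceil>)"
  show ?thesis
  proof (rule that[of J])
    show "2 \<le> J" by (simp add: J_def)
    fix J' assume "J \<le> J'"
    then have "- log 2 B / \<eta> \<le> real J'" unfolding J_def by linarith
    then have "- (real J' * \<eta>) \<le> log 2 B" using assms by (simp add: field_simps)
    then have "2 powr (- (real J' * \<eta>)) \<le> 2 powr (log 2 B)" by simp
    then show "(2 powr - real J') powr \<eta> \<le> B" using assms by (simp add: powr_powr)
  qed
qed



lemma powr_power_swap:
  fixes x :: real
  assumes "0 < x" shows "(x ^ m) powr b = (x powr b) ^ m"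
proof -
  have "(x ^ m) powr b = (x powr real m) powr b" using assms by (subst powr_realpow) auto
  also have "\<dots> = (x powr b) powr real m" unfolding powr_powr by (simp only: mult.commute)
  also have "\<dots> = (x powr b) ^ m" by (rule powr_realpow) (use assms in simp)
  finally show ?thesis .
qed

text \<open>\<open>C\<close> is fixed before the functional, the level, the centre and the scale.
  After M steps f \<psi> splits into the sampled averages, which sum geometrically to the claimed
  bound, and three errors: the part cut off from \<psi>, the parts cut off later, and the last
  remainder. The last error vanishes as M tends to infinity, the other two as the cutoff radius
  does.\<close>

lemma functional_bound:
  fixes kk :: "int \<Rightarrow> 'a \<Rightarrow> 'a \<Rightarrow> real"
  assumes gk: "\<And>j. good_kernel c e1 e2 e3 (2 powr - real_of_int j) (kk j)" and e1: "e1 \<le> 1"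
    and \<epsilon>: "\<epsilon> < e1" "\<epsilon> < e2" and q: "0 < q" "q < 1"
    and \<beta>: "n * (1 / q - 1) < \<beta>" "\<beta> < \<epsilon>" and \<gamma>: "n * (1 / q - 1) < \<gamma>" "\<gamma> < \<epsilon>"
  obtains C where "0 < C" "\<And>f l x r \<psi> K A. functional \<epsilon> \<beta> \<gamma> f \<Longrightarrow>
    (\<And>j. (\<lambda>u. \<bar>f (kk j u)\<bar>) \<in> borel_measurable \<mu>) \<Longrightarrow> 0 < r \<Longrightarrow> r \<le> 2 powr - real_of_int l \<Longrightarrow>
    \<psi> \<in> tests \<epsilon> \<Longrightarrow> test_bound x r \<beta> \<gamma> \<psi> K \<Longrightarrow> 0 \<le> A \<Longrightarrow>
    (\<And>j \<rho>. l + 1 \<le> j \<Longrightarrow> 0 < \<rho> \<Longrightarrow> (\<integral>\<^sup>+y\<in>ball x \<rho>. ennreal (\<bar>f (kk j y)\<bar> powr q) \<partial>\<mu>) \<le> ennreal A * ennreal (V x \<rho>)) \<Longrightarrow>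
    \<bar>f \<psi>\<bar> \<le> C * K * A powr (1 / q)"
proof -
  define a where "a = n * (1 / q - 1)"
  have a: "0 < a" "a < \<beta>" "a < \<gamma>" using q n_pos \<beta> \<gamma> by (auto simp: a_def field_simps)
  have pos: "0 < \<beta>" "0 < \<gamma>" "0 < \<epsilon>" "\<epsilon> \<le> 1" "\<beta> \<le> 1" using a \<beta> \<gamma> \<epsilon> e1 by auto
  have cond: "0 < \<beta>" "\<beta> < e2" "\<beta> \<le> e1" "0 < \<gamma>" "\<gamma> \<le> e2" "0 < \<epsilon>" "\<epsilon> < e2" "\<epsilon> \<le> e1" "0 \<le> \<beta>" "\<beta> \<le> 1"
    using pos \<beta> \<gamma> \<epsilon> by auto
  obtain C\<beta> where C\<beta>: "1 \<le> C\<beta>" "\<And>x r s t \<delta> K \<pi> k E. good_kernel c e1 e2 e3 t k \<Longrightarrow> sampling_map \<delta> \<pi> \<Longrightarrow>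
    regular x r s \<beta> \<gamma> K E \<Longrightarrow> t \<le> s / 2 \<Longrightarrow> s \<le> r \<Longrightarrow> 0 < \<delta> \<Longrightarrow> \<delta> \<le> t / 3 \<Longrightarrow> \<delta> / t \<le> t / s \<Longrightarrow>
    regular x r t \<beta> \<gamma> (C\<beta> * (t / s) powr \<beta> * K) (\<lambda>z. E z - sampled_average \<pi> k E z)"
    by (rule regular_remainder[of \<beta> e2 e1 \<gamma> c e3, OF cond(1-5)]) blast
  obtain C\<epsilon> where C\<epsilon>: "1 \<le> C\<epsilon>" "\<And>x r s t \<delta> K \<pi> k E. good_kernel c e1 e2 e3 t k \<Longrightarrow> sampling_map \<delta> \<pi> \<Longrightarrow>
    regular x r s \<epsilon> \<gamma> K E \<Longrightarrow> t \<le> s / 2 \<Longrightarrow> s \<le> r \<Longrightarrow> 0 < \<delta> \<Longrightarrow> \<delta> \<le> t / 3 \<Longrightarrow> \<delta> / t \<le> t / s \<Longrightarrow>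
    regular x r t \<epsilon> \<gamma> (C\<epsilon> * (t / s) powr \<epsilon> * K) (\<lambda>z. E z - sampled_average \<pi> k E z)"
    by (rule regular_remainder[of \<epsilon> e2 e1 \<gamma> c e3, OF cond(6-8,4,5)]) blast
  obtain Ct where Ct: "0 < Ct" "\<And>x r t \<delta> K R \<pi> k E. good_kernel c e1 e2 e3 t k \<Longrightarrow> sampling_map \<delta> \<pi> \<Longrightarrow> \<delta> \<le> t \<Longrightarrow> t \<le> r / 2 \<Longrightarrow> r \<le> R \<Longrightarrow>
     0 \<le> K \<Longrightarrow> (\<And>y. \<bar>E y\<bar> \<le> K * P \<gamma> x r y) \<Longrightarrow> (\<And>y. R / 2 \<le> dist x y \<Longrightarrow> E y = 0) \<Longrightarrow>
     test_bound x r \<beta> \<gamma> (\<lambda>y. (1 - cutoff x R y) * sampled_average \<pi> k E y) (Ct * (K * (r / R) powr (e2 - \<gamma>)))"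
    by (rule sampled_average_tail[of \<beta> e1 \<gamma> e2 c e3, OF cond(9,3,10,4,5)]) blast
  obtain Cs where Cs: "0 < Cs" "\<And>F \<delta>. F \<in> borel_measurable \<mu> \<Longrightarrow> (\<And>u. 0 \<le> F u) \<Longrightarrow> 0 < \<delta> \<Longrightarrow>
    \<exists>\<pi>. sampling_map \<delta> \<pi> \<and> (\<forall>x r A. \<delta> \<le> r / 2 \<longrightarrow> 0 \<le> A \<longrightarrow>
      (\<forall>\<rho>>0. (\<integral>\<^sup>+y\<in>ball x \<rho>. ennreal (F y powr q) \<partial>\<mu>) \<le> ennreal A * ennreal (V x \<rho>)) \<longrightarrow>
      (\<integral>\<^sup>+u. ennreal (P \<gamma> x r u * F (\<pi> u)) \<partial>\<mu>) \<le> ennreal (Cs * (r / \<delta>) powr a * A powr (1 / q)))"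
    unfolding a_def by (rule sampled_integral_bound[OF q \<gamma>(1)]) blast
  obtain J1 where J1: "2 \<le> J1" "\<And>J'. J1 \<le> J' \<Longrightarrow> (2 powr - real J') powr (\<beta> - a) \<le> 1 / (4 * C\<beta>)"
    using small_dyadic[of "\<beta> - a" "1 / (4 * C\<beta>)"] a C\<beta>(1) by auto
  obtain J2 where J2: "2 \<le> J2" "\<And>J'. J2 \<le> J' \<Longrightarrow> (2 powr - real J') powr (\<epsilon> - \<beta>) \<le> 1 / (4 * C\<epsilon> * 4 powr \<beta>)"
    using small_dyadic[of "\<epsilon> - \<beta>" "1 / (4 * C\<epsilon> * 4 powr \<beta>)"] \<beta> C\<epsilon>(1) by auto
  define J where "J = max J1 J2"
  define \<theta> where "\<theta> = 2 powr - real J"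
  have \<theta>0: "0 < \<theta>" by (simp add: \<theta>_def)
  have \<theta>4: "\<theta> \<le> 1 / 4"
  proof -
    have "\<theta> \<le> 2 powr - real 2" unfolding \<theta>_def using J1(1) by (intro powr_mono) (auto simp: J_def)
    also have "\<dots> = 1 / 4" by (simp add: powr_minus)
    finally show ?thesis .
  qed
  \<comment> \<open>\<open>\<kappa>\<close> and \<open>\<nu>\<close> are the factors by which one
    step multiplies the constants of order \<beta> and \<epsilon>; the 2 comes from the cutoff.
    \<open>\<kappa>\<close> must beat the loss \<theta>^(-a) per step of the sampled averages, and
    \<open>\<nu>\<close> the loss (4 / \<theta>)^\<beta> per step when the last remainder is read as
    a test function.\<close>
  define \<kappa> where "\<kappa> = 2 * C\<beta> * \<theta> powr \<beta>"
  define \<nu> where "\<nu> = 2 * C\<epsilon> * \<theta> powr \<epsilon>"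
  have \<kappa>a: "\<kappa> * \<theta> powr - a \<le> 1 / 2"
  proof -
    have "\<kappa> * \<theta> powr - a = 2 * C\<beta> * \<theta> powr (\<beta> - a)" by (simp add: \<kappa>_def powr_diff powr_minus divide_inverse)
    also have "\<dots> \<le> 2 * C\<beta> * (1 / (4 * C\<beta>))"
      using J1(2)[of J] C\<beta>(1) by (intro mult_left_mono) (auto simp: \<theta>_def J_def)
    finally show ?thesis using C\<beta>(1) by simp
  qed
  have \<kappa>0: "0 \<le> \<kappa>" using C\<beta>(1) by (simp add: \<kappa>_def)
  have \<kappa>12: "\<kappa> \<le> 1 / 2"
  proof -
    have "1 \<le> \<theta> powr - a" using \<theta>0 \<theta>4 a by (simp add: powr_minus one_le_inverse_iff powr_le1)
    then have "\<kappa> * 1 \<le> \<kappa> * \<theta> powr - a" using \<kappa>0 by (rule mult_left_mono)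
    then show ?thesis using \<kappa>a by simp
  qed
  have \<nu>0: "0 \<le> \<nu>" using C\<epsilon>(1) by (simp add: \<nu>_def)
  have \<nu>12: "\<nu> * (4 / \<theta>) powr \<beta> \<le> 1 / 2"
  proof -
    have "\<nu> * (4 / \<theta>) powr \<beta> = 2 * C\<epsilon> * 4 powr \<beta> * \<theta> powr (\<epsilon> - \<beta>)"
      by (simp add: \<nu>_def powr_diff powr_divide)
    also have "\<dots> \<le> 2 * C\<epsilon> * 4 powr \<beta> * (1 / (4 * C\<epsilon> * 4 powr \<beta>))"
      using J2(2)[of J] C\<epsilon>(1) by (intro mult_left_mono) (auto simp: \<theta>_def J_def)
    finally show ?thesis using C\<epsilon>(1) by simp
  qed
  have c\<gamma>: "1 \<le> near_const \<gamma>" using pos by (intro near_const_ge1) auto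
  \<comment> \<open>The 4 collects the 2 from the cutoff and the bound 2 for the geometric sum. The
    12 and \<theta>^(-2) come from r < 4 \<open>s 0\<close> and
    \<open>\<delta> 0 = s 0 * \<theta> powr 2 / 3\<close>.\<close>
  define C where "C = 4 * near_const \<gamma> * Cs * (12 * \<theta> powr - 2) powr a"
  have C0: "0 < C" using c\<gamma> Cs(1) \<theta>0 by (simp add: C_def)
  show ?thesis
  proof (rule that[OF C0])
    fix f l x r \<psi> K A
    assume f: "functional \<epsilon> \<beta> \<gamma> f" and fm: "\<And>j. (\<lambda>u. \<bar>f (kk j u)\<bar>) \<in> borel_measurable \<mu>"
      and r: "0 < r" "r \<le> 2 powr - real_of_int l" and \<psi>: "\<psi> \<in> tests \<epsilon>" "test_bound x r \<beta> \<gamma> \<psi> K" and A: "0 \<le> A"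
      and av: "\<And>j \<rho>. l + 1 \<le> j \<Longrightarrow> 0 < \<rho> \<Longrightarrow> (\<integral>\<^sup>+y\<in>ball x \<rho>. ennreal (\<bar>f (kk j y)\<bar> powr q) \<partial>\<mu>) \<le> ennreal A * ennreal (V x \<rho>)"
    obtain N where N: "0 \<le> N" "\<And>\<phi> C. \<phi> \<in> tests \<epsilon> \<Longrightarrow> test_bound x r \<beta> \<gamma> \<phi> C \<Longrightarrow> \<bar>f \<phi>\<bar> \<le> N * C"
      using f r(1) unfolding functional_def by meson
    obtain K2 where K2: "test_bound x r \<epsilon> \<epsilon> \<psi> K2" using testsE[OF \<psi>(1) _ r(1)] pos by (metis less_imp_le)
    have K0: "0 \<le> K" "0 \<le> K2" using test_bound_D(1)[OF \<psi>(2)] test_bound_D(1)[OF K2] .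
    \<comment> \<open>\<open>s 0 = 2 powr - j0\<close> is the largest dyadic scale not exceeding r /
      2. Since r is at most 2^(-l), all kernels used have index at least l + 1.\<close>
    define j0 where "j0 = \<lceil>- log 2 (r / 2)\<rceil>"
    define s where "s m = 2 powr - real_of_int (j0 + int (m * J))" for m :: nat
    have s_pos: "0 < s m" for m by (simp add: s_def)
    have s_eq: "s m = s 0 * \<theta> ^ m" for m
    proof -
      have "\<theta> ^ m = 2 powr (- real J * real m)"
        using \<theta>0 by (simp add: \<theta>_def powr_powr flip: powr_realpow)
      then show ?thesis by (simp add: s_def mult.commute flip: powr_add)
    qed
    have s_Suc: "s (Suc m) = \<theta> * s m" for m unfolding s_eq[of m] s_eq[of "Suc m"] by simp
    have j0: "s 0 \<le> r / 2" "r < 4 * s 0" "l + 1 \<le> j0"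
    proof -
      have "- log 2 (r / 2) \<le> j0" "j0 < - log 2 (r / 2) + 1" unfolding j0_def by linarith+
      then have "- real_of_int j0 \<le> log 2 (r / 2)" "log 2 (r / 2) < 1 - real_of_int j0" by linarith+
      moreover have "2 powr log 2 (r / 2) = r / 2" using r by simp
      ultimately have 1: "2 powr - real_of_int j0 \<le> r / 2" "r / 2 < 2 powr (1 - real_of_int j0)"
        by (metis powr_le_cancel_iff one_less_numeral_iff semiring_norm(76), metis powr_less_cancel_iff one_less_numeral_iff semiring_norm(76))
      then show "s 0 \<le> r / 2" "r < 4 * s 0" by (simp_all add: s_def powr_diff powr_minus field_simps)
      have "2 powr - real_of_int j0 \<le> 2 powr - real_of_int l / 2" using 1 r by linarith
      also have "\<dots> = 2 powr - real_of_int (l + 1)" by (simp add: powr_diff powr_minus field_simps)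
      finally have "2 powr - real_of_int j0 \<le> 2 powr - real_of_int (l + 1)" .
      then show "l + 1 \<le> j0" by simp
    qed
    have s_r: "s m \<le> r / 2" for m
    proof -
      have "s m \<le> s 0 * 1" unfolding s_eq[of m] using \<theta>0 \<theta>4 s_pos[of 0] by (intro mult_left_mono power_le_one) auto
      then show ?thesis using j0 by simp
    qed
    define km where "km m = kk (j0 + int (Suc m * J))" for m
    have gkm: "good_kernel c e1 e2 e3 (s (Suc m)) (km m)" for m
      unfolding km_def s_def by (rule gk)
    \<comment> \<open>The mesh is at most a third of the kernel scale, as the mixed difference
      requires, and finer than that scale by the factor \<theta> / 3.\<close>
    define \<delta> where "\<delta> m = \<theta> * s (Suc m) / 3" for m
    have \<delta>: "0 < \<delta> m" "\<delta> m \<le> s (Suc m) / 3" "\<delta> m / s (Suc m) \<le> s (Suc m) / s m" "\<delta> m \<le> r / 2" "\<delta> m \<le> s (Suc m)" for m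
    proof -
      show "0 < \<delta> m" using \<theta>0 s_pos by (simp add: \<delta>_def)
      have "\<theta> * s (Suc m) \<le> 1 * s (Suc m)" using \<theta>4 s_pos[of "Suc m"] by (intro mult_right_mono) auto
      then show d3: "\<delta> m \<le> s (Suc m) / 3" by (simp add: \<delta>_def)
      then show "\<delta> m \<le> s (Suc m)" using s_pos[of "Suc m"] by simp
      then show "\<delta> m \<le> r / 2" using s_r[of "Suc m"] by simp
      have "\<delta> m / s (Suc m) = \<theta> / 3" using s_pos[of "Suc m"] by (simp add: \<delta>_def)
      moreover have "s (Suc m) / s m = \<theta>" using s_pos[of m] by (simp add: s_Suc)
      ultimately show "\<delta> m / s (Suc m) \<le> s (Suc m) / s m" using \<theta>0 by simp
    qed
    have "\<exists>\<pi>. sampling_map (\<delta> m) \<pi> \<and> (\<integral>\<^sup>+u. ennreal (P \<gamma> x r u * \<bar>f (km m (\<pi> u))\<bar>) \<partial>\<mu>) \<le> ennreal (Cs * (r / \<delta> m) powr a * A powr (1 / q))" for m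
    proof -
      have "(\<lambda>u. \<bar>f (km m u)\<bar>) \<in> borel_measurable \<mu>" unfolding km_def by (rule fm)
      from Cs(2)[OF this _ \<delta>(1)[of m]] obtain \<pi> where \<pi>: "sampling_map (\<delta> m) \<pi>"
        "\<And>x r A. \<delta> m \<le> r / 2 \<Longrightarrow> 0 \<le> A \<Longrightarrow>
        (\<forall>\<rho>>0. (\<integral>\<^sup>+y\<in>ball x \<rho>. ennreal (\<bar>f (km m y)\<bar> powr q) \<partial>\<mu>) \<le> ennreal A * ennreal (V x \<rho>)) \<Longrightarrow>
        (\<integral>\<^sup>+u. ennreal (P \<gamma> x r u * \<bar>f (km m (\<pi> u))\<bar>) \<partial>\<mu>) \<le> ennreal (Cs * (r / \<delta> m) powr a * A powr (1 / q))" by auto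
      have "l + 1 \<le> j0 + int (Suc m * J)"
        by (rule order_trans[OF j0(3)]) (simp only: le_add_same_cancel1 of_nat_0_le_iff)
      then show ?thesis using \<pi>(1) \<pi>(2)[OF \<delta>(4) A] av unfolding km_def by blast
    qed
    then obtain \<pi> where \<pi>: "\<And>m. sampling_map (\<delta> m) (\<pi> m)"
      "\<And>m. (\<integral>\<^sup>+u. ennreal (P \<gamma> x r u * \<bar>f (km m (\<pi> m u))\<bar>) \<partial>\<mu>) \<le> ennreal (Cs * (r / \<delta> m) powr a * A powr (1 / q))"
      by metis
    let ?X = "C * K * A powr (1 / q)"
    define D where "D = 8 powr \<beta> * (near_const \<gamma> + 1) + 6 * near_const \<gamma>"
    have D0: "0 \<le> D" using c\<gamma> by (simp add: D_def)
    have main: "\<bar>f \<psi>\<bar> \<le> ?X + N * (D * (K2 * (r / R0) powr (\<epsilon> - \<gamma>))) + 4 * N * Ct * K * (r / R0) powr (e2 - \<gamma>)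
        + N * (2 * K2 * (near_const \<gamma> + 1) * (8 * R0 / s 0) powr \<beta>) * (1 / 2) ^ M"
      if R0: "r \<le> R0" for R0 :: real and M :: nat
    proof -
      \<comment> \<open>The factor 4 makes 2 \<open>R m\<close>, beyond which \<open>E' m\<close>
        vanishes, equal to half of \<open>R (Suc m)\<close>. The next cutoff therefore acts only on
        the tail of the sampled average.\<close>
      define R where "R m = 4 ^ m * R0" for m :: nat
      have R: "r \<le> R m" "R0 \<le> R m" "0 < R m" for m
      proof -
        have "1 * R0 \<le> R m" unfolding R_def using R0 r by (intro mult_right_mono) auto
        then show "r \<le> R m" "R0 \<le> R m" "0 < R m" using R0 r by auto
      qed
      let ?cut = "\<lambda>m e y. cutoff x (R m) y * e y"
      \<comment> \<open>\<open>E m\<close> is the remainder after m steps and \<open>E' m\<close>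
        its truncation; only the truncation is sampled, so that the sampled average is a finite sum
        of kernels.\<close>
      define E where "E = rec_nat \<psi> (\<lambda>m e. \<lambda>z. ?cut m e z - sampled_average (\<pi> m) (km m) (?cut m e) z)"
      have E0: "E 0 = \<psi>" by (simp add: E_def)
      define E' where "E' m = ?cut m (E m)" for m
      have ES: "E (Suc m) = (\<lambda>z. E' m z - sampled_average (\<pi> m) (km m) (E' m) z)" for m by (simp add: E_def E'_def)
      have sR: "s m \<le> R m" for m using s_r[of m] R(1)[of m] r by linarith
      have step_le: "s (Suc m) \<le> s m / 2" for m
        unfolding s_Suc using mult_right_mono[OF \<theta>4, of "s m"] s_pos[of m] by simp
      have sr: "s m \<le> r" for m using s_r[of m] r by linarith
      have ratio: "s (Suc m) / s m = \<theta>" for m using s_pos[of m] by (simp add: s_Suc)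
      have reg\<beta>: "regular x r (s m) \<beta> \<gamma> (K * \<kappa> ^ m) (E m)" for m
      proof (induction m)
        case 0
        show ?case using test_bound_regular[OF \<psi>(2) s_pos s_r] pos by (simp add: E0)
      next
        case (Suc m)
        have "regular x r (s m) \<beta> \<gamma> (2 * (K * \<kappa> ^ m)) (E' m)"
          unfolding E'_def by (rule regular_cutoff[OF Suc s_pos sR pos(5)])
        from C\<beta>(2)[OF gkm \<pi>(1) this step_le sr \<delta>(1-3)]
        show ?case by (simp add: ES ratio \<kappa>_def mult_ac)
      qed
      have reg\<epsilon>: "regular x r (s m) \<epsilon> \<gamma> (K2 * \<nu> ^ m) (E m)" for m
      proof (induction m)
        case 0
        have "test_bound x r \<epsilon> \<gamma> \<psi> K2" by (rule test_bound_exponents[OF K2 r(1)]) (use \<gamma> in auto)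
        then show ?case using test_bound_regular[OF _ s_pos s_r] pos by (simp add: E0)
      next
        case (Suc m)
        have "regular x r (s m) \<epsilon> \<gamma> (2 * (K2 * \<nu> ^ m)) (E' m)"
          unfolding E'_def by (rule regular_cutoff[OF Suc s_pos sR pos(4)])
        from C\<epsilon>(2)[OF gkm \<pi>(1) this step_le sr \<delta>(1-3)]
        show ?case by (simp add: ES ratio \<nu>_def mult_ac)
      qed
      have reg\<beta>': "regular x r (s m) \<beta> \<gamma> (2 * (K * \<kappa> ^ m)) (E' m)" for m
        unfolding E'_def by (rule regular_cutoff[OF reg\<beta> s_pos sR pos(5)])
      have reg\<epsilon>': "regular x r (s m) \<epsilon> \<gamma> (2 * (K2 * \<nu> ^ m)) (E' m)" for m
        unfolding E'_def by (rule regular_cutoff[OF reg\<epsilon> s_pos sR pos(4)])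
      have supp: "E' m y = 0" if "2 * R m \<le> dist x y" for m y
        using cutoff_out[OF R(3) that] by (simp add: E'_def)
      have size: "\<bar>E' m y\<bar> \<le> 2 * (K * \<kappa> ^ m) * P \<gamma> x r y" for m y using reg\<beta>'[of m] by (simp add: regular_def)
      have E't: "E' m \<in> tests \<epsilon>" for m
        by (rule testsI[OF r(1)], rule regular_bounded_support_test_bound[OF reg\<epsilon>' s_pos sr _ supp])
           (use R[of m] pos \<gamma> in auto)
      note fAV = functional_sampled_average[OF f gkm _ _ _ \<pi>(1) supp _ r(1) \<delta>(4) _ size _ \<pi>(2)]
      have AVt: "sampled_average (\<pi> m) (km m) (E' m) \<in> tests \<epsilon>" for m
        by (rule fAV(1)) (use pos \<epsilon> K0 \<kappa>0 Cs(1) in auto)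
      have AVb: "\<bar>f (sampled_average (\<pi> m) (km m) (E' m))\<bar> \<le> 2 * (K * \<kappa> ^ m) * near_const \<gamma> * (Cs * (r / \<delta> m) powr a * A powr (1 / q))" for m
        by (rule fAV(2)) (use pos \<epsilon> K0 \<kappa>0 Cs(1) in auto)
      have Et: "E m \<in> tests \<epsilon>" for m
      proof (cases m)
        case 0 then show ?thesis using \<psi> by (simp add: E0)
      next
        case (Suc i)
        show ?thesis unfolding Suc ES by (rule tests_diff[OF E't AVt]) (use pos in simp)
      qed
      \<comment> \<open>The part removed by the m-th truncation.\<close>
      define T where "T m = (\<lambda>y. E m y - E' m y)" for m
      have Tt: "T m \<in> tests \<epsilon>" for m unfolding T_def by (rule tests_diff[OF Et E't]) (use pos in simp)
      have fE: "f (E m) = f (T m) + f (E' m)" for m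
        unfolding T_def using functional_diff[OF f Et E't] by simp
      have fE': "f (E' m) = f (sampled_average (\<pi> m) (km m) (E' m)) + f (E (Suc m))" for m
        unfolding ES using functional_diff[OF f E't AVt] by simp
      have tele: "f \<psi> = (\<Sum>m<M. f (sampled_average (\<pi> m) (km m) (E' m))) + f (T 0) + (\<Sum>m<M. f (T (Suc m))) + f (E' M)"
      proof (induction M)
        case 0 then show ?case using fE[of 0] by (simp add: E0)
      next
        case (Suc M)
        then show ?case using fE'[of M] fE[of "Suc M"] by simp
      qed
      have b1: "\<bar>(\<Sum>m<M. f (sampled_average (\<pi> m) (km m) (E' m)))\<bar> \<le> ?X"
      proof -
        let ?Y = "2 * K * near_const \<gamma> * Cs * (12 * \<theta> powr - 2) powr a * A powr (1 / q)"
        have Y0: "0 \<le> ?Y" using K0 c\<gamma> Cs(1) by simp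
        have "\<bar>(\<Sum>m<M. f (sampled_average (\<pi> m) (km m) (E' m)))\<bar> \<le> (\<Sum>m<M. \<bar>f (sampled_average (\<pi> m) (km m) (E' m))\<bar>)" by (rule sum_abs)
        also have "\<dots> \<le> (\<Sum>m<M. ?Y * (\<kappa> * \<theta> powr - a) ^ m)"
        proof (rule sum_mono)
          fix m
          have "r / \<delta> m \<le> (12 * \<theta> powr - 2) * \<theta> powr - real m"
          proof -
            have dm: "\<delta> m = s 0 * \<theta> powr (2 + real m) / 3"
              unfolding \<delta>_def s_eq[of "Suc m"] using \<theta>0 by (simp add: powr_add powr_realpow power2_eq_square)
            have "r / \<delta> m \<le> 4 * s 0 / \<delta> m" using j0 \<delta>(1)[of m] by (intro divide_right_mono) auto
            also have "\<dots> = 12 * (1 / \<theta> powr (2 + real m))"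
            proof -
              have "4 * S / (S * Q / 3) = 12 * (1 / Q)" if "S \<noteq> 0" for S Q :: real using that by simp
              then show ?thesis unfolding dm using s_pos[of 0] by (metis less_irrefl)
            qed
            also have "\<dots> = (12 * \<theta> powr - 2) * \<theta> powr - real m"
              using \<theta>0 by (simp add: powr_add powr_minus_divide)
            finally show ?thesis .
          qed
          then have "(r / \<delta> m) powr a \<le> ((12 * \<theta> powr - 2) * \<theta> powr - real m) powr a"
            using a r \<delta>(1)[of m] by (intro powr_mono2) auto
          also have "\<dots> = (12 * \<theta> powr - 2) powr a * (\<theta> powr - a) ^ m"
          proof -
            have "\<theta> powr - real m = (1 / \<theta>) ^ m"
              using \<theta>0 by (simp add: powr_minus powr_realpow power_one_over inverse_eq_divide)
            moreover have "(1 / \<theta>) powr a = \<theta> powr - a"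
              using \<theta>0 by (simp add: powr_divide powr_minus inverse_eq_divide)
            ultimately show ?thesis
              unfolding powr_mult[of "12 * \<theta> powr - 2"] using powr_power_swap[of "1 / \<theta>" m a] \<theta>0 by simp
          qed
          finally have "2 * (K * \<kappa> ^ m) * near_const \<gamma> * (Cs * (r / \<delta> m) powr a * A powr (1 / q))
            \<le> 2 * (K * \<kappa> ^ m) * near_const \<gamma> * (Cs * ((12 * \<theta> powr - 2) powr a * (\<theta> powr - a) ^ m) * A powr (1 / q))"
            using K0 \<kappa>0 c\<gamma> Cs(1) by (intro mult_left_mono mult_right_mono) auto
          also have "\<dots> = ?Y * (\<kappa> * \<theta> powr - a) ^ m" by (simp add: power_mult_distrib mult_ac)
          finally show "\<bar>f (sampled_average (\<pi> m) (km m) (E' m))\<bar> \<le> ?Y * (\<kappa> * \<theta> powr - a) ^ m" using AVb[of m] by linarith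
        qed
        also have "\<dots> = ?Y * (\<Sum>m<M. (\<kappa> * \<theta> powr - a) ^ m)" by (rule sum_distrib_left[symmetric])
        also have "\<dots> \<le> ?Y * 2" using \<kappa>a \<kappa>0 by (intro mult_left_mono geometric_sum_le Y0) auto
        also have "\<dots> = ?X" by (simp add: C_def)
        finally show ?thesis .
      qed
      have b2: "\<bar>f (T 0)\<bar> \<le> N * (D * (K2 * (r / R0) powr (\<epsilon> - \<gamma>)))"
      proof (rule N(2)[OF Tt])
        have "test_bound x r \<beta> \<epsilon> \<psi> K2" by (rule test_bound_exponents[OF K2 r(1)]) (use \<beta> in auto)
        note p = test_bound_D[OF this]
        have "test_bound x r \<beta> \<gamma> (\<lambda>y. (1 - cutoff x (R 0) y) * \<psi> y) ((8 powr \<beta> * (near_const \<gamma> + 1) + 6 * near_const \<gamma>) * (K2 * (r / R 0) powr (\<epsilon> - \<gamma>)))"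
        proof (rule test_bound_tail[OF r(1) R(1)])
          fix y z assume "dist y z \<le> (r + dist x y) / 8"
          then have "dist y z \<le> (r + dist x y) / 2" using r zero_le_dist[of x y] by argo
          then show "\<bar>\<psi> z - \<psi> y\<bar> \<le> K2 * (dist y z / (r + dist x y)) powr \<beta> * P \<epsilon> x r y" by (rule p(3))
        qed (use pos p \<gamma> in auto)
        then show "test_bound x r \<beta> \<gamma> (T 0) (D * (K2 * (r / R0) powr (\<epsilon> - \<gamma>)))"
          by (simp add: T_def E'_def E0 D_def R_def algebra_simps)
      qed
      have b3: "\<bar>(\<Sum>m<M. f (T (Suc m)))\<bar> \<le> 4 * N * Ct * K * (r / R0) powr (e2 - \<gamma>)"
      proof -
        let ?Y = "2 * N * Ct * K * (r / R0) powr (e2 - \<gamma>)"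
        have Y0: "0 \<le> ?Y" using N K0 Ct(1) by simp
        have "\<bar>(\<Sum>m<M. f (T (Suc m)))\<bar> \<le> (\<Sum>m<M. \<bar>f (T (Suc m))\<bar>)" by (rule sum_abs)
        also have "\<dots> \<le> (\<Sum>m<M. ?Y * \<kappa> ^ m)"
        proof (rule sum_mono)
          fix m
          let ?Z = "Ct * (2 * (K * \<kappa> ^ m) * (r / R (Suc m)) powr (e2 - \<gamma>))"
          have "test_bound x r \<beta> \<gamma> (\<lambda>y. (1 - cutoff x (R (Suc m)) y) * sampled_average (\<pi> m) (km m) (E' m) y) ?Z"
          proof (rule Ct(2)[OF gkm \<pi>(1) \<delta>(5) s_r R(1) _ size])
            fix y assume "R (Suc m) / 2 \<le> dist x y"
            then show "E' m y = 0" by (intro supp) (simp add: R_def mult_ac)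
          qed (use K0 \<kappa>0 in auto)
          then have G: "test_bound x r \<beta> \<gamma> (\<lambda>y. - 1 * ((1 - cutoff x (R (Suc m)) y) * sampled_average (\<pi> m) (km m) (E' m) y) + 0) (\<bar>-1\<bar> * ?Z + 0)"
            by (rule test_bound_lincomb) (simp add: test_bound_def)
          have "T (Suc m) y = - 1 * ((1 - cutoff x (R (Suc m)) y) * sampled_average (\<pi> m) (km m) (E' m) y) + 0" for y
          proof -
            have "(1 - cutoff x (R (Suc m)) y) * E' m y = 0"
            proof (cases "dist x y \<le> R (Suc m)")
              case True then show ?thesis using cutoff_in[OF R(3) True] by simp
            next
              case False
              then have "2 * R m \<le> dist x y" using R(3)[of m] by (simp add: R_def)
              then show ?thesis using supp by simp
            qed
            \<comment> \<open>Since \<open>E' m\<close> vanishes where the new cutoff differs from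
              one, only minus the tail of the sampled average is cut off, and this tail is known to
              be small.\<close>
            moreover have "T (Suc m) y = (1 - cutoff x (R (Suc m)) y) * E (Suc m) y"
              unfolding T_def E'_def[of "Suc m"] by (simp add: left_diff_distrib)
            then have "T (Suc m) y = (1 - cutoff x (R (Suc m)) y) * E' m y - (1 - cutoff x (R (Suc m)) y) * sampled_average (\<pi> m) (km m) (E' m) y"
              unfolding ES by (simp only: right_diff_distrib)
            ultimately show ?thesis by linarith
          qed
          then have "T (Suc m) = (\<lambda>y. - 1 * ((1 - cutoff x (R (Suc m)) y) * sampled_average (\<pi> m) (km m) (E' m) y) + 0)" by (rule ext)
          then have "\<bar>f (T (Suc m))\<bar> \<le> N * ?Z" using N(2)[OF Tt[of "Suc m"]] G by simp
          also have "\<dots> \<le> N * (Ct * (2 * (K * \<kappa> ^ m) * (r / R0) powr (e2 - \<gamma>)))"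
            using N(1) Ct(1) K0 \<kappa>0 R[of "Suc m"] R0 r \<epsilon> \<gamma>
            by (intro mult_left_mono powr_mono2 divide_left_mono) auto
          also have "\<dots> = ?Y * \<kappa> ^ m" by (simp add: mult_ac)
          finally show "\<bar>f (T (Suc m))\<bar> \<le> ?Y * \<kappa> ^ m" .
        qed
        also have "\<dots> = ?Y * (\<Sum>m<M. \<kappa> ^ m)" by (rule sum_distrib_left[symmetric])
        also have "\<dots> \<le> ?Y * 2" by (intro mult_left_mono geometric_sum_le Y0 \<kappa>0 \<kappa>12)
        finally show ?thesis by (simp add: mult_ac)
      qed
      \<comment> \<open>The constant of order \<epsilon> decays faster than the ratio
        (\<open>R M\<close> / \<open>s M\<close>)^\<beta> of support radius to regularity scale
        grows.\<close>
      have b4: "\<bar>f (E' M)\<bar> \<le> N * (2 * K2 * (near_const \<gamma> + 1) * (8 * R0 / s 0) powr \<beta>) * (1 / 2) ^ M"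
      proof -
        have "test_bound x r \<beta> \<gamma> (E' M) (2 * (K2 * \<nu> ^ M) * (near_const \<gamma> + 1) * (4 * (2 * R M) / s M) powr \<beta> * (4 * (2 * R M) / r) powr (\<gamma> - \<gamma>))"
          by (rule regular_bounded_support_test_bound[OF reg\<epsilon>' s_pos sr _ supp]) (use R[of M] pos \<beta> in auto)
        from N(2)[OF E't this] have "\<bar>f (E' M)\<bar> \<le> N * (2 * (K2 * \<nu> ^ M) * (near_const \<gamma> + 1) * (4 * (2 * R M) / s M) powr \<beta>)"
          using R[of M] r by simp
        also have "(4 * (2 * R M) / s M) powr \<beta> = (8 * R0 / s 0) powr \<beta> * ((4 / \<theta>) powr \<beta>) ^ M"
        proof -
          have "4 * (2 * R M) / s M = (8 * R0 / s 0) * (4 / \<theta>) ^ M"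
            unfolding R_def s_eq[of M] by (simp add: power_divide)
          moreover have "((4 / \<theta>) ^ M) powr \<beta> = ((4 / \<theta>) powr \<beta>) ^ M"
            using \<theta>0 by (intro powr_power_swap) simp
          ultimately show ?thesis by (simp only: powr_mult)
        qed
        also have "N * (2 * (K2 * \<nu> ^ M) * (near_const \<gamma> + 1) * ((8 * R0 / s 0) powr \<beta> * ((4 / \<theta>) powr \<beta>) ^ M))
          = N * (2 * K2 * (near_const \<gamma> + 1) * (8 * R0 / s 0) powr \<beta>) * (\<nu> * (4 / \<theta>) powr \<beta>) ^ M"
          by (simp add: power_mult_distrib mult_ac)
        also have "\<dots> \<le> N * (2 * K2 * (near_const \<gamma> + 1) * (8 * R0 / s 0) powr \<beta>) * (1 / 2) ^ M"
          using \<nu>12 \<nu>0 N(1) K0 c\<gamma> by (intro mult_left_mono power_mono) auto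
        finally show ?thesis .
      qed
      show ?thesis unfolding tele using b1 b2 b3 b4 by linarith
    qed
    \<comment> \<open>M tends to infinity first, with the initial radius fixed: the coefficient of
      the last remainder grows with \<open>R0\<close>.\<close>
    have lim1: "\<bar>f \<psi>\<bar> \<le> ?X + N * (D * (K2 * (r / R0) powr (\<epsilon> - \<gamma>))) + 4 * N * Ct * K * (r / R0) powr (e2 - \<gamma>)"
      if R0: "r \<le> R0" for R0 :: real
    proof (rule LIMSEQ_le_const)
      let ?u = "?X + N * (D * (K2 * (r / R0) powr (\<epsilon> - \<gamma>))) + 4 * N * Ct * K * (r / R0) powr (e2 - \<gamma>)"
      let ?v = "N * (2 * K2 * (near_const \<gamma> + 1) * (8 * R0 / s 0) powr \<beta>)"
      have "(\<lambda>M. ?u + ?v * (1 / 2) ^ M) \<longlonglongrightarrow> ?u + ?v * 0"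
        by (intro tendsto_intros LIMSEQ_realpow_zero) auto
      then show "(\<lambda>M. ?u + ?v * (1 / 2) ^ M) \<longlonglongrightarrow> ?u" by simp
      show "\<exists>N. \<forall>M\<ge>N. \<bar>f \<psi>\<bar> \<le> ?u + ?v * (1 / 2) ^ M" using main[OF R0] by blast
    qed
    show "\<bar>f \<psi>\<bar> \<le> ?X"
    proof (rule LIMSEQ_le_const)
      let ?w = "\<lambda>i::nat. ?X + N * (D * (K2 * (1 / real (Suc i)) powr (\<epsilon> - \<gamma>))) + 4 * N * Ct * K * (1 / real (Suc i)) powr (e2 - \<gamma>)"
      have z: "(\<lambda>i. (1 / real (Suc i)) powr \<eta>) \<longlonglongrightarrow> 0" if "0 < \<eta>" for \<eta>
        using that by (intro tendsto_zero_powrI[where b = \<eta>] lim_1_over_n[THEN LIMSEQ_Suc]) (auto intro!: always_eventually)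
      have "?w \<longlonglongrightarrow> ?X + N * (D * (K2 * 0)) + 4 * N * Ct * K * 0"
        by (intro tendsto_intros z) (use \<gamma> \<epsilon> in auto)
      then show "?w \<longlonglongrightarrow> ?X" by simp
      have "\<bar>f \<psi>\<bar> \<le> ?w i" for i
      proof -
        have "r / (r * real (Suc i)) = 1 / real (Suc i)" using r by simp
        moreover have "r * 1 \<le> r * real (Suc i)" using r by (intro mult_left_mono) auto
        ultimately show ?thesis using lim1[of "r * real (Suc i)"] by simp
      qed
      then show "\<exists>N. \<forall>i\<ge>N. \<bar>f \<psi>\<bar> \<le> ?w i" by blast
    qed
  qed
qed


text \<open>Interpolation: a function that is small in size and merely bounded with regularity b0 is
  small with regularity \<beta> < b0. Increments up to a threshold \<open>h0\<close> use the surplus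
  b0 - \<beta>, larger ones the smallness in size.\<close>

lemma test_bound_small:
  assumes \<beta>: "0 \<le> \<beta>" "\<beta> < b0" and g: "0 \<le> g" and N: "0 \<le> N" and \<eta>: "0 < \<eta>"
  obtains \<eta>' where "0 < \<eta>'" "\<And>x r u. 0 < r \<Longrightarrow> (\<And>y. \<bar>u y\<bar> \<le> \<eta>' * P g x r y) \<Longrightarrow>
    (\<And>y z. dist y z \<le> (r + dist x y) / 4 \<Longrightarrow> \<bar>u z - u y\<bar> \<le> N * (dist y z / (r + dist x y)) powr b0 * P g x r y) \<Longrightarrow>
    test_bound x r \<beta> g u \<eta>"
proof -
  \<comment> \<open>Solves N h^(b0 - \<beta>) = \<eta> up to replacing N by N + 1, which avoids a
    zero denominator; the minimum with 1/4 keeps the regularity hypothesis applicable.\<close>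
  define h0 where "h0 = min (1 / 4) ((\<eta> / (N + 1)) powr (1 / (b0 - \<beta>)))"
  have h0: "0 < h0" "h0 \<le> 1 / 4" using \<eta> N by (auto simp: h0_def)
  have h0N: "N * h0 powr (b0 - \<beta>) \<le> \<eta>"
  proof -
    have "h0 powr (b0 - \<beta>) \<le> ((\<eta> / (N + 1)) powr (1 / (b0 - \<beta>))) powr (b0 - \<beta>)"
      using \<beta> h0 by (intro powr_mono2) (auto simp: h0_def)
    also have "\<dots> = \<eta> / (N + 1)" using \<beta> \<eta> N by (simp add: powr_powr)
    finally have "N * h0 powr (b0 - \<beta>) \<le> N * (\<eta> / (N + 1))" using N by (rule mult_left_mono)
    also have "\<dots> \<le> \<eta>" using N \<eta> by (simp add: field_simps)
    finally show ?thesis .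
  qed
  have cg: "1 \<le> near_const g" using g by (rule near_const_ge1)
  define \<eta>' where "\<eta>' = \<eta> * h0 powr \<beta> / (near_const g + 1)"
  have \<eta>'0: "0 < \<eta>'" using \<eta> h0 cg by (simp add: \<eta>'_def)
  have \<eta>'\<eta>: "\<eta>' \<le> \<eta>"
  proof -
    have "h0 powr \<beta> \<le> 1" using h0 \<beta> by (intro powr_le1) auto
    then have "\<eta> * h0 powr \<beta> \<le> \<eta> * (near_const g + 1)" using \<eta> cg by (intro mult_left_mono) auto
    then show ?thesis using cg by (simp add: \<eta>'_def field_simps)
  qed
  show ?thesis
  proof (rule that[OF \<eta>'0])
    fix x :: 'a and r :: real and u :: "'a \<Rightarrow> real"
    assume r: "0 < r" and size: "\<And>y. \<bar>u y\<bar> \<le> \<eta>' * P g x r y"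
      and hol: "\<And>y z. dist y z \<le> (r + dist x y) / 4 \<Longrightarrow> \<bar>u z - u y\<bar> \<le> N * (dist y z / (r + dist x y)) powr b0 * P g x r y"
    show "test_bound x r \<beta> g u \<eta>"
      unfolding test_bound_def
    proof (intro conjI allI impI)
      show "0 \<le> \<eta>" using \<eta> by simp
      show "\<bar>u y\<bar> \<le> \<eta> * P g x r y" for y
        by (rule order_trans[OF size mult_right_mono[OF \<eta>'\<eta>]]) simp
      fix y z assume d: "dist y z \<le> (r + dist x y) / 2"
      define h where "h = dist y z / (r + dist x y)"
      have h: "0 \<le> h" using r by (simp add: h_def)
      show "\<bar>u z - u y\<bar> \<le> \<eta> * (dist y z / (r + dist x y)) powr \<beta> * P g x r y"
      proof (cases "h \<le> h0")
        case True
        have "dist y z \<le> (r + dist x y) / 4"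
        proof -
          have "h \<le> 1 / 4" using True h0 by simp
          then show ?thesis using r by (simp add: h_def field_simps)
        qed
        then have "\<bar>u z - u y\<bar> \<le> N * h powr b0 * P g x r y" unfolding h_def by (rule hol)
        also have "N * h powr b0 \<le> \<eta> * h powr \<beta>"
        proof -
          have "h powr b0 = h powr (b0 - \<beta>) * h powr \<beta>" by (simp flip: powr_add)
          also have "\<dots> \<le> h0 powr (b0 - \<beta>) * h powr \<beta>"
            using True h \<beta> by (intro mult_right_mono powr_mono2) auto
          finally have "N * h powr b0 \<le> (N * h0 powr (b0 - \<beta>)) * h powr \<beta>"
            using N by (simp add: mult_left_mono mult.assoc)
          also have "\<dots> \<le> \<eta> * h powr \<beta>" using h0N by (rule mult_right_mono) simp
          finally show ?thesis .
        qed
        finally show ?thesis by (simp add: h_def mult_right_mono)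
      next
        case False
        have "\<bar>u z - u y\<bar> \<le> \<eta>' * P g x r z + \<eta>' * P g x r y" using size[of z] size[of y] by linarith
        also have "\<dots> \<le> \<eta>' * (near_const g * P g x r y) + \<eta>' * P g x r y"
          using r g d \<eta>'0 by (intro add_right_mono mult_left_mono P_near) auto
        also have "\<dots> = ((near_const g + 1) * \<eta>') * P g x r y" by (simp add: algebra_simps)
        also have "(near_const g + 1) * \<eta>' = \<eta> * h0 powr \<beta>" using cg by (simp add: \<eta>'_def)
        also have "\<eta> * h0 powr \<beta> * P g x r y \<le> \<eta> * h powr \<beta> * P g x r y"
          using False h0 \<beta> \<eta> by (intro mult_right_mono mult_left_mono powr_mono2) auto
        finally show ?thesis by (simp add: h_def)
      qed
    qed
  qed
qed

text \<open>For nearby centres the difference of two kernels is small in size by regularity in the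
  first variable and bounded with regularity e1 by that in the second, hence small in the test norm
  of order \<beta> < e1. This yields measurability of S_k f for an arbitrary functional.\<close>

lemma functional_kernel_continuous:
  assumes f: "functional \<epsilon> \<beta> \<gamma> f" and gk: "good_kernel c e1 e2 e3 t k"
    and \<epsilon>: "0 \<le> \<epsilon>" "\<epsilon> \<le> e1" "\<epsilon> \<le> e2" and \<beta>: "0 \<le> \<beta>" "\<beta> < \<epsilon>" and \<gamma>: "0 \<le> \<gamma>" "\<gamma> < \<epsilon>"
  shows "continuous_on UNIV (\<lambda>v. f (k v))"
  unfolding continuous_on_eq_continuous_at[OF open_UNIV]
proof
  fix v
  note gp = gk_pos[OF gk]
  have kt: "k p \<in> tests \<epsilon>" for p by (rule good_kernel_tests[OF gk \<epsilon>(2,3)])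
  obtain N where N: "0 \<le> N" "\<And>\<phi> C. \<phi> \<in> tests \<epsilon> \<Longrightarrow> test_bound v t \<beta> \<gamma> \<phi> C \<Longrightarrow> \<bar>f \<phi>\<bar> \<le> N * C"
    using f gp(1) unfolding functional_def by meson
  have c2: "1 \<le> near_const e2" using gp by (intro near_const_ge1) auto
  define N' where "N' = c * (1 + 2 powr e1 * near_const e2)"
  have N'0: "0 \<le> N'" using gp c2 by (simp add: N'_def)
  show "isCont (\<lambda>v. f (k v)) v"
    unfolding continuous_at_eps_delta
  proof (intro allI impI)
    fix e :: real assume e: "0 < e"
    define \<eta> where "\<eta> = e / (2 * (N + 1))"
    have \<eta>: "0 < \<eta>" "N * \<eta> < e" 
    proof -
      show "0 < \<eta>" using e N(1) by (simp add: \<eta>_def)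
      have "N + 1 \<noteq> 0" using N(1) by simp
      then have "(N + 1) * \<eta> = e / 2" by (simp add: \<eta>_def divide_simps)
      then show "N * \<eta> < e" using e \<open>0 < \<eta>\<close> by (simp add: distrib_right)
    qed
    obtain \<eta>' where \<eta>': "0 < \<eta>'" "\<And>x r u. 0 < r \<Longrightarrow> (\<And>y. \<bar>u y\<bar> \<le> \<eta>' * P \<gamma> x r y) \<Longrightarrow>
      (\<And>y z. dist y z \<le> (r + dist x y) / 4 \<Longrightarrow> \<bar>u z - u y\<bar> \<le> N' * (dist y z / (r + dist x y)) powr e1 * P \<gamma> x r y) \<Longrightarrow>
      test_bound x r \<beta> \<gamma> u \<eta>"
      by (rule test_bound_small[of \<beta> e1 \<gamma> N' \<eta>]) (use \<beta> \<gamma> \<epsilon> N'0 \<eta> in auto)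
    define d where "d = min (t / 2) (t * (\<eta>' / c) powr (1 / e1))"
    have d: "0 < d" "d \<le> t / 2" using gp \<eta>' by (auto simp: d_def)
    have dc: "c * (d / t) powr e1 \<le> \<eta>'"
    proof -
      have "d \<le> t * (\<eta>' / c) powr (1 / e1)" by (simp add: d_def)
      then have "d / t \<le> (\<eta>' / c) powr (1 / e1)" using gp by (simp add: pos_divide_le_eq mult.commute)
      then have "(d / t) powr e1 \<le> ((\<eta>' / c) powr (1 / e1)) powr e1"
        using gp d by (intro powr_mono2) auto
      also have "\<dots> = \<eta>' / c" using gp \<eta>' by (simp add: powr_powr)
      finally show ?thesis using gp by (simp add: pos_le_divide_eq mult.commute)
    qed
    show "\<exists>d>0. \<forall>v'. dist v' v < d \<longrightarrow> dist (f (k v')) (f (k v)) < e"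
    proof (intro exI[of _ d] conjI allI impI d(1))
      fix v' assume v': "dist v' v < d"
      then have vv: "dist v v' \<le> d" "dist v v' \<le> t / 2" using d by (auto simp: dist_commute)
      let ?u = "\<lambda>y. k v y - k v' y"
      have Pe: "P e2 v t y \<le> P \<gamma> v t y" for y using gp \<gamma> \<epsilon> by (intro P_antimono_exp) auto
      have "test_bound v t \<beta> \<gamma> ?u \<eta>"
      proof (rule \<eta>'(2)[OF gp(1)])
        fix y
        have "dist v v' \<le> (t + dist v y) / 2" using vv zero_le_dist[of v y] by argo
        then have "\<bar>?u y\<bar> \<le> c * (dist v v' / (t + dist v y)) powr e1 * P e2 v t y"
          using gk by (simp add: good_kernel_def)
        also have "\<dots> \<le> c * (d / t) powr e1 * P \<gamma> v t y"
          using gp vv by (intro mult_mono mult_left_mono ratio_powr_mono Pe) auto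
        also have "\<dots> \<le> \<eta>' * P \<gamma> v t y" using dc by (rule mult_right_mono) simp
        finally show "\<bar>?u y\<bar> \<le> \<eta>' * P \<gamma> v t y" .
        fix z assume yz: "dist y z \<le> (t + dist v y) / 4"
        let ?h = "(dist y z / (t + dist v y)) powr e1"
        have tri: "dist v y \<le> dist v' y + t / 2" using dist_triangle[of v y v'] vv by argo
        have 1: "\<bar>k v y - k v z\<bar> \<le> c * ?h * P e2 v t y"
        proof -
          have "dist y z \<le> (t + dist v y) / 2" using yz gp zero_le_dist[of v y] by argo
          then show ?thesis using gk by (simp add: good_kernel_def)
        qed
        have 2: "\<bar>k v' y - k v' z\<bar> \<le> c * (2 powr e1 * ?h) * (near_const e2 * P e2 v t y)"
        proof -
          have "dist y z \<le> (t + dist v' y) / 2" using yz gp tri zero_le_dist[of v' y] by argo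
          then have "\<bar>k v' y - k v' z\<bar> \<le> c * (dist y z / (t + dist v' y)) powr e1 * P e2 v' t y"
            using gk by (simp add: good_kernel_def)
          also have "\<dots> \<le> c * (2 powr e1 * ?h) * (near_const e2 * P e2 v t y)"
          proof (intro mult_mono mult_left_mono)
            have "t + dist v y \<le> 2 * (t + dist v' y)" using tri gp zero_le_dist[of v' y] by argo
            then have "1 / (t + dist v' y) \<le> 2 / (t + dist v y)" using gp by (simp add: field_simps)
            from mult_left_mono[OF this, of "dist y z"]
            have "dist y z / (t + dist v' y) \<le> 2 * (dist y z / (t + dist v y))" by (simp add: mult_ac)
            then have "(dist y z / (t + dist v' y)) powr e1 \<le> (2 * (dist y z / (t + dist v y))) powr e1"
              using gp by (intro powr_mono2) auto
            then show "(dist y z / (t + dist v' y)) powr e1 \<le> 2 powr e1 * ?h" by (simp only: powr_mult)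
            show "P e2 v' t y \<le> near_const e2 * P e2 v t y"
            proof (rule P_change2)
              show "t + dist v y + dist v' v \<le> 2 * (t + dist v' y)"
                using tri vv gp zero_le_dist[of v' y] dist_commute[of v v'] by argo
            qed (use gp in auto)
          qed (use gp c2 in auto)
          finally show ?thesis .
        qed
        have "\<bar>?u z - ?u y\<bar> \<le> \<bar>k v y - k v z\<bar> + \<bar>k v' y - k v' z\<bar>" by linarith
        also have "\<dots> \<le> c * ?h * P e2 v t y + c * (2 powr e1 * ?h) * (near_const e2 * P e2 v t y)" by (rule add_mono[OF 1 2])
        also have "\<dots> = N' * ?h * P e2 v t y" by (simp add: N'_def algebra_simps)
        also have "\<dots> \<le> N' * ?h * P \<gamma> v t y" using N'0 by (intro mult_left_mono Pe) auto
        finally show "\<bar>?u z - ?u y\<bar> \<le> N' * ?h * P \<gamma> v t y" .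
      qed
      then have "\<bar>f ?u\<bar> \<le> N * \<eta>" by (rule N(2)[OF tests_diff[OF kt kt \<epsilon>(1)]])
      then show "dist (f (k v')) (f (k v)) < e"
        using functional_diff[OF f kt kt] \<eta>(2) by (simp add: dist_real_def abs_minus_commute)
    qed
  qed
qed

section \<open>Passage to the test spaces, duals and maximal functions of the statement\<close>

definition test_weight :: "'a \<Rightarrow> real \<Rightarrow> real \<Rightarrow> 'a \<Rightarrow> real" where
  "test_weight x r g y = 1 / (Vr \<mu> r x + Vxy \<mu> x y) * (r / (r + dist x y)) powr g"

lemma test_weight_nonneg [simp]: "0 \<le> test_weight x r g y"
  by (simp add: test_weight_def Vr_def Vxy_def)

lemma G_bound_alt:
  "G_bound \<mu> x r b g \<phi> C \<longleftrightarrow> 0 \<le> C \<and> (\<forall>y. \<bar>\<phi> y\<bar> \<le> C * test_weight x r g y) \<and>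
     (\<forall>y z. dist y z \<le> (r + dist x y) / 2 \<longrightarrow> \<bar>\<phi> z - \<phi> y\<bar> \<le> C * ((dist y z / (r + dist x y)) powr b * test_weight x r g y))"
  unfolding G_bound_def test_weight_def by (simp only: mult.assoc)

lemma G_bound_diff:
  assumes "G_bound \<mu> x r b g \<phi> C" "G_bound \<mu> x r b g \<psi> D" shows "G_bound \<mu> x r b g (\<lambda>y. \<phi> y - \<psi> y) (C + D)"
  unfolding G_bound_alt
proof (intro conjI allI impI)
  note C = assms(1)[unfolded G_bound_alt] and D = assms(2)[unfolded G_bound_alt]
  show "0 \<le> C + D" using C D by simp
  show "\<bar>\<phi> y - \<psi> y\<bar> \<le> (C + D) * test_weight x r g y" for y
  proof -
    have "\<bar>\<phi> y\<bar> \<le> C * test_weight x r g y" "\<bar>\<psi> y\<bar> \<le> D * test_weight x r g y" using C D by blast+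
    then show ?thesis unfolding distrib_right by linarith
  qed
  show "\<bar>\<phi> z - \<psi> z - (\<phi> y - \<psi> y)\<bar> \<le> (C + D) * ((dist y z / (r + dist x y)) powr b * test_weight x r g y)"
    if "dist y z \<le> (r + dist x y) / 2" for y z
  proof -
    let ?W = "(dist y z / (r + dist x y)) powr b * test_weight x r g y"
    have "\<bar>\<phi> z - \<phi> y\<bar> \<le> C * ?W" "\<bar>\<psi> z - \<psi> y\<bar> \<le> D * ?W" using C D that by blast+
    then show ?thesis unfolding distrib_right by linarith
  qed
qed

lemma G_bound_scale:
  assumes "G_bound \<mu> x r b g \<phi> C" shows "G_bound \<mu> x r b g (\<lambda>y. a * \<phi> y) (\<bar>a\<bar> * C)"
  unfolding G_bound_alt
proof (intro conjI allI impI)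
  note C = assms[unfolded G_bound_alt]
  show "0 \<le> \<bar>a\<bar> * C" using C by simp
  show "\<bar>a * \<phi> y\<bar> \<le> \<bar>a\<bar> * C * test_weight x r g y" for y
  proof -
    have "\<bar>\<phi> y\<bar> \<le> C * test_weight x r g y" using C by blast
    from mult_left_mono[OF this, of "\<bar>a\<bar>"] show ?thesis by (simp add: abs_mult mult.assoc)
  qed
  show "\<bar>a * \<phi> z - a * \<phi> y\<bar> \<le> \<bar>a\<bar> * C * ((dist y z / (r + dist x y)) powr b * test_weight x r g y)"
    if "dist y z \<le> (r + dist x y) / 2" for y z
  proof -
    have "\<bar>\<phi> z - \<phi> y\<bar> \<le> C * ((dist y z / (r + dist x y)) powr b * test_weight x r g y)" using C that by blast
    from mult_left_mono[OF this, of "\<bar>a\<bar>"] show ?thesis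
      by (simp add: abs_mult mult.assoc flip: right_diff_distrib)
  qed
qed

lemma Gnorm_le: "G_bound \<mu> x r b g \<phi> C \<Longrightarrow> Gnorm \<mu> x r b g \<phi> \<le> C"
  unfolding Gnorm_def by (rule cInf_lower) (auto intro!: bdd_belowI[of _ 0] simp: G_bound_def)

lemma Gnorm_nonneg: "\<phi> \<in> Gtest \<mu> x r b g \<Longrightarrow> 0 \<le> Gnorm \<mu> x r b g \<phi>"
  unfolding Gnorm_def Gtest_def by (rule cInf_greatest) (auto simp: G_bound_def)

text \<open>Every condition on C has the form: a is at most C w with w nonnegative. Such conditions
  survive passing to the infimum.\<close>

lemma Gnorm_attained:
  assumes "\<phi> \<in> Gtest \<mu> x r b g" shows "G_bound \<mu> x r b g \<phi> (Gnorm \<mu> x r b g \<phi>)"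
proof -
  let ?S = "{C. G_bound \<mu> x r b g \<phi> C}"
  have ne: "?S \<noteq> {}" using assms by (auto simp: Gtest_def)
  have inf: "a \<le> Gnorm \<mu> x r b g \<phi> * w" if aw: "\<And>C. G_bound \<mu> x r b g \<phi> C \<Longrightarrow> a \<le> C * w" and w: "0 \<le> w" for a w
  proof (cases "w = 0")
    case True
    then show ?thesis using ne aw by auto
  next
    case False
    then have "a / w \<le> Inf ?S" using ne aw w by (intro cInf_greatest) (auto simp: divide_le_eq)
    then show ?thesis using False w by (simp add: divide_le_eq Gnorm_def)
  qed
  show ?thesis
    unfolding G_bound_alt
  proof (intro conjI allI impI)
    show "0 \<le> Gnorm \<mu> x r b g \<phi>" by (rule Gnorm_nonneg[OF assms])
    show "\<bar>\<phi> y\<bar> \<le> Gnorm \<mu> x r b g \<phi> * test_weight x r g y" for y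
      by (rule inf) (auto simp: G_bound_alt)
    show "\<bar>\<phi> z - \<phi> y\<bar> \<le> Gnorm \<mu> x r b g \<phi> * ((dist y z / (r + dist x y)) powr b * test_weight x r g y)"
      if "dist y z \<le> (r + dist x y) / 2" for y z
      by (rule inf) (use that in \<open>auto simp: G_bound_alt\<close>)
  qed
qed

lemma tests_eq: assumes "0 \<le> \<epsilon>" shows "tests \<epsilon> = Gtest \<mu> x 1 \<epsilon> \<epsilon>"
proof (intro equalityI subsetI)
  fix \<phi> assume "\<phi> \<in> tests \<epsilon>"
  then obtain C where "test_bound x 1 \<epsilon> \<epsilon> \<phi> C" using assms by (rule testsE[of _ _ 1]) simp
  then have "G_bound \<mu> x 1 \<epsilon> \<epsilon> \<phi> (2 * C)" by (rule test_bound_imp_G_bound) simp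
  then show "\<phi> \<in> Gtest \<mu> x 1 \<epsilon> \<epsilon>" by (auto simp: Gtest_def)
next
  fix \<phi> assume "\<phi> \<in> Gtest \<mu> x 1 \<epsilon> \<epsilon>"
  then obtain C where "G_bound \<mu> x 1 \<epsilon> \<epsilon> \<phi> C" by (auto simp: Gtest_def)
  from testsI[OF _ G_bound_imp_test_bound[OF this]] show "\<phi> \<in> tests \<epsilon>" by simp
qed

lemma tests_Gtest:
  assumes "\<phi> \<in> tests \<epsilon>" "0 \<le> \<epsilon>" "\<beta> \<le> \<epsilon>" "\<gamma> \<le> \<epsilon>" "0 < r" shows "\<phi> \<in> Gtest \<mu> x r \<beta> \<gamma>"
proof -
  obtain C where "test_bound x r \<epsilon> \<epsilon> \<phi> C" using assms(1,2,5) by (rule testsE)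
  then have "test_bound x r \<beta> \<gamma> \<phi> C" using assms(5,3,4) by (rule test_bound_exponents)
  from test_bound_imp_G_bound[OF this assms(5)] show ?thesis by (auto simp: Gtest_def)
qed

lemma tests_G0:
  assumes "\<phi> \<in> tests \<epsilon>" "0 \<le> \<epsilon>" "\<beta> \<le> \<epsilon>" "\<gamma> \<le> \<epsilon>" shows "\<phi> \<in> G0 \<mu> x1 \<epsilon> \<beta> \<gamma>"
  unfolding G0_def
proof (intro CollectI conjI allI impI)
  show "\<phi> \<in> Gtest \<mu> x1 1 \<beta> \<gamma>" using assms by (intro tests_Gtest) auto
  fix \<eta> :: real assume "0 < \<eta>"
  have "G_bound \<mu> x1 1 \<beta> \<gamma> (\<lambda>y. \<phi> y - \<phi> y) 0" by (simp add: G_bound_def)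
  from Gnorm_le[OF this] have "Gnorm \<mu> x1 1 \<beta> \<gamma> (\<lambda>y. \<phi> y - \<phi> y) < \<eta>" using \<open>0 < \<eta>\<close> by linarith
  moreover have "\<phi> \<in> Gtest \<mu> x1 1 \<epsilon> \<epsilon>" using assms by (simp flip: tests_eq)
  ultimately show "\<exists>\<psi>\<in>Gtest \<mu> x1 1 \<epsilon> \<epsilon>. Gnorm \<mu> x1 1 \<beta> \<gamma> (\<lambda>y. \<phi> y - \<psi> y) < \<eta>"
    by (rule bexI)
qed

lemma dual_lincomb:
  assumes "f \<in> G0_dual \<mu> x1 \<epsilon> \<beta> \<gamma>" "\<phi> \<in> G0 \<mu> x1 \<epsilon> \<beta> \<gamma>" "\<psi> \<in> G0 \<mu> x1 \<epsilon> \<beta> \<gamma>"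
  shows "f (\<lambda>y. a * \<phi> y + \<psi> y) = a * f \<phi> + f \<psi>"
  by (rule conjunct1[OF assms(1)[unfolded G0_dual_def mem_Collect_eq], rule_format, OF assms(2,3)])

lemma dual_bound:
  assumes "f \<in> G0_dual \<mu> x1 \<epsilon> \<beta> \<gamma>"
  obtains N where "0 \<le> N" "\<And>\<phi> C. \<phi> \<in> G0 \<mu> x1 \<epsilon> \<beta> \<gamma> \<Longrightarrow> G_bound \<mu> x1 1 \<beta> \<gamma> \<phi> C \<Longrightarrow> \<bar>f \<phi>\<bar> \<le> N * C"
proof -
  from conjunct2[OF assms[unfolded G0_dual_def mem_Collect_eq]]
  obtain N where "\<forall>\<phi>\<in>G0 \<mu> x1 \<epsilon> \<beta> \<gamma>. \<bar>f \<phi>\<bar> \<le> N * Gnorm \<mu> x1 1 \<beta> \<gamma> \<phi>" ..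
  then have N: "\<bar>f \<phi>\<bar> \<le> N * Gnorm \<mu> x1 1 \<beta> \<gamma> \<phi>" if "\<phi> \<in> G0 \<mu> x1 \<epsilon> \<beta> \<gamma>" for \<phi>
    using that by (rule bspec)
  show ?thesis
  proof (rule that[of "max N 0"])
    fix \<phi> C assume \<phi>: "\<phi> \<in> G0 \<mu> x1 \<epsilon> \<beta> \<gamma>" and G: "G_bound \<mu> x1 1 \<beta> \<gamma> \<phi> C"
    have n0: "0 \<le> Gnorm \<mu> x1 1 \<beta> \<gamma> \<phi>" using \<phi> by (intro Gnorm_nonneg) (auto simp: G0_def)
    have "N * Gnorm \<mu> x1 1 \<beta> \<gamma> \<phi> \<le> max N 0 * C"
      by (intro mult_mono Gnorm_le[OF G]) (use n0 in auto)
    then show "\<bar>f \<phi>\<bar> \<le> max N 0 * C" using N[OF \<phi>] by linarith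
  qed simp
qed

lemma dual_functional:
  assumes f: "f \<in> G0_dual \<mu> x1 \<epsilon> \<beta> \<gamma>" and \<beta>: "0 \<le> \<beta>" "\<beta> \<le> \<epsilon>" and \<gamma>: "0 \<le> \<gamma>" "\<gamma> \<le> \<epsilon>"
  shows "functional \<epsilon> \<beta> \<gamma> f"
  unfolding functional_def
proof (intro conjI ballI allI impI)
  have \<epsilon>: "0 \<le> \<epsilon>" using \<beta> by simp
  note G0 = tests_G0[OF _ \<epsilon> \<beta>(2) \<gamma>(2)]
  show "f (\<lambda>y. a * \<phi> y + \<psi> y) = a * f \<phi> + f \<psi>" if "\<phi> \<in> tests \<epsilon>" "\<psi> \<in> tests \<epsilon>" for \<phi> \<psi> a
    by (rule dual_lincomb[OF f G0[OF that(1)] G0[OF that(2)]])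
  fix x :: 'a and r :: real assume r: "0 < r"
  obtain N where N: "0 \<le> N" "\<And>\<phi> C. \<phi> \<in> G0 \<mu> x1 \<epsilon> \<beta> \<gamma> \<Longrightarrow> G_bound \<mu> x1 1 \<beta> \<gamma> \<phi> C \<Longrightarrow> \<bar>f \<phi>\<bar> \<le> N * C"
    using dual_bound[OF f] by blast
  obtain L where L: "1 \<le> L" "\<And>\<phi> C. test_bound x r \<beta> \<gamma> \<phi> C \<Longrightarrow> test_bound x1 1 \<beta> \<gamma> \<phi> (L * C)"
    by (rule test_bound_change[of r 1 \<beta> \<gamma> x x1]) (use r \<beta> \<gamma> in auto)
  show "\<exists>N\<ge>0. \<forall>\<phi>\<in>tests \<epsilon>. \<forall>C. test_bound x r \<beta> \<gamma> \<phi> C \<longrightarrow> \<bar>f \<phi>\<bar> \<le> N * C"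
  proof (intro exI[of _ "N * (2 * L)"] conjI ballI allI impI)
    show "0 \<le> N * (2 * L)" using N L by simp
    fix \<phi> C assume "\<phi> \<in> tests \<epsilon>" "test_bound x r \<beta> \<gamma> \<phi> C"
    then have "\<bar>f \<phi>\<bar> \<le> N * (2 * (L * C))"
      by (intro N(2)[OF G0 test_bound_imp_G_bound[OF L(2)]]) simp_all
    then show "\<bar>f \<phi>\<bar> \<le> N * (2 * L) * C" by (simp add: mult.assoc)
  qed
qed

text \<open>Closeness in the norm at \<open>x1\<close> and scale 1 is transferred to the given
  centre and scale. Thus a competitor in the grand maximal function can be replaced by an element of
  \<open>tests \<epsilon>\<close> with almost the same norm there and almost the same value of
  f.\<close>

lemma G0_approx:
  assumes f: "f \<in> G0_dual \<mu> x1 \<epsilon> \<beta> \<gamma>" and \<beta>: "0 \<le> \<beta>" "\<beta> \<le> \<epsilon>" and \<gamma>: "0 \<le> \<gamma>" "\<gamma> \<le> \<epsilon>"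
    and \<phi>: "\<phi> \<in> G0 \<mu> x1 \<epsilon> \<beta> \<gamma>" "G_bound \<mu> x r \<beta> \<gamma> \<phi> B" and r: "0 < r" and \<eta>: "0 < \<eta>"
  obtains \<psi> where "\<psi> \<in> tests \<epsilon>" "G_bound \<mu> x r \<beta> \<gamma> \<psi> (B + \<eta>)" "\<bar>f \<phi> - f \<psi>\<bar> \<le> \<eta>"
proof -
  have \<epsilon>: "0 \<le> \<epsilon>" using \<beta> by simp
  obtain N where N: "0 \<le> N" "\<And>\<phi> C. \<phi> \<in> G0 \<mu> x1 \<epsilon> \<beta> \<gamma> \<Longrightarrow> G_bound \<mu> x1 1 \<beta> \<gamma> \<phi> C \<Longrightarrow> \<bar>f \<phi>\<bar> \<le> N * C"
    using dual_bound[OF f] by blast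
  obtain L where L: "1 \<le> L" "\<And>\<phi> C. test_bound x1 1 \<beta> \<gamma> \<phi> C \<Longrightarrow> test_bound x r \<beta> \<gamma> \<phi> (L * C)"
    by (rule test_bound_change[of 1 r \<beta> \<gamma> x1 x]) (use r \<beta> \<gamma> in auto)
  define M where "M = 2 * L * (C1 * 2 powr n)"
  have M: "0 < M" using L C1_ge1 by (simp add: M_def)
  \<comment> \<open>The sum M + N makes both the change of norm and the change of f at most
    \<eta>.\<close>
  define \<eta>' where "\<eta>' = \<eta> / (M + N)"
  have \<eta>': "0 < \<eta>'" "N * \<eta>' \<le> \<eta>" "M * \<eta>' \<le> \<eta>"
  proof -
    have MN: "0 < M + N" using M N by simp
    show "0 < \<eta>'" using \<eta> MN by (simp add: \<eta>'_def)
    have "(M + N) * \<eta>' = \<eta>" using MN by (simp add: \<eta>'_def)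
    moreover have "0 \<le> M * \<eta>'" "0 \<le> N * \<eta>'" using M N \<open>0 < \<eta>'\<close> by auto
    ultimately show "N * \<eta>' \<le> \<eta>" "M * \<eta>' \<le> \<eta>" by (simp_all add: distrib_right)
  qed
  obtain \<psi> where \<psi>: "\<psi> \<in> tests \<epsilon>" and lt: "Gnorm \<mu> x1 1 \<beta> \<gamma> (\<lambda>y. \<phi> y - \<psi> y) < \<eta>'"
    using \<phi>(1) \<eta>'(1) unfolding G0_def tests_eq[OF \<epsilon>, of x1] by blast
  let ?\<chi> = "\<lambda>y. \<phi> y - \<psi> y"
  obtain a b where "G_bound \<mu> x1 1 \<beta> \<gamma> \<phi> a" "G_bound \<mu> x1 1 \<beta> \<gamma> \<psi> b"
    using \<phi>(1) tests_Gtest[OF \<psi> \<epsilon> \<beta>(2) \<gamma>(2), of 1 x1] by (auto simp: G0_def Gtest_def)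
  from G_bound_diff[OF this] have \<chi>t: "?\<chi> \<in> Gtest \<mu> x1 1 \<beta> \<gamma>" by (auto simp: Gtest_def)
  have \<psi>0: "\<psi> \<in> G0 \<mu> x1 \<epsilon> \<beta> \<gamma>" by (rule tests_G0[OF \<psi> \<epsilon> \<beta>(2) \<gamma>(2)])
  have \<chi>0: "?\<chi> \<in> G0 \<mu> x1 \<epsilon> \<beta> \<gamma>"
    unfolding G0_def
  proof (intro CollectI conjI \<chi>t allI impI)
    fix e :: real assume "0 < e"
    then obtain \<psi>' where \<psi>': "\<psi>' \<in> tests \<epsilon>" "Gnorm \<mu> x1 1 \<beta> \<gamma> (\<lambda>y. \<phi> y - \<psi>' y) < e"
      using \<phi>(1) unfolding G0_def tests_eq[OF \<epsilon>, of x1] by blast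
    have "(\<lambda>y. \<psi>' y - \<psi> y) \<in> tests \<epsilon>" by (rule tests_diff[OF \<psi>'(1) \<psi> \<epsilon>])
    then show "\<exists>\<psi>''\<in>Gtest \<mu> x1 1 \<epsilon> \<epsilon>. Gnorm \<mu> x1 1 \<beta> \<gamma> (\<lambda>y. ?\<chi> y - \<psi>'' y) < e"
      unfolding tests_eq[OF \<epsilon>, of x1] using \<psi>'(2) by (intro bexI[of _ "\<lambda>y. \<psi>' y - \<psi> y"]) auto
  qed
  have \<chi>b: "G_bound \<mu> x1 1 \<beta> \<gamma> ?\<chi> (Gnorm \<mu> x1 1 \<beta> \<gamma> ?\<chi>)" by (rule Gnorm_attained[OF \<chi>t])
  show ?thesis
  proof (rule that[OF \<psi>])
    have "test_bound x1 1 \<beta> \<gamma> ?\<chi> (C1 * 2 powr n * \<eta>')"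
      by (rule test_bound_mono[OF G_bound_imp_test_bound[OF \<chi>b]]) (use lt C1_ge1 in \<open>auto intro!: mult_left_mono\<close>)
    from test_bound_imp_G_bound[OF L(2)[OF this] r] have "G_bound \<mu> x r \<beta> \<gamma> ?\<chi> (M * \<eta>')" by (simp add: M_def mult_ac)
    from G_bound_diff[OF \<phi>(2) this] have "G_bound \<mu> x r \<beta> \<gamma> \<psi> (B + M * \<eta>')" by simp
    then show "G_bound \<mu> x r \<beta> \<gamma> \<psi> (B + \<eta>)"
    proof -
      assume G: "G_bound \<mu> x r \<beta> \<gamma> \<psi> (B + M * \<eta>')"
      \<comment> \<open>Subtracting the zero function with a positive constant enlarges the constant
        of \<psi> to the stated one.\<close>
      have "G_bound \<mu> x r \<beta> \<gamma> (\<lambda>_. 0) (\<eta> - M * \<eta>')"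
        using \<eta>'(3) r by (simp add: G_bound_def Vr_def Vxy_def)
      from G_bound_diff[OF G this] show ?thesis by simp
    qed
    have "f (\<lambda>y. - 1 * \<psi> y + \<phi> y) = - 1 * f \<psi> + f \<phi>"
      by (rule dual_lincomb[OF f \<psi>0 \<phi>(1)])
    then have "f \<phi> - f \<psi> = f ?\<chi>" by simp
    moreover have "\<bar>f ?\<chi>\<bar> \<le> N * Gnorm \<mu> x1 1 \<beta> \<gamma> ?\<chi>" by (rule N(2)[OF \<chi>0 \<chi>b])
    moreover have "N * Gnorm \<mu> x1 1 \<beta> \<gamma> ?\<chi> \<le> N * \<eta>'" using lt N(1) by (intro mult_left_mono) auto
    ultimately show "\<bar>f \<phi> - f \<psi>\<bar> \<le> \<eta>" using \<eta>'(2) by linarith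
  qed
qed

lemma grand_max_ge:
  assumes \<phi>: "\<phi> \<in> tests \<epsilon>" and f: "functional \<epsilon> \<beta> \<gamma> f" and \<epsilon>: "0 \<le> \<epsilon>" "\<beta> \<le> \<epsilon>" "\<gamma> \<le> \<epsilon>"
    and G: "G_bound \<mu> x r \<beta> \<gamma> \<phi> B" and B: "0 < B" and r: "0 < r" "r \<le> 2 powr - real_of_int l"
  shows "ennreal \<bar>f \<phi>\<bar> \<le> ennreal B * grand_max \<mu> x1 \<epsilon> \<beta> \<gamma> f l x"
proof -
  let ?\<psi> = "\<lambda>y. (1 / B) * \<phi> y + 0"
  have \<psi>t: "?\<psi> \<in> tests \<epsilon>" using tests_lincomb[OF \<phi> tests_zero \<epsilon>(1), of "1 / B"] by simp
  have "G_bound \<mu> x r \<beta> \<gamma> ?\<psi> 1" using G_bound_scale[OF G, of "1 / B"] B by simp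
  moreover from this have "?\<psi> \<in> Gtest \<mu> x r \<beta> \<gamma>" by (auto simp: Gtest_def)
  ultimately have "0 < r \<and> r \<le> 2 powr - real_of_int l \<and> ?\<psi> \<in> Gtest \<mu> x r \<beta> \<gamma> \<and> Gnorm \<mu> x r \<beta> \<gamma> ?\<psi> \<le> 1"
    using r by (intro conjI Gnorm_le)
  then have "ennreal \<bar>f ?\<psi>\<bar> \<le> grand_max \<mu> x1 \<epsilon> \<beta> \<gamma> f l x"
    unfolding grand_max_def by (intro SUP_upper CollectI conjI tests_G0[OF \<psi>t \<epsilon>]) (rule exI)
  moreover have "f ?\<psi> = f \<phi> / B"
    using functional_lincomb[OF f \<phi> tests_zero, of "1 / B"] functional_zero[OF f] by simp
  ultimately have "ennreal B * ennreal (\<bar>f \<phi>\<bar> / B) \<le> ennreal B * grand_max \<mu> x1 \<epsilon> \<beta> \<gamma> f l x"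
    using B by (intro mult_left_mono) auto
  then show ?thesis using B by (simp flip: ennreal_mult)
qed

text \<open>A distance of at most a t keeps the change of centre within the ratio 2 + 2 a. The case
  a = 0 serves the radial maximal function, a > 0 the local averages.\<close>

lemma kernel_le_grand_max:
  assumes \<beta>: "0 \<le> \<beta>" "\<beta> \<le> \<epsilon>" and \<gamma>: "0 \<le> \<gamma>" "\<gamma> \<le> \<epsilon>" and \<epsilon>: "\<epsilon> \<le> e1" "\<epsilon> \<le> e2" and a: "0 \<le> a" and c: "0 < c"
  obtains C where "0 < C" "\<And>f t k l x y x1. f \<in> G0_dual \<mu> x1 \<epsilon> \<beta> \<gamma> \<Longrightarrow> good_kernel c e1 e2 e3 t k \<Longrightarrow> t \<le> 2 powr - real_of_int l \<Longrightarrow>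
    dist x y \<le> a * t \<Longrightarrow> ennreal \<bar>f (k y)\<bar> \<le> ennreal C * grand_max \<mu> x1 \<epsilon> \<beta> \<gamma> f l x"
proof -
  have M: "1 \<le> 2 + 2 * a" using a by simp
  obtain L where L: "1 \<le> L" "\<And>x x' r r' \<phi> C. 0 < r \<Longrightarrow> 0 < r' \<Longrightarrow> 1 + (r' + 2 * dist x x') / r \<le> 2 + 2 * a \<Longrightarrow>
    1 + (r + dist x x') / r' \<le> 2 + 2 * a \<Longrightarrow> test_bound x r \<beta> \<gamma> \<phi> C \<Longrightarrow> test_bound x' r' \<beta> \<gamma> \<phi> (L * C)"
    by (rule test_bound_change_uniform[OF \<beta>(1) \<gamma>(1) M]) blast
  show ?thesis
  proof (rule that[of "2 * (L * c)"])
    show "0 < 2 * (L * c)" using L c by simp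
    fix f t k l and x y x1 :: 'a
    assume f: "f \<in> G0_dual \<mu> x1 \<epsilon> \<beta> \<gamma>" and gk: "good_kernel c e1 e2 e3 t k" and t: "t \<le> 2 powr - real_of_int l"
      and d: "dist x y \<le> a * t"
    have \<epsilon>0: "0 \<le> \<epsilon>" using \<beta> by simp
    note t0 = gk_pos(1)[OF gk]
    have "test_bound y t \<beta> \<gamma> (k y) c"
      by (rule test_bound_exponents[OF good_kernel_test_bound[OF gk \<epsilon>] t0 \<beta>(2) \<gamma>(2)])
    moreover have "1 + (t + 2 * dist y x) / t \<le> 2 + 2 * a" "1 + (t + dist y x) / t \<le> 2 + 2 * a"
    proof -
      have "dist y x / t \<le> a" using d t0 by (simp add: pos_divide_le_eq dist_commute)
      then show "1 + (t + 2 * dist y x) / t \<le> 2 + 2 * a" "1 + (t + dist y x) / t \<le> 2 + 2 * a"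
        using t0 a by (simp_all add: add_divide_distrib)
    qed
    ultimately have "test_bound x t \<beta> \<gamma> (k y) (L * c)" using L(2) t0 by blast
    then have G: "G_bound \<mu> x t \<beta> \<gamma> (k y) (2 * (L * c))" by (rule test_bound_imp_G_bound[OF _ t0])
    show "ennreal \<bar>f (k y)\<bar> \<le> ennreal (2 * (L * c)) * grand_max \<mu> x1 \<epsilon> \<beta> \<gamma> f l x"
      by (rule grand_max_ge[OF good_kernel_tests[OF gk \<epsilon>] dual_functional[OF f \<beta> \<gamma>] \<epsilon>0 \<beta>(2) \<gamma>(2) G _ t0 t])
         (use L c in simp)
  qed
qed


section \<open>Measurability of the grand maximal function\<close>

text \<open>On a bounded family of test functions the values on a fine finite net, rounded to a fine grid,
  determine a function up to a small error in the weaker test norm.  There are countably many such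
  codes.\<close>

lemma tests_separable:
  assumes \<beta>: "0 \<le> \<beta>" "\<beta> < \<epsilon>" and \<gamma>: "0 \<le> \<gamma>" "\<gamma> < \<epsilon>"
  obtains \<D> where "countable \<D>" "\<D> \<subseteq> tests \<epsilon>"
    "\<And>\<psi> \<eta>. \<psi> \<in> tests \<epsilon> \<Longrightarrow> 0 < \<eta> \<Longrightarrow> \<exists>\<tau>\<in>\<D>. test_bound x1 1 \<beta> \<gamma> (\<lambda>y. \<psi> y - \<tau> y) \<eta>"
proof -
  have "\<exists>Z::'a set. separated (1 / real (Suc m)) Z \<and> (\<forall>x. \<exists>z\<in>Z. dist x z < 1 / real (Suc m))" for m
    using maximal_separated[of "1 / real (Suc m)"] by (metis of_nat_0_less_iff zero_less_Suc zero_less_divide_1_iff)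
  then obtain Z :: "nat \<Rightarrow> 'a set" where Z: "\<And>m. separated (1 / real (Suc m)) (Z m)"
    "\<And>m x. \<exists>z\<in>Z m. dist x z < 1 / real (Suc m)" by metis
  have "finite (Z m \<inter> ball x1 (real m + 1))" for m
    by (rule separated_finite[OF _ Z(1)]) simp
  then have "\<exists>ps. set ps = Z m \<inter> ball x1 (real m + 1)" for m using finite_list by blast
  then obtain ps where ps: "\<And>m. set (ps m) = Z m \<inter> ball x1 (real m + 1)" by metis
  \<comment> \<open>Values are rounded to multiples of \<open>1 / real (Suc m)\<close>, so functions
    with equal codes differ by at most that much at the net points.\<close>
  define code where "code m \<psi> = map (\<lambda>p. \<lfloor>\<psi> p * real (Suc m)\<rfloor>) (ps m)" for m :: nat and \<psi> :: "'a \<Rightarrow> real"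
  define rep where "rep = (\<lambda>(N::nat, m, c). SOME \<tau>. test_bound x1 1 \<epsilon> \<epsilon> \<tau> (real N) \<and> code m \<tau> = c)"
  define I where "I = {(N::nat, m, c). \<exists>\<tau>. test_bound x1 1 \<epsilon> \<epsilon> \<tau> (real N) \<and> code m \<tau> = c}"
  have rep: "test_bound x1 1 \<epsilon> \<epsilon> (rep (N, m, c)) (real N)" "code m (rep (N, m, c)) = c" if "(N, m, c) \<in> I" for N m c
  proof -
    have "\<exists>\<tau>. test_bound x1 1 \<epsilon> \<epsilon> \<tau> (real N) \<and> code m \<tau> = c" using that by (simp add: I_def)
    from someI_ex[OF this] show "test_bound x1 1 \<epsilon> \<epsilon> (rep (N, m, c)) (real N)" "code m (rep (N, m, c)) = c"
      by (simp_all add: rep_def)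
  qed
  have \<epsilon>: "0 < \<epsilon>" using \<beta> by simp
  show ?thesis
  proof (rule that[of "rep ` I"])
    show "countable (rep ` I)" by (rule countable_image[OF countableI_type])
    show "rep ` I \<subseteq> tests \<epsilon>"
    proof
      fix \<tau> assume "\<tau> \<in> rep ` I"
      then obtain N m c where "\<tau> = rep (N, m, c)" "(N, m, c) \<in> I" by auto
      then show "\<tau> \<in> tests \<epsilon>" using testsI[OF _ rep(1)] by simp
    qed
    fix \<psi> :: "'a \<Rightarrow> real" and \<eta> :: real assume \<psi>: "\<psi> \<in> tests \<epsilon>" and \<eta>: "0 < \<eta>"
    obtain C where C: "test_bound x1 1 \<epsilon> \<epsilon> \<psi> C" using \<psi> less_imp_le[OF \<epsilon>] zero_less_one by (rule testsE)
    obtain N :: nat where N: "C \<le> N" using real_arch_simple by blast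
    have \<psi>N: "test_bound x1 1 \<epsilon> \<epsilon> \<psi> (real N)" by (rule test_bound_mono[OF C N])
    obtain \<eta>' where \<eta>': "0 < \<eta>'" "\<And>x r u. 0 < r \<Longrightarrow> (\<And>y. \<bar>u y\<bar> \<le> \<eta>' * P \<gamma> x r y) \<Longrightarrow>
      (\<And>y z. dist y z \<le> (r + dist x y) / 4 \<Longrightarrow> \<bar>u z - u y\<bar> \<le> (2 * real N) * (dist y z / (r + dist x y)) powr \<epsilon> * P \<gamma> x r y) \<Longrightarrow>
      test_bound x r \<beta> \<gamma> u \<eta>"
      by (rule test_bound_small[OF \<beta> \<gamma>(1) _ \<eta>, of "2 * real N"]) auto
    \<comment> \<open>Beyond 1 + d = Q the surplus decay \<epsilon> - \<gamma> alone makes the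
      difference of two functions with constant N small; inside, the net is used.\<close>
    define Q where "Q = max 1 (((2 * real N + 1) / \<eta>') powr (1 / (\<epsilon> - \<gamma>)))"
    have Q: "1 \<le> Q" by (simp add: Q_def)
    have QN: "2 * real N \<le> \<eta>' * Q powr (\<epsilon> - \<gamma>)"
    proof -
      have "(2 * real N + 1) / \<eta>' = (((2 * real N + 1) / \<eta>') powr (1 / (\<epsilon> - \<gamma>))) powr (\<epsilon> - \<gamma>)"
        using \<eta>'(1) \<gamma> by (simp add: powr_powr)
      also have "\<dots> \<le> Q powr (\<epsilon> - \<gamma>)" using \<gamma> by (intro powr_mono2) (auto simp: Q_def)
      finally show ?thesis using \<eta>'(1) by (simp add: pos_divide_le_eq mult.commute)
    qed
    define pR where "pR = (1 / Q) powr \<gamma> / V x1 Q"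
    have pR: "0 < pR" using Q by (simp add: pR_def)
    \<comment> \<open>Rounding error at a net point plus variation of the difference over the net
      spacing; \<open>pR\<close> bounds the weight from below inside Q.\<close>
    define v where "v m = 1 / real (Suc m) + 2 * real N * (1 / real (Suc m)) powr \<epsilon> * (1 / V x1 1)" for m
    have "(\<lambda>m. 1 / real (Suc m)) \<longlonglongrightarrow> 0" by (rule lim_1_over_n[THEN LIMSEQ_Suc])
    moreover from this have "(\<lambda>m. (1 / real (Suc m)) powr \<epsilon>) \<longlonglongrightarrow> 0"
      using \<epsilon> by (intro tendsto_zero_powrI[where b = \<epsilon>]) (auto intro!: always_eventually)
    ultimately have "v \<longlonglongrightarrow> 0 + 2 * real N * 0 * (1 / V x1 1)" unfolding v_def by (intro tendsto_intros)
    then have "v \<longlonglongrightarrow> 0" by simp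
    then have "\<forall>\<^sub>F m in sequentially. v m < \<eta>' * pR"
      using \<eta>'(1) pR by (intro order_tendstoD(2)) auto
    moreover have "\<forall>\<^sub>F m in sequentially. max 1 (nat \<lceil>Q\<rceil>) \<le> m" by (rule eventually_ge_at_top)
    ultimately have "\<forall>\<^sub>F m in sequentially. v m < \<eta>' * pR \<and> max 1 (nat \<lceil>Q\<rceil>) \<le> m" by (rule eventually_conj)
    then obtain m where m: "v m < \<eta>' * pR" "max 1 (nat \<lceil>Q\<rceil>) \<le> m"
      using eventually_happens trivial_limit_sequentially by blast
    have mQ: "Q \<le> real m" "1 \<le> m" using m(2) by linarith+
    let ?c = "code m \<psi>"
    have inI: "(N, m, ?c) \<in> I" using \<psi>N by (auto simp: I_def)
    define \<tau> where "\<tau> = rep (N, m, ?c)"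
    note \<tau> = rep[OF inI, folded \<tau>_def]
    let ?u = "\<lambda>y. \<psi> y - \<tau> y"
    have "test_bound x1 1 \<epsilon> \<epsilon> (\<lambda>y. - 1 * \<tau> y + \<psi> y) (\<bar>- 1\<bar> * real N + real N)" by (rule test_bound_lincomb[OF \<tau>(1) \<psi>N])
    then have u: "test_bound x1 1 \<epsilon> \<epsilon> ?u (2 * real N)" by simp
    note ub = test_bound_D[OF u]
    have grid: "\<bar>?u p\<bar> \<le> 1 / real (Suc m)" if "p \<in> set (ps m)" for p
    proof -
      have "\<lfloor>\<tau> p * real (Suc m)\<rfloor> = \<lfloor>\<psi> p * real (Suc m)\<rfloor>"
        using \<tau>(2) that unfolding code_def map_eq_conv by blast
      then have "\<bar>\<psi> p * real (Suc m) - \<tau> p * real (Suc m)\<bar> \<le> 1" by linarith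
      then have "\<bar>?u p\<bar> * real (Suc m) \<le> 1" by (simp only: left_diff_distrib[symmetric] abs_mult abs_of_nat)
      then show ?thesis by (simp add: pos_le_divide_eq)
    qed
    have size: "\<bar>?u y\<bar> \<le> \<eta>' * P \<gamma> x1 1 y" for y
    proof (cases "1 + dist x1 y \<le> Q")
      case False
      have eq: "P \<epsilon> x1 1 y * (1 + dist x1 y) powr (\<epsilon> - \<gamma>) = P \<gamma> x1 1 y"
        using P_mult[of 1 \<epsilon> x1 y "\<epsilon> - \<gamma>"] by simp
      have "2 * real N * P \<epsilon> x1 1 y \<le> \<eta>' * Q powr (\<epsilon> - \<gamma>) * P \<epsilon> x1 1 y" using QN by (rule mult_right_mono) simp
      also have "\<dots> \<le> \<eta>' * (1 + dist x1 y) powr (\<epsilon> - \<gamma>) * P \<epsilon> x1 1 y"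
        using False Q \<gamma> \<eta>'(1) by (intro mult_right_mono mult_left_mono powr_mono2) auto
      also have "\<dots> = \<eta>' * P \<gamma> x1 1 y" unfolding eq[symmetric] by (simp add: mult_ac)
      finally show ?thesis using ub(2)[of y] by linarith
    next
      case True
      obtain p where p: "p \<in> Z m" "dist y p < 1 / real (Suc m)" using Z(2) by blast
      have m1: "1 / real (Suc m) \<le> 1 / 2" using mQ(2) by (simp add: field_simps)
      have "dist x1 p \<le> dist x1 y + dist y p" by (rule dist_triangle)
      then have "dist x1 p < real m + 1" using True mQ(1) p(2) m1 by linarith
      then have pin: "p \<in> set (ps m)" unfolding ps using p(1) by simp
      have "dist y p \<le> (1 + dist x1 y) / 2" using p(2) m1 zero_le_dist[of x1 y] by argo
      then have "\<bar>?u p - ?u y\<bar> \<le> 2 * real N * (dist y p / (1 + dist x1 y)) powr \<epsilon> * P \<epsilon> x1 1 y" by (rule ub(3))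
      also have "\<dots> \<le> 2 * real N * (1 / real (Suc m)) powr \<epsilon> * (1 / V x1 1)"
      proof (intro mult_mono mult_left_mono)
        have "(dist y p / (1 + dist x1 y)) powr \<epsilon> \<le> ((1 / real (Suc m)) / 1) powr \<epsilon>"
          using p(2) \<epsilon> by (intro ratio_powr_mono) auto
        then show "(dist y p / (1 + dist x1 y)) powr \<epsilon> \<le> (1 / real (Suc m)) powr \<epsilon>" by simp
        show "P \<epsilon> x1 1 y \<le> 1 / V x1 1" using \<epsilon> by (intro P_le_V) auto
      qed auto
      finally have "\<bar>?u y\<bar> \<le> v m" using grid[OF pin] unfolding v_def by linarith
      also have "\<dots> \<le> \<eta>' * pR" using m(1) by simp
      also have "\<dots> \<le> \<eta>' * P \<gamma> x1 1 y"
      proof (rule mult_left_mono)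
        have "(1 / Q) powr \<gamma> \<le> (1 / (1 + dist x1 y)) powr \<gamma>"
          using True Q \<gamma> by (intro powr_mono2 divide_left_mono) (auto simp: add_pos_nonneg)
        moreover have "V x1 (1 + dist x1 y) \<le> V x1 Q" using True by (rule V_mono)
        ultimately show "pR \<le> P \<gamma> x1 1 y" unfolding pR_def P_def by (intro frac_le) auto
      qed (use \<eta>'(1) in simp)
      finally show ?thesis .
    qed
    have "test_bound x1 1 \<beta> \<gamma> ?u \<eta>"
    proof (rule \<eta>'(2)[OF _ size])
      fix y z assume d: "dist y z \<le> (1 + dist x1 y) / 4"
      then have "dist y z \<le> (1 + dist x1 y) / 2" using zero_le_dist[of x1 y] by argo
      from ub(3)[OF this] have "\<bar>?u z - ?u y\<bar> \<le> 2 * real N * (dist y z / (1 + dist x1 y)) powr \<epsilon> * P \<epsilon> x1 1 y" .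
      also have "\<dots> \<le> 2 * real N * (dist y z / (1 + dist x1 y)) powr \<epsilon> * P \<gamma> x1 1 y"
        using \<gamma> by (intro mult_left_mono P_antimono_exp) auto
      finally show "\<bar>?u z - ?u y\<bar> \<le> 2 * real N * (dist y z / (1 + dist x1 y)) powr \<epsilon> * P \<gamma> x1 1 y" .
    qed simp
    then show "\<exists>\<tau>\<in>rep ` I. test_bound x1 1 \<beta> \<gamma> (\<lambda>y. \<psi> y - \<tau> y) \<eta>"
      using inI unfolding \<tau>_def by (intro bexI[of _ "rep (N, m, ?c)"] imageI)
  qed
qed

text \<open>The reciprocal of \<open>test_weight\<close>. Ball volumes are lower semicontinuous in
  the centre, so with the weight moved to the other side a violated inequality holds on an open set
  of centres.\<close>

definition inverse_weight :: "'a \<Rightarrow> real \<Rightarrow> real \<Rightarrow> 'a \<Rightarrow> real" where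
  "inverse_weight x r g y = (V x r + V x (dist x y)) * ((r + dist x y) / r) powr g"

lemma inverse_weight_pos: "0 < r \<Longrightarrow> 0 < inverse_weight x r g y"
  unfolding inverse_weight_def by (intro mult_pos_pos add_pos_nonneg) auto

lemma test_weight_eq: assumes "0 < r" shows "test_weight x r g y = 1 / inverse_weight x r g y"
proof -
  have "(r / (r + dist x y)) powr g = 1 / ((r + dist x y) / r) powr g"
    using assms by (simp add: powr_divide)
  then show ?thesis by (simp add: test_weight_def inverse_weight_def Vr_def Vxy_def V_def)
qed

text \<open>The strict inequality in the constraint makes the set of admissible centres \<open>x\<close> closed;
  shrinking the radius slightly recovers the original constraint.\<close>

definition strict_test_bound :: "'a \<Rightarrow> real \<Rightarrow> real \<Rightarrow> real \<Rightarrow> ('a \<Rightarrow> real) \<Rightarrow> real \<Rightarrow> bool" where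
  "strict_test_bound x r b g \<psi> s \<longleftrightarrow> (\<forall>y. \<bar>\<psi> y\<bar> * inverse_weight x r g y \<le> s) \<and>
     (\<forall>y z. dist y z < (r + dist x y) / 2 \<longrightarrow> \<bar>\<psi> z - \<psi> y\<bar> * inverse_weight x r g y \<le> s * (dist y z / (r + dist x y)) powr b)"

lemma G_bound_imp_strict_test_bound:
  assumes G: "G_bound \<mu> x r b g \<psi> s" and r: "0 < r" shows "strict_test_bound x r b g \<psi> s"
  unfolding strict_test_bound_def
proof (intro conjI allI impI)
  note C = G[unfolded G_bound_alt test_weight_eq[OF r]]
  show "\<bar>\<psi> y\<bar> * inverse_weight x r g y \<le> s" for y
  proof -
    have "\<bar>\<psi> y\<bar> \<le> s * (1 / inverse_weight x r g y)" using C by blast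
    then show ?thesis using inverse_weight_pos[OF r, of x g y] by (simp add: pos_le_divide_eq)
  qed
  show "\<bar>\<psi> z - \<psi> y\<bar> * inverse_weight x r g y \<le> s * (dist y z / (r + dist x y)) powr b" if "dist y z < (r + dist x y) / 2" for y z
  proof -
    have "\<bar>\<psi> z - \<psi> y\<bar> \<le> s * ((dist y z / (r + dist x y)) powr b * (1 / inverse_weight x r g y))"
      using C less_imp_le[OF that] by blast
    then show ?thesis using inverse_weight_pos[OF r, of x g y] by (simp add: pos_le_divide_eq)
  qed
qed

lemma strict_test_bound_imp_G_bound:
  assumes S: "strict_test_bound x r b g \<psi> s" and r: "0 < r'" "r' < r" and s: "0 \<le> s" and bg: "0 \<le> b" "0 \<le> g"
  shows "G_bound \<mu> x r' b g \<psi> ((r / r') powr g * s)"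
  unfolding G_bound_alt
proof (intro conjI allI impI)
  let ?k = "(r / r') powr g"
  have r0: "0 < r" using r by simp
  have k0: "0 < ?k" using r by simp
  have W: "1 / inverse_weight x r g y \<le> ?k * test_weight x r' g y" for y
  proof -
    have "inverse_weight x r' g y \<le> (V x r + V x (dist x y)) * (?k * ((r + dist x y) / r) powr g)"
      unfolding inverse_weight_def
    proof (intro mult_mono add_mono V_mono)
      have "((r' + dist x y) / r') powr g \<le> ((r / r') * ((r + dist x y) / r)) powr g"
        using r bg by (intro powr_mono2) (auto simp: divide_right_mono)
      then show "((r' + dist x y) / r') powr g \<le> ?k * ((r + dist x y) / r) powr g" by (simp only: powr_mult)
    qed (use r in auto)
    then have "inverse_weight x r' g y \<le> ?k * inverse_weight x r g y" by (simp add: inverse_weight_def mult_ac)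
    then show ?thesis unfolding test_weight_eq[OF r(1)]
      using inverse_weight_pos[OF r0, of x g y] inverse_weight_pos[OF r(1), of x g y] by (simp add: field_simps)
  qed
  show "0 \<le> ?k * s" using s by simp
  show "\<bar>\<psi> y\<bar> \<le> ?k * s * test_weight x r' g y" for y
  proof -
    have "\<bar>\<psi> y\<bar> * inverse_weight x r g y \<le> s" using S unfolding strict_test_bound_def by blast
    then have "\<bar>\<psi> y\<bar> \<le> s * (1 / inverse_weight x r g y)" using inverse_weight_pos[OF r0, of x g y] by (simp add: pos_le_divide_eq)
    also have "\<dots> \<le> s * (?k * test_weight x r' g y)" using s by (intro mult_left_mono W)
    finally show ?thesis by (simp add: mult_ac)
  qed
  show "\<bar>\<psi> z - \<psi> y\<bar> \<le> ?k * s * ((dist y z / (r' + dist x y)) powr b * test_weight x r' g y)" if d: "dist y z \<le> (r' + dist x y) / 2" for y z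
  proof -
    have "dist y z < (r + dist x y) / 2" using d r by argo
    then have "\<bar>\<psi> z - \<psi> y\<bar> * inverse_weight x r g y \<le> s * (dist y z / (r + dist x y)) powr b" using S unfolding strict_test_bound_def by blast
    then have "\<bar>\<psi> z - \<psi> y\<bar> \<le> s * ((dist y z / (r + dist x y)) powr b * (1 / inverse_weight x r g y))"
      using inverse_weight_pos[OF r0, of x g y] by (simp add: pos_le_divide_eq)
    also have "\<dots> \<le> s * ((dist y z / (r' + dist x y)) powr b * (?k * test_weight x r' g y))"
      using s r bg less_imp_le[OF inverse_weight_pos[OF r0, of x g y]]
      by (intro mult_left_mono mult_mono W powr_mono2 divide_left_mono) auto
    finally show ?thesis by (simp add: mult_ac)
  qed
qed

lemma strict_test_bound_mono: "strict_test_bound x r b g \<psi> s \<Longrightarrow> s \<le> s' \<Longrightarrow> strict_test_bound x r b g \<psi> s'"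
  unfolding strict_test_bound_def by (meson mult_right_mono order_trans powr_ge_zero)

lemma V_lsc:
  assumes "continuous_on UNIV \<rho>" shows "open {x. m < V x (\<rho> x)}"
proof (cases "m < 0")
  case True
  then have "{x. m < V x (\<rho> x)} = UNIV" using V_nonneg less_le_trans by blast
  then show ?thesis by simp
next
  case False
  then have "{x. m < V x (\<rho> x)} = {x. ennreal m < emeasure \<mu> (ball x (\<rho> x))}"
    by (simp add: emeasure_ball ennreal_less_iff)
  then show ?thesis using V_lower[OF sets_mu assms] by simp
qed

text \<open>The excess over c is split between two thresholds, one third of it below each
  volume.\<close>

lemma Vsum_lsc:
  assumes "continuous_on UNIV c" shows "open {x. c x < V x r + V x (dist x y)}"
proof -
  have 1: "open {x. a < V x r}" for a by (rule V_lsc) (rule continuous_on_const)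
  have 2: "open {x. a < V x (dist x y)}" for a by (rule V_lsc) (intro continuous_intros)
  have "{x. c x < V x r + V x (dist x y)} = (\<Union>(a, b)\<in>UNIV. {x. c x < a + b} \<inter> ({x. a < V x r} \<inter> {x. b < V x (dist x y)}))"
  proof (intro equalityI subsetI)
    fix x assume "x \<in> {x. c x < V x r + V x (dist x y)}"
    then have lt: "c x < V x r + V x (dist x y)" by simp
    define d where "d = (V x r + V x (dist x y) - c x) / 3"
    have "0 < d" "c x < (V x r - d) + (V x (dist x y) - d)" using lt by (auto simp: d_def field_simps)
    then show "x \<in> (\<Union>(a, b)\<in>UNIV. {x. c x < a + b} \<inter> ({x. a < V x r} \<inter> {x. b < V x (dist x y)}))"
      by (intro UN_I[of "(V x r - d, V x (dist x y) - d)"]) auto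
  qed auto
  also have "open \<dots>"
  proof (intro open_UN ballI)
    fix p :: "real \<times> real"
    show "open (case p of (a, b) \<Rightarrow> {x. c x < a + b} \<inter> ({x. a < V x r} \<inter> {x. b < V x (dist x y)}))"
      unfolding case_prod_beta by (intro open_Int 1 2 open_Collect_less assms continuous_on_const)
  qed
  finally show ?thesis .
qed

lemma inverse_weight_le_closed:
  assumes r: "0 < r" and A: "0 \<le> A" and c: "continuous_on UNIV c" and c0: "A = 0 \<Longrightarrow> \<forall>x. 0 \<le> c x"
  shows "open {x. c x < A * inverse_weight x r g y}"
proof (cases "A = 0")
  case True
  then have "{x. c x < A * inverse_weight x r g y} = {}" using c0 by (auto simp: not_less)
  then show ?thesis by simp
next
  case False
  then have A: "0 < A" using A by simp
  let ?h = "\<lambda>x. A * ((r + dist x y) / r) powr g"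
  have h: "0 < ?h x" for x using A r by simp
  have "{x. c x < A * inverse_weight x r g y} = {x. c x / ?h x < V x r + V x (dist x y)}"
    using h by (auto simp: inverse_weight_def pos_divide_less_eq mult_ac)
  also have "open \<dots>"
    by (rule Vsum_lsc) (use r h A in \<open>auto intro!: continuous_intros c simp: less_imp_neq[symmetric]\<close>)
  finally show ?thesis .
qed

text \<open>The complement is the union, over all y and z, of the sets where a single inequality
  fails. The strict constraint on d(y, z) keeps each of these sets open.\<close>

lemma closed_strict_test_bound:
  assumes r: "0 < r" and s: "0 \<le> s" shows "closed {x. strict_test_bound x r b g \<psi> s}"
proof -
  have 1: "open {x. s < \<bar>\<psi> y\<bar> * inverse_weight x r g y}" for y
    by (rule inverse_weight_le_closed[OF r]) (use s in auto)
  have 2: "open {x. dist y z < (r + dist x y) / 2 \<and> s * (dist y z / (r + dist x y)) powr b < \<bar>\<psi> z - \<psi> y\<bar> * inverse_weight x r g y}" for y z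
  \<comment> \<open>For y = z both sides vanish. For distinct points the base of the power is
    positive, so the power is continuous in x.\<close>
  proof (cases "y = z")
    case True
    then have "\<not> s * (dist y z / (r + dist x y)) powr b < \<bar>\<psi> z - \<psi> y\<bar> * inverse_weight x r g y" for x
      using s by (simp add: not_less)
    then have "{x. dist y z < (r + dist x y) / 2 \<and> s * (dist y z / (r + dist x y)) powr b < \<bar>\<psi> z - \<psi> y\<bar> * inverse_weight x r g y} = {}" by blast
    then show ?thesis by (simp only: open_empty)
  next
    case False
    have "open {x. s * (dist y z / (r + dist x y)) powr b < \<bar>\<psi> z - \<psi> y\<bar> * inverse_weight x r g y}"
      by (rule inverse_weight_le_closed[OF r]) (use False s r in \<open>auto intro!: continuous_intros\<close>)
    moreover have "open {x. dist y z < (r + dist x y) / 2}"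
      by (intro open_Collect_less continuous_intros) auto
    ultimately show ?thesis unfolding Collect_conj_eq by (intro open_Int)
  qed
  have "- {x. strict_test_bound x r b g \<psi> s} = (\<Union>y. {x. s < \<bar>\<psi> y\<bar> * inverse_weight x r g y}) \<union>
    (\<Union>y. \<Union>z. {x. dist y z < (r + dist x y) / 2 \<and> s * (dist y z / (r + dist x y)) powr b < \<bar>\<psi> z - \<psi> y\<bar> * inverse_weight x r g y})"
    unfolding strict_test_bound_def not_le[symmetric] by blast
  also have "open \<dots>" using 1 2 by (intro open_Un open_UN ballI)
  finally show ?thesis by (simp only: closed_def)
qed

text \<open>Semicontinuity of ball measures, applied to the measure with density g.\<close>

lemma ball_integral_measurable:
  assumes g: "g \<in> borel_measurable \<mu>"
  shows "(\<lambda>x. \<integral>\<^sup>+y\<in>ball x \<rho>. g y \<partial>\<mu>) \<in> borel_measurable \<mu>"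
proof -
  have sd: "sets (density \<mu> g) = sets borel" using sets_mu by simp
  have "(\<lambda>x. emeasure (density \<mu> g) (ball x \<rho>)) \<in> borel_measurable borel"
    by (rule borel_measurableI_greater) (use V_lower[OF sd continuous_on_const[of UNIV \<rho>]] in auto)
  moreover have "emeasure (density \<mu> g) (ball x \<rho>) = (\<integral>\<^sup>+y\<in>ball x \<rho>. g y \<partial>\<mu>)" for x
    by (rule emeasure_density[OF g]) simp
  ultimately show ?thesis by (simp add: borel_measurable_mu)
qed

text \<open>The supremum is rewritten over a countable family of dense test functions, rational
  radii and tolerances \<open>\<sigma> i\<close> tending to one. Each member contributes a multiple
  of the indicator of a closed set of centres.\<close>

lemma grand_max_measurable:
  assumes f: "f \<in> G0_dual \<mu> x1 \<epsilon> \<beta> \<gamma>" and \<beta>: "0 \<le> \<beta>" "\<beta> < \<epsilon>" and \<gamma>: "0 < \<gamma>" "\<gamma> < \<epsilon>"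
  shows "grand_max \<mu> x1 \<epsilon> \<beta> \<gamma> f l \<in> borel_measurable \<mu>"
proof -
  have \<epsilon>: "0 \<le> \<epsilon>" "\<beta> \<le> \<epsilon>" "\<gamma> \<le> \<epsilon>" "0 \<le> \<gamma>" using \<beta> \<gamma> by auto
  note ff = dual_functional[OF f \<beta>(1) \<epsilon>(2,4,3)]
  obtain \<D> where \<D>: "countable \<D>" "\<D> \<subseteq> tests \<epsilon>"
    "\<And>\<psi> \<eta>. \<psi> \<in> tests \<epsilon> \<Longrightarrow> 0 < \<eta> \<Longrightarrow> \<exists>\<tau>\<in>\<D>. test_bound x1 1 \<beta> \<gamma> (\<lambda>y. \<psi> y - \<tau> y) \<eta>"
    by (rule tests_separable[OF \<beta> \<epsilon>(4) \<gamma>(2), of x1]) blast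
  let ?R = "2 powr - real_of_int l"
  define e where "e i = 1 / real (Suc i)" for i
  \<comment> \<open>1 + 2 e pays for approximating first by a test function of order \<epsilon> and
    then by one from the countable set; 1 + e pays for moving to a rational radius.\<close>
  define \<sigma> where "\<sigma> i = (1 + e i) * (1 + 2 * e i)" for i
  have e0: "0 < e i" for i by (simp add: e_def)
  have \<sigma>0: "0 < \<sigma> i" for i using e0[of i] by (simp add: \<sigma>_def add_pos_pos)
  have elim: "e \<longlonglongrightarrow> 0" unfolding e_def by (rule lim_1_over_n[THEN LIMSEQ_Suc])
  define J where "J = \<D> \<times> (UNIV :: nat set) \<times> (\<rat> \<inter> {0<..?R})"
  define h where "h = (\<lambda>(\<tau>, i, r) x. ennreal (\<bar>f \<tau>\<bar> / \<sigma> i) * indicator {x. strict_test_bound x r \<beta> \<gamma> \<tau> (\<sigma> i)} x)"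
  have J: "countable J" unfolding J_def using \<D>(1) countable_rat by (intro countable_SIGMA) auto
  have hm: "h j \<in> borel_measurable \<mu>" if jJ: "j \<in> J" for j
  proof -
    obtain \<tau> i r where j: "j = (\<tau>, i, r)" "0 < r" using jJ by (cases j) (auto simp: J_def)
    have "{x. strict_test_bound x r \<beta> \<gamma> \<tau> (\<sigma> i)} \<in> sets \<mu>"
      unfolding sets_mu using closed_strict_test_bound[OF j(2) less_imp_le[OF \<sigma>0]] by (rule borel_closed)
    then show ?thesis unfolding h_def j by simp
  qed
  have "grand_max \<mu> x1 \<epsilon> \<beta> \<gamma> f l x = (SUP j\<in>J. h j x)" for x
  proof (rule antisym)
    let ?GM = "grand_max \<mu> x1 \<epsilon> \<beta> \<gamma> f l x"
    show "(SUP j\<in>J. h j x) \<le> ?GM"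
    proof (rule SUP_least)
      fix j assume "j \<in> J"
      then obtain \<tau> i r where j: "j = (\<tau>, i, r)" "0 < r" "r \<le> ?R" "\<tau> \<in> tests \<epsilon>"
        using \<D>(2) by (cases j) (auto simp: J_def)
      show "h j x \<le> ?GM"
      proof (cases "strict_test_bound x r \<beta> \<gamma> \<tau> (\<sigma> i) \<and> ?GM \<noteq> top")
        case False
        then show ?thesis by (auto simp: h_def j(1))
      next
        case True
        then obtain g where g: "?GM = ennreal g" "0 \<le> g" by (cases ?GM) auto
        have "\<bar>f \<tau>\<bar> \<le> (1 + e m) powr \<gamma> * \<sigma> i * g" for m
        proof -
          \<comment> \<open>The strict condition gives back a test norm only at a smaller radius;
            the loss tends to one as m grows.\<close>
          let ?r' = "r / (1 + e m)"
          have r': "0 < ?r'" "?r' < r" "r / ?r' = 1 + e m" "?r' \<le> ?R"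
            using j e0[of m] by (auto simp: field_simps add_pos_pos intro: order_trans)
          have "G_bound \<mu> x ?r' \<beta> \<gamma> \<tau> ((r / ?r') powr \<gamma> * \<sigma> i)"
            by (rule strict_test_bound_imp_G_bound) (use True r' \<sigma>0[of i] \<beta> \<epsilon> in auto)
          then have "ennreal \<bar>f \<tau>\<bar> \<le> ennreal ((1 + e m) powr \<gamma> * \<sigma> i) * ?GM"
            unfolding r'(3) by (rule grand_max_ge[OF j(4) ff \<epsilon>(1-3) _ _ r'(1,4)]) (use e0[of m] \<sigma>0[of i] in simp)
          then show ?thesis using g \<sigma>0[of i] by (simp add: ennreal_mult[symmetric] ennreal_le_iff)
        qed
        moreover have "(\<lambda>m. (1 + e m) powr \<gamma> * \<sigma> i * g) \<longlonglongrightarrow> (1 + 0) powr \<gamma> * \<sigma> i * g"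
          by (intro tendsto_intros elim) auto
        ultimately have "\<bar>f \<tau>\<bar> \<le> \<sigma> i * g" by (intro LIMSEQ_le_const[of _ "\<sigma> i * g"]) auto
        then have "\<bar>f \<tau>\<bar> / \<sigma> i \<le> g" using \<sigma>0[of i] by (simp add: pos_divide_le_eq mult.commute)
        then show ?thesis using True by (simp add: h_def j(1) g ennreal_leI)
      qed
    qed
    show "?GM \<le> (SUP j\<in>J. h j x)"
      unfolding grand_max_def
    proof (rule SUP_least)
      let ?S = "SUP j\<in>J. h j x"
      fix \<phi> assume "\<phi> \<in> {\<phi> \<in> G0 \<mu> x1 \<epsilon> \<beta> \<gamma>. \<exists>r. 0 < r \<and> r \<le> ?R \<and> \<phi> \<in> Gtest \<mu> x r \<beta> \<gamma> \<and> Gnorm \<mu> x r \<beta> \<gamma> \<phi> \<le> 1}"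
      then obtain r where \<phi>: "\<phi> \<in> G0 \<mu> x1 \<epsilon> \<beta> \<gamma>" and r: "0 < r" "r \<le> ?R"
        and t: "\<phi> \<in> Gtest \<mu> x r \<beta> \<gamma>" and le: "Gnorm \<mu> x r \<beta> \<gamma> \<phi> \<le> 1" by auto
      note G = Gnorm_attained[OF t]
      let ?B = "Gnorm \<mu> x r \<beta> \<gamma> \<phi>"
      show "ennreal \<bar>f \<phi>\<bar> \<le> ?S"
      proof (cases "?S = top")
        case False
        then obtain S where S: "?S = ennreal S" "0 \<le> S" by (cases ?S) auto
        obtain L where L: "1 \<le> L" "\<And>\<phi> C. test_bound x1 1 \<beta> \<gamma> \<phi> C \<Longrightarrow> test_bound x r \<beta> \<gamma> \<phi> (L * C)"
          by (rule test_bound_change[of 1 r \<beta> \<gamma> x1 x]) (use r \<beta> \<epsilon> in auto)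
        obtain N where N: "0 \<le> N" "\<And>\<phi> C. \<phi> \<in> tests \<epsilon> \<Longrightarrow> test_bound x1 1 \<beta> \<gamma> \<phi> C \<Longrightarrow> \<bar>f \<phi>\<bar> \<le> N * C"
          using ff zero_less_one unfolding functional_def by meson
        have "\<bar>f \<phi>\<bar> \<le> \<sigma> i * S + 2 * e i" for i
        proof -
          obtain \<psi> where \<psi>: "\<psi> \<in> tests \<epsilon>" "G_bound \<mu> x r \<beta> \<gamma> \<psi> (?B + e i)" "\<bar>f \<phi> - f \<psi>\<bar> \<le> e i"
            by (rule G0_approx[OF f \<beta>(1) \<epsilon>(2,4,3) \<phi> G r(1) e0])
          define \<eta> where "\<eta> = e i / (2 * L + N)"
          have LN: "0 < 2 * L + N" using L N by linarith
          have \<eta>: "0 < \<eta>" using e0[of i] LN by (simp add: \<eta>_def)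
          have "(2 * L + N) * \<eta> = e i" using LN by (simp add: \<eta>_def)
          moreover have "0 \<le> 2 * L * \<eta>" "0 \<le> N * \<eta>" using L N \<eta> by auto
          ultimately have \<eta>b: "2 * L * \<eta> \<le> e i" "N * \<eta> \<le> e i" by (simp_all add: distrib_right)
          obtain \<tau> where \<tau>: "\<tau> \<in> \<D>" "test_bound x1 1 \<beta> \<gamma> (\<lambda>y. \<psi> y - \<tau> y) \<eta>" using \<D>(3)[OF \<psi>(1) \<eta>] by blast
          have \<tau>t: "\<tau> \<in> tests \<epsilon>" using \<tau>(1) \<D>(2) by blast
          have "\<bar>f \<psi> - f \<tau>\<bar> \<le> N * \<eta>"
            using N(2)[OF tests_diff[OF \<psi>(1) \<tau>t \<epsilon>(1)] \<tau>(2)] functional_diff[OF ff \<psi>(1) \<tau>t] by simp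
          then have close: "\<bar>f \<phi>\<bar> \<le> \<bar>f \<tau>\<bar> + 2 * e i" using \<psi>(3) \<eta>b(2) by linarith
          from G_bound_diff[OF \<psi>(2) test_bound_imp_G_bound[OF L(2)[OF \<tau>(2)] r(1)]]
          have "G_bound \<mu> x r \<beta> \<gamma> \<tau> (?B + e i + 2 * (L * \<eta>))" by simp
          then have "strict_test_bound x r \<beta> \<gamma> \<tau> (?B + e i + 2 * (L * \<eta>))" by (rule G_bound_imp_strict_test_bound[OF _ r(1)])
          then have SG1: "strict_test_bound x r \<beta> \<gamma> \<tau> (1 + 2 * e i)" by (rule strict_test_bound_mono) (use \<eta>b(1) le in simp)
          \<comment> \<open>With this exponent, a change of radius within the ratio changes the
            constant (r / r')^\<gamma> by at most 1 + e; this needs \<gamma> > 0.\<close>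
          have "1 < (1 + e i) powr (1 / \<gamma>)" using e0[of i] \<gamma> by (intro gr_one_powr) auto
          moreover have "r / K < r" if "1 < K" for K using that r(1) by (simp add: pos_divide_less_eq)
          ultimately have "r / (1 + e i) powr (1 / \<gamma>) < r" by blast
          then obtain r' where r': "r' \<in> \<rat>" "r / (1 + e i) powr (1 / \<gamma>) < r'" "r' < r" using Rats_dense_in_real by blast
          have r'0: "0 < r'"
          proof -
            have "0 \<le> r / (1 + e i) powr (1 / \<gamma>)" using r(1) by simp
            then show ?thesis using r'(2) by linarith
          qed
          have "(r / r') powr \<gamma> \<le> ((1 + e i) powr (1 / \<gamma>)) powr \<gamma>"
          proof (rule powr_mono2)
            have "0 < (1 + e i) powr (1 / \<gamma>)" using e0[of i] by simp
            then show "r / r' \<le> (1 + e i) powr (1 / \<gamma>)"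
              using r'(2) r'0 by (simp add: pos_divide_le_eq pos_divide_less_eq mult.commute)
          qed (use r r'0 \<gamma> in auto)
          also have "\<dots> = 1 + e i" using e0[of i] \<gamma> by (simp add: powr_powr)
          finally have "(r / r') powr \<gamma> * (1 + 2 * e i) \<le> \<sigma> i"
            unfolding \<sigma>_def using e0[of i] by (intro mult_right_mono) auto
          moreover have "strict_test_bound x r' \<beta> \<gamma> \<tau> ((r / r') powr \<gamma> * (1 + 2 * e i))"
            by (rule G_bound_imp_strict_test_bound[OF strict_test_bound_imp_G_bound[OF SG1 r'0 r'(3) _ \<beta>(1) \<epsilon>(4)] r'0]) (use e0[of i] in simp)
          ultimately have "strict_test_bound x r' \<beta> \<gamma> \<tau> (\<sigma> i)" by (rule strict_test_bound_mono[rotated])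
          then have "ennreal (\<bar>f \<tau>\<bar> / \<sigma> i) = h (\<tau>, i, r') x" by (simp add: h_def)
          also have "\<dots> \<le> ?S" by (rule SUP_upper) (use \<tau>(1) r' r'0 r in \<open>auto simp: J_def\<close>)
          finally have "\<bar>f \<tau>\<bar> / \<sigma> i \<le> S" unfolding S(1) using S(2) by (simp add: ennreal_le_iff)
          then have "\<bar>f \<tau>\<bar> \<le> \<sigma> i * S" using \<sigma>0[of i] by (simp add: pos_divide_le_eq mult.commute)
          then show ?thesis using close by linarith
        qed
        moreover have "(\<lambda>i. \<sigma> i * S + 2 * e i) \<longlonglongrightarrow> ((1 + 0) * (1 + 2 * 0)) * S + 2 * 0"
          unfolding \<sigma>_def by (intro tendsto_intros elim)
        ultimately have "\<bar>f \<phi>\<bar> \<le> S" by (intro LIMSEQ_le_const[of _ S]) auto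
        then show ?thesis unfolding S(1) by (rule ennreal_leI)
      next
        case True
        then show ?thesis by (simp only: top_greatest)
      qed
    qed
  qed
  then have "grand_max \<mu> x1 \<epsilon> \<beta> \<gamma> f l = (\<lambda>x. SUP j\<in>J. h j x)" by (rule ext)
  also have "\<dots> \<in> borel_measurable \<mu>" by (rule borel_measurable_SUP[OF J hm])
  finally show ?thesis .
qed

end

section \<open>Comparison of the norms\<close>

lemma nn_integral_enn_powr_le:
  assumes p: "0 < p" and C: "0 < C" and h: "h \<in> borel_measurable M" and le: "\<And>x. g x \<le> ennreal C * h x"
  shows "(\<integral>\<^sup>+x. enn_powr (g x) p \<partial>M) \<le> ennreal (C powr p) * (\<integral>\<^sup>+x. enn_powr (h x) p \<partial>M)"
proof -
  have "(\<integral>\<^sup>+x. enn_powr (g x) p \<partial>M) \<le> (\<integral>\<^sup>+x. ennreal (C powr p) * enn_powr (h x) p \<partial>M)"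
  proof (rule nn_integral_mono)
    fix x
    have "enn_powr (g x) p \<le> enn_powr (ennreal C * h x) p" using p le by (intro enn_powr_mono) auto
    then show "enn_powr (g x) p \<le> ennreal (C powr p) * enn_powr (h x) p" using p C by (simp add: enn_powr_mult)
  qed
  also have "\<dots> = ennreal (C powr p) * (\<integral>\<^sup>+x. enn_powr (h x) p \<partial>M)"
    by (intro nn_integral_cmult enn_powr_measurable h)
  finally show ?thesis .
qed

lemma Lp_norm_le:
  assumes p: "0 < p" and C: "0 < C"
    and le: "(\<integral>\<^sup>+x. enn_powr (g x) p \<partial>\<mu>) \<le> ennreal C * (\<integral>\<^sup>+x. enn_powr (h x) p \<partial>\<mu>)"
  shows "Lp_norm \<mu> p g \<le> ennreal (C powr (1 / p)) * Lp_norm \<mu> p h"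
  unfolding Lp_norm_def using enn_powr_mono[OF _ le, of "1 / p"] p C by (simp add: enn_powr_mult)

lemma Lp_norm_le_pointwise:
  assumes p: "0 < p" and C: "0 < C" and h: "h \<in> borel_measurable \<mu>" and le: "\<And>x. g x \<le> ennreal C * h x"
  shows "Lp_norm \<mu> p g \<le> ennreal C * Lp_norm \<mu> p h"
  using Lp_norm_le[OF p _ nn_integral_enn_powr_le[OF assms]] p C by (simp add: powr_powr)

lemma in_Lp_le:
  assumes "(\<integral>\<^sup>+x. enn_powr (g x) p \<partial>\<mu>) \<le> ennreal C * (\<integral>\<^sup>+x. enn_powr (h x) p \<partial>\<mu>)"
    and "in_Lp \<mu> p h" "g \<in> borel_measurable \<mu>"
  shows "in_Lp \<mu> p g"
proof -
  have "(\<integral>\<^sup>+x. enn_powr (h x) p \<partial>\<mu>) < top" using assms(2) by (simp add: in_Lp_def)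
  then have "ennreal C * (\<integral>\<^sup>+x. enn_powr (h x) p \<partial>\<mu>) < top" by (simp add: ennreal_mult_less_top)
  with assms(1,3) show ?thesis by (simp add: in_Lp_def)
qed

context doubling_measure
begin

lemma AOTI_good_kernel:
  assumes "AOTI \<mu> e1 e2 e3 S"
  obtains c where "0 < c" "\<And>j. good_kernel c e1 e2 e3 (2 powr - real_of_int j) (S j)"
proof -
  define B where "B = C1 * 2 powr n"
  have B: "0 < B" using C1_ge1 by (simp add: B_def)
  obtain C4 where C4: "0 < C4" and A: "\<And>k x y. let t = 2 powr (- real_of_int k) in
        \<bar>S k x y\<bar> \<le> C4 * (1 / (Vr \<mu> t x + Vxy \<mu> x y)) * (t / (t + dist x y)) powr e2
      \<and> (\<forall>x'. dist x x' \<le> (t + dist x y) / 2 \<longrightarrow>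
          \<bar>S k x y - S k x' y\<bar> \<le> C4 * (dist x x' / (t + dist x y)) powr e1
             * (1 / (Vr \<mu> t x + Vxy \<mu> x y)) * (t / (t + dist x y)) powr e2)
      \<and> (\<forall>y'. dist y y' \<le> (t + dist x y) / 2 \<longrightarrow>
          \<bar>S k x y - S k x y'\<bar> \<le> C4 * (dist y y' / (t + dist x y)) powr e1
             * (1 / (Vr \<mu> t x + Vxy \<mu> x y)) * (t / (t + dist x y)) powr e2)
      \<and> (\<forall>x' y'. dist x x' \<le> (t + dist x y) / 3 \<and> dist y y' \<le> (t + dist x y) / 3 \<longrightarrow>
          \<bar>(S k x y - S k x y') - (S k x' y - S k x' y')\<bar> \<le>
             C4 * (dist x x' / (t + dist x y)) powr e1 * (dist y y' / (t + dist x y)) powr e1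
             * (1 / (Vr \<mu> t x + Vxy \<mu> x y)) * (t / (t + dist x y)) powr e3)
      \<and> (\<integral>z. S k x z \<partial>\<mu>) = 1 \<and> (\<integral>z. S k z y \<partial>\<mu>) = 1"
    using assms unfolding AOTI_def by (elim conjE exE) blast
  have es: "0 < e1" "0 < e2" "0 < e3" using assms by (simp_all add: AOTI_def)
  show ?thesis
  proof (rule that[of "C4 * B"])
    show "0 < C4 * B" using C4 B by simp
    fix j
    define t where "t = 2 powr - real_of_int j"
    have t: "0 < t" by (simp add: t_def)
    note A' = A[of j, folded t_def, unfolded Let_def]
    have W: "a * (1 / (Vr \<mu> t x + Vxy \<mu> x y)) * (t / (t + dist x y)) powr e \<le> a * (B * P e t' t y)"
      if "0 \<le> a" "t' = x" for a e x y t'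
      using mult_left_mono[OF weight_equiv(1)[OF t, of x y e] that(1)] that(2) by (simp add: B_def mult.assoc)
    show "good_kernel (C4 * B) e1 e2 e3 (2 powr - real_of_int j) (S j)"
      unfolding t_def[symmetric] good_kernel_def
    proof (intro conjI allI impI)
      show "0 < t" "0 < C4 * B" "0 < e1" "0 < e2" "0 < e3" using t C4 B es by auto
      show "\<bar>S j x y\<bar> \<le> C4 * B * P e2 x t y" for x y
      proof -
        have "\<bar>S j x y\<bar> \<le> C4 * (1 / (Vr \<mu> t x + Vxy \<mu> x y)) * (t / (t + dist x y)) powr e2" using A' by blast
        also have "\<dots> \<le> C4 * (B * P e2 x t y)" using C4 by (intro W) auto
        finally show ?thesis by (simp add: mult.assoc)
      qed
      show "\<bar>S j x y - S j x' y\<bar> \<le> C4 * B * (dist x x' / (t + dist x y)) powr e1 * P e2 x t y"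
        if "dist x x' \<le> (t + dist x y) / 2" for x x' y
      proof -
        have "\<bar>S j x y - S j x' y\<bar> \<le> C4 * (dist x x' / (t + dist x y)) powr e1
          * (1 / (Vr \<mu> t x + Vxy \<mu> x y)) * (t / (t + dist x y)) powr e2" using A' that by blast
        also have "\<dots> \<le> C4 * (dist x x' / (t + dist x y)) powr e1 * (B * P e2 x t y)" using C4 by (intro W) auto
        finally show ?thesis by (simp add: mult_ac)
      qed
      show "\<bar>S j x y - S j x y'\<bar> \<le> C4 * B * (dist y y' / (t + dist x y)) powr e1 * P e2 x t y"
        if "dist y y' \<le> (t + dist x y) / 2" for x y y'
      proof -
        have "\<bar>S j x y - S j x y'\<bar> \<le> C4 * (dist y y' / (t + dist x y)) powr e1
          * (1 / (Vr \<mu> t x + Vxy \<mu> x y)) * (t / (t + dist x y)) powr e2" using A' that by blast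
        also have "\<dots> \<le> C4 * (dist y y' / (t + dist x y)) powr e1 * (B * P e2 x t y)" using C4 by (intro W) auto
        finally show ?thesis by (simp add: mult_ac)
      qed
      show "\<bar>(S j x y - S j x y') - (S j x' y - S j x' y')\<bar>
          \<le> C4 * B * (dist x x' / (t + dist x y)) powr e1 * (dist y y' / (t + dist x y)) powr e1 * P e3 x t y"
        if "dist x x' \<le> (t + dist x y) / 3" "dist y y' \<le> (t + dist x y) / 3" for x x' y y'
      proof -
        have "\<bar>(S j x y - S j x y') - (S j x' y - S j x' y')\<bar>
          \<le> C4 * (dist x x' / (t + dist x y)) powr e1 * (dist y y' / (t + dist x y)) powr e1
             * (1 / (Vr \<mu> t x + Vxy \<mu> x y)) * (t / (t + dist x y)) powr e3" using A' that by blast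
        also have "\<dots> \<le> C4 * (dist x x' / (t + dist x y)) powr e1 * (dist y y' / (t + dist x y)) powr e1 * (B * P e3 x t y)"
          using C4 by (intro W) auto
        finally show ?thesis by (simp add: mult_ac)
      qed
      show "(\<integral>u. S j u y \<partial>\<mu>) = 1" for y using A' by blast
    qed
  qed
qed

text \<open>The condition n (1/q - 1) < \<kappa> says q > n / (n + \<kappa>), an open condition that
  p satisfies.\<close>

lemma exponent_between:
  assumes p: "n / (n + \<epsilon>) < p" "0 < \<epsilon>" and \<kappa>: "n * (1 / p - 1) < \<kappa>" "0 < \<kappa>"
  obtains q where "0 < q" "q < p" "n * (1 / q - 1) < \<kappa>"
proof -
  have p0: "0 < p" using p n_pos by (meson add_pos_pos divide_pos_pos less_trans)
  have "n < p * (n + \<kappa>)" using \<kappa>(1) p0 by (simp add: field_simps)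
  then have "n / (n + \<kappa>) < p" using n_pos \<kappa>(2) by (simp add: pos_divide_less_eq)
  then obtain q where q: "n / (n + \<kappa>) < q" "q < p" using dense by blast
  have q0: "0 < q" using q(1) n_pos \<kappa>(2) by (meson add_pos_pos divide_pos_pos less_trans)
  have "n < q * (n + \<kappa>)" using q(1) n_pos \<kappa>(2) by (simp add: pos_divide_less_eq)
  then have "n * (1 / q - 1) < \<kappa>" using q0 by (simp add: field_simps)
  with q0 q(2) that show ?thesis by blast
qed

text \<open>The maximal function is taken of the q-th power of the whole supremum over levels, so
  the one number A = \<open>M x\<close> bounds the averages of all levels at once. Since q < p it
  acts on an exponent p / q > 1.\<close>

lemma grand_max_Lp_bound:
  assumes gk: "\<And>j. good_kernel c e1 e2 e3 (2 powr - real_of_int j) (S j)" and e1: "e1 \<le> 1"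
    and \<epsilon>: "0 < \<epsilon>" "\<epsilon> < e1" "\<epsilon> < e2" and p: "n / (n + \<epsilon>) < p" "p \<le> 1"
    and \<beta>: "n * (1 / p - 1) < \<beta>" "\<beta> < \<epsilon>" and \<gamma>: "n * (1 / p - 1) < \<gamma>" "\<gamma> < \<epsilon>"
  obtains C where "0 < C" "\<And>f l x1. f \<in> G0_dual \<mu> x1 \<epsilon> \<beta> \<gamma> \<Longrightarrow>
    (\<integral>\<^sup>+x. enn_powr (grand_max \<mu> x1 \<epsilon> \<beta> \<gamma> f l x) p \<partial>\<mu>) \<le> ennreal C * (\<integral>\<^sup>+x. enn_powr (radial_max S f (l + 1) x) p \<partial>\<mu>)"
proof -
  have p0: "0 < p" using p(1) n_pos \<epsilon>(1) by (meson add_pos_pos divide_pos_pos less_trans)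
  have n0: "0 \<le> n * (1 / p - 1)" using n_pos p p0 by simp
  have pos: "0 \<le> \<beta>" "\<beta> \<le> \<epsilon>" "0 \<le> \<gamma>" "\<gamma> \<le> \<epsilon>" "0 < \<beta>" "0 < \<gamma>" using n0 \<beta> \<gamma> by auto
  obtain q where q: "0 < q" "q < p" "n * (1 / q - 1) < min \<beta> \<gamma>"
    by (rule exponent_between[OF p(1) \<epsilon>(1), of "min \<beta> \<gamma>"]) (use \<beta> \<gamma> pos in auto)
  have q1: "q < 1" "n * (1 / q - 1) < \<beta>" "n * (1 / q - 1) < \<gamma>" using q p by auto
  obtain C where C: "0 < C" "\<And>f l x r \<psi> K A. functional \<epsilon> \<beta> \<gamma> f \<Longrightarrow>
    (\<And>j. (\<lambda>u. \<bar>f (S j u)\<bar>) \<in> borel_measurable \<mu>) \<Longrightarrow> 0 < r \<Longrightarrow> r \<le> 2 powr - real_of_int l \<Longrightarrow>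
    \<psi> \<in> tests \<epsilon> \<Longrightarrow> test_bound x r \<beta> \<gamma> \<psi> K \<Longrightarrow> 0 \<le> A \<Longrightarrow>
    (\<And>j \<rho>. l + 1 \<le> j \<Longrightarrow> 0 < \<rho> \<Longrightarrow> (\<integral>\<^sup>+y\<in>ball x \<rho>. ennreal (\<bar>f (S j y)\<bar> powr q) \<partial>\<mu>) \<le> ennreal A * ennreal (V x \<rho>)) \<Longrightarrow>
    \<bar>f \<psi>\<bar> \<le> C * K * A powr (1 / q)"
    by (rule functional_bound[OF gk e1 \<epsilon>(2,3) q(1) q1(1,2) \<beta>(2) q1(3) \<gamma>(2)]) blast
  have pq: "1 < p / q" using q by simp
  obtain CM where CM: "0 < CM" "\<And>h. h \<in> borel_measurable \<mu> \<Longrightarrow> \<exists>M\<in>borel_measurable \<mu>.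
    (\<forall>x \<rho>. 0 < \<rho> \<longrightarrow> (\<integral>\<^sup>+y\<in>ball x \<rho>. h y \<partial>\<mu>) \<le> M x * ennreal (V x \<rho>))
    \<and> (\<integral>\<^sup>+x. enn_powr (M x) (p / q) \<partial>\<mu>) \<le> ennreal CM * (\<integral>\<^sup>+x. enn_powr (h x) (p / q) \<partial>\<mu>)"
    by (rule maximal_function[OF pq]) blast
  define B where "B = C1 * 2 powr n"
  have B: "0 < B" using C1_ge1 by (simp add: B_def)
  show ?thesis
  proof (rule that[of "(C * B) powr p * CM"])
    show "0 < (C * B) powr p * CM" using C(1) B CM(1) by simp
    fix f l x1 assume f: "f \<in> G0_dual \<mu> x1 \<epsilon> \<beta> \<gamma>"
    note ff = dual_functional[OF f pos(1-4)]
    let ?RM = "radial_max S f (l + 1)"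
    have Sc: "continuous_on UNIV (\<lambda>u. f (S j u))" for j
      by (rule functional_kernel_continuous[OF ff gk]) (use \<epsilon> \<beta> \<gamma> pos in auto)
    have Sm [measurable]: "(\<lambda>u. f (S j u)) \<in> borel_measurable \<mu>" for j
      unfolding borel_measurable_mu by (rule borel_measurable_continuous_onI[OF Sc])
    have RMm: "?RM \<in> borel_measurable \<mu>"
      unfolding radial_max_def[abs_def] Sk_f_def by (rule borel_measurable_SUP) auto
    have hm: "(\<lambda>x. enn_powr (?RM x) q) \<in> borel_measurable \<mu>" by (rule enn_powr_measurable[OF RMm])
    from CM(2)[OF this] obtain M where M: "M \<in> borel_measurable \<mu>"
      "\<And>x \<rho>. 0 < \<rho> \<Longrightarrow> (\<integral>\<^sup>+y\<in>ball x \<rho>. enn_powr (?RM y) q \<partial>\<mu>) \<le> M x * ennreal (V x \<rho>)"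
      "(\<integral>\<^sup>+x. enn_powr (M x) (p / q) \<partial>\<mu>) \<le> ennreal CM * (\<integral>\<^sup>+x. enn_powr (enn_powr (?RM x) q) (p / q) \<partial>\<mu>)" by blast
    have pt: "grand_max \<mu> x1 \<epsilon> \<beta> \<gamma> f l x \<le> ennreal (C * B) * enn_powr (M x) (1 / q)" for x
    proof (cases "M x")
      case top
      have "ennreal (C * B) * enn_powr (M x) (1 / q) = top" using C(1) B top by (simp add: ennreal_mult_top)
      then show ?thesis by simp
    next
      case (real A)
      have av: "(\<integral>\<^sup>+y\<in>ball x \<rho>. ennreal (\<bar>f (S j y)\<bar> powr q) \<partial>\<mu>) \<le> ennreal A * ennreal (V x \<rho>)"
        if "l + 1 \<le> j" "0 < \<rho>" for j \<rho>
      proof -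
        have "(\<integral>\<^sup>+y\<in>ball x \<rho>. ennreal (\<bar>f (S j y)\<bar> powr q) \<partial>\<mu>) \<le> (\<integral>\<^sup>+y\<in>ball x \<rho>. enn_powr (?RM y) q \<partial>\<mu>)"
        proof (rule nn_integral_mono, rule mult_right_mono)
          fix y
          have "ennreal \<bar>f (S j y)\<bar> \<le> ?RM y"
            unfolding radial_max_def Sk_f_def using that(1) by (intro SUP_upper) simp
          then have "enn_powr (ennreal \<bar>f (S j y)\<bar>) q \<le> enn_powr (?RM y) q" using q(1) by (intro enn_powr_mono) auto
          then show "ennreal (\<bar>f (S j y)\<bar> powr q) \<le> enn_powr (?RM y) q" by simp
        qed simp
        then show ?thesis using M(2)[OF that(2), of x] real by simp
      qed
      have eq: "ennreal (C * B) * enn_powr (M x) (1 / q) = ennreal (C * B * A powr (1 / q))"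
        using real C(1) B by (simp add: ennreal_mult)
      show ?thesis
        unfolding grand_max_def eq
      proof (rule SUP_least)
        fix \<phi> assume "\<phi> \<in> {\<phi> \<in> G0 \<mu> x1 \<epsilon> \<beta> \<gamma>. \<exists>r. 0 < r \<and> r \<le> 2 powr - real_of_int l \<and> \<phi> \<in> Gtest \<mu> x r \<beta> \<gamma> \<and> Gnorm \<mu> x r \<beta> \<gamma> \<phi> \<le> 1}"
        then obtain r where \<phi>: "\<phi> \<in> G0 \<mu> x1 \<epsilon> \<beta> \<gamma>" and r: "0 < r" "r \<le> 2 powr - real_of_int l"
          and t: "\<phi> \<in> Gtest \<mu> x r \<beta> \<gamma>" and le: "Gnorm \<mu> x r \<beta> \<gamma> \<phi> \<le> 1" by auto
        let ?X = "C * B * A powr (1 / q)"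
        have X0: "0 \<le> ?X" using C(1) B by simp
        have "\<bar>f \<phi>\<bar> \<le> ?X"
        \<comment> \<open>The competitor lies only in the closure. Its approximant has a norm larger
          by up to \<eta> and a value of f differing by up to \<eta>; the total error (?X + 1)
          \<eta> is e.\<close>
        proof (rule field_le_epsilon)
          fix e :: real assume e: "0 < e"
          define \<eta> where "\<eta> = e / (?X + 1)"
          have X1: "0 < ?X + 1" using X0 by linarith
          have \<eta>: "0 < \<eta>" using e X1 by (simp add: \<eta>_def)
          have "d * (e / d) = e" if "0 < d" for d using that by simp
          from this[OF X1] have \<eta>e: "(?X + 1) * \<eta> = e" unfolding \<eta>_def .
          obtain \<psi> where \<psi>: "\<psi> \<in> tests \<epsilon>" "G_bound \<mu> x r \<beta> \<gamma> \<psi> (Gnorm \<mu> x r \<beta> \<gamma> \<phi> + \<eta>)" "\<bar>f \<phi> - f \<psi>\<bar> \<le> \<eta>"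
            by (rule G0_approx[OF f pos(1-4) \<phi> Gnorm_attained[OF t] r(1) \<eta>])
          have "test_bound x r \<beta> \<gamma> \<psi> (B * (1 + \<eta>))"
            by (rule test_bound_mono[OF G_bound_imp_test_bound[OF \<psi>(2) r(1), folded B_def]]) (use le B in simp)
          then have "\<bar>f \<psi>\<bar> \<le> C * (B * (1 + \<eta>)) * A powr (1 / q)"
            using real by (intro C(2)[OF ff borel_measurable_abs[OF Sm] r \<psi>(1) _ _ av])
          also have "\<dots> = ?X + ?X * \<eta>" by (simp add: algebra_simps)
          finally have "\<bar>f \<phi>\<bar> \<le> ?X + (?X + 1) * \<eta>" using \<psi>(3) by (simp add: algebra_simps)
          then show "\<bar>f \<phi>\<bar> \<le> ?X + e" unfolding \<eta>e .
        qed
        then show "ennreal \<bar>f \<phi>\<bar> \<le> ennreal ?X" by (rule ennreal_leI)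
      qed
    qed
    have "(\<integral>\<^sup>+x. enn_powr (grand_max \<mu> x1 \<epsilon> \<beta> \<gamma> f l x) p \<partial>\<mu>)
      \<le> ennreal ((C * B) powr p) * (\<integral>\<^sup>+x. enn_powr (enn_powr (M x) (1 / q)) p \<partial>\<mu>)"
      by (rule nn_integral_enn_powr_le[OF p0 _ enn_powr_measurable[OF M(1)] pt]) (use C(1) B in simp)
    also have "(\<integral>\<^sup>+x. enn_powr (enn_powr (M x) (1 / q)) p \<partial>\<mu>) = (\<integral>\<^sup>+x. enn_powr (M x) (p / q) \<partial>\<mu>)"
      by (simp add: enn_powr_powr)
    also have "ennreal ((C * B) powr p) * \<dots> \<le> ennreal ((C * B) powr p) * (ennreal CM * (\<integral>\<^sup>+x. enn_powr (enn_powr (?RM x) q) (p / q) \<partial>\<mu>))"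
      by (intro mult_left_mono M(3)) simp
    also have "\<dots> = ennreal ((C * B) powr p * CM) * (\<integral>\<^sup>+x. enn_powr (?RM x) p \<partial>\<mu>)"
      using CM(1) q(1) by (simp add: enn_powr_powr ennreal_mult mult.assoc)
    finally show "(\<integral>\<^sup>+x. enn_powr (grand_max \<mu> x1 \<epsilon> \<beta> \<gamma> f l x) p \<partial>\<mu>)
      \<le> ennreal ((C * B) powr p * CM) * (\<integral>\<^sup>+x. enn_powr (?RM x) p \<partial>\<mu>)" .
  qed
qed

end

lemma ennreal_inverse_scale:
  assumes "0 < C" "C \<le> D" "h \<le> ennreal C * r" shows "ennreal (1 / D) * h \<le> r"
proof -
  have "ennreal (1 / D) * h \<le> ennreal (1 / D) * (ennreal C * r)" using assms by (intro mult_left_mono) auto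
  also have "\<dots> = ennreal (C / D) * r" using assms by (simp add: mult.assoc[symmetric] flip: ennreal_mult)
  also have "\<dots> \<le> 1 * r" using assms by (intro mult_right_mono) auto
  finally show ?thesis by simp
qed

theorem theorem3p2:
  fixes \<mu> :: "'a::metric_space measure"
    and n e1 e2 e3 \<epsilon> p \<beta> \<gamma> :: real
    and S :: "int \<Rightarrow> 'a \<Rightarrow> 'a \<Rightarrow> real"
    and x1 :: 'a
  assumes RD: "RD_space \<mu> n"
    and infinite: "emeasure \<mu> (space \<mu>) = \<infinity>"
    and e1: "0 < e1" "e1 \<le> 1" and e2: "0 < e2" and e3: "0 < e3"
    and eps: "0 < \<epsilon>" "\<epsilon> < min e1 e2"
    and S: "AOTI \<mu> e1 e2 e3 S"
    and p: "n / (n + \<epsilon>) < p" "p \<le> 1"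
    and \<beta>: "n * (1 / p - 1) < \<beta>" "\<beta> < \<epsilon>"
    and \<gamma>: "n * (1 / p - 1) < \<gamma>" "\<gamma> < \<epsilon>"
  shows
    "(\<forall>a>0. \<forall>l f. in_Hardy \<mu> x1 \<epsilon> \<beta> \<gamma> p l f \<longleftrightarrow>
        (f \<in> G0_dual \<mu> x1 \<epsilon> \<beta> \<gamma> \<and> in_Lp \<mu> p (radial_max S f (l + 1))
         \<and> in_Lp \<mu> p (S_avg \<mu> S a f l)))
   \<and> (\<forall>a>0. \<exists>C>0. \<forall>l. \<forall>f\<in>G0_dual \<mu> x1 \<epsilon> \<beta> \<gamma>.
        ennreal (1 / C) * Hardy_norm \<mu> x1 \<epsilon> \<beta> \<gamma> p l f
          \<le> Lp_norm \<mu> p (radial_max S f (l + 1)) + Lp_norm \<mu> p (S_avg \<mu> S a f l)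
      \<and> Lp_norm \<mu> p (radial_max S f (l + 1)) + Lp_norm \<mu> p (S_avg \<mu> S a f l)
          \<le> ennreal C * Hardy_norm \<mu> x1 \<epsilon> \<beta> \<gamma> p l f)
   \<and> (\<forall>l f. f \<in> G0_dual \<mu> x1 \<epsilon> \<beta> \<gamma> \<and> (\<forall>k. \<forall>a>0. in_Lp \<mu> p (S_avg \<mu> S a f k)) \<longrightarrow>
        (in_Hardy \<mu> x1 \<epsilon> \<beta> \<gamma> p l f \<longleftrightarrow> in_Lp \<mu> p (radial_max S f l)))
   \<and> (\<exists>C>0. \<forall>l f. f \<in> G0_dual \<mu> x1 \<epsilon> \<beta> \<gamma> \<and> (\<forall>k. \<forall>a>0. in_Lp \<mu> p (S_avg \<mu> S a f k))
          \<and> in_Hardy \<mu> x1 \<epsilon> \<beta> \<gamma> p l f \<longrightarrow>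
        ennreal (1 / C) * Hardy_norm \<mu> x1 \<epsilon> \<beta> \<gamma> p l f \<le> Lp_norm \<mu> p (radial_max S f l)
      \<and> Lp_norm \<mu> p (radial_max S f l) \<le> ennreal C * Hardy_norm \<mu> x1 \<epsilon> \<beta> \<gamma> p l f)"
proof -
  have ht: "homogeneous_type \<mu> n" using RD unfolding RD_space_def by (rule conjunct1)
  then obtain C1 where C1: "1 \<le> C1" "\<And>x lam r. 1 \<le> lam \<Longrightarrow> 0 < r \<Longrightarrow>
    measure \<mu> (ball x (lam * r)) \<le> C1 * lam powr n * measure \<mu> (ball x r)"
    unfolding homogeneous_type_def by blast
  interpret doubling_measure \<mu> n C1
    by unfold_locales (use ht C1 in \<open>simp_all add: homogeneous_type_def\<close>)
  obtain c where c: "0 < c" and gk: "\<And>j. good_kernel c e1 e2 e3 (2 powr - real_of_int j) (S j)"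
    using AOTI_good_kernel[OF S] by blast
  have \<epsilon>: "\<epsilon> < e1" "\<epsilon> < e2" "\<epsilon> \<le> e1" "\<epsilon> \<le> e2" "0 \<le> \<epsilon>" using eps by auto
  have p0: "0 < p" using p(1) n_pos eps(1) by (meson add_pos_pos divide_pos_pos less_trans)
  have n0: "0 \<le> n * (1 / p - 1)" using n_pos p p0 by simp
  have pos: "0 \<le> \<beta>" "\<beta> \<le> \<epsilon>" "0 \<le> \<gamma>" "\<gamma> \<le> \<epsilon>" "0 < \<gamma>" using n0 \<beta> \<gamma> by auto
  let ?D = "G0_dual \<mu> x1 \<epsilon> \<beta> \<gamma>"
  let ?GM = "grand_max \<mu> x1 \<epsilon> \<beta> \<gamma>"
  have GMm: "?GM f l \<in> borel_measurable \<mu>" if "f \<in> ?D" for f l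
    by (rule grand_max_measurable[OF that pos(1) \<beta>(2) pos(5) \<gamma>(2)])
  have Sm: "(\<lambda>u. f (S j u)) \<in> borel_measurable \<mu>" if "f \<in> ?D" for f j
    unfolding borel_measurable_mu
    by (intro borel_measurable_continuous_onI functional_kernel_continuous[OF dual_functional[OF that pos(1-4)] gk \<epsilon>(5,3,4) pos(1) \<beta>(2) pos(3) \<gamma>(2)])
  have RMm: "radial_max S f l \<in> borel_measurable \<mu>" if "f \<in> ?D" for f l
    unfolding radial_max_def[abs_def] Sk_f_def
    by (rule borel_measurable_SUP) (auto intro!: measurable_compose[OF _ measurable_ennreal] borel_measurable_abs Sm[OF that])
  have SAm: "S_avg \<mu> S a f l \<in> borel_measurable \<mu>" if "f \<in> ?D" for f a l
  proof -
    have "(\<lambda>y. ennreal \<bar>f (S l y)\<bar>) \<in> borel_measurable \<mu>"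
      by (intro measurable_compose[OF _ measurable_ennreal] borel_measurable_abs Sm[OF that])
    note 1 = ball_integral_measurable[OF this, of "a * 2 powr - real_of_int l"]
    have [measurable]: "(\<lambda>x. V x (a * 2 powr - real_of_int l)) \<in> borel_measurable \<mu>"
      by (rule V_measurable[OF continuous_on_const])
    have 2: "(\<lambda>x. ennreal (1 / Vr \<mu> (a * 2 powr - real_of_int l) x)) \<in> borel_measurable \<mu>"
      unfolding Vr_def V_def[symmetric] by measurable
    show ?thesis unfolding S_avg_def[abs_def] Sk_f_def by (rule borel_measurable_times_ennreal[OF 2 1])
  qed
  obtain B1 where B1: "0 < B1" "\<And>f l x1. f \<in> G0_dual \<mu> x1 \<epsilon> \<beta> \<gamma> \<Longrightarrow>
    (\<integral>\<^sup>+x. enn_powr (grand_max \<mu> x1 \<epsilon> \<beta> \<gamma> f l x) p \<partial>\<mu>) \<le> ennreal B1 * (\<integral>\<^sup>+x. enn_powr (radial_max S f (l + 1) x) p \<partial>\<mu>)"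
    by (rule grand_max_Lp_bound[OF gk e1(2) eps(1) \<epsilon>(1,2) p \<beta> \<gamma>]) blast
  obtain B2 where B2: "0 < B2" "\<And>f t k l x y x1. f \<in> G0_dual \<mu> x1 \<epsilon> \<beta> \<gamma> \<Longrightarrow> good_kernel c e1 e2 e3 t k \<Longrightarrow> t \<le> 2 powr - real_of_int l \<Longrightarrow>
    dist x y \<le> 0 * t \<Longrightarrow> ennreal \<bar>f (k y)\<bar> \<le> ennreal B2 * grand_max \<mu> x1 \<epsilon> \<beta> \<gamma> f l x"
    by (rule kernel_le_grand_max[OF pos(1-4) \<epsilon>(3,4) order_refl c]) blast
  have RM_le: "radial_max S f l' x \<le> ennreal B2 * ?GM f l x" if "f \<in> ?D" "l \<le> l'" for f l l' x
    unfolding radial_max_def Sk_f_def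
  proof (rule SUP_least)
    fix k assume "k \<in> {l'..}"
    then show "ennreal \<bar>f (S k x)\<bar> \<le> ennreal B2 * ?GM f l x"
      using that(2) by (intro B2(2)[OF that(1) gk]) auto
  qed
  have SA_le: "\<exists>B3>0. \<forall>f l x. f \<in> ?D \<longrightarrow> S_avg \<mu> S a f l x \<le> ennreal B3 * ?GM f l x" if a: "0 < a" for a
  proof -
    obtain B3 where B3: "0 < B3" "\<And>f t k l x y x1. f \<in> G0_dual \<mu> x1 \<epsilon> \<beta> \<gamma> \<Longrightarrow> good_kernel c e1 e2 e3 t k \<Longrightarrow> t \<le> 2 powr - real_of_int l \<Longrightarrow>
      dist x y \<le> a * t \<Longrightarrow> ennreal \<bar>f (k y)\<bar> \<le> ennreal B3 * grand_max \<mu> x1 \<epsilon> \<beta> \<gamma> f l x"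
      by (rule kernel_le_grand_max[OF pos(1-4) \<epsilon>(3,4) less_imp_le[OF a] c]) blast
    have "S_avg \<mu> S a f l x \<le> ennreal B3 * ?GM f l x" if f: "f \<in> ?D" for f l x
    proof -
      let ?r = "a * 2 powr - real_of_int l" and ?G = "ennreal B3 * ?GM f l x"
      have v: "0 < V x ?r" using a by simp
      have "S_avg \<mu> S a f l x \<le> ennreal (1 / V x ?r) * (\<integral>\<^sup>+y\<in>ball x ?r. ?G \<partial>\<mu>)"
        unfolding S_avg_def Sk_f_def Vr_def V_def[symmetric]
      proof (rule mult_left_mono, rule nn_integral_mono)
        fix y
        show "ennreal \<bar>f (S l y)\<bar> * indicator (ball x ?r) y \<le> ?G * indicator (ball x ?r) y"
        proof (cases "y \<in> ball x ?r")
          case True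
          then have "ennreal \<bar>f (S l y)\<bar> \<le> ?G" by (intro B3(2)[OF f gk]) auto
          then show ?thesis using True by simp
        qed simp
      qed simp
      also have "\<dots> = ennreal (1 / V x ?r) * (?G * ennreal (V x ?r))"
        by (simp add: nn_integral_cmult_indicator emeasure_ball)
      also have "\<dots> = ennreal (1 / V x ?r * V x ?r) * ?G"
        using v by (subst ennreal_mult) (auto simp: mult_ac)
      also have "\<dots> = ?G" using less_imp_neq[OF v] by simp
      finally show ?thesis .
    qed
    then show ?thesis using B3(1) by blast
  qed
  have Hardy: "in_Hardy \<mu> x1 \<epsilon> \<beta> \<gamma> p l f \<longleftrightarrow> f \<in> ?D \<and> in_Lp \<mu> p (?GM f l)" for l f by (rule in_Hardy_def)
  have GM_in: "in_Lp \<mu> p (?GM f l)" if "f \<in> ?D" "in_Lp \<mu> p (radial_max S f (l + 1))" for f l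
    by (rule in_Lp_le[OF B1(2)[OF that(1)] that(2) GMm[OF that(1)]])
  have in_pointwise: "in_Lp \<mu> p g" if "in_Lp \<mu> p h" "g \<in> borel_measurable \<mu>" "0 < C" "\<And>x. g x \<le> ennreal C * h x" for g h C
    by (rule in_Lp_le[OF nn_integral_enn_powr_le[OF p0 that(3) _ that(4)] that(1,2)]) (use that(1) in \<open>simp add: in_Lp_def\<close>)
  have RM_in: "in_Lp \<mu> p (radial_max S f l')" if "f \<in> ?D" "in_Lp \<mu> p (?GM f l)" "l \<le> l'" for f l l'
    by (rule in_pointwise[OF that(2) RMm[OF that(1)] B2(1) RM_le[OF that(1,3)]])
  \<comment> \<open>Dropping the level l only decreases the supremum, so in part (ii) the lower
    bound follows from the one at level l + 1. The factor one fits the shape of the pointwise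
    comparison lemmas.\<close>
  have RM_mono: "radial_max S f (l + 1) x \<le> ennreal 1 * radial_max S f l x" for f l x
    unfolding radial_max_def by (simp add: SUP_subset_mono)
  define D1 where "D1 = B1 powr (1 / p)"
  have D1: "0 < D1" using B1(1) by (simp add: D1_def)
  have H1: "Hardy_norm \<mu> x1 \<epsilon> \<beta> \<gamma> p l f \<le> ennreal D1 * Lp_norm \<mu> p (radial_max S f (l + 1))" if "f \<in> ?D" for l f
    unfolding Hardy_norm_def D1_def by (rule Lp_norm_le[OF p0 B1(1) B1(2)[OF that]])
  have H2: "Lp_norm \<mu> p (radial_max S f l') \<le> ennreal B2 * Hardy_norm \<mu> x1 \<epsilon> \<beta> \<gamma> p l f" if "f \<in> ?D" "l \<le> l'" for l l' f
    unfolding Hardy_norm_def by (rule Lp_norm_le_pointwise[OF p0 B2(1) GMm[OF that(1)] RM_le[OF that]])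
  show ?thesis
  proof (intro conjI allI impI)
    fix a :: real and l f assume a: "0 < a"
    obtain B3 where B3: "0 < B3" "\<And>f l x. f \<in> ?D \<Longrightarrow> S_avg \<mu> S a f l x \<le> ennreal B3 * ?GM f l x"
      using SA_le[OF a] by blast
    show "in_Hardy \<mu> x1 \<epsilon> \<beta> \<gamma> p l f \<longleftrightarrow>
      (f \<in> ?D \<and> in_Lp \<mu> p (radial_max S f (l + 1)) \<and> in_Lp \<mu> p (S_avg \<mu> S a f l))"
    proof
      assume "in_Hardy \<mu> x1 \<epsilon> \<beta> \<gamma> p l f"
      then have f: "f \<in> ?D" and G: "in_Lp \<mu> p (?GM f l)" by (simp_all add: Hardy)
      have "in_Lp \<mu> p (radial_max S f (l + 1))" by (rule RM_in[OF f G]) simp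
      moreover have "in_Lp \<mu> p (S_avg \<mu> S a f l)" by (rule in_pointwise[OF G SAm[OF f] B3(1) B3(2)[OF f]])
      ultimately show "f \<in> ?D \<and> in_Lp \<mu> p (radial_max S f (l + 1)) \<and> in_Lp \<mu> p (S_avg \<mu> S a f l)" using f by blast
    next
      assume "f \<in> ?D \<and> in_Lp \<mu> p (radial_max S f (l + 1)) \<and> in_Lp \<mu> p (S_avg \<mu> S a f l)"
      then show "in_Hardy \<mu> x1 \<epsilon> \<beta> \<gamma> p l f" using GM_in by (simp add: Hardy)
    qed
  next
    fix a :: real assume a: "0 < a"
    obtain B3 where B3: "0 < B3" "\<And>f l x. f \<in> ?D \<Longrightarrow> S_avg \<mu> S a f l x \<le> ennreal B3 * ?GM f l x"
      using SA_le[OF a] by blast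
    \<comment> \<open>\<open>D1\<close> is for the bound of the Hardy norm, \<open>B2 + B3\<close>
      for the two summands in the reverse direction; only \<open>B3\<close> depends on a.\<close>
    define C where "C = D1 + B2 + B3"
    have C: "0 < C" "D1 \<le> C" "B2 + B3 \<le> C" using D1 B2(1) B3(1) by (auto simp: C_def)
    show "\<exists>C>0. \<forall>l. \<forall>f\<in>?D.
        ennreal (1 / C) * Hardy_norm \<mu> x1 \<epsilon> \<beta> \<gamma> p l f
          \<le> Lp_norm \<mu> p (radial_max S f (l + 1)) + Lp_norm \<mu> p (S_avg \<mu> S a f l)
      \<and> Lp_norm \<mu> p (radial_max S f (l + 1)) + Lp_norm \<mu> p (S_avg \<mu> S a f l)
          \<le> ennreal C * Hardy_norm \<mu> x1 \<epsilon> \<beta> \<gamma> p l f"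
    proof (intro exI[of _ C] conjI allI ballI C(1))
      fix l f assume f: "f \<in> ?D"
      let ?H = "Hardy_norm \<mu> x1 \<epsilon> \<beta> \<gamma> p l f"
      have "ennreal (1 / C) * ?H \<le> Lp_norm \<mu> p (radial_max S f (l + 1))"
        by (rule ennreal_inverse_scale[OF D1 C(2) H1[OF f]])
      also have "\<dots> \<le> Lp_norm \<mu> p (radial_max S f (l + 1)) + Lp_norm \<mu> p (S_avg \<mu> S a f l)" by simp
      finally show "ennreal (1 / C) * ?H \<le> Lp_norm \<mu> p (radial_max S f (l + 1)) + Lp_norm \<mu> p (S_avg \<mu> S a f l)" .
      have "Lp_norm \<mu> p (S_avg \<mu> S a f l) \<le> ennreal B3 * ?H"
        unfolding Hardy_norm_def by (rule Lp_norm_le_pointwise[OF p0 B3(1) GMm[OF f] B3(2)[OF f]])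
      moreover have "Lp_norm \<mu> p (radial_max S f (l + 1)) \<le> ennreal B2 * ?H" by (rule H2[OF f]) simp
      ultimately have "Lp_norm \<mu> p (radial_max S f (l + 1)) + Lp_norm \<mu> p (S_avg \<mu> S a f l) \<le> ennreal B2 * ?H + ennreal B3 * ?H"
        by (intro add_mono)
      also have "\<dots> = ennreal (B2 + B3) * ?H" using B2(1) B3(1) by (simp add: distrib_right ennreal_plus)
      also have "\<dots> \<le> ennreal C * ?H" by (intro mult_right_mono ennreal_leI C(3)) simp
      finally show "Lp_norm \<mu> p (radial_max S f (l + 1)) + Lp_norm \<mu> p (S_avg \<mu> S a f l) \<le> ennreal C * ?H" .
    qed
  next
    fix l f assume "f \<in> ?D \<and> (\<forall>k. \<forall>a>0. in_Lp \<mu> p (S_avg \<mu> S a f k))"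
    then have f: "f \<in> ?D" ..
    show "in_Hardy \<mu> x1 \<epsilon> \<beta> \<gamma> p l f \<longleftrightarrow> in_Lp \<mu> p (radial_max S f l)"
    proof
      assume "in_Hardy \<mu> x1 \<epsilon> \<beta> \<gamma> p l f"
      then show "in_Lp \<mu> p (radial_max S f l)" using RM_in[OF f _ order_refl] by (simp add: Hardy)
    next
      assume "in_Lp \<mu> p (radial_max S f l)"
      then have "in_Lp \<mu> p (radial_max S f (l + 1))"
        by (rule in_pointwise[OF _ RMm[OF f] zero_less_one RM_mono])
      then show "in_Hardy \<mu> x1 \<epsilon> \<beta> \<gamma> p l f" using GM_in f by (simp add: Hardy)
    qed
  next
    define C where "C = D1 + B2"
    have C: "0 < C" "D1 \<le> C" "B2 \<le> C" using D1 B2(1) by (auto simp: C_def)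
    show "\<exists>C>0. \<forall>l f. f \<in> ?D \<and> (\<forall>k. \<forall>a>0. in_Lp \<mu> p (S_avg \<mu> S a f k))
          \<and> in_Hardy \<mu> x1 \<epsilon> \<beta> \<gamma> p l f \<longrightarrow>
        ennreal (1 / C) * Hardy_norm \<mu> x1 \<epsilon> \<beta> \<gamma> p l f \<le> Lp_norm \<mu> p (radial_max S f l)
      \<and> Lp_norm \<mu> p (radial_max S f l) \<le> ennreal C * Hardy_norm \<mu> x1 \<epsilon> \<beta> \<gamma> p l f"
    proof (intro exI[of _ C] conjI allI impI C(1))
      fix l f assume "f \<in> ?D \<and> (\<forall>k. \<forall>a>0. in_Lp \<mu> p (S_avg \<mu> S a f k)) \<and> in_Hardy \<mu> x1 \<epsilon> \<beta> \<gamma> p l f"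
      then have f: "f \<in> ?D" ..
      let ?H = "Hardy_norm \<mu> x1 \<epsilon> \<beta> \<gamma> p l f"
      have "ennreal (1 / C) * ?H \<le> Lp_norm \<mu> p (radial_max S f (l + 1))"
        by (rule ennreal_inverse_scale[OF D1 C(2) H1[OF f]])
      also have "\<dots> \<le> ennreal 1 * Lp_norm \<mu> p (radial_max S f l)"
        by (rule Lp_norm_le_pointwise[OF p0 zero_less_one RMm[OF f] RM_mono])
      finally show "ennreal (1 / C) * ?H \<le> Lp_norm \<mu> p (radial_max S f l)" by simp
      have "Lp_norm \<mu> p (radial_max S f l) \<le> ennreal B2 * ?H" by (rule H2[OF f order_refl])
      also have "\<dots> \<le> ennreal C * ?H" by (intro mult_right_mono ennreal_leI C(3)) simp
      finally show "Lp_norm \<mu> p (radial_max S f l) \<le> ennreal C * ?H" .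
    qed
  qed
qed

end
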